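(* Let $i\in\mathbb{Z}_+$, $r\in\mathbb{N}$ and $s\in(-1/2,i]$ satisfy $r>\max\{s,i-1\}$. Let $\psi^1,\psi^2\in C^{\infty}([0,1])$ satisfy $\operatorname{supp}\psi^1\subset[0,\tfrac23]$, $\operatorname{supp}\psi^2\subset[\tfrac13,1]$ and $\psi^1+\psi^2\equiv1$ on $[0,1]$, and extend them by zero to $\mathbb{R}$. Then there is a constant $C$ such that the following holds. Let $\{\Delta_m\}_{m\in\mathcal{M}}$, $\Delta_m=[a_m,b_m]$, be any finite or countable collection of pairwise disjoint intervals in $\mathbb{R}$, with lengths $l_m=b_m-a_m$, such that $0\notin(a_m,b_m)$ for every $m\in\mathcal{M}$, and put $\psi^{\sigma}_m(\xi)=\psi^{\sigma}\big((\xi-a_m)/l_m\big)$, $\sigma=1,2$. Then there exist sequences (indexed by $\nu$) of functions $\psi^{\sigma}_{m,\nu}\in\mathcal{S}(\mathbb{R})$, $m\in\mathcal{M}$, $\sigma=1,2$, with $\psi^{\sigma}_{m,\nu}\to\psi^{\sigma}_m$ in $L^2(\mathbb{R})$ as $\nu\to\infty$, such that for every $f\in\dot C^{s,i}_2(\mathbb{R})$ there exist polynomials $p^{\sigma}_{m,\nu}\in\mathcal{P}_r$ and functions $\widetilde S^{\sigma}f\in L^2_{\mathrm{loc}}(\mathbb{R},l^2)$, $\sigma=1,2$, with $$\Big\{e^{-2\pi i\,a_mx}\big(\widehat f\,\psi^1_{m,\nu}\big)^{\vee}(x)-p^1_{m,\nu}(x)\Big\}_{m\in\mathcal{M}}\to\widetilde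 S^1f,\qquad \Big\{e^{-2\pi i\,b_mx}\big(\widehat f\,\psi^2_{m,\nu}\big)^{\vee}(x)-p^2_{m,\nu}(x)\Big\}_{m\in\mathcal{M}}\to\widetilde S^2f$$ in $L^2(I,l^2)$ for every bounded interval $I$ as $\nu\to\infty$, and $$\|\widetilde S^{\sigma}f\|_{r,2,s}\le C\,\|f\|_{i,2,s},\qquad\sigma=1,2,$$ where the constant $C$ does not depend on $f$ or $\{\Delta_m\}$.
   Context: In the exponentials the letter $i$ is the imaginary unit; as a parameter it is a nonnegative integer. $\mathbb{Z}_+=\{0,1,2,\dots\}$, $\mathbb{N}=\{1,2,\dots\}$. $\mathcal{S}(\mathbb{R})$ is the Schwartz class. The Fourier transform is $\widehat f(\xi)=\int f(x)e^{-2\pi i x\xi}\,dx$, extended to tempered distributions, and $^{\vee}$ is its inverse. Functions $f\in\dot C^{s,i}_2(\mathbb{R})$ (defined below) satisfy $\int|f(x)|(1+|x|^{1+\beta})^{-1}dx<\infty$ for every $\beta>0$ with $\beta>\max\{s,i-1\}$, hence are tempered distributions, and for $\psi\in\mathcal{S}$ the expression $(\widehat f\,\psi)^{\vee}=f*\psi^{\vee}$ is a $C^\infty$ function. $\mathcal{P}_i$ is the space of (complex) algebraic polynomials on $\mathbb{R}$ of degree strictly less than $i$, with $\mathcal{P}_0=\{0\}$; $\mathcal{P}_i(l^2)$ is the analogous space of $l^2$-valued polynomials. Morrey--Campanato spaces: for $i\in\mathbb{Z}_+$, $1\le p<\infty$, $s\in(-1/p,i]$ and a locally integrable function $f$ on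 $\mathbb{R}$ (scalar-valued or $l^2$-valued), $f\in\dot C^{s,i}_p(\mathbb{R})$ means $$\|f\|_{i,p,s}=\sup_Q\inf_P\frac1{|Q|^{s}}\bigg(\frac1{|Q|}\int_Q|f-P|^p\bigg)^{1/p}<\infty,$$ the supremum being over all bounded intervals $Q\subset\mathbb{R}$ and the infimum over all $P\in\mathcal{P}_i$ (respectively $P\in\mathcal{P}_i(l^2)$), where $|\cdot|$ is the absolute value (respectively the $l^2$-norm). *)

theory Defs
  imports "HOL-Probability.Sinc_Integral" "HOL-Computational_Algebra.Polynomial"
begin

section \<open>Smooth functions and the Schwartz class\<close>

text \<open>At the end points of a closed interval the derivatives are one-sided.\<close>

definition smooth_on :: "real set \<Rightarrow> (real \<Rightarrow> complex) \<Rightarrow> bool" where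
  "smooth_on A f \<longleftrightarrow> (\<exists>D :: nat \<Rightarrow> real \<Rightarrow> complex. D 0 = f \<and>
     (\<forall>n. \<forall>x\<in>A. (D n has_vector_derivative D (Suc n) x) (at x within A)))"

definition schwartz :: "(real \<Rightarrow> complex) set" where
  "schwartz = {f. \<exists>D :: nat \<Rightarrow> real \<Rightarrow> complex. D 0 = f \<and>
     (\<forall>n x. (D n has_vector_derivative D (Suc n) x) (at x)) \<and>
     (\<forall>n k. bounded (range (\<lambda>x. of_real (x ^ k) * D n x)))}"

section \<open>The Fourier transform of tempered distributions\<close>

definition fourier :: "(real \<Rightarrow> complex) \<Rightarrow> real \<Rightarrow> complex" where
  "fourier f \<xi> = (LINT x|lborel. f x * cis (- (2 * pi * x * \<xi>)))"

definition inv_fourier :: "(real \<Rightarrow> complex) \<Rightarrow> real \<Rightarrow> complex" where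
  "inv_fourier f x = (LINT \<xi>|lborel. f \<xi> * cis (2 * pi * x * \<xi>))"

text \<open>A distribution is represented by its (bilinear) action on Schwartz functions; its values on
  other functions are never used.\<close>

type_synonym distr = "(real \<Rightarrow> complex) \<Rightarrow> complex"

definition distr_of :: "(real \<Rightarrow> complex) \<Rightarrow> distr" where
  "distr_of f \<phi> = (LINT x|lebesgue. f x * \<phi> x)"

definition distr_fourier :: "distr \<Rightarrow> distr" where
  "distr_fourier T \<phi> = T (fourier \<phi>)"

definition distr_inv_fourier :: "distr \<Rightarrow> distr" where
  "distr_inv_fourier T \<phi> = T (inv_fourier \<phi>)"

definition distr_mult :: "distr \<Rightarrow> (real \<Rightarrow> complex) \<Rightarrow> distr" where
  "distr_mult T \<psi> \<phi> = T (\<lambda>x. \<psi> x * \<phi> x)"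

definition represents :: "(real \<Rightarrow> complex) \<Rightarrow> distr \<Rightarrow> bool" where
  "represents g T \<longleftrightarrow>
     (\<forall>\<phi>\<in>schwartz. integrable lebesgue (\<lambda>x. g x * \<phi> x) \<and> distr_of g \<phi> = T \<phi>)"

text \<open>The inverse Fourier transform of the product of \<open>\<psi>\<close> with the Fourier transform of \<open>f\<close>, as a
  function: the continuous representative of that distribution. Its existence, its uniqueness and
  the formula \<open>f * inv_fourier \<psi>\<close> for it are proved in \<open>fourier_multiplier_eq_convolution\<close>, for all
  \<open>f\<close> with at most polynomial growth in the mean.\<close>

definition fourier_multiplier :: "(real \<Rightarrow> complex) \<Rightarrow> (real \<Rightarrow> complex) \<Rightarrow> real \<Rightarrow> complex" where
  "fourier_multiplier f \<psi> = (THE g. continuous_on UNIV g \<and>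
     represents g (distr_inv_fourier (distr_mult (distr_fourier (distr_of f)) \<psi>)))"

subsection \<open>The convolution formula\<close>

text \<open>Decay faster than any power, without smoothness.\<close>

definition rapid :: "(real \<Rightarrow> complex) \<Rightarrow> bool" where
  "rapid f \<longleftrightarrow> (\<forall>N. \<exists>C. \<forall>x. cmod (f x) * (1 + \<bar>x\<bar>) ^ N \<le> C)"

lemma rapidI:
  assumes "\<And>k. bounded (range (\<lambda>x. of_real (x ^ k) * f x))"
  shows "rapid f"
  unfolding rapid_def
proof
  fix N
  obtain B0 where B0: "\<And>x. cmod (f x) \<le> B0"
    using assms[of 0] by (auto simp: bounded_iff)
  obtain BN where BN: "\<And>x. cmod (of_real (x ^ N) * f x) \<le> BN"
    using assms[of N] by (auto simp: bounded_iff)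
  have "cmod (f x) * (1 + \<bar>x\<bar>) ^ N \<le> 2 ^ N * (B0 + BN)" for x
  proof -
    have "(1 + \<bar>x\<bar>) ^ N \<le> (2 * max 1 \<bar>x\<bar>) ^ N"
      by (intro power_mono) auto
    also have "\<dots> = 2 ^ N * max 1 \<bar>x\<bar> ^ N"
      by (simp add: power_mult_distrib)
    also have "\<dots> \<le> 2 ^ N * (1 + \<bar>x\<bar> ^ N)"
      by (auto simp: max_def)
    finally have "cmod (f x) * (1 + \<bar>x\<bar>) ^ N \<le> cmod (f x) * (2 ^ N * (1 + \<bar>x\<bar> ^ N))"
      by (intro mult_left_mono) auto
    also have "\<dots> = 2 ^ N * (cmod (f x) + cmod (of_real (x ^ N) * f x))"
      by (simp add: norm_mult norm_power power_abs algebra_simps)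
    also have "\<dots> \<le> 2 ^ N * (B0 + BN)"
      by (intro mult_left_mono add_mono B0 BN) auto
    finally show ?thesis .
  qed
  then show "\<exists>C. \<forall>x. cmod (f x) * (1 + \<bar>x\<bar>) ^ N \<le> C" by blast
qed

lemma schwartzE:
  assumes "f \<in> schwartz"
  obtains D where "D 0 = f" "\<And>n x. (D n has_vector_derivative D (Suc n) x) (at x)"
    "\<And>n. continuous_on UNIV (D n)" "\<And>n. rapid (D n)"
proof -
  obtain D where D: "D 0 = f" "\<And>n x. (D n has_vector_derivative D (Suc n) x) (at x)"
    "\<And>n k. bounded (range (\<lambda>x. of_real (x ^ k) * D n x))"
    using assms unfolding schwartz_def by auto
  moreover have "continuous_on UNIV (D n)" for n
    using D(2)[of n] by (meson continuous_at_imp_continuous_on has_vector_derivative_continuous)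
  ultimately show ?thesis using that rapidI by blast
qed

lemma schwartz_rapid_continuous:
  assumes "f \<in> schwartz"
  shows "rapid f" "continuous_on UNIV f"
proof -
  obtain D where D: "D 0 = f" "\<And>n x. (D n has_vector_derivative D (Suc n) x) (at x)"
    "\<And>n. continuous_on UNIV (D n)" "\<And>n. rapid (D n)"
    using schwartzE[OF assms] by blast
  show "rapid f" using D(4)[of 0] D(1) by simp
  show "continuous_on UNIV f" using D(3)[of 0] D(1) by simp
qed

lemma rapidE:
  assumes "rapid f"
  obtains C where "C > 0" "\<And>x. cmod (f x) \<le> C / (1 + \<bar>x\<bar>) ^ N"
proof -
  obtain C where C: "\<And>x. cmod (f x) * (1 + \<bar>x\<bar>) ^ N \<le> C"
    using assms unfolding rapid_def by blast
  have "cmod (f x) \<le> (\<bar>C\<bar> + 1) / (1 + \<bar>x\<bar>) ^ N" for x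
  proof -
    have "(1 + \<bar>x\<bar>) ^ N > 0" by (intro zero_less_power) linarith
    moreover have "cmod (f x) * (1 + \<bar>x\<bar>) ^ N \<le> \<bar>C\<bar> + 1" using C[of x] by linarith
    ultimately show ?thesis by (simp add: field_simps)
  qed
  then show ?thesis using that[of "\<bar>C\<bar> + 1"] by simp
qed

lemma rapid_bounded:
  assumes "rapid f"
  obtains C where "C > 0" "\<And>x. cmod (f x) \<le> C"
  using rapidE[OF assms, of 0] by auto

lemma borel_measurable_continuous_UNIV:
  fixes f :: "real \<Rightarrow> complex"
  shows "continuous_on UNIV f \<Longrightarrow> f \<in> borel_measurable borel"
  by (rule borel_measurable_continuous_onI)

lemma integrable_weight: "integrable lborel (\<lambda>x::real. 1 / (1 + \<bar>x\<bar>)\<^sup>2)"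
proof (rule Bochner_Integration.integrable_bound)
  show "integrable lborel (\<lambda>x::real. inverse (1 + x\<^sup>2))"
    using integrable_inverse_1_plus_square by (simp add: set_integrable_def einterval_def)
  show "AE x::real in lborel. norm (1 / (1 + \<bar>x\<bar>)\<^sup>2) \<le> norm (inverse (1 + x\<^sup>2))"
  proof (rule AE_I2)
    fix x :: real
    have "1 + x\<^sup>2 \<le> (1 + \<bar>x\<bar>)\<^sup>2" by (simp add: power2_eq_square algebra_simps)
    moreover have "1 + x\<^sup>2 > 0" by (simp add: add_pos_nonneg)
    ultimately show "norm (1 / (1 + \<bar>x\<bar>)\<^sup>2) \<le> norm (inverse (1 + x\<^sup>2))"
      by (simp add: inverse_eq_divide frac_le)
  qed
qed simp

lemma rapid_integrable:
  assumes "rapid f" "continuous_on UNIV f"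
  shows "integrable lborel f"
proof -
  obtain C where C: "C > 0" "\<And>x. cmod (f x) \<le> C / (1 + \<bar>x\<bar>) ^ 2"
    using rapidE[OF assms(1)] by blast
  show ?thesis
  proof (rule Bochner_Integration.integrable_bound)
    show "integrable lborel (\<lambda>x::real. C * (1 / (1 + \<bar>x\<bar>)\<^sup>2))"
      by (intro integrable_mult_right integrable_weight)
    show "f \<in> borel_measurable lborel"
      using assms(2) borel_measurable_continuous_UNIV by simp
    show "AE x in lborel. norm (f x) \<le> norm (C * (1 / (1 + \<bar>x\<bar>)\<^sup>2))"
      using C by (auto intro!: AE_I2 simp: abs_mult)
  qed
qed

lemma rapid_tendsto:
  assumes "rapid f"
  shows "(f \<longlongrightarrow> 0) at_top" "(f \<longlongrightarrow> 0) at_bot"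
proof -
  obtain C where C: "C > 0" "\<And>x. cmod (f x) \<le> C / (1 + \<bar>x\<bar>) ^ 1"
    using rapidE[OF assms] by blast
  have "((\<lambda>x::real. C / (1 + \<bar>x\<bar>) ^ 1) \<longlongrightarrow> 0) at_top" 
    using C(1) by real_asymp
  then show "(f \<longlongrightarrow> 0) at_top"
    by (rule Lim_null_comparison[rotated]) (use C in auto)
  have "((\<lambda>x::real. C / (1 + \<bar>x\<bar>) ^ 1) \<longlongrightarrow> 0) at_bot" 
    using C(1) by real_asymp
  then show "(f \<longlongrightarrow> 0) at_bot"
    by (rule Lim_null_comparison[rotated]) (use C in auto)
qed

lemma inv_fourier_deriv:
  assumes "\<And>x. (f has_vector_derivative f' x) (at x)"
    "continuous_on UNIV f" "continuous_on UNIV f'" "rapid f" "rapid f'"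
  shows "inv_fourier f' x = - (2 * pi * x) * \<i> * inv_fourier f x"
proof -
  let ?e = "\<lambda>\<xi>. cis (2 * pi * x * \<xi>)"
  let ?F = "\<lambda>\<xi>. f \<xi> * ?e \<xi>"
  let ?F' = "\<lambda>\<xi>. f' \<xi> * ?e \<xi> + (2 * pi * x) * \<i> * (f \<xi> * ?e \<xi>)"
  have rap: "rapid (\<lambda>\<xi>. g \<xi> * ?e \<xi>)" if "rapid g" for g
    using that unfolding rapid_def by (simp add: norm_mult)
  have int: "integrable lborel (\<lambda>\<xi>. g \<xi> * ?e \<xi>)" if "rapid g" "continuous_on UNIV g" for g
    using that by (intro rapid_integrable rap continuous_intros)
  have der: "(?F has_vector_derivative ?F' \<xi>) (at \<xi>)" for \<xi>
  proof -
    have "(?e has_vector_derivative (2 * pi * x) * \<i> * ?e \<xi>) (at \<xi>)"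
      unfolding has_vector_derivative_def
      by (auto intro!: derivative_eq_intros simp: fun_eq_iff scaleR_conv_of_real algebra_simps)
    from has_vector_derivative_mult[OF assms(1)[of \<xi>] this]
    show ?thesis by (simp add: algebra_simps)
  qed
  have "(LBINT \<xi>=-\<infinity>..\<infinity>. ?F' \<xi>) = 0 - 0"
  proof (rule interval_integral_FTC_integrable[where F = ?F])
    have "continuous_on UNIV ?F'" by (intro continuous_intros assms)
    then show "isCont ?F' \<xi>" for \<xi> by (simp add: continuous_on_eq_continuous_at)
    show "set_integrable lborel (einterval (-\<infinity>) \<infinity>) ?F'"
      using int[OF assms(4,2)] int[OF assms(5,3)] by (simp add: set_integrable_def einterval_def)
    show "((?F \<circ> real_of_ereal) \<longlongrightarrow> 0) (at_right (-\<infinity>))"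
      using rapid_tendsto(2)[OF rap[OF assms(4)]] by (simp add: ereal_tendsto_simps)
    show "((?F \<circ> real_of_ereal) \<longlongrightarrow> 0) (at_left \<infinity>)"
      using rapid_tendsto(1)[OF rap[OF assms(4)]] by (simp add: ereal_tendsto_simps)
  qed (use der in auto)
  then have "(LINT \<xi>|lborel. ?F' \<xi>) = 0"
    by (simp add: interval_lebesgue_integral_def set_lebesgue_integral_def einterval_def)
  then show ?thesis
    using int[OF assms(4,2)] int[OF assms(5,3)]
    by (simp add: inv_fourier_def add_eq_0_iff2 mult.assoc)
qed

lemma inv_fourier_bound:
  assumes "rapid f" "continuous_on UNIV f"
  shows "cmod (inv_fourier f x) \<le> (LINT \<xi>|lborel. cmod (f \<xi>))"
proof -
  have "cmod (inv_fourier f x) \<le> (LINT \<xi>|lborel. cmod (f \<xi> * cis (2 * pi * x * \<xi>)))"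
    unfolding inv_fourier_def by (rule integral_norm_bound)
  then show ?thesis by (simp add: norm_mult)
qed

lemma inv_fourier_rapid:
  assumes "f \<in> schwartz"
  shows "rapid (inv_fourier f)"
proof (rule rapidI)
  fix k
  obtain D where D: "D 0 = f" "\<And>n x. (D n has_vector_derivative D (Suc n) x) (at x)"
    "\<And>n. continuous_on UNIV (D n)" "\<And>n. rapid (D n)"
    using schwartzE[OF assms] by blast
  have *: "inv_fourier (D n) x = (- (2 * pi * x) * \<i>) ^ n * inv_fourier f x" for n x
  proof (induction n)
    case (Suc n)
    then show ?case using inv_fourier_deriv[OF D(2) D(3) D(3) D(4) D(4), of n x] by simp
  qed (simp add: D)
  have "cmod (of_real (x ^ k) * inv_fourier f x) \<le> (LINT \<xi>|lborel. cmod (D k \<xi>))" for x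
  proof -
    have "cmod (of_real (x ^ k) * inv_fourier f x) \<le> (2 * pi) ^ k * cmod (of_real (x ^ k) * inv_fourier f x)"
    proof -
      have "1 \<le> (2 * pi) ^ k" using pi_ge_two by (intro one_le_power) linarith
      from mult_right_mono[OF this, of "cmod (of_real (x ^ k) * inv_fourier f x)"]
      show ?thesis by simp
    qed
    also have "\<dots> = cmod (inv_fourier (D k) x)"
      unfolding * by (simp add: norm_mult norm_power power_mult_distrib power_abs abs_mult)
    also have "\<dots> \<le> (LINT \<xi>|lborel. cmod (D k \<xi>))"
      by (intro inv_fourier_bound D)
    finally show ?thesis .
  qed
  then show "bounded (range (\<lambda>x. of_real (x ^ k) * inv_fourier f x))"
    by (auto simp: bounded_iff)
qed

lemma inv_fourier_continuous:
  assumes "rapid f" "continuous_on UNIV f"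
  shows "continuous_on UNIV (inv_fourier f)"
proof (rule continuous_on_sequentiallyI)
  fix u :: "nat \<Rightarrow> real" and a assume u: "u \<longlonglongrightarrow> a"
  note [measurable] = borel_measurable_continuous_UNIV[OF assms(2)]
  show "(\<lambda>n. inv_fourier f (u n)) \<longlonglongrightarrow> inv_fourier f a"
    unfolding inv_fourier_def
  proof (rule integral_dominated_convergence[where w = "\<lambda>\<xi>. cmod (f \<xi>)"])
    show "integrable lborel (\<lambda>\<xi>. cmod (f \<xi>))" using rapid_integrable[OF assms] by simp
    have "(\<lambda>n. f \<xi> * cis (2 * pi * u n * \<xi>)) \<longlonglongrightarrow> f \<xi> * cis (2 * pi * a * \<xi>)" for \<xi>
      unfolding cis_conv_exp by (intro tendsto_intros u)
    then show "AE \<xi> in lborel. (\<lambda>n. f \<xi> * cis (2 * pi * u n * \<xi>)) \<longlonglongrightarrow> f \<xi> * cis (2 * pi * a * \<xi>)"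
      by simp
  qed (auto simp: norm_mult cis_conv_exp)
qed


lemma peetre: "1 + \<bar>y\<bar> \<le> (1 + \<bar>x\<bar>) * (1 + \<bar>x - y\<bar>)" for x y :: real
proof -
  have "\<bar>y\<bar> \<le> \<bar>x\<bar> + \<bar>x - y\<bar>" by linarith
  moreover have "0 \<le> \<bar>x\<bar> * \<bar>x - y\<bar>" by simp
  ultimately show ?thesis unfolding distrib_right distrib_left by linarith
qed

lemma fourier_mult_inv_fourier:
  assumes "rapid \<psi>" "continuous_on UNIV \<psi>" "rapid \<phi>" "continuous_on UNIV \<phi>"
  shows "fourier (\<lambda>\<xi>. \<psi> \<xi> * inv_fourier \<phi> \<xi>) y = (LINT x|lborel. \<phi> x * inv_fourier \<psi> (x - y))"
proof -
  note [measurable] = borel_measurable_continuous_UNIV[OF assms(2)]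
    borel_measurable_continuous_UNIV[OF assms(4)]
  note int = rapid_integrable[OF assms(1,2)] rapid_integrable[OF assms(3,4)]
  let ?G = "\<lambda>\<xi> x. \<psi> \<xi> * \<phi> x * cis (2 * pi * (x - y) * \<xi>)"
  have *: "integrable (lborel \<Otimes>\<^sub>M lborel) (case_prod ?G)"
  proof (rule lborel_pair.Fubini_integrable)
    show "case_prod ?G \<in> borel_measurable (lborel \<Otimes>\<^sub>M lborel)"
      unfolding cis_conv_exp by measurable
    show "integrable lborel (\<lambda>\<xi>. LINT x|lborel. norm (case_prod ?G (\<xi>, x)))"
      using int by (simp add: norm_mult)
    have "integrable lborel (\<lambda>x. \<phi> x * cis (2 * pi * (x - y) * \<xi>))" for \<xi>
      by (rule Bochner_Integration.integrable_bound[OF int(2)])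
        (auto simp: norm_mult cis_conv_exp)
    then show "AE \<xi> in lborel. integrable lborel (\<lambda>x. case_prod ?G (\<xi>, x))"
      by (simp add: mult.assoc)
  qed
  have "fourier (\<lambda>\<xi>. \<psi> \<xi> * inv_fourier \<phi> \<xi>) y = (LINT \<xi>|lborel. LINT x|lborel. ?G \<xi> x)"
    unfolding fourier_def inv_fourier_def
  proof (intro Bochner_Integration.integral_cong refl)
    fix \<xi> :: real
    have "\<psi> \<xi> * (LINT x|lborel. \<phi> x * cis (2 * pi * \<xi> * x)) * cis (- (2 * pi * \<xi> * y))
      = (LINT x|lborel. \<psi> \<xi> * cis (- (2 * pi * \<xi> * y)) * (\<phi> x * cis (2 * pi * \<xi> * x)))"
      unfolding integral_mult_right_zero by (simp only: mult_ac)
    also have "\<dots> = (LINT x|lborel. ?G \<xi> x)"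
    proof (intro Bochner_Integration.integral_cong refl)
      fix x :: real
      have "cis (- (2 * pi * \<xi> * y)) * cis (2 * pi * \<xi> * x) = cis (2 * pi * (x - y) * \<xi>)"
        by (simp add: cis_mult algebra_simps)
      then show "\<psi> \<xi> * cis (- (2 * pi * \<xi> * y)) * (\<phi> x * cis (2 * pi * \<xi> * x)) = ?G \<xi> x"
        by (simp add: mult_ac)
    qed
    finally show "\<psi> \<xi> * (LINT x|lborel. \<phi> x * cis (2 * pi * \<xi> * x)) * cis (- (2 * pi * \<xi> * y))
      = (LINT x|lborel. ?G \<xi> x)" .
  qed
  also have "\<dots> = (LINT x|lborel. LINT \<xi>|lborel. ?G \<xi> x)"
    using lborel_pair.Fubini_integral[OF *] by simp
  also have "\<dots> = (LINT x|lborel. \<phi> x * inv_fourier \<psi> (x - y))"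
    unfolding inv_fourier_def
    by (simp flip: integral_mult_right_zero add: mult_ac)
  finally show ?thesis .
qed

text \<open>Polynomials times Gaussians, as test functions for the uniqueness of the representative.\<close>

definition hgauss :: "real poly \<Rightarrow> real \<Rightarrow> real \<Rightarrow> real \<Rightarrow> complex" where
  "hgauss q t c x = of_real (poly q (x - c) * exp (- (t * (x - c)\<^sup>2)))"

lemma hgauss_deriv:
  "(hgauss q t c has_vector_derivative hgauss (pderiv q - [:0, 2 * t:] * q) t c x) (at x)"
  unfolding hgauss_def
  by (rule has_vector_derivative_of_real)
    (auto intro!: derivative_eq_intros DERIV_chain2[OF poly_DERIV] simp: algebra_simps)

lemma hgauss_bounded:
  assumes "t > 0"
  shows "bounded (range (hgauss q t c))"
proof -
  have *: "((\<lambda>x. x ^ n * exp (- (t * x\<^sup>2))) \<longlongrightarrow> 0) at_top" for n using assms by real_asymp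
  have **: "((\<lambda>x. poly q x * exp (- (t * x\<^sup>2))) \<longlongrightarrow> 0) at_top" for q
    unfolding poly_altdef sum_distrib_right mult.assoc
    by (intro tendsto_null_sum tendsto_mult_right_zero *)
  have top: "((\<lambda>x. poly q x * exp (- (t * x\<^sup>2))) \<longlongrightarrow> 0) at_top" by (rule **)
  have bot: "((\<lambda>x. poly q x * exp (- (t * x\<^sup>2))) \<longlongrightarrow> 0) at_bot"
    using **[of "q \<circ>\<^sub>p [:0, -1:]"] by (simp add: filterlim_at_bot_mirror poly_pcompose)
  let ?h = "\<lambda>x. poly q x * exp (- (t * x\<^sup>2))"
  obtain A where A: "\<And>x. x \<ge> A \<Longrightarrow> \<bar>?h x\<bar> < 1"
    using tendstoD[OF top, of 1] by (auto simp: eventually_at_top_linorder)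
  obtain B where B: "\<And>x. x \<le> B \<Longrightarrow> \<bar>?h x\<bar> < 1"
    using tendstoD[OF bot, of 1] by (auto simp: eventually_at_bot_linorder)
  have "bounded (?h ` {B..A})"
    by (intro compact_imp_bounded compact_continuous_image continuous_intros compact_Icc)
  then obtain K where K: "\<And>x. x \<in> {B..A} \<Longrightarrow> \<bar>?h x\<bar> \<le> K"
    unfolding bounded_iff real_norm_def by blast
  have "\<bar>?h x\<bar> \<le> max 1 K" for x
    using A[of x] B[of x] K[of x] by (cases "x \<in> {B..A}") fastforce+
  then show ?thesis
    unfolding hgauss_def by (auto simp: bounded_iff simp flip: of_real_mult intro!: exI[of _ "max 1 K"])
qed

lemma hgauss_schwartz:
  assumes "t > 0"
  shows "hgauss q t c \<in> schwartz"
proof -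
  define D where "D n = hgauss (((\<lambda>q. pderiv q - [:0, 2 * t:] * q) ^^ n) q) t c" for n
  have "bounded (range (\<lambda>x. of_real (x ^ k) * D n x))" for n k
  proof -
    have "(\<lambda>x. of_real (x ^ k) * D n x) = hgauss ([:c, 1:] ^ k * ((\<lambda>q. pderiv q - [:0, 2 * t:] * q) ^^ n) q) t c"
      by (simp add: D_def hgauss_def fun_eq_iff)
    then show ?thesis using hgauss_bounded[OF assms] by presburger
  qed
  moreover have "(D n has_vector_derivative D (Suc n) x) (at x)" for n x
    unfolding D_def using hgauss_deriv by simp
  moreover have "D 0 = hgauss q t c" by (simp add: D_def)
  ultimately show ?thesis unfolding schwartz_def by blast
qed

lemma continuous_representative_zero:
  fixes h :: "real \<Rightarrow> complex"
  assumes cont: "continuous_on UNIV h"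
    and int: "\<And>\<phi>. \<phi> \<in> schwartz \<Longrightarrow> integrable lborel (\<lambda>x. h x * \<phi> x)"
    and zero: "\<And>\<phi>. \<phi> \<in> schwartz \<Longrightarrow> (LINT x|lborel. h x * \<phi> x) = 0"
  shows "h c = 0"
proof (rule ccontr)
  assume nz: "h c \<noteq> 0"
  define k where "k x = Re (h x * cnj (h c))" for x
  define G where "G t x = exp (- (t * (x - c)\<^sup>2))" for t x :: real
  have kcont: "continuous_on UNIV k"
    unfolding k_def by (intro continuous_intros cont)
  have kc: "k c > 0" 
    using nz by (simp add: k_def complex_mult_cnj complex_eq_iff sum_power2_gt_zero_iff del: of_real_add)
  note [measurable] = borel_measurable_continuous_onI[OF kcont]
  have hG: "hgauss 1 t c x = of_real (G t x)" for t x by (simp add: hgauss_def G_def)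
  have kint: "integrable lborel (\<lambda>x. k x * G t x)" and kzero: "(LINT x|lborel. k x * G t x) = 0"
    if "t > 0" for t
  proof -
    have e: "k x * G t x = Re (h x * hgauss 1 t c x * cnj (h c))" for x
      by (simp add: hG k_def algebra_simps)
    have i: "integrable lborel (\<lambda>x. h x * hgauss 1 t c x * cnj (h c))"
      using int[OF hgauss_schwartz[OF that]] by simp
    show "integrable lborel (\<lambda>x. k x * G t x)" unfolding e using i by (rule integrable_Re)
    have "(LINT x|lborel. h x * hgauss 1 t c x * cnj (h c)) = 0"
      using zero[OF hgauss_schwartz[OF that], of 1 c] by simp
    then show "(LINT x|lborel. k x * G t x) = 0"
      unfolding e integral_Re[OF i] by (simp only: zero_complex.sel)
  qed
  obtain d where d: "d > 0" "\<And>x. \<bar>x - c\<bar> < d \<Longrightarrow> k x > k c / 2"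
  proof -
    have "isCont k c" using kcont by (simp add: continuous_on_eq_continuous_at)
    then have "\<forall>\<^sub>F x in at c. k c / 2 < k x"
      using kc by (intro order_tendstoD) (auto simp: isCont_def)
    then obtain d where "d > 0" "\<And>x. x \<noteq> c \<Longrightarrow> dist x c < d \<Longrightarrow> k c / 2 < k x"
      by (auto simp: eventually_at)
    then show ?thesis using kc that[of d] by (metis dist_real_def field_sum_of_halves less_add_same_cancel1 half_gt_zero)
  qed
  define A where "A = (LINT x|lborel. \<bar>k x * G 1 x\<bar>)"
  have ineq: "k c / 2 * d * exp (- (t * (d / 2)\<^sup>2)) \<le> exp (- ((t - 1) * d\<^sup>2)) * A" if "t \<ge> 1" for t
  proof -
    have pt: "indicator {c - d / 2..c + d / 2} x * (k c / 2 * exp (- (t * (d / 2)\<^sup>2)))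
       \<le> k x * G t x + exp (- ((t - 1) * d\<^sup>2)) * \<bar>k x * G 1 x\<bar>" for x
    proof (cases "\<bar>x - c\<bar> < d")
      case True
      then have kx: "k x > k c / 2" using d by simp
      have "indicator {c - d / 2..c + d / 2} x * (k c / 2 * exp (- (t * (d / 2)\<^sup>2))) \<le> k x * G t x"
      proof (cases "x \<in> {c - d / 2..c + d / 2}")
        case True
        then have "\<bar>x - c\<bar> \<le> \<bar>d / 2\<bar>"
          unfolding atLeastAtMost_iff using d(1) by linarith
        then have "(x - c)\<^sup>2 \<le> (d / 2)\<^sup>2" by (rule abs_le_square_iff[THEN iffD1])
        then have "exp (- (t * (d / 2)\<^sup>2)) \<le> G t x"
          unfolding G_def using that by (simp add: mult_left_mono)
        then have "k c / 2 * exp (- (t * (d / 2)\<^sup>2)) \<le> k x * G t x"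
          using kx kc by (intro mult_mono) auto
        then show ?thesis using True by simp
      next
        case False
        then show ?thesis using kx kc by (simp add: G_def)
      qed
      then show ?thesis by (smt (verit) abs_ge_zero exp_ge_zero mult_nonneg_nonneg)
    next
      case False
      then have 1: "x \<notin> {c - d / 2..c + d / 2}" using d(1) by (auto simp: abs_if split: if_splits)
      have "\<bar>d\<bar> \<le> \<bar>x - c\<bar>" using False d(1) by simp
      then have "d\<^sup>2 \<le> (x - c)\<^sup>2" by (rule abs_le_square_iff[THEN iffD1])
      then have "(t - 1) * d\<^sup>2 \<le> (t - 1) * (x - c)\<^sup>2"
        using that by (intro mult_left_mono) auto
      then have "G t x \<le> exp (- ((t - 1) * d\<^sup>2)) * G 1 x"
        unfolding G_def by (simp flip: exp_add add: algebra_simps)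
      then have "\<bar>k x\<bar> * G t x \<le> \<bar>k x\<bar> * (exp (- ((t - 1) * d\<^sup>2)) * G 1 x)"
        by (rule mult_left_mono) simp
      then have "- (k x * G t x) \<le> exp (- ((t - 1) * d\<^sup>2)) * \<bar>k x * G 1 x\<bar>"
        using abs_ge_minus_self[of "k x * G t x"] by (simp add: abs_mult G_def mult_ac)
      then show ?thesis using 1 by simp
    qed
    have "(LINT x|lborel. indicator {c - d / 2..c + d / 2} x * (k c / 2 * exp (- (t * (d / 2)\<^sup>2))))
       \<le> (LINT x|lborel. k x * G t x + exp (- ((t - 1) * d\<^sup>2)) * \<bar>k x * G 1 x\<bar>)"
    proof (rule integral_mono[OF _ _ pt])
      show "integrable lborel (\<lambda>x. k x * G t x + exp (- ((t - 1) * d\<^sup>2)) * \<bar>k x * G 1 x\<bar>)"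
        using kint[of t] kint[of 1] that by (intro Bochner_Integration.integrable_add integrable_mult_right integrable_abs) auto
      show "integrable lborel (\<lambda>x. indicator {c - d / 2..c + d / 2} x *
          (k c / 2 * exp (- (t * (d / 2)\<^sup>2))))"
        by (intro integrable_mult_left integrable_real_indicator)
          (simp_all add: d(1) less_imp_le)
    qed
    moreover have "(LINT x|lborel. k x * G t x + exp (- ((t - 1) * d\<^sup>2)) * \<bar>k x * G 1 x\<bar>)
        = exp (- ((t - 1) * d\<^sup>2)) * A"
      unfolding A_def using kint[of t] kint[of 1] kzero[of t] that
      by (subst Bochner_Integration.integral_add) (auto intro!: integrable_mult_right integrable_abs)
    ultimately show ?thesis using d(1) by (simp add: mult_ac)
  qed
  have "((\<lambda>t. exp (- ((t - 1) * d\<^sup>2)) / exp (- (t * (d / 2)\<^sup>2))) \<longlongrightarrow> 0) at_top"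
  proof -
    have e: "d\<^sup>2 > 0" using d(1) by simp
    have "((\<lambda>t. exp e * exp (- (3 / 4 * e * t))) \<longlongrightarrow> 0) at_top" if "e > 0" for e :: real
      using that by real_asymp
    moreover have "exp (- ((t - 1) * d\<^sup>2)) / exp (- (t * (d / 2)\<^sup>2))
        = exp (d\<^sup>2) * exp (- (3 / 4 * d\<^sup>2 * t))" for t
      unfolding exp_diff[symmetric] exp_add[symmetric] by (simp add: power_divide field_simps)
    ultimately show ?thesis using e by simp
  qed
  then have "((\<lambda>t. exp (- ((t - 1) * d\<^sup>2)) * A / exp (- (t * (d / 2)\<^sup>2))) \<longlongrightarrow> 0) at_top"
    by (drule_tac tendsto_mult_left_zero[where c = A]) simp
  then have "\<forall>\<^sub>F t in at_top. exp (- ((t - 1) * d\<^sup>2)) * A / exp (- (t * (d / 2)\<^sup>2)) < k c / 2 * d"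
    by (rule order_tendstoD) (use kc d(1) in simp)
  then obtain T where T: "\<And>t. t \<ge> T \<Longrightarrow> exp (- ((t - 1) * d\<^sup>2)) * A / exp (- (t * (d / 2)\<^sup>2)) < k c / 2 * d"
    by (auto simp: eventually_at_top_linorder)
  show False using T[of "max 1 T"] ineq[of "max 1 T"]
    by (simp add: divide_less_eq)
qed

lemma borel_version:
  fixes f :: "real \<Rightarrow> complex"
  assumes "f \<in> borel_measurable lebesgue"
  obtains f' where "f' \<in> borel_measurable borel" "AE x in lebesgue. f x = f' x"
proof -
  have "(\<lambda>x. Re (f x)) \<in> borel_measurable lebesgue" "(\<lambda>x. Im (f x)) \<in> borel_measurable lebesgue"
    using assms by measurable
  then obtain u v where "u \<in> borel_measurable lborel" "AE x in lborel. Re (f x) = u x"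
    "v \<in> borel_measurable lborel" "AE x in lborel. Im (f x) = v x"
    by (metis completion_ex_borel_measurable_real)
  then have "(\<lambda>x. Complex (u x) (v x)) \<in> borel_measurable borel"
     "AE x in lebesgue. f x = Complex (u x) (v x)"
    by (auto simp: AE_completion_iff complex_eq_iff Complex_eq)
  then show ?thesis using that by blast
qed

theorem fourier_multiplier_eq_convolution:
  assumes f: "integrable lebesgue (\<lambda>x. f x / of_real ((1 + \<bar>x\<bar>) ^ N))" and \<psi>: "\<psi> \<in> schwartz"
  shows "fourier_multiplier f \<psi> = (\<lambda>x. LINT y|lebesgue. f y * inv_fourier \<psi> (x - y))"
    (is "_ = ?g")
proof -
  let ?T = "distr_inv_fourier (distr_mult (distr_fourier (distr_of f)) \<psi>)"
  have pos: "(1 + \<bar>x\<bar>) ^ N > 0" for x :: real by (intro zero_less_power) linarith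
  have nz: "complex_of_real ((1 + \<bar>x\<bar>) ^ N) \<noteq> 0" for x :: real
    using pos[of x] by (metis less_irrefl of_real_eq_0_iff)
  have "(\<lambda>x. f x / of_real ((1 + \<bar>x\<bar>) ^ N) * of_real ((1 + \<bar>x\<bar>) ^ N)) \<in> borel_measurable lebesgue"
    by (intro borel_measurable_times borel_measurable_integrable[OF f] measurable_completion) simp
  then have fm: "f \<in> borel_measurable lebesgue" using nz by (simp only: times_divide_eq_left nonzero_mult_div_cancel_right not_False_eq_True)
  obtain f' where f'm [measurable]: "f' \<in> borel_measurable borel"
    and f': "AE x in lebesgue. f x = f' x" using borel_version[OF fm] by blast
  have swap: "(LINT y|lebesgue. f y * u y) = (LINT y|lborel. f' y * u y)"
    if [measurable]: "u \<in> borel_measurable borel" for u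
  proof -
    have "(LINT y|lebesgue. f y * u y) = (LINT y|lebesgue. f' y * u y)"
      using f' by (intro integral_cong_AE borel_measurable_times fm) (auto intro: measurable_completion)
    then show ?thesis by (simp add: integral_completion)
  qed
  define w where "w y = cmod (f' y) / (1 + \<bar>y\<bar>) ^ N" for y
  have w: "integrable lborel w"
  proof -
    have "integrable lebesgue (\<lambda>x. f' x / of_real ((1 + \<bar>x\<bar>) ^ N))"
      using f' by (intro integrable_cong_AE_imp[OF f]) (auto intro: measurable_completion)
    then have "integrable lborel (\<lambda>x. cmod (f' x / of_real ((1 + \<bar>x\<bar>) ^ N)))"
      by (intro integrable_norm) (simp add: integrable_completion)
    moreover have "cmod (f' x / of_real ((1 + \<bar>x\<bar>) ^ N)) = w x" for x
      unfolding w_def norm_divide norm_of_real using pos[of x] by simp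
    ultimately show ?thesis by simp
  qed
  define K where "K = inv_fourier \<psi>"
  have Kc: "continuous_on UNIV K" unfolding K_def by (intro inv_fourier_continuous schwartz_rapid_continuous \<psi>)
  note [measurable] = borel_measurable_continuous_UNIV[OF Kc]
  obtain C where C: "C > 0" "\<And>x. cmod (K x) \<le> C / (1 + \<bar>x\<bar>) ^ N"
    using rapidE[OF inv_fourier_rapid[OF \<psi>], of N] unfolding K_def by blast
  have bound: "cmod (f' y * K (x - y)) \<le> C * (1 + \<bar>x\<bar>) ^ N * w y" for x y
  proof -
    have "(1 + \<bar>y\<bar>) ^ N \<le> (1 + \<bar>x\<bar>) ^ N * (1 + \<bar>x - y\<bar>) ^ N"
      using power_mono[OF peetre[of y x], of N] by (simp add: power_mult_distrib)
    then have "C / (1 + \<bar>x - y\<bar>) ^ N \<le> C * (1 + \<bar>x\<bar>) ^ N / (1 + \<bar>y\<bar>) ^ N"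
      using pos[of y] pos[of "x - y"] C(1) by (simp add: field_simps)
    then have "cmod (K (x - y)) \<le> C * (1 + \<bar>x\<bar>) ^ N / (1 + \<bar>y\<bar>) ^ N"
      using C(2)[of "x - y"] by linarith
    from mult_left_mono[OF this norm_ge_zero[of "f' y"]] show ?thesis
      by (simp add: norm_mult w_def mult_ac)
  qed
  define g where "g x = (LINT y|lborel. f' y * K (x - y))" for x
  have g: "?g = g"
    unfolding g_def K_def[symmetric] by (intro ext swap) simp
  have fK: "integrable lborel (\<lambda>y. f' y * K (x - y))" for x
    by (rule Bochner_Integration.integrable_bound[of _ "\<lambda>y. C * (1 + \<bar>x\<bar>) ^ N * w y"])
      (use w order_trans[OF bound abs_ge_self] in auto)
  have gc: "continuous_on UNIV g"
  proof (rule continuous_on_sequentiallyI)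
    fix u :: "nat \<Rightarrow> real" and a assume u: "u \<longlonglongrightarrow> a"
    obtain R where R: "\<And>n. \<bar>u n\<bar> \<le> R"
      using convergent_imp_bounded[OF u] by (auto simp: bounded_iff)
    show "(\<lambda>n. g (u n)) \<longlonglongrightarrow> g a"
      unfolding g_def
    proof (rule integral_dominated_convergence[where w = "\<lambda>y. C * (1 + R) ^ N * w y"])
      show "integrable lborel (\<lambda>y. C * (1 + R) ^ N * w y)" using w by simp
      have "(\<lambda>n. f' y * K (u n - y)) \<longlonglongrightarrow> f' y * K (a - y)" for y
        by (intro tendsto_intros isCont_tendsto_compose[of _ K] u)
          (use Kc in \<open>simp add: continuous_on_eq_continuous_at\<close>)
      then show "AE y in lborel. (\<lambda>n. f' y * K (u n - y)) \<longlonglongrightarrow> f' y * K (a - y)" by simp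
      have "cmod (f' y * K (u n - y)) \<le> C * (1 + R) ^ N * w y" for n y
      proof -
        have "C * (1 + \<bar>u n\<bar>) ^ N * w y \<le> C * (1 + R) ^ N * w y"
          using C(1) R[of n] by (intro mult_right_mono mult_left_mono power_mono) (auto simp: w_def)
        then show ?thesis using bound[of y "u n"] by linarith
      qed
      then show "AE y in lborel. norm (f' y * K (u n - y)) \<le> C * (1 + R) ^ N * w y" for n by simp
    qed simp_all
  qed
  note [measurable] = borel_measurable_continuous_UNIV[OF gc]
  have rep: "represents g ?T"
    unfolding represents_def
  proof (intro ballI conjI)
    fix \<phi> assume \<phi>: "\<phi> \<in> schwartz"
    note \<phi>r = schwartz_rapid_continuous(1)[OF \<phi>] and \<phi>c = schwartz_rapid_continuous(2)[OF \<phi>]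
    note [measurable] = borel_measurable_continuous_UNIV[OF \<phi>c]
    define v where "v x = of_real ((1 + \<bar>x\<bar>) ^ N) * \<phi> x" for x
    have v: "integrable lborel v"
    proof (rule rapid_integrable)
      show "continuous_on UNIV v" unfolding v_def by (intro continuous_intros \<phi>c)
      show "rapid v" unfolding rapid_def
      proof
        fix M
        obtain B where "\<And>x. cmod (\<phi> x) * (1 + \<bar>x\<bar>) ^ (N + M) \<le> B"
          using \<phi>r unfolding rapid_def by blast
        moreover have "cmod (v x) * (1 + \<bar>x\<bar>) ^ M = cmod (\<phi> x) * (1 + \<bar>x\<bar>) ^ (N + M)" for x
          unfolding v_def norm_mult norm_of_real using pos[of x] by (simp add: power_add mult_ac)
        ultimately show "\<exists>B. \<forall>x. cmod (v x) * (1 + \<bar>x\<bar>) ^ M \<le> B" by (intro exI[of _ B]) simp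
      qed
    qed
    let ?G = "\<lambda>x y. f' y * K (x - y) * \<phi> x"
    have Gb: "cmod (?G x y) \<le> C * cmod (v x) * w y" for x y
    proof -
      have "cmod (v x) = (1 + \<bar>x\<bar>) ^ N * cmod (\<phi> x)"
        unfolding v_def norm_mult norm_of_real using pos[of x] by simp
      then show ?thesis
        using mult_right_mono[OF bound[of y x], of "cmod (\<phi> x)"] by (simp add: norm_mult mult_ac)
    qed
    have Gx: "integrable lborel (\<lambda>y. ?G x y)" for x
      using fK by simp
    have inn: "(LINT y|lborel. cmod (?G x y)) \<le> C * cmod (v x) * (LINT y|lborel. w y)" for x
    proof -
      have "(LINT y|lborel. cmod (?G x y)) \<le> (LINT y|lborel. C * cmod (v x) * w y)"
        by (intro integral_mono integrable_norm Gx Gb) (use w in simp)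
      then show ?thesis by simp
    qed
    have *: "integrable (lborel \<Otimes>\<^sub>M lborel) (case_prod ?G)"
    proof (rule lborel_pair.Fubini_integrable)
      show "case_prod ?G \<in> borel_measurable (lborel \<Otimes>\<^sub>M lborel)" by measurable
      show "integrable lborel (\<lambda>x. LINT y|lborel. norm (case_prod ?G (x, y)))"
      proof (rule Bochner_Integration.integrable_bound)
        show "integrable lborel (\<lambda>x. C * cmod (v x) * (LINT y|lborel. w y))" using v by simp
        show "(\<lambda>x. LINT y|lborel. norm (case_prod ?G (x, y))) \<in> borel_measurable lborel"
          by measurable
        show "AE x in lborel. norm (LINT y|lborel. norm (case_prod ?G (x, y)))
            \<le> norm (C * cmod (v x) * (LINT y|lborel. w y))"
          using order_trans[OF inn abs_ge_self] by simp
      qed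
      show "AE x in lborel. integrable lborel (\<lambda>y. case_prod ?G (x, y))" using Gx by simp
    qed
    have Gg: "(LINT y|lborel. ?G x y) = g x * \<phi> x" for x by (simp add: g_def)
    have "integrable lborel (\<lambda>x. LINT y|lborel. ?G x y)"
      using lborel_pair.integrable_fst'[OF *] by simp
    then show "integrable lebesgue (\<lambda>x. g x * \<phi> x)" unfolding Gg by (simp add: integrable_completion)
    have fou: "fourier (\<lambda>\<xi>. \<psi> \<xi> * inv_fourier \<phi> \<xi>) y = (LINT x|lborel. \<phi> x * K (x - y))" for y
      unfolding K_def by (intro fourier_mult_inv_fourier schwartz_rapid_continuous \<phi> \<psi>)
    have "?T \<phi> = (LINT y|lebesgue. f y * (LINT x|lborel. \<phi> x * K (x - y)))"
      by (simp add: distr_inv_fourier_def distr_mult_def distr_fourier_def distr_of_def fou)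
    also have "\<dots> = (LINT y|lborel. f' y * (LINT x|lborel. \<phi> x * K (x - y)))"
      by (rule swap) simp
    also have "\<dots> = (LINT y|lborel. LINT x|lborel. ?G x y)"
      by (simp flip: integral_mult_right_zero add: mult_ac)
    also have "\<dots> = (LINT x|lborel. g x * \<phi> x)"
      unfolding Gg[symmetric] using lborel_pair.Fubini_integral[OF *] by simp
    also have "\<dots> = distr_of g \<phi>"
      by (simp add: distr_of_def integral_completion)
    finally show "distr_of g \<phi> = ?T \<phi>" by simp
  qed
  have "fourier_multiplier f \<psi> = g"
    unfolding fourier_multiplier_def
  proof (rule the_equality)
    fix g2 assume g2: "continuous_on UNIV g2 \<and> represents g2 ?T"
    note [measurable] = borel_measurable_continuous_UNIV[OF conjunct1[OF g2]]
    have "g2 c - g c = 0" for c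
    proof (rule continuous_representative_zero[of "\<lambda>x. g2 x - g x"])
      show "continuous_on UNIV (\<lambda>x. g2 x - g x)" using g2 gc by (intro continuous_intros) auto
      fix \<phi> assume \<phi>: "\<phi> \<in> schwartz"
      have [measurable]: "\<phi> \<in> borel_measurable borel"
        by (intro borel_measurable_continuous_UNIV schwartz_rapid_continuous \<phi>)
      have i: "integrable lborel (\<lambda>x. g2 x * \<phi> x)" "integrable lborel (\<lambda>x. g x * \<phi> x)"
        using g2 rep \<phi> by (auto simp: represents_def integrable_completion)
      have "distr_of g2 \<phi> = distr_of g \<phi>"
        using g2 rep \<phi> by (metis represents_def)
      then have "(LINT x|lborel. g2 x * \<phi> x) = (LINT x|lborel. g x * \<phi> x)"
        by (simp add: distr_of_def integral_completion)
      then show "integrable lborel (\<lambda>x. (g2 x - g x) * \<phi> x)"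
        "(LINT x|lborel. (g2 x - g x) * \<phi> x) = 0" using i by (simp_all add: left_diff_distrib)
    qed
    then show "g2 = g" by (simp add: fun_eq_iff)
  qed (use gc rep in simp)
  then show ?thesis using g by simp
qed

section \<open>Functions with values in \<open>l\<^sup>2\<close>\<close>

text \<open>An \<open>l\<^sup>2(M)\<close>-valued function is a map \<open>F :: real \<Rightarrow> nat \<Rightarrow> complex\<close>; only the components
  \<open>F x m\<close> with \<open>m \<in> M\<close> are relevant. As \<open>l\<^sup>2(M)\<close> is separable, measurability is measurability of
  all components. Norms take values in \<^typ>\<open>ennreal\<close>, and \<open>epowr\<close> is the power with positive
  real exponent there.\<close>

definition epowr :: "ennreal \<Rightarrow> real \<Rightarrow> ennreal" where
  "epowr x a = (if x = \<infinity> then \<infinity> else ennreal (enn2real x powr a))"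

definition l2_norm :: "nat set \<Rightarrow> (nat \<Rightarrow> complex) \<Rightarrow> ennreal" where
  "l2_norm M v = epowr (\<Sum>\<^sub>\<infinity>m\<in>M. ennreal ((cmod (v m))\<^sup>2)) (1 / 2)"

definition L2_loc :: "nat set \<Rightarrow> (real \<Rightarrow> nat \<Rightarrow> complex) set" where
  "L2_loc M = {F. (\<forall>m\<in>M. (\<lambda>x. F x m) \<in> borel_measurable lebesgue) \<and>
     (\<forall>a b. (\<integral>\<^sup>+x\<in>{a..b}. (l2_norm M (F x))\<^sup>2 \<partial>lebesgue) < \<infinity>)}"

text \<open>Convergence in \<open>L\<^sup>2(I, l\<^sup>2(M))\<close> for every bounded interval \<open>I\<close>.\<close>

definition tendsto_L2_loc ::
    "nat set \<Rightarrow> (nat \<Rightarrow> real \<Rightarrow> nat \<Rightarrow> complex) \<Rightarrow> (real \<Rightarrow> nat \<Rightarrow> complex) \<Rightarrow> bool" where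
  "tendsto_L2_loc M F G \<longleftrightarrow> (\<forall>\<nu>. F \<nu> \<in> L2_loc M) \<and> G \<in> L2_loc M \<and>
     (\<forall>a b. (\<lambda>\<nu>. \<integral>\<^sup>+x\<in>{a..b}. (l2_norm M (F \<nu> x - G x))\<^sup>2 \<partial>lebesgue) \<longlonglongrightarrow> 0)"

definition tendsto_L2 :: "(nat \<Rightarrow> real \<Rightarrow> complex) \<Rightarrow> (real \<Rightarrow> complex) \<Rightarrow> bool" where
  "tendsto_L2 f g \<longleftrightarrow> (\<lambda>\<nu>. \<integral>\<^sup>+x. ennreal ((cmod (f \<nu> x - g x))\<^sup>2) \<partial>lebesgue) \<longlonglongrightarrow> 0"

section \<open>Morrey--Campanato spaces\<close>

definition polys :: "nat \<Rightarrow> (real \<Rightarrow> complex) set" where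
  "polys i = {\<lambda>x. poly p (of_real x) | p. p = 0 \<or> degree p < i}"

definition polys_l2 :: "nat set \<Rightarrow> nat \<Rightarrow> (real \<Rightarrow> nat \<Rightarrow> complex) set" where
  "polys_l2 M i = {\<lambda>x m. \<Sum>k<i. c k m * of_real x ^ k | c. \<forall>k<i. l2_norm M (c k) < \<infinity>}"

text \<open>The scalar and the \<open>l\<^sup>2\<close>-valued seminorms are instances of one expression, with \<open>N\<close> the norm on
  the values and \<open>V\<close> the space of polynomials.\<close>

definition campanato_sup ::
    "('v :: minus \<Rightarrow> ennreal) \<Rightarrow> (real \<Rightarrow> 'v) set \<Rightarrow> real \<Rightarrow> real \<Rightarrow> (real \<Rightarrow> 'v) \<Rightarrow> ennreal" where
  "campanato_sup N V p s f = (SUP (a, b)\<in>{(a, b). a < b}. INF P\<in>V.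
     ennreal (1 / (b - a) powr s) *
     epowr (ennreal (1 / (b - a)) * (\<integral>\<^sup>+x\<in>{a..b}. epowr (N (f x - P x)) p \<partial>lebesgue)) (1 / p))"

definition campanato_norm :: "nat \<Rightarrow> real \<Rightarrow> real \<Rightarrow> (real \<Rightarrow> complex) \<Rightarrow> ennreal" where
  "campanato_norm i p s f = campanato_sup (\<lambda>z. ennreal (cmod z)) (polys i) p s f"

definition campanato_norm_l2 ::
    "nat set \<Rightarrow> nat \<Rightarrow> real \<Rightarrow> real \<Rightarrow> (real \<Rightarrow> nat \<Rightarrow> complex) \<Rightarrow> ennreal" where
  "campanato_norm_l2 M i p s F = campanato_sup (l2_norm M) (polys_l2 M i) p s F"

definition campanato :: "nat \<Rightarrow> real \<Rightarrow> real \<Rightarrow> (real \<Rightarrow> complex) set" where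
  "campanato i p s = {f. (\<forall>a b. set_integrable lebesgue {a..b} f) \<and> campanato_norm i p s f < \<infinity>}"

end

theory Submission
  imports Defs "HOL-Probability.Probability"
begin

text \<open>Subtracting dilates of \<open>\<psi>\<close> at an endpoint decomposes the multiplier of one half of \<open>\<Delta>\<^sub>m\<close>
  into smooth dyadic pieces, and \<open>\<psi>\<^sub>m\<^sub>,\<^sub>\<nu>\<close> is the sum of the first \<open>\<nu>\<close> of them. On a fixed interval \<open>I\<close>
  one may replace \<open>f\<close> by \<open>f - P\<close> with \<open>P\<close> an approximating polynomial on a dilate of \<open>I\<close>, because the
  pieces vanish near the frequency 0. The part of \<open>f - P\<close> near \<open>I\<close> is estimated by Plancherel and the
  disjointness of the \<open>\<Delta>\<^sub>m\<close>. From the part far from \<open>I\<close>, cut into dyadic shells, one subtracts the Taylor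
  polynomial of order \<open>r\<close>; in the remainder a weight \<open>(u - y)\<^sup>-\<^sup>N\<close> is moved onto \<open>f\<close>. This costs derivatives
  of the multiplier but preserves its support, so Plancherel and the disjointness apply to every shell,
  and the growth of \<open>f - P\<close> is slow enough for the sum over shells to converge because \<open>r > max s (i - 1)\<close>.
  Finally the polynomials depending on \<open>I\<close> are replaced by those of one fixed interval; their differences
  form an absolutely convergent series of coefficients, by the equivalence of norms on polynomials.\<close>

section \<open>The Plancherel inequality\<close>

text \<open>The cut-off jumps at the end point, so its kernel has too little decay for functions
  that grow; the harm comes from low frequencies relative to that end point, and there a Taylor
  polynomial helps. To make the end point frequency 0, the exponential is moved onto
  \<open>f\<close>; at scale \<sigma>, r derivatives then gain \<sigma>^r. For data at distance R
  all depends on z = |\<sigma>| R: the plain estimate serves z \<le> 1, the weighted one z > 1, and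
  both are controlled by \<open>omega z\<close>, whose sum over the scales is at most 4. The scales
  therefore cost only a constant. The shells decay like 2^(-2 \<delta> k) with \<delta> = r - max s
  (i - 1); half of this pays for Cauchy-Schwarz weights, half for the factor (k + 1)^2 in the growth
  of f - P. The obstacle is the l^2 norm over m, because the weight depends on the point u. The far
  part is estimated at a fixed u, where Plancherel bounds the sum over all bands by the norm of one
  shell, and only afterwards integrated in u. The right end point is the left one reflected: the
  signed length \<kappa> is negative there.\<close>

definition l2sq :: "real set \<Rightarrow> (real \<Rightarrow> complex) \<Rightarrow> ennreal" where
  "l2sq A g = (\<integral>\<^sup>+x\<in>A. ennreal ((cmod (g x))\<^sup>2) \<partial>lborel)"

lemma borel_measurable_cis [measurable (raw)]:
  "f \<in> borel_measurable M \<Longrightarrow> (\<lambda>x. cis (f x)) \<in> borel_measurable M"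
  unfolding cis_conv_exp by measurable

lemma integrable_mult_cis:
  assumes "integrable lborel g" "h \<in> borel_measurable borel"
  shows "integrable lborel (\<lambda>x. g x * cis (h x))"
  by (rule Bochner_Integration.integrable_bound[OF assms(1)])
    (use assms in \<open>auto simp: norm_mult\<close>)

text \<open>A non-integrable function has Bochner integral 0 by convention, which is still
  dominated.\<close>

lemma norm_integral_le_nn_integral:
  fixes f :: "'a \<Rightarrow> 'b::{banach, second_countable_topology}"
  shows "ennreal (norm (integral\<^sup>L M f)) \<le> (\<integral>\<^sup>+x. ennreal (norm (f x)) \<partial>M)"
proof (cases "integrable M f")
  case True
  then show ?thesis by (rule integral_norm_bound_ennreal)
qed (simp add: not_integrable_integral_eq)

lemma fourier_measurable [measurable]:
  assumes [measurable]: "g \<in> borel_measurable borel"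
  shows "fourier g \<in> borel_measurable borel"
  unfolding fourier_def by measurable

lemma fourier_bound: "cmod (fourier g \<xi>) \<le> (LINT x|lborel. cmod (g x))"
  unfolding fourier_def by (rule order_trans[OF integral_norm_bound]) (simp add: norm_mult)

lemma fourier_multiplication_formula:
  assumes g: "integrable lborel g" and h: "integrable lborel h"
  shows "(LINT \<xi>|lborel. fourier g \<xi> * h \<xi>) = (LINT x|lborel. g x * fourier h x)"
proof -
  have [measurable]: "g \<in> borel_measurable borel" "h \<in> borel_measurable borel"
    using g h by auto
  let ?G = "\<lambda>\<xi> x. g x * h \<xi> * cis (- (2 * pi * x * \<xi>))"
  have *: "integrable (lborel \<Otimes>\<^sub>M lborel) (case_prod ?G)"
  proof (rule lborel_pair.Fubini_integrable)
    show "case_prod ?G \<in> borel_measurable (lborel \<Otimes>\<^sub>M lborel)" by measurable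
    show "integrable lborel (\<lambda>\<xi>. LINT x|lborel. norm (case_prod ?G (\<xi>, x)))"
      using h by (simp add: norm_mult)
    have "integrable lborel (\<lambda>x. g x * h \<xi> * cis (- (2 * pi * x * \<xi>)))" for \<xi>
      using g by (intro integrable_mult_cis) auto
    then show "AE \<xi> in lborel. integrable lborel (\<lambda>x. case_prod ?G (\<xi>, x))" by simp
  qed
  have "(LINT \<xi>|lborel. fourier g \<xi> * h \<xi>) = (LINT \<xi>|lborel. LINT x|lborel. ?G \<xi> x)"
    unfolding fourier_def integral_mult_left_zero[symmetric]
    by (intro Bochner_Integration.integral_cong refl) (simp add: mult_ac)
  also have "\<dots> = (LINT x|lborel. LINT \<xi>|lborel. ?G \<xi> x)"
    using lborel_pair.Fubini_integral[OF *] by simp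
  also have "\<dots> = (LINT x|lborel. g x * fourier h x)"
    unfolding fourier_def integral_mult_right_zero[symmetric]
    by (intro Bochner_Integration.integral_cong refl) (simp add: mult_ac)
  finally show ?thesis .
qed

text \<open>The multiplication formula with \<Phi> times a character. It does the work of Fourier
  inversion and of the convolution theorem for merely integrable \<open>g\<close> and
  \<Phi>.\<close>

lemma convolution_inv_fourier:
  assumes g: "integrable lborel g" and \<Phi>: "integrable lborel \<Phi>"
  shows "(LINT y|lborel. g y * inv_fourier \<Phi> (u - y)) = inv_fourier (\<lambda>\<xi>. fourier g \<xi> * \<Phi> \<xi>) u"
proof -
  have e: "inv_fourier \<Phi> (u - y) = fourier (\<lambda>\<xi>. \<Phi> \<xi> * cis (2 * pi * u * \<xi>)) y" for y
    unfolding inv_fourier_def fourier_def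
    by (intro Bochner_Integration.integral_cong) (auto simp: mult.assoc cis_mult algebra_simps)
  have "(LINT y|lborel. g y * inv_fourier \<Phi> (u - y))
     = (LINT \<xi>|lborel. fourier g \<xi> * (\<Phi> \<xi> * cis (2 * pi * u * \<xi>)))"
    unfolding e by (intro fourier_multiplication_formula[symmetric] g integrable_mult_cis \<Phi>) auto
  then show ?thesis by (simp add: inv_fourier_def mult.assoc)
qed

text \<open>Rescaled characteristic function of the standard normal distribution. The density has
  width t / (2 pi), so it is an approximate identity as t tends to 0.\<close>

lemma gaussian_inv_fourier:
  fixes t z :: real
  assumes t: "t > 0"
  shows "inv_fourier (\<lambda>\<xi>. of_real (exp (- (t * \<xi>)\<^sup>2 / 2))) z = of_real (normal_density 0 (t / (2 * pi)) z)"
    and "integrable lborel (\<lambda>\<xi>. exp (- (t * \<xi>)\<^sup>2 / 2))"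
proof -
  have e: "exp (- (t * \<xi>)\<^sup>2 / 2) = sqrt (2 * pi) * std_normal_density (t * \<xi>)" for \<xi>
    by (simp add: std_normal_density_def)
  have i: "integrable lborel (\<lambda>x. std_normal_density (0 + t * x))"
    by (subst lborel_integrable_real_affine_iff) (use t in auto)
  then show "integrable lborel (\<lambda>\<xi>. exp (- (t * \<xi>)\<^sup>2 / 2))" unfolding e by simp
  define I where "I = (LINT \<xi>|lborel. of_real (std_normal_density (t * \<xi>)) * cis (2 * pi * z * \<xi>))"
  have "char std_normal_distribution (2 * pi * z / t)
     = (LINT x|lborel. of_real (std_normal_density x) * cis (2 * pi * z / t * x))"
    unfolding char_def by (subst integral_density) (auto simp: cis_conv_exp scaleR_conv_of_real)
  also have "\<dots> = t *\<^sub>R (LINT \<xi>|lborel. of_real (std_normal_density (0 + t * \<xi>)) * cis (2 * pi * z / t * (0 + t * \<xi>)))"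
    by (subst lborel_integral_real_affine[where c = t and t = 0]) (use t in auto)
  also have "\<dots> = t *\<^sub>R I" unfolding I_def using t by (simp add: mult.assoc)
  finally have "t *\<^sub>R I = of_real (exp (- (2 * pi * z / t)\<^sup>2 / 2))"
    by (simp add: char_std_normal_distribution)
  then have "I = of_real (exp (- (2 * pi * z / t)\<^sup>2 / 2) / t)"
    using t by (simp add: scaleR_conv_of_real field_simps)
  moreover have "inv_fourier (\<lambda>\<xi>. of_real (exp (- (t * \<xi>)\<^sup>2 / 2))) z
     = of_real (sqrt (2 * pi)) * I"
    unfolding I_def inv_fourier_def e of_real_mult mult.assoc by (rule integral_mult_right_zero)
  moreover have "normal_density 0 (t / (2 * pi)) z = sqrt (2 * pi) * (exp (- (2 * pi * z / t)\<^sup>2 / 2) / t)"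
  proof -
    have "1 / sqrt (2 * pi * (t / (2 * pi))\<^sup>2) = sqrt (2 * pi) / t"
    proof -
      have "2 * pi * (t / (2 * pi))\<^sup>2 = t\<^sup>2 / (2 * pi)" by (simp add: power2_eq_square)
      then have "sqrt (2 * pi * (t / (2 * pi))\<^sup>2) = t / sqrt (2 * pi)"
        using t by (simp add: real_sqrt_divide)
      then show ?thesis by simp
    qed
    moreover have "- (z - 0)\<^sup>2 / (2 * (t / (2 * pi))\<^sup>2) = - (2 * pi * z / t)\<^sup>2 / 2"
      using t by (simp add: power2_eq_square)
    ultimately show ?thesis unfolding normal_density_def by simp
  qed
  ultimately show "inv_fourier (\<lambda>\<xi>. of_real (exp (- (t * \<xi>)\<^sup>2 / 2))) z = of_real (normal_density 0 (t / (2 * pi)) z)"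
    by simp
qed

lemma nn_integral_normal_density_shift:
  assumes "\<sigma> > 0"
  shows "(\<integral>\<^sup>+y. ennreal (normal_density 0 \<sigma> (x - y)) \<partial>lborel) = 1"
    "(\<integral>\<^sup>+x. ennreal (normal_density 0 \<sigma> (x - y)) \<partial>lborel) = 1"
proof -
  have 1: "normal_density 0 \<sigma> (x - y) = normal_density x \<sigma> y" "normal_density 0 \<sigma> (x - y) = normal_density y \<sigma> x" for x y
    by (simp_all add: normal_density_def power2_commute)
  have 2: "(\<integral>\<^sup>+x. ennreal (normal_density y \<sigma> x) \<partial>lborel) = 1" for y
    using assms by (subst nn_integral_eq_integral) auto
  show "(\<integral>\<^sup>+y. ennreal (normal_density 0 \<sigma> (x - y)) \<partial>lborel) = 1"
    unfolding 1(1) by (rule 2)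
  show "(\<integral>\<^sup>+x. ennreal (normal_density 0 \<sigma> (x - y)) \<partial>lborel) = 1"
    unfolding 1(2) by (rule 2)
qed

text \<open>Schur's test against a Gaussian of total mass 1.\<close>

lemma gaussian_l2_bound:
  assumes g: "integrable lborel g" and t: "t > 0"
  shows "(\<integral>\<^sup>+\<xi>. ennreal (exp (- (t * \<xi>)\<^sup>2 / 2) * (cmod (fourier g \<xi>))\<^sup>2) \<partial>lborel) \<le> l2sq UNIV g"
proof -
  have gm [measurable]: "g \<in> borel_measurable borel" using g by auto
  define e where "e \<xi> = exp (- (t * \<xi>)\<^sup>2 / 2)" for \<xi>
  define \<gamma> where "\<gamma> = normal_density 0 (t / (2 * pi))"
  have \<gamma>0: "\<gamma> z \<ge> 0" for z by (simp add: \<gamma>_def)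
  have [measurable]: "\<gamma> \<in> borel_measurable borel" "e \<in> borel_measurable borel"
    unfolding \<gamma>_def e_def by measurable
  have ei: "integrable lborel e" unfolding e_def by (rule gaussian_inv_fourier(2)[OF t])
  have eic: "integrable lborel (\<lambda>\<xi>. complex_of_real (e \<xi>))" using ei by simp
  have inv: "inv_fourier (\<lambda>\<xi>. of_real (e \<xi>)) z = of_real (\<gamma> z)" for z
    unfolding e_def \<gamma>_def by (rule gaussian_inv_fourier(1)[OF t])
  \<comment> \<open>Chosen so that \<open>fourier g * h\<close> is the weighted squared modulus. The
    multiplication formula moves the transform onto \<open>h\<close>, where it gives the conjugate
    of \<open>g\<close> smoothed by \<gamma>.\<close>
  define h where "h \<xi> = of_real (e \<xi>) * cnj (fourier g \<xi>)" for \<xi>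
  have [measurable]: "(\<lambda>x. cnj (fourier g x)) \<in> borel_measurable borel"
    by (rule borel_measurable_continuous_on[OF _ fourier_measurable[OF gm]]) (intro continuous_intros)
  let ?B = "LINT x|lborel. cmod (g x)"
  have hi: "integrable lborel h"
  proof (rule Bochner_Integration.integrable_bound)
    show "integrable lborel (\<lambda>\<xi>. e \<xi> * ?B)" using ei by simp
    show "h \<in> borel_measurable lborel" unfolding h_def by measurable
    show "AE \<xi> in lborel. norm (h \<xi>) \<le> norm (e \<xi> * ?B)"
      by (auto intro!: mult_left_mono order_trans[OF fourier_bound] simp: h_def norm_mult e_def abs_mult)
  qed
  have fh: "fourier h x = cnj (LINT y|lborel. g y * of_real (\<gamma> (x - y)))" for x
  proof -
    have "fourier h x = (LINT \<xi>|lborel. cnj (fourier g \<xi> * of_real (e \<xi>) * cis (2 * pi * x * \<xi>)))"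
      unfolding fourier_def[of h] h_def
      by (intro Bochner_Integration.integral_cong refl) (simp add: cis_cnj mult_ac)
    also have "\<dots> = cnj (inv_fourier (\<lambda>\<xi>. fourier g \<xi> * of_real (e \<xi>)) x)"
      unfolding inv_fourier_def by (rule Bochner_Integration.integral_cnj)
    also have "inv_fourier (\<lambda>\<xi>. fourier g \<xi> * of_real (e \<xi>)) x = (LINT y|lborel. g y * of_real (\<gamma> (x - y)))"
      using convolution_inv_fourier[OF g eic, of x] by (simp add: inv)
    finally show ?thesis .
  qed
  have ie: "integrable lborel (\<lambda>\<xi>. e \<xi> * (cmod (fourier g \<xi>))\<^sup>2)"
  proof (rule Bochner_Integration.integrable_bound)
    show "integrable lborel (\<lambda>\<xi>. e \<xi> * ?B\<^sup>2)" using ei by simp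
    show "AE \<xi> in lborel. norm (e \<xi> * (cmod (fourier g \<xi>))\<^sup>2) \<le> norm (e \<xi> * ?B\<^sup>2)"
      by (auto intro!: mult_left_mono power_mono fourier_bound simp: e_def abs_mult)
  qed simp
  let ?I = "LINT \<xi>|lborel. e \<xi> * (cmod (fourier g \<xi>))\<^sup>2"
  have "complex_of_real ?I = (LINT \<xi>|lborel. fourier g \<xi> * h \<xi>)"
    unfolding integral_complex_of_real[symmetric] h_def
    by (intro Bochner_Integration.integral_cong) (auto simp: complex_norm_square simp flip: of_real_power)
  also have "\<dots> = (LINT x|lborel. g x * cnj (LINT y|lborel. g y * of_real (\<gamma> (x - y))))"
    unfolding fourier_multiplication_formula[OF g hi] fh ..
  finally have I: "complex_of_real ?I = \<dots>" .
  have nn: "?I \<ge> 0" by (intro Bochner_Integration.integral_nonneg) (auto simp: e_def)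
  have "ennreal ?I = ennreal (cmod (complex_of_real ?I))" using nn by simp
  also have "\<dots> \<le> (\<integral>\<^sup>+x. ennreal (norm (g x * cnj (LINT y|lborel. g y * of_real (\<gamma> (x - y))))) \<partial>lborel)"
    unfolding I by (rule norm_integral_le_nn_integral) 
  also have "\<dots> \<le> (\<integral>\<^sup>+x. ennreal (cmod (g x)) * (\<integral>\<^sup>+y. ennreal (cmod (g y) * \<gamma> (x - y)) \<partial>lborel) \<partial>lborel)"
  proof (intro nn_integral_mono)
    fix x
    have "ennreal (cmod (LINT y|lborel. g y * of_real (\<gamma> (x - y)))) \<le> (\<integral>\<^sup>+y. ennreal (cmod (g y) * \<gamma> (x - y)) \<partial>lborel)"
      using norm_integral_le_nn_integral[of lborel "\<lambda>y. g y * of_real (\<gamma> (x - y))"] \<gamma>0 by (simp add: norm_mult)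
    then show "ennreal (norm (g x * cnj (LINT y|lborel. g y * of_real (\<gamma> (x - y))))) \<le> ennreal (cmod (g x)) * (\<integral>\<^sup>+y. ennreal (cmod (g y) * \<gamma> (x - y)) \<partial>lborel)"
      by (simp add: norm_mult ennreal_mult mult_left_mono)
  qed
  also have "\<dots> = (\<integral>\<^sup>+x. (\<integral>\<^sup>+y. ennreal (cmod (g x) * (cmod (g y) * \<gamma> (x - y))) \<partial>lborel) \<partial>lborel)"
    by (simp add: ennreal_mult' nn_integral_cmult)
  also have "\<dots> \<le> (\<integral>\<^sup>+x. (\<integral>\<^sup>+y. ennreal ((cmod (g x))\<^sup>2 / 2) * ennreal (\<gamma> (x - y)) + ennreal ((cmod (g y))\<^sup>2 / 2) * ennreal (\<gamma> (x - y)) \<partial>lborel) \<partial>lborel)"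
  proof (intro nn_integral_mono)
    fix x y
    have "cmod (g x) * cmod (g y) \<le> (cmod (g x))\<^sup>2 / 2 + (cmod (g y))\<^sup>2 / 2"
      using sum_squares_bound[of "cmod (g x)" "cmod (g y)"] by simp
    then have "cmod (g x) * cmod (g y) * \<gamma> (x - y) \<le> ((cmod (g x))\<^sup>2 / 2 + (cmod (g y))\<^sup>2 / 2) * \<gamma> (x - y)"
      by (intro mult_right_mono \<gamma>0)
    then show "ennreal (cmod (g x) * (cmod (g y) * \<gamma> (x - y))) \<le> ennreal ((cmod (g x))\<^sup>2 / 2) * ennreal (\<gamma> (x - y)) + ennreal ((cmod (g y))\<^sup>2 / 2) * ennreal (\<gamma> (x - y))"
      using \<gamma>0 by (simp flip: ennreal_mult ennreal_plus add: algebra_simps)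
  qed
  also have "\<dots> = (\<integral>\<^sup>+x. (\<integral>\<^sup>+y. ennreal ((cmod (g x))\<^sup>2 / 2) * ennreal (\<gamma> (x - y)) \<partial>lborel) \<partial>lborel) + (\<integral>\<^sup>+x. (\<integral>\<^sup>+y. ennreal ((cmod (g y))\<^sup>2 / 2) * ennreal (\<gamma> (x - y)) \<partial>lborel) \<partial>lborel)"
    by (simp add: nn_integral_add)
  also have "(\<integral>\<^sup>+x. (\<integral>\<^sup>+y. ennreal ((cmod (g y))\<^sup>2 / 2) * ennreal (\<gamma> (x - y)) \<partial>lborel) \<partial>lborel)
     = (\<integral>\<^sup>+y. (\<integral>\<^sup>+x. ennreal ((cmod (g y))\<^sup>2 / 2) * ennreal (\<gamma> (x - y)) \<partial>lborel) \<partial>lborel)"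
    by (rule lborel_pair.Fubini') measurable
  also have "(\<integral>\<^sup>+x. (\<integral>\<^sup>+y. ennreal ((cmod (g x))\<^sup>2 / 2) * ennreal (\<gamma> (x - y)) \<partial>lborel) \<partial>lborel)
      + (\<integral>\<^sup>+y. (\<integral>\<^sup>+x. ennreal ((cmod (g y))\<^sup>2 / 2) * ennreal (\<gamma> (x - y)) \<partial>lborel) \<partial>lborel)
     = (\<integral>\<^sup>+x. ennreal ((cmod (g x))\<^sup>2 / 2) \<partial>lborel) + (\<integral>\<^sup>+x. ennreal ((cmod (g x))\<^sup>2 / 2) \<partial>lborel)"
    using t by (simp add: nn_integral_cmult \<gamma>_def nn_integral_normal_density_shift)
  also have "\<dots> = l2sq UNIV g"
    by (subst nn_integral_add[symmetric]) (auto simp: l2sq_def simp flip: ennreal_plus)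
  finally have "ennreal ?I \<le> l2sq UNIV g" .
  moreover have "(\<integral>\<^sup>+\<xi>. ennreal (e \<xi> * (cmod (fourier g \<xi>))\<^sup>2) \<partial>lborel) = ennreal ?I"
    by (rule nn_integral_eq_integral[OF ie]) (auto simp: e_def)
  ultimately show ?thesis unfolding e_def by simp
qed

text \<open>Fatou's lemma with Gaussian weights of parameter 1 / (n + 1), which tend to 1 pointwise.
  If \<open>g\<close> is not square integrable, the right-hand side is infinite.\<close>

lemma plancherel_le:
  assumes g: "integrable lborel g"
  shows "l2sq UNIV (fourier g) \<le> l2sq UNIV g"
proof -
  have [measurable]: "g \<in> borel_measurable borel" using g by auto
  let ?e = "\<lambda>n \<xi>. exp (- (1 / real (Suc n) * \<xi>)\<^sup>2 / 2) * (cmod (fourier g \<xi>))\<^sup>2"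
  have lim: "(\<lambda>n. ?e n \<xi>) \<longlonglongrightarrow> exp (- (0 * \<xi>)\<^sup>2 / 2) * (cmod (fourier g \<xi>))\<^sup>2" for \<xi>
    by (intro tendsto_intros) (use LIMSEQ_Suc[OF lim_inverse_n'] in simp_all)
  have "(cmod (fourier g \<xi>))\<^sup>2 = exp (- (0 * \<xi>)\<^sup>2 / 2) * (cmod (fourier g \<xi>))\<^sup>2" for \<xi> by simp
  then have "l2sq UNIV (fourier g) = (\<integral>\<^sup>+\<xi>. liminf (\<lambda>n. ennreal (?e n \<xi>)) \<partial>lborel)"
    unfolding l2sq_def using lim_imp_Liminf[OF sequentially_bot tendsto_ennrealI[OF lim]] 
    by (intro nn_integral_cong) simp
  also have "\<dots> \<le> liminf (\<lambda>n. \<integral>\<^sup>+\<xi>. ennreal (?e n \<xi>) \<partial>lborel)"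
    by (rule nn_integral_liminf) measurable
  also have "\<dots> \<le> liminf (\<lambda>n::nat. l2sq UNIV g)"
    by (intro Liminf_mono always_eventually allI gaussian_l2_bound g) simp
  finally show ?thesis by (simp add: Liminf_const)
qed

lemma inv_fourier_eq_fourier_neg: "inv_fourier f x = fourier f (- x)"
  unfolding inv_fourier_def fourier_def
  by (intro Bochner_Integration.integral_cong refl) (simp add: mult_ac)

lemma plancherel_inv_le:
  assumes g: "integrable lborel g"
  shows "l2sq UNIV (inv_fourier g) \<le> l2sq UNIV g"
proof -
  have [measurable]: "g \<in> borel_measurable borel" using g by auto
  have "l2sq UNIV (inv_fourier g) = l2sq UNIV (fourier g)"
    unfolding l2sq_def inv_fourier_eq_fourier_neg
    by (subst (2) nn_integral_real_affine[where c = "-1" and t = 0]) auto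
  then show ?thesis using plancherel_le[OF g] by simp
qed

lemma Cauchy_Schwarz_nn_integral:
  fixes f g :: "'a \<Rightarrow> real"
  assumes [measurable]: "f \<in> borel_measurable M" "g \<in> borel_measurable M"
  shows "(\<integral>\<^sup>+x. ennreal \<bar>f x * g x\<bar> \<partial>M)\<^sup>2 \<le> (\<integral>\<^sup>+x. ennreal ((f x)\<^sup>2) \<partial>M) * (\<integral>\<^sup>+x. ennreal ((g x)\<^sup>2) \<partial>M)"
    (is "?I\<^sup>2 \<le> ?A * ?B")
\<comment> \<open>In \<open>ennreal\<close> 0 times infinity is 0, so a vanishing factor has to be
  treated before an infinite one; the product of the functions is then 0 almost everywhere.\<close>
proof (cases "?A = 0 \<or> ?B = 0")
  case True
  then have "AE x in M. f x * g x = 0"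
  proof
    assume "?A = 0"
    then have "AE x in M. f x = 0" by (subst (asm) nn_integral_0_iff_AE) simp_all
    then show ?thesis by eventually_elim simp
  next
    assume "?B = 0"
    then have "AE x in M. g x = 0" by (subst (asm) nn_integral_0_iff_AE) simp_all
    then show ?thesis by eventually_elim simp
  qed
  then have "?I = 0" by (subst nn_integral_0_iff_AE) auto
  then show ?thesis by simp
next
  case nz: False
  show ?thesis
  proof (cases "?A = \<infinity> \<or> ?B = \<infinity>")
    case True
    then show ?thesis using nz by (auto simp: ennreal_mult_top ennreal_top_mult)
  next
    case False
    define A where "A = enn2real ?A"
    define B where "B = enn2real ?B"
    have A: "?A = ennreal A" "A \<ge> 0" and B: "?B = ennreal B" "B \<ge> 0"
      using False by (simp_all add: A_def B_def less_top)
    have pos: "A > 0" "B > 0" using nz A B by (auto simp: less_le)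
    \<comment> \<open>Minimises (l / 2) A + B / (2 l). The minimum is sqrt (A B), so the pointwise
      arithmetic-geometric inequality integrates to the sharp bound.\<close>
    define l where "l = sqrt (B / A)"
    have l: "l > 0" "l * l = B / A" using pos by (auto simp: l_def)
    have "?I \<le> (\<integral>\<^sup>+x. ennreal (l / 2) * ennreal ((f x)\<^sup>2) + ennreal (1 / (2 * l)) * ennreal ((g x)\<^sup>2) \<partial>M)"
    proof (rule nn_integral_mono)
      fix x
      have "0 \<le> (l * \<bar>f x\<bar> - \<bar>g x\<bar>)\<^sup>2 / (2 * l)" using l by simp
      also have "\<dots> = l / 2 * (f x)\<^sup>2 + 1 / (2 * l) * (g x)\<^sup>2 - \<bar>f x * g x\<bar>"
      proof -
        have "(l * \<bar>f x\<bar> - \<bar>g x\<bar>)\<^sup>2 = l * l * (f x)\<^sup>2 + (g x)\<^sup>2 - 2 * l * \<bar>f x * g x\<bar>"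
          unfolding power2_diff power_mult_distrib power2_abs abs_mult by (simp add: power2_eq_square)
        then show ?thesis using l(1) by (simp add: add_divide_distrib diff_divide_distrib)
      qed
      finally show "ennreal \<bar>f x * g x\<bar> \<le> ennreal (l / 2) * ennreal ((f x)\<^sup>2) + ennreal (1 / (2 * l)) * ennreal ((g x)\<^sup>2)"
        using l by (simp flip: ennreal_mult ennreal_plus)
    qed
    also have "\<dots> = ennreal (l / 2) * ?A + ennreal (1 / (2 * l)) * ?B"
      by (simp add: nn_integral_add nn_integral_cmult)
    also have "\<dots> = ennreal (l / 2 * A + 1 / (2 * l) * B)"
      using A B l by (simp flip: ennreal_mult ennreal_plus)
    also have "l / 2 * A + 1 / (2 * l) * B = sqrt (A * B)"
    proof -
      have "l * A = sqrt (A * B)"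
      proof (rule real_sqrt_unique[symmetric])
        have "(l * A)\<^sup>2 = (l * l) * A * A" by (simp add: power2_eq_square)
        then show "(l * A)\<^sup>2 = A * B" unfolding l(2) using pos by simp
      qed (use pos l in simp)
      moreover have "B = l * l * A" unfolding l(2) using pos by simp
      ultimately show ?thesis using l(1) by simp
    qed
    finally have "?I \<le> ennreal (sqrt (A * B))" .
    then have "?I\<^sup>2 \<le> (ennreal (sqrt (A * B)))\<^sup>2" by (rule power_mono) simp
    also have "\<dots> = ?A * ?B" using A B by (simp add: ennreal_power ennreal_mult)
    finally show ?thesis .
  qed
qed

text \<open>Cauchy-Schwarz on the frequency side. Only frequencies in \<open>U\<close> enter, so
  over disjoint sets \<open>U\<close> such bounds add up to a single L^2 norm.\<close>

lemma inv_fourier_product_bound: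
  assumes g: "integrable lborel g" and \<Phi>: "integrable lborel \<Phi>"
    and U: "U \<in> sets borel" "\<And>\<xi>. \<xi> \<notin> U \<Longrightarrow> \<Phi> \<xi> = 0"
  shows "ennreal ((cmod (LINT y|lborel. g y * inv_fourier \<Phi> (u - y)))\<^sup>2) \<le> l2sq U (fourier g) * l2sq UNIV \<Phi>"
proof -
  have [measurable]: "g \<in> borel_measurable borel" "\<Phi> \<in> borel_measurable borel" "U \<in> sets borel"
    using g \<Phi> U by auto
  let ?h = "\<lambda>\<xi>. fourier g \<xi> * \<Phi> \<xi> * cis (2 * pi * u * \<xi>)"
  have "ennreal (cmod (LINT y|lborel. g y * inv_fourier \<Phi> (u - y))) \<le> (\<integral>\<^sup>+\<xi>. ennreal (cmod (?h \<xi>)) \<partial>lborel)"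
    unfolding convolution_inv_fourier[OF g \<Phi>] unfolding inv_fourier_def by (rule norm_integral_le_nn_integral)
  also have "\<dots> = (\<integral>\<^sup>+\<xi>. ennreal \<bar>(indicator U \<xi> * cmod (fourier g \<xi>)) * cmod (\<Phi> \<xi>)\<bar> \<partial>lborel)"
    using U(2) by (intro nn_integral_cong) (auto simp: norm_mult indicator_def)
  finally have "(ennreal (cmod (LINT y|lborel. g y * inv_fourier \<Phi> (u - y))))\<^sup>2 \<le> \<dots>\<^sup>2"
    by (rule power_mono) simp
  also have "\<dots> \<le> (\<integral>\<^sup>+\<xi>. ennreal ((indicator U \<xi> * cmod (fourier g \<xi>))\<^sup>2) \<partial>lborel) * (\<integral>\<^sup>+\<xi>. ennreal ((cmod (\<Phi> \<xi>))\<^sup>2) \<partial>lborel)"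
    by (rule Cauchy_Schwarz_nn_integral) measurable
  also have "(\<integral>\<^sup>+\<xi>. ennreal ((indicator U \<xi> * cmod (fourier g \<xi>))\<^sup>2) \<partial>lborel) = l2sq U (fourier g)"
    unfolding l2sq_def by (intro nn_integral_cong) (auto simp: indicator_def)
  finally show ?thesis by (simp add: ennreal_power l2sq_def)
qed

text \<open>Plancherel in place of Cauchy-Schwarz: the multiplier now enters through its supremum
  instead of its L^2 norm.\<close>

lemma inv_fourier_product_l2_bound:
  assumes g: "integrable lborel g" and \<Phi>: "integrable lborel \<Phi>"
    and U: "U \<in> sets borel" "\<And>\<xi>. \<xi> \<notin> U \<Longrightarrow> \<Phi> \<xi> = 0" and B: "\<And>\<xi>. cmod (\<Phi> \<xi>) \<le> B"
  shows "l2sq UNIV (\<lambda>u. LINT y|lborel. g y * inv_fourier \<Phi> (u - y)) \<le> ennreal (B\<^sup>2) * l2sq U (fourier g)"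
proof -
  have [measurable]: "g \<in> borel_measurable borel" "\<Phi> \<in> borel_measurable borel" "U \<in> sets borel"
    using g \<Phi> U by auto
  have i: "integrable lborel (\<lambda>\<xi>. fourier g \<xi> * \<Phi> \<xi>)"
  proof (rule Bochner_Integration.integrable_bound)
    show "integrable lborel (\<lambda>\<xi>. (LINT x|lborel. cmod (g x)) * \<Phi> \<xi>)" using \<Phi> by simp
    show "AE \<xi> in lborel. norm (fourier g \<xi> * \<Phi> \<xi>) \<le> norm (complex_of_real (LINT x|lborel. cmod (g x)) * \<Phi> \<xi>)"
      by (auto intro!: mult_right_mono order_trans[OF fourier_bound] simp: norm_mult)
  qed simp
  have "l2sq UNIV (\<lambda>u. LINT y|lborel. g y * inv_fourier \<Phi> (u - y)) \<le> l2sq UNIV (\<lambda>\<xi>. fourier g \<xi> * \<Phi> \<xi>)"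
    unfolding convolution_inv_fourier[OF g \<Phi>] by (rule plancherel_inv_le[OF i])
  also have "\<dots> \<le> (\<integral>\<^sup>+\<xi>. ennreal (B\<^sup>2) * (ennreal ((cmod (fourier g \<xi>))\<^sup>2) * indicator U \<xi>) \<partial>lborel)"
    unfolding l2sq_def
  proof (rule nn_integral_mono)
    fix \<xi>
    have "(cmod (fourier g \<xi>))\<^sup>2 * (cmod (\<Phi> \<xi>))\<^sup>2 \<le> (cmod (fourier g \<xi>))\<^sup>2 * B\<^sup>2"
      by (intro mult_left_mono power_mono B) auto
    then show "ennreal ((cmod (fourier g \<xi> * \<Phi> \<xi>))\<^sup>2) * indicator UNIV \<xi> \<le> ennreal (B\<^sup>2) * (ennreal ((cmod (fourier g \<xi>))\<^sup>2) * indicator U \<xi>)"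
      using U(2)[of \<xi>] by (cases "\<xi> \<in> U") (auto simp: norm_mult power_mult_distrib mult.commute simp flip: ennreal_mult)
  qed
  also have "\<dots> = ennreal (B\<^sup>2) * l2sq U (fourier g)"
    unfolding l2sq_def by (rule nn_integral_cmult) measurable
  finally show ?thesis .
qed

section \<open>Operations on Schwartz functions\<close>

lemma rapid_imp_bounded_moments:
  assumes "rapid f"
  shows "bounded (range (\<lambda>x. of_real (x ^ k) * f x))"
proof -
  obtain C where C: "\<And>x. cmod (f x) * (1 + \<bar>x\<bar>) ^ k \<le> C"
    using assms unfolding rapid_def by blast
  have "cmod (of_real (x ^ k) * f x) \<le> C" for x
  proof -
    have "\<bar>x\<bar> ^ k \<le> (1 + \<bar>x\<bar>) ^ k" by (intro power_mono) auto
    then have "cmod (f x) * \<bar>x\<bar> ^ k \<le> cmod (f x) * (1 + \<bar>x\<bar>) ^ k" by (intro mult_left_mono) auto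
    then show ?thesis using C[of x] by (simp add: norm_mult norm_power mult.commute)
  qed
  then show ?thesis by (auto simp: bounded_iff)
qed

lemma schwartzI:
  assumes "\<And>n x. (D n has_vector_derivative D (Suc n) x) (at x)" "\<And>n. rapid (D n)"
  shows "D 0 \<in> schwartz"
  using assms rapid_imp_bounded_moments unfolding schwartz_def by blast

lemma rapid_add:
  assumes "rapid f" "rapid g"
  shows "rapid (\<lambda>x. f x + g x)"
  unfolding rapid_def
proof
  fix N
  obtain C D where C: "\<And>x. cmod (f x) * (1 + \<bar>x\<bar>) ^ N \<le> C" and D: "\<And>x. cmod (g x) * (1 + \<bar>x\<bar>) ^ N \<le> D"
    using assms unfolding rapid_def by meson
  have "cmod (f x + g x) * (1 + \<bar>x\<bar>) ^ N \<le> C + D" for x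
  proof -
    have "cmod (f x + g x) * (1 + \<bar>x\<bar>) ^ N \<le> (cmod (f x) + cmod (g x)) * (1 + \<bar>x\<bar>) ^ N"
      by (intro mult_right_mono norm_triangle_ineq) auto
    then show ?thesis using C[of x] D[of x] by (simp add: distrib_right)
  qed
  then show "\<exists>C. \<forall>x. cmod (f x + g x) * (1 + \<bar>x\<bar>) ^ N \<le> C" by blast
qed

lemma rapid_cmult:
  assumes "rapid f"
  shows "rapid (\<lambda>x. c * f x)"
  unfolding rapid_def
proof
  fix N
  obtain C where C: "\<And>x. cmod (f x) * (1 + \<bar>x\<bar>) ^ N \<le> C"
    using assms unfolding rapid_def by meson
  have "cmod (c * f x) * (1 + \<bar>x\<bar>) ^ N \<le> cmod c * C" for x
    using mult_left_mono[OF C[of x], of "cmod c"] by (simp add: norm_mult mult.assoc)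
  then show "\<exists>C. \<forall>x. cmod (c * f x) * (1 + \<bar>x\<bar>) ^ N \<le> C" by blast
qed

lemma rapid_mult_id:
  assumes "rapid f"
  shows "rapid (\<lambda>x. of_real x * f x)"
  unfolding rapid_def
proof
  fix N
  obtain C where C: "\<And>x. cmod (f x) * (1 + \<bar>x\<bar>) ^ Suc N \<le> C"
    using assms unfolding rapid_def by meson
  have "cmod (of_real x * f x) * (1 + \<bar>x\<bar>) ^ N \<le> C" for x
  proof -
    have "cmod (of_real x * f x) * (1 + \<bar>x\<bar>) ^ N = cmod (f x) * (\<bar>x\<bar> * (1 + \<bar>x\<bar>) ^ N)"
      by (simp add: norm_mult)
    also have "\<dots> \<le> cmod (f x) * (1 + \<bar>x\<bar>) ^ Suc N"
      by (intro mult_left_mono) (auto intro!: mult_right_mono)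
    finally show ?thesis using C[of x] by (rule order_trans)
  qed
  then show "\<exists>C. \<forall>x. cmod (of_real x * f x) * (1 + \<bar>x\<bar>) ^ N \<le> C" by blast
qed

lemma rapid_affine:
  fixes \<sigma> \<alpha> :: real
  assumes "rapid f" "\<sigma> \<noteq> 0"
  shows "rapid (\<lambda>x. f ((x - \<alpha>) / \<sigma>))"
  unfolding rapid_def
proof
  fix N
  obtain C where C: "\<And>x. cmod (f x) * (1 + \<bar>x\<bar>) ^ N \<le> C"
    using assms unfolding rapid_def by meson
  let ?K = "1 + \<bar>\<alpha>\<bar> + \<bar>\<sigma>\<bar>"
  have "cmod (f ((x - \<alpha>) / \<sigma>)) * (1 + \<bar>x\<bar>) ^ N \<le> ?K ^ N * C" for x
  proof -
    let ?t = "(x - \<alpha>) / \<sigma>"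
    have "x = \<alpha> + \<sigma> * ?t" using assms(2) by simp
    then have "\<bar>x\<bar> \<le> \<bar>\<alpha>\<bar> + \<bar>\<sigma>\<bar> * \<bar>?t\<bar>" by (metis abs_mult abs_triangle_ineq)
    moreover have "0 \<le> \<bar>\<alpha>\<bar> * \<bar>?t\<bar>" "0 \<le> \<bar>?t\<bar>" by (rule mult_nonneg_nonneg) simp_all
    ultimately have "1 + \<bar>x\<bar> \<le> ?K * (1 + \<bar>?t\<bar>)" unfolding distrib_right distrib_left by linarith
    then have "(1 + \<bar>x\<bar>) ^ N \<le> (?K * (1 + \<bar>?t\<bar>)) ^ N" by (intro power_mono) auto
    then have "cmod (f ?t) * (1 + \<bar>x\<bar>) ^ N \<le> cmod (f ?t) * (?K ^ N * (1 + \<bar>?t\<bar>) ^ N)"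
      unfolding power_mult_distrib by (intro mult_left_mono) auto
    also have "\<dots> = ?K ^ N * (cmod (f ?t) * (1 + \<bar>?t\<bar>) ^ N)" by (simp only: mult_ac)
    also have "\<dots> \<le> ?K ^ N * C" by (intro mult_left_mono C) auto
    finally show ?thesis .
  qed
  then show "\<exists>C. \<forall>x. cmod (f ((x - \<alpha>) / \<sigma>)) * (1 + \<bar>x\<bar>) ^ N \<le> C" by blast
qed

lemma schwartz_add:
  assumes "f \<in> schwartz" "g \<in> schwartz"
  shows "(\<lambda>x. f x + g x) \<in> schwartz"
proof -
  obtain D where D: "D 0 = f" "\<And>n x. (D n has_vector_derivative D (Suc n) x) (at x)" "\<And>n. rapid (D n)"
    using schwartzE[OF assms(1)] by metis
  obtain E where E: "E 0 = g" "\<And>n x. (E n has_vector_derivative E (Suc n) x) (at x)" "\<And>n. rapid (E n)"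
    using schwartzE[OF assms(2)] by metis
  have "(\<lambda>n x. D n x + E n x) 0 \<in> schwartz"
    by (rule schwartzI) (intro has_vector_derivative_add D E rapid_add)+
  then show ?thesis by (simp add: D E)
qed

lemma schwartz_cmult:
  assumes "f \<in> schwartz"
  shows "(\<lambda>x. c * f x) \<in> schwartz"
proof -
  obtain D where D: "D 0 = f" "\<And>n x. (D n has_vector_derivative D (Suc n) x) (at x)" "\<And>n. rapid (D n)"
    using schwartzE[OF assms(1)] by metis
  have "(\<lambda>n x. c * D n x) 0 \<in> schwartz"
    by (rule schwartzI) (intro has_vector_derivative_mult_right D rapid_cmult)+
  then show ?thesis by (simp add: D)
qed

lemma schwartz_zero: "(\<lambda>x. 0) \<in> schwartz"
  by (rule schwartzI[of "\<lambda>n x. 0"]) (auto simp: rapid_def)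

lemma schwartz_sum:
  assumes "\<And>j. j \<in> J \<Longrightarrow> f j \<in> schwartz"
  shows "(\<lambda>x. \<Sum>j\<in>J. f j x) \<in> schwartz"
  using assms by (induction J rule: infinite_finite_induct) (auto intro: schwartz_zero schwartz_add)

lemma schwartz_mult_id:
  assumes "f \<in> schwartz"
  shows "(\<lambda>x. of_real x * f x) \<in> schwartz"
proof -
  obtain D where D: "D 0 = f" "\<And>n x. (D n has_vector_derivative D (Suc n) x) (at x)" "\<And>n. rapid (D n)"
    using schwartzE[OF assms(1)] by metis
  \<comment> \<open>Leibniz rule. At n = 0 the truncated index \<open>n - 1\<close> is harmless,
    since its coefficient is 0.\<close>
  let ?E = "\<lambda>n x. of_real x * D n x + of_nat n * D (n - 1) x"
  have "?E 0 \<in> schwartz"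
  proof (rule schwartzI)
    show "rapid (?E n)" for n by (intro rapid_add rapid_cmult rapid_mult_id D)
    fix n and x :: real
    have 1: "((\<lambda>x. of_real x * D n x) has_vector_derivative of_real x * D (Suc n) x + of_real 1 * D n x) (at x)"
      by (intro has_vector_derivative_mult D has_vector_derivative_of_real DERIV_ident)
    have 2: "((\<lambda>x. of_nat n * D (n - 1) x) has_vector_derivative of_nat n * D n x) (at x)"
    proof (cases n)
      case (Suc m)
      then show ?thesis using has_vector_derivative_mult_right[OF D(2)[of m x], of "of_nat n"] by simp
    qed simp
    show "(?E n has_vector_derivative ?E (Suc n) x) (at x)"
      using has_vector_derivative_add[OF 1 2] by (simp add: algebra_simps)
  qed
  then show ?thesis by (simp add: D)
qed

lemma schwartz_affine:
  fixes \<sigma> \<alpha> :: real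
  assumes "f \<in> schwartz" "\<sigma> \<noteq> 0"
  shows "(\<lambda>x. f ((x - \<alpha>) / \<sigma>)) \<in> schwartz"
proof -
  obtain D where D: "D 0 = f" "\<And>n x. (D n has_vector_derivative D (Suc n) x) (at x)" "\<And>n. rapid (D n)"
    using schwartzE[OF assms(1)] by metis
  let ?E = "\<lambda>n x. of_real ((1 / \<sigma>) ^ n) * D n ((x - \<alpha>) / \<sigma>)"
  have "?E 0 \<in> schwartz"
  proof (rule schwartzI)
    show "rapid (?E n)" for n by (intro rapid_cmult rapid_affine D assms)
    fix n and x :: real
    have "((\<lambda>x. (x - \<alpha>) / \<sigma>) has_vector_derivative 1 / \<sigma>) (at x)"
      unfolding has_real_derivative_iff_has_vector_derivative[symmetric]
      by (auto intro!: derivative_eq_intros simp: assms(2))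
    from vector_diff_chain_at[OF this D(2)]
    have "((\<lambda>x. D n ((x - \<alpha>) / \<sigma>)) has_vector_derivative (1 / \<sigma>) *\<^sub>R D (Suc n) ((x - \<alpha>) / \<sigma>)) (at x)"
      by (simp add: o_def)
    from has_vector_derivative_mult_right[OF this, of "of_real ((1 / \<sigma>) ^ n)"]
    show "(?E n has_vector_derivative ?E (Suc n) x) (at x)"
      by (simp add: scaleR_conv_of_real mult_ac)
  qed
  then show ?thesis by (simp add: D)
qed

text \<open>Replaces the existential sequence of derivatives in \<open>schwartz\<close> by an
  operator that can be iterated.\<close>

definition vderiv :: "(real \<Rightarrow> complex) \<Rightarrow> real \<Rightarrow> complex" where
  "vderiv f x = vector_derivative f (at x)"

lemma schwartz_vderiv:
  assumes "f \<in> schwartz"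
  shows "vderiv f \<in> schwartz" "(f has_vector_derivative vderiv f x) (at x)"
proof -
  obtain D where D: "D 0 = f" "\<And>n x. (D n has_vector_derivative D (Suc n) x) (at x)" "\<And>n. rapid (D n)"
    using schwartzE[OF assms(1)] by metis
  have e: "vderiv f = D 1"
    using D(2)[of 0] D(1) by (auto simp: vderiv_def fun_eq_iff intro: vector_derivative_at)
  have "(\<lambda>n. D (Suc n)) 0 \<in> schwartz" by (rule schwartzI) (use D in auto)
  then show "vderiv f \<in> schwartz" by (simp add: e)
  show "(f has_vector_derivative vderiv f x) (at x)" using D(2)[of 0] D(1) by (simp add: e)
qed

lemma schwartz_vderiv_funpow: "f \<in> schwartz \<Longrightarrow> (vderiv ^^ n) f \<in> schwartz"
  by (induction n) (auto intro: schwartz_vderiv)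

text \<open>Differentiation preserves supports; this keeps the weighted estimates of a piece in the
  same frequency band as the plain ones.\<close>

lemma vderiv_zero_on_open:
  assumes "open S" "\<And>x. x \<in> S \<Longrightarrow> f x = 0" "x \<in> S"
  shows "(vderiv ^^ n) f x = 0"
  using assms(3)
proof (induction n arbitrary: x)
  case (Suc n)
  have "((vderiv ^^ n) f has_vector_derivative 0) (at x)"
    by (rule has_vector_derivative_transform_within_open[OF has_vector_derivative_const assms(1) Suc(2)])
      (simp add: Suc(1))
  then have "vderiv ((vderiv ^^ n) f) x = 0" unfolding vderiv_def[of "(vderiv ^^ n) f"] by (rule vector_derivative_at)
  then show ?case by simp
qed (use assms in auto)

lemma schwartz_integrable: "f \<in> schwartz \<Longrightarrow> integrable lborel f"
  by (intro rapid_integrable schwartz_rapid_continuous)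

lemma inv_fourier_vderiv_funpow:
  assumes "f \<in> schwartz"
  shows "inv_fourier ((vderiv ^^ n) f) x = (- (2 * pi * x) * \<i>) ^ n * inv_fourier f x"
proof (induction n)
  case (Suc n)
  have s: "(vderiv ^^ n) f \<in> schwartz" by (rule schwartz_vderiv_funpow[OF assms])
  have "inv_fourier (vderiv ((vderiv ^^ n) f)) x = - (2 * pi * x) * \<i> * inv_fourier ((vderiv ^^ n) f) x"
    by (intro inv_fourier_deriv schwartz_vderiv(2) schwartz_rapid_continuous schwartz_vderiv(1) s)
  then show ?case using Suc by simp
qed simp

section \<open>Differentiation under the integral sign\<close>

text \<open>Reduces the derivative to sequences, for which dominated convergence is
  available.\<close>

lemma has_vector_derivative_sequentiallyI:
  fixes f :: "real \<Rightarrow> complex"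
  assumes "\<And>u. u \<longlonglongrightarrow> x \<Longrightarrow> (\<And>n. u n \<noteq> x) \<Longrightarrow> (\<lambda>n. (f (u n) - f x) /\<^sub>R (u n - x)) \<longlonglongrightarrow> d"
  shows "(f has_vector_derivative d) (at x)"
proof -
  have "((\<lambda>y. (f y - f x) /\<^sub>R (y - x)) \<longlongrightarrow> d) (at x)"
    unfolding tendsto_at_iff_sequentially by (auto simp: o_def intro!: assms)
  then have "((\<lambda>y. (f y - f x) /\<^sub>R (y - x) - d) \<longlongrightarrow> 0) (at x)"
    by (simp add: LIM_zero)
  then have *: "((\<lambda>y. norm ((f y - f x) /\<^sub>R (y - x) - d)) \<longlongrightarrow> 0) (at x)"
    by (rule tendsto_norm_zero)
  have "((\<lambda>y. norm (f y - f x - (y - x) *\<^sub>R d) / norm (y - x)) \<longlongrightarrow> 0) (at x)"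
  proof (rule Lim_transform_eventually[OF *])
    have "norm ((f y - f x) /\<^sub>R (y - x) - d) = norm (f y - f x - (y - x) *\<^sub>R d) / norm (y - x)" if "y \<noteq> x" for y
    proof -
      have "(f y - f x) /\<^sub>R (y - x) - d = (f y - f x - (y - x) *\<^sub>R d) /\<^sub>R (y - x)"
        using that by (simp add: scaleR_diff_right)
      then show ?thesis by (simp add: divide_inverse mult.commute)
    qed
    then show "\<forall>\<^sub>F y in at x. norm ((f y - f x) /\<^sub>R (y - x) - d) = norm (f y - f x - (y - x) *\<^sub>R d) / norm (y - x)"
      by (auto simp: eventually_at_filter)
  qed
  then show ?thesis
    unfolding has_vector_derivative_def has_derivative_iff_norm by (auto intro: bounded_linear_scaleR_left)
qed

lemma has_vector_derivative_tendsto_sequentially: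
  fixes f :: "real \<Rightarrow> complex"
  assumes d: "(f has_vector_derivative d) (at x)" and u: "u \<longlonglongrightarrow> x" "\<And>n. u n \<noteq> x"
  shows "(\<lambda>n. (f (u n) - f x) /\<^sub>R (u n - x)) \<longlonglongrightarrow> d"
proof -
  have *: "((\<lambda>y. norm (f y - f x - (y - x) *\<^sub>R d) / norm (y - x)) \<longlongrightarrow> 0) (at x)"
    using d unfolding has_vector_derivative_def has_derivative_iff_norm by auto
  have "filterlim u (at x) sequentially" using u by (simp add: filterlim_at)
  from filterlim_compose[OF * this]
  have lim: "(\<lambda>n. norm (f (u n) - f x - (u n - x) *\<^sub>R d) / norm (u n - x)) \<longlonglongrightarrow> 0" .
  have e: "norm (f (u n) - f x - (u n - x) *\<^sub>R d) / norm (u n - x) = norm ((f (u n) - f x) /\<^sub>R (u n - x) - d)" for n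
  proof -
    have "(f (u n) - f x) /\<^sub>R (u n - x) - d = (f (u n) - f x - (u n - x) *\<^sub>R d) /\<^sub>R (u n - x)"
      using u(2)[of n] by (simp add: scaleR_diff_right)
    then show ?thesis by (simp add: divide_inverse mult.commute)
  qed
  show ?thesis
    by (rule LIM_zero_cancel, rule tendsto_norm_zero_cancel) (rule lim[unfolded e])
qed

lemma has_vector_derivative_integral:
  fixes k k' :: "real \<Rightarrow> 'a \<Rightarrow> complex"
  assumes der: "\<And>x y. ((\<lambda>x. k x y) has_vector_derivative k' x y) (at x)"
    and int: "\<And>x. integrable M (k x)"
    and meas: "k' x0 \<in> borel_measurable M"
    and w: "integrable M w" "\<And>x y. \<bar>x - x0\<bar> \<le> 1 \<Longrightarrow> cmod (k' x y) \<le> w y"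
  shows "((\<lambda>x. LINT y|M. k x y) has_vector_derivative (LINT y|M. k' x0 y)) (at x0)"
proof (rule has_vector_derivative_sequentiallyI)
  fix u :: "nat \<Rightarrow> real" assume u: "u \<longlonglongrightarrow> x0" "\<And>n. u n \<noteq> x0"
  obtain N where N: "\<And>n. n \<ge> N \<Longrightarrow> \<bar>u n - x0\<bar> < 1"
    using LIMSEQ_D[OF u(1), of 1] by auto
  \<comment> \<open>Drops the terms at distance more than 1 from \<open>x0\<close>, where the
    majorant \<open>w\<close> is not assumed. On the rest the mean value inequality bounds the
    difference quotients by \<open>w\<close>.\<close>
  define v where "v n = u (n + N)" for n
  have v: "v \<longlonglongrightarrow> x0" "\<And>n. v n \<noteq> x0" "\<And>n. \<bar>v n - x0\<bar> \<le> 1"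
    using u N LIMSEQ_ignore_initial_segment[OF u(1), of N] by (auto simp: v_def[abs_def] less_imp_le)
  have "(\<lambda>n. LINT y|M. (k (v n) y - k x0 y) /\<^sub>R (v n - x0)) \<longlonglongrightarrow> (LINT y|M. k' x0 y)"
  proof (rule integral_dominated_convergence[where w = w])
    show "AE y in M. (\<lambda>n. (k (v n) y - k x0 y) /\<^sub>R (v n - x0)) \<longlonglongrightarrow> k' x0 y"
      by (intro AE_I2 has_vector_derivative_tendsto_sequentially der v)
    have "norm ((k (v n) y - k x0 y) /\<^sub>R (v n - x0)) \<le> w y" for n y
    proof -
      have "norm (k (v n) y - k x0 y) \<le> w y * norm (v n - x0)"
      proof (rule differentiable_bound[where S = "{x0 - 1..x0 + 1}" and f' = "\<lambda>x h. h *\<^sub>R k' x y"])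
        fix x assume x: "x \<in> {x0 - 1..x0 + 1}"
        show "((\<lambda>x. k x y) has_derivative (\<lambda>h. h *\<^sub>R k' x y)) (at x within {x0 - 1..x0 + 1})"
          using der[where x = x and y = y] by (auto simp: has_vector_derivative_def intro: has_derivative_at_withinI)
        have "cmod (k' x y) \<le> w y" using x by (intro w) (auto simp: abs_le_iff)
        then show "onorm (\<lambda>h. h *\<^sub>R k' x y) \<le> w y"
          by (intro onorm_le) (auto simp: mult.commute intro: mult_left_mono)
      qed (use v(3)[of n] in \<open>auto simp: abs_le_iff\<close>)
      moreover have "norm (v n - x0) > 0" using v(2)[of n] by simp
      ultimately have "norm (k (v n) y - k x0 y) / norm (v n - x0) \<le> w y" by (simp add: divide_le_eq)
      then show ?thesis by (simp add: divide_inverse mult.commute)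
    qed
    then show "AE y in M. norm ((k (v n) y - k x0 y) /\<^sub>R (v n - x0)) \<le> w y" for n by simp
    show "(\<lambda>y. (k (v n) y - k x0 y) /\<^sub>R (v n - x0)) \<in> borel_measurable M" for n
      using int by (intro borel_measurable_scaleR borel_measurable_diff) auto
  qed (use meas w in auto)
  then have "(\<lambda>n. ((LINT y|M. k (v n) y) - (LINT y|M. k x0 y)) /\<^sub>R (v n - x0)) \<longlonglongrightarrow> (LINT y|M. k' x0 y)"
    by (simp add: int)
  then show "(\<lambda>n. ((LINT y|M. k (u n) y) - (LINT y|M. k x0 y)) /\<^sub>R (u n - x0)) \<longlonglongrightarrow> (LINT y|M. k' x0 y)"
    unfolding v_def by (rule LIMSEQ_offset)
qed

lemma has_vector_derivative_inv_fourier: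
  assumes f: "f \<in> schwartz"
  shows "(inv_fourier f has_vector_derivative inv_fourier (\<lambda>t. 2 * pi * \<i> * (of_real t * f t)) x) (at x)"
proof -
  have f': "(\<lambda>t. 2 * pi * \<i> * (of_real t * f t)) \<in> schwartz"
    by (intro schwartz_cmult schwartz_mult_id f)
  have i: "integrable lborel f" "integrable lborel (\<lambda>t. 2 * pi * \<i> * (of_real t * f t))"
    by (intro schwartz_integrable f f')+
  have "((\<lambda>x. LINT \<xi>|lborel. f \<xi> * cis (2 * pi * x * \<xi>)) has_vector_derivative
      (LINT \<xi>|lborel. 2 * pi * \<i> * (of_real \<xi> * f \<xi>) * cis (2 * pi * x * \<xi>))) (at x)"
  proof (rule has_vector_derivative_integral[where w = "\<lambda>t. cmod (2 * pi * \<i> * (of_real t * f t))"])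
    show "integrable lborel (\<lambda>\<xi>. f \<xi> * cis (2 * pi * x * \<xi>))" for x
      by (intro integrable_mult_cis i) simp
    show "(\<lambda>\<xi>. 2 * pi * \<i> * (of_real \<xi> * f \<xi>) * cis (2 * pi * x * \<xi>)) \<in> borel_measurable lborel"
      by (rule borel_measurable_integrable, rule integrable_mult_cis[OF i(2)]) simp
    fix x \<xi> :: real
    have "((\<lambda>x. cis (2 * pi * x * \<xi>)) has_vector_derivative (2 * pi * \<xi>) * \<i> * cis (2 * pi * x * \<xi>)) (at x)"
      unfolding has_vector_derivative_def
      by (auto intro!: derivative_eq_intros simp: fun_eq_iff scaleR_conv_of_real algebra_simps)
    from has_vector_derivative_mult_right[OF this, of "f \<xi>"]
    show "((\<lambda>x. f \<xi> * cis (2 * pi * x * \<xi>)) has_vector_derivative 2 * pi * \<i> * (of_real \<xi> * f \<xi>) * cis (2 * pi * x * \<xi>)) (at x)"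
      by (simp add: mult_ac)
    show "cmod (2 * pi * \<i> * (of_real \<xi> * f \<xi>) * cis (2 * pi * x * \<xi>)) \<le> cmod (2 * pi * \<i> * (of_real \<xi> * f \<xi>))"
      by (simp add: norm_mult)
  qed (rule integrable_norm[OF i(2)])
  then show ?thesis unfolding inv_fourier_def[abs_def] .
qed

section \<open>Functions of polynomial growth in the mean\<close>

text \<open>The growth hypothesis of \<open>fourier_multiplier_eq_convolution\<close>, for Borel
  functions. The order \<open>N\<close> stays existential, so that the class is closed under sums
  and contains all polynomials.\<close>

definition tempered :: "(real \<Rightarrow> complex) \<Rightarrow> bool" where
  "tempered g \<longleftrightarrow> g \<in> borel_measurable borel \<and> (\<exists>N. integrable lborel (\<lambda>y. cmod (g y) / (1 + \<bar>y\<bar>) ^ N))"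

lemma tempered_measurable [measurable_dest]: "tempered g \<Longrightarrow> g \<in> borel_measurable borel"
  by (simp add: tempered_def)

lemma tempered_bound:
  assumes "tempered g" "h \<in> borel_measurable borel" "\<And>y. cmod (h y) \<le> cmod (g y)"
  shows "tempered h"
proof -
  obtain N where N: "integrable lborel (\<lambda>y. cmod (g y) / (1 + \<bar>y\<bar>) ^ N)"
    using assms(1) by (auto simp: tempered_def)
  have "integrable lborel (\<lambda>y. cmod (h y) / (1 + \<bar>y\<bar>) ^ N)"
    by (rule Bochner_Integration.integrable_bound[OF N])
      (use assms in \<open>auto intro!: divide_right_mono\<close>)
  then show ?thesis using assms by (auto simp: tempered_def)
qed

text \<open>Peetre's inequality: decay in x - y is traded for decay in y times growth in x, and the
  latter is harmless for x in a bounded set.\<close>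

lemma rapid_shift_bound:
  assumes "rapid V"
  obtains C where "C > 0" "\<And>x y. cmod (V (x - y)) \<le> C * (1 + \<bar>x\<bar>) ^ N / (1 + \<bar>y\<bar>) ^ N"
proof -
  obtain C where C: "C > 0" "\<And>x. cmod (V x) \<le> C / (1 + \<bar>x\<bar>) ^ N"
    using rapidE[OF assms] by blast
  have pos: "(1 + \<bar>x\<bar>) ^ N > 0" for x :: real by (intro zero_less_power) linarith
  have "cmod (V (x - y)) \<le> C * (1 + \<bar>x\<bar>) ^ N / (1 + \<bar>y\<bar>) ^ N" for x y
  proof -
    have "(1 + \<bar>y\<bar>) ^ N \<le> (1 + \<bar>x\<bar>) ^ N * (1 + \<bar>x - y\<bar>) ^ N"
      using power_mono[OF peetre[of y x], of N] by (simp add: power_mult_distrib)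
    then have "C / (1 + \<bar>x - y\<bar>) ^ N \<le> C * (1 + \<bar>x\<bar>) ^ N / (1 + \<bar>y\<bar>) ^ N"
      using pos[of y] pos[of "x - y"] C(1) by (simp add: field_simps)
    then show ?thesis using C(2)[of "x - y"] by linarith
  qed
  then show ?thesis using that C(1) by blast
qed

lemma tempered_integrable:
  assumes g: "tempered g" and V: "rapid V" "continuous_on UNIV V"
  shows "integrable lborel (\<lambda>y. g y * V (x - y))"
proof -
  obtain N where N: "integrable lborel (\<lambda>y. cmod (g y) / (1 + \<bar>y\<bar>) ^ N)"
    using g by (auto simp: tempered_def)
  note [measurable] = borel_measurable_continuous_UNIV[OF V(2)] tempered_measurable[OF g]
  obtain C where C: "C > 0" "\<And>x y. cmod (V (x - y)) \<le> C * (1 + \<bar>x\<bar>) ^ N / (1 + \<bar>y\<bar>) ^ N"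
    using rapid_shift_bound[OF V(1)] by blast
  show ?thesis
  proof (rule Bochner_Integration.integrable_bound)
    show "integrable lborel (\<lambda>y. C * (1 + \<bar>x\<bar>) ^ N * (cmod (g y) / (1 + \<bar>y\<bar>) ^ N))"
      by (intro integrable_mult_right N)
    have "cmod (g y * V (x - y)) \<le> C * (1 + \<bar>x\<bar>) ^ N * (cmod (g y) / (1 + \<bar>y\<bar>) ^ N)" for y
      using mult_left_mono[OF C(2)[of x y], of "cmod (g y)"] by (simp add: norm_mult mult_ac)
    then show "AE y in lborel. norm (g y * V (x - y)) \<le> norm (C * (1 + \<bar>x\<bar>) ^ N * (cmod (g y) / (1 + \<bar>y\<bar>) ^ N))"
      unfolding real_norm_def by (intro AE_I2 order_trans[OF _ abs_ge_self])
  qed simp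
qed

lemma has_vector_derivative_convolution:
  assumes g: "tempered g" and V: "rapid V" "continuous_on UNIV V" and W: "rapid W" "continuous_on UNIV W"
    and der: "\<And>x. (V has_vector_derivative W x) (at x)"
  shows "((\<lambda>x. LINT y|lborel. g y * V (x - y)) has_vector_derivative (LINT y|lborel. g y * W (x - y))) (at x)"
proof -
  obtain N where N: "integrable lborel (\<lambda>y. cmod (g y) / (1 + \<bar>y\<bar>) ^ N)"
    using g by (auto simp: tempered_def)
  obtain C where C: "C > 0" "\<And>x y. cmod (W (x - y)) \<le> C * (1 + \<bar>x\<bar>) ^ N / (1 + \<bar>y\<bar>) ^ N"
    using rapid_shift_bound[OF W(1)] by blast
  show ?thesis
  proof (rule has_vector_derivative_integral[where w = "\<lambda>y. C * (2 + \<bar>x\<bar>) ^ N * (cmod (g y) / (1 + \<bar>y\<bar>) ^ N)"])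
    show "integrable lborel (\<lambda>y. C * (2 + \<bar>x\<bar>) ^ N * (cmod (g y) / (1 + \<bar>y\<bar>) ^ N))"
      by (intro integrable_mult_right N)
    show "integrable lborel (\<lambda>y. g y * V (x - y))" for x by (rule tempered_integrable[OF g V])
    show "(\<lambda>y. g y * W (x - y)) \<in> borel_measurable lborel"
      by (intro borel_measurable_integrable tempered_integrable[OF g W])
    show "((\<lambda>x. g y * V (x - y)) has_vector_derivative g y * W (x - y)) (at x)" for x y
    proof -
      have "((\<lambda>x. x - y) has_vector_derivative 1) (at x)"
        by (auto intro!: derivative_eq_intros)
      from has_vector_derivative_mult_right[OF vector_diff_chain_at[OF this der]]
      show ?thesis by (simp add: o_def)
    qed
    fix x' y assume x': "\<bar>x' - x\<bar> \<le> 1"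
    have "cmod (W (x' - y)) \<le> C * (1 + \<bar>x'\<bar>) ^ N / (1 + \<bar>y\<bar>) ^ N" by (rule C)
    also have "\<dots> \<le> C * (2 + \<bar>x\<bar>) ^ N / (1 + \<bar>y\<bar>) ^ N"
      using x' C(1) by (intro divide_right_mono mult_left_mono power_mono) auto
    finally have "cmod (W (x' - y)) \<le> C * (2 + \<bar>x\<bar>) ^ N / (1 + \<bar>y\<bar>) ^ N" .
    from mult_left_mono[OF this, of "cmod (g y)"]
    show "cmod (g y * W (x' - y)) \<le> C * (2 + \<bar>x\<bar>) ^ N * (cmod (g y) / (1 + \<bar>y\<bar>) ^ N)"
      by (simp add: norm_mult mult_ac)
  qed
qed

section \<open>Polynomials are annihilated\<close>

text \<open>Formally the integral is \<open>\<Phi> 0\<close>. A Gaussian of parameter t inserted in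
  it becomes, on the frequency side, a normal density of width t / (2 pi) integrated against \<Phi>
  and a character; off the \<delta>-neighbourhood of 0 that density tends to 0 uniformly.\<close>

lemma integral_inv_fourier_zero:
  assumes \<Phi>: "\<Phi> \<in> schwartz" and \<delta>: "\<delta> > 0" "\<And>\<xi>. \<bar>\<xi>\<bar> < \<delta> \<Longrightarrow> \<Phi> \<xi> = 0"
  shows "(LINT y|lborel. inv_fourier \<Phi> (u - y)) = 0"
proof -
  let ?K = "inv_fourier \<Phi>"
  have K: "rapid ?K" "continuous_on UNIV ?K"
    by (intro inv_fourier_rapid inv_fourier_continuous schwartz_rapid_continuous \<Phi>)+
  note [measurable] = borel_measurable_continuous_UNIV[OF K(2)]
  have Ki: "integrable lborel (\<lambda>y. ?K (u - y))"
    using rapid_integrable[OF K] lborel_integrable_real_affine_iff[of "-1" ?K u] by simp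
  have \<Phi>i: "integrable lborel \<Phi>" by (rule schwartz_integrable[OF \<Phi>])
  define t where "t n = 1 / real (Suc n)" for n
  have t: "t n > 0" "t \<longlonglongrightarrow> 0" for n
    using LIMSEQ_Suc[OF lim_inverse_n'] by (auto simp: t_def[abs_def])
  let ?e = "\<lambda>n y. complex_of_real (exp (- (t n * y)\<^sup>2 / 2))"
  let ?I = "\<lambda>n. LINT y|lborel. ?e n y * ?K (u - y)"
  have ei: "integrable lborel (?e n)" for n using gaussian_inv_fourier(2)[OF t(1)] by simp
  have 1: "?I \<longlonglongrightarrow> (LINT y|lborel. ?K (u - y))"
  proof (rule integral_dominated_convergence[where w = "\<lambda>y. cmod (?K (u - y))"])
    have "(\<lambda>n. ?e n y * ?K (u - y)) \<longlonglongrightarrow> of_real (exp (- (0 * y)\<^sup>2 / 2)) * ?K (u - y)" for y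
      by (intro tendsto_intros t) simp
    then show "AE y in lborel. (\<lambda>n. ?e n y * ?K (u - y)) \<longlonglongrightarrow> ?K (u - y)" by simp
    show "AE y in lborel. norm (?e n y * ?K (u - y)) \<le> cmod (?K (u - y))" for n
      by (auto intro!: AE_I2 mult_left_le_one_le simp: norm_mult)
  qed (use Ki in auto)
  have bnd: "norm (?I n) \<le> 2 * pi / t n * exp (- (2 * pi * \<delta> / t n)\<^sup>2 / 2) * (LINT \<xi>|lborel. cmod (\<Phi> \<xi>))" for n
  proof -
    have fe: "fourier (?e n) \<xi> = of_real (normal_density 0 (t n / (2 * pi)) (- \<xi>))" for \<xi>
      using gaussian_inv_fourier(1)[OF t(1), of n "- \<xi>"] by (simp add: inv_fourier_eq_fourier_neg)
    have nd: "normal_density 0 (t n / (2 * pi)) (- \<xi>) \<le> 2 * pi / t n * exp (- (2 * pi * \<delta> / t n)\<^sup>2 / 2)" if "\<bar>\<xi>\<bar> \<ge> \<delta>" for \<xi>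
    proof -
      have "t n / (2 * pi) \<le> sqrt (2 * pi * (t n / (2 * pi))\<^sup>2)"
        using t(1)[of n] pi_gt3 by (intro real_le_rsqrt) (simp add: power2_eq_square field_simps)
      then have "1 / sqrt (2 * pi * (t n / (2 * pi))\<^sup>2) \<le> 1 / (t n / (2 * pi))"
        using t(1)[of n] by (intro divide_left_mono) auto
      then have "1 / sqrt (2 * pi * (t n / (2 * pi))\<^sup>2) \<le> 2 * pi / t n" by simp
      moreover have "\<delta>\<^sup>2 \<le> \<xi>\<^sup>2" using that \<delta>(1) by (metis abs_le_square_iff abs_of_pos)
      then have "- (- \<xi> - 0)\<^sup>2 / (2 * (t n / (2 * pi))\<^sup>2) \<le> - (2 * pi * \<delta> / t n)\<^sup>2 / 2"
        using t(1)[of n] by (simp add: power2_eq_square divide_right_mono)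
      ultimately show ?thesis
        unfolding normal_density_def using t(1)[of n] by (intro mult_mono) (simp_all only: exp_le_cancel_iff exp_ge_zero divide_nonneg_pos mult_nonneg_nonneg pi_ge_zero zero_le_numeral)
    qed
    have "norm (?I n) = norm (LINT \<xi>|lborel. fourier (?e n) \<xi> * \<Phi> \<xi> * cis (2 * pi * u * \<xi>))"
      unfolding convolution_inv_fourier[OF ei \<Phi>i] by (simp add: inv_fourier_def)
    also have "\<dots> \<le> (LINT \<xi>|lborel. 2 * pi / t n * exp (- (2 * pi * \<delta> / t n)\<^sup>2 / 2) * cmod (\<Phi> \<xi>))"
    proof (rule Bochner_Integration.integral_norm_bound_integral)
      have *: "norm (fourier (?e n) \<xi> * \<Phi> \<xi> * cis (2 * pi * u * \<xi>)) \<le> 2 * pi / t n * exp (- (2 * pi * \<delta> / t n)\<^sup>2 / 2) * cmod (\<Phi> \<xi>)" for \<xi>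
      proof (cases "\<bar>\<xi>\<bar> < \<delta>")
        case False
        then have "cmod (fourier (?e n) \<xi>) \<le> 2 * pi / t n * exp (- (2 * pi * \<delta> / t n)\<^sup>2 / 2)"
          unfolding fe using nd[of \<xi>] by simp
        from mult_right_mono[OF this, of "cmod (\<Phi> \<xi>)"] show ?thesis by (simp only: norm_mult norm_cis mult_1_right norm_ge_zero simp_thms)
      qed (simp add: \<delta>)
      then show "norm (fourier (?e n) \<xi> * \<Phi> \<xi> * cis (2 * pi * u * \<xi>)) \<le> 2 * pi / t n * exp (- (2 * pi * \<delta> / t n)\<^sup>2 / 2) * cmod (\<Phi> \<xi>)" for \<xi> .
      show "integrable lborel (\<lambda>\<xi>. 2 * pi / t n * exp (- (2 * pi * \<delta> / t n)\<^sup>2 / 2) * cmod (\<Phi> \<xi>))"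
        using \<Phi>i by simp
      then show "integrable lborel (\<lambda>\<xi>. fourier (?e n) \<xi> * \<Phi> \<xi> * cis (2 * pi * u * \<xi>))"
        by (rule Bochner_Integration.integrable_bound) (use \<Phi>i in simp, unfold real_norm_def, intro AE_I2 order_trans[OF * abs_ge_self])
    qed
    finally show ?thesis by simp
  qed
  have "(\<lambda>n. 2 * pi / t n * exp (- (2 * pi * \<delta> / t n)\<^sup>2 / 2)) \<longlonglongrightarrow> 0"
  proof -
    have "((\<lambda>x::real. 2 * pi / x * exp (- (2 * pi * \<delta> / x)\<^sup>2 / 2)) \<longlongrightarrow> 0) (at_right 0)"
      using \<delta>(1) by real_asymp
    moreover have "filterlim t (at_right 0) sequentially"
      using t less_imp_neq[OF t(1), symmetric] by (auto simp: filterlim_at)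
    ultimately show ?thesis by (rule filterlim_compose)
  qed
  then have "(\<lambda>n. 2 * pi / t n * exp (- (2 * pi * \<delta> / t n)\<^sup>2 / 2) * (LINT \<xi>|lborel. cmod (\<Phi> \<xi>))) \<longlonglongrightarrow> 0"
    by (rule tendsto_mult_left_zero)
  then have "?I \<longlonglongrightarrow> 0"
    by (rule Lim_null_comparison[rotated]) (use bnd in simp)
  with 1 show ?thesis by (rule LIMSEQ_unique)
qed

text \<open>A factor (u - y)^n turns \<Phi> into a multiple of its n-th derivative, which still
  vanishes near 0, so the case of constants applies to each term.\<close>

lemma poly_convolution_zero:
  assumes \<Phi>: "\<Phi> \<in> schwartz" and \<delta>: "\<delta> > 0" "\<And>\<xi>. \<bar>\<xi>\<bar> < \<delta> \<Longrightarrow> \<Phi> \<xi> = 0"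
  shows "(LINT y|lborel. poly p (of_real y) * inv_fourier \<Phi> (u - y)) = 0"
    "integrable lborel (\<lambda>y. poly p (of_real y) * inv_fourier \<Phi> (u - y))"
proof -
  \<comment> \<open>Re-expansion of \<open>p\<close> in powers of u - y.\<close>
  define q where "q = p \<circ>\<^sub>p [:of_real u, -1:]"
  define c where "c n = coeff q n / (- 2 * pi * \<i>) ^ n" for n
  have s: "(vderiv ^^ n) \<Phi> \<in> schwartz" for n by (rule schwartz_vderiv_funpow[OF \<Phi>])
  have e: "poly p (of_real y) * inv_fourier \<Phi> (u - y) = (\<Sum>n\<le>degree q. c n * inv_fourier ((vderiv ^^ n) \<Phi>) (u - y))" for y
  proof -
    have "poly p (of_real y) = poly q (of_real (u - y))" by (simp add: q_def poly_pcompose)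
    also have "\<dots> = (\<Sum>n\<le>degree q. coeff q n * of_real (u - y) ^ n)" by (rule poly_altdef)
    finally have "poly p (of_real y) * inv_fourier \<Phi> (u - y) = (\<Sum>n\<le>degree q. coeff q n * of_real (u - y) ^ n * inv_fourier \<Phi> (u - y))"
      by (simp add: sum_distrib_right)
    also have "\<dots> = (\<Sum>n\<le>degree q. c n * inv_fourier ((vderiv ^^ n) \<Phi>) (u - y))"
    proof (intro sum.cong refl)
      fix n
      have "(- (2 * pi * (u - y)) * \<i>) ^ n = (- 2 * pi * \<i>) ^ n * of_real (u - y) ^ n"
        by (simp flip: power_mult_distrib add: mult_ac)
      then show "coeff q n * of_real (u - y) ^ n * inv_fourier \<Phi> (u - y) = c n * inv_fourier ((vderiv ^^ n) \<Phi>) (u - y)"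
        unfolding inv_fourier_vderiv_funpow[OF \<Phi>] c_def by simp
    qed
    finally show ?thesis .
  qed
  have i: "integrable lborel (\<lambda>y. inv_fourier ((vderiv ^^ n) \<Phi>) (u - y))" for n
    using rapid_integrable[OF inv_fourier_rapid[OF s] inv_fourier_continuous[OF schwartz_rapid_continuous[OF s]]]
      lborel_integrable_real_affine_iff[of "-1" "inv_fourier ((vderiv ^^ n) \<Phi>)" u] by simp
  have z: "(vderiv ^^ n) \<Phi> \<xi> = 0" if "\<bar>\<xi>\<bar> < \<delta>" for n \<xi>
    using vderiv_zero_on_open[of "ball 0 \<delta>" \<Phi> \<xi> n] \<delta> that by auto
  show "integrable lborel (\<lambda>y. poly p (of_real y) * inv_fourier \<Phi> (u - y))"
    unfolding e by (intro Bochner_Integration.integrable_sum integrable_mult_right i)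
  show "(LINT y|lborel. poly p (of_real y) * inv_fourier \<Phi> (u - y)) = 0"
    unfolding e using i integral_inv_fourier_zero[OF s \<delta>(1) z] by simp
qed

section \<open>Squared norms\<close>

lemma l2sq_mono_set: "A \<subseteq> B \<Longrightarrow> l2sq A g \<le> l2sq B g"
  unfolding l2sq_def by (intro nn_integral_mono) (auto simp: indicator_def)

lemma l2sq_zero [simp]: "l2sq A (\<lambda>x. 0) = 0"
  by (simp add: l2sq_def)

lemma l2sq_cmult:
  assumes [measurable]: "g \<in> borel_measurable borel" "A \<in> sets borel"
  shows "l2sq A (\<lambda>x. c * g x) = ennreal ((cmod c)\<^sup>2) * l2sq A g"
  unfolding l2sq_def
  by (subst nn_integral_cmult[symmetric]) (auto simp: norm_mult power_mult_distrib ennreal_mult mult.assoc)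

lemma sum_squared_le_card:
  fixes x :: "'a \<Rightarrow> real"
  shows "(\<Sum>l\<in>L. x l)\<^sup>2 \<le> card L * (\<Sum>l\<in>L. (x l)\<^sup>2)"
  using Cauchy_Schwarz_ineq_sum[of "\<lambda>_. 1" x L] by simp

lemma l2sq_sum:
  assumes [measurable]: "\<And>l. l \<in> L \<Longrightarrow> g l \<in> borel_measurable borel" "A \<in> sets borel"
  shows "l2sq A (\<lambda>x. \<Sum>l\<in>L. g l x) \<le> of_nat (card L) * (\<Sum>l\<in>L. l2sq A (g l))"
proof -
  have "l2sq A (\<lambda>x. \<Sum>l\<in>L. g l x) \<le> (\<integral>\<^sup>+x. of_nat (card L) * (\<Sum>l\<in>L. ennreal ((cmod (g l x))\<^sup>2) * indicator A x) \<partial>lborel)"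
    unfolding l2sq_def
  proof (rule nn_integral_mono)
    fix x
    have "(cmod (\<Sum>l\<in>L. g l x))\<^sup>2 \<le> (\<Sum>l\<in>L. cmod (g l x))\<^sup>2" by (intro power_mono norm_sum) auto
    also have "\<dots> \<le> card L * (\<Sum>l\<in>L. (cmod (g l x))\<^sup>2)" by (rule sum_squared_le_card)
    finally have "ennreal ((cmod (\<Sum>l\<in>L. g l x))\<^sup>2) \<le> ennreal (card L * (\<Sum>l\<in>L. (cmod (g l x))\<^sup>2))"
      by (rule ennreal_leI)
    also have "\<dots> = of_nat (card L) * (\<Sum>l\<in>L. ennreal ((cmod (g l x))\<^sup>2))"
      by (simp add: ennreal_mult sum_nonneg ennreal_of_nat_eq_real_of_nat)
    finally have "ennreal ((cmod (\<Sum>l\<in>L. g l x))\<^sup>2) \<le> of_nat (card L) * (\<Sum>l\<in>L. ennreal ((cmod (g l x))\<^sup>2))" .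
    then show "ennreal ((cmod (\<Sum>l\<in>L. g l x))\<^sup>2) * indicator A x \<le> of_nat (card L) * (\<Sum>l\<in>L. ennreal ((cmod (g l x))\<^sup>2) * indicator A x)"
      by (cases "x \<in> A") (simp_all del: sum_ennreal)
  qed
  also have "\<dots> = of_nat (card L) * (\<Sum>l\<in>L. l2sq A (g l))"
    unfolding l2sq_def by (subst nn_integral_cmult) (auto simp: nn_integral_sum)
  finally show ?thesis .
qed

lemma l2sq_add:
  assumes "f \<in> borel_measurable borel" "g \<in> borel_measurable borel" "A \<in> sets borel"
  shows "l2sq A (\<lambda>x. f x + g x) \<le> 2 * (l2sq A f + l2sq A g)"
  using l2sq_sum[of "{False, True}" "\<lambda>b. if b then g else f" A] assms by simp

lemma l2sq_diff:
  assumes "f \<in> borel_measurable borel" "g \<in> borel_measurable borel" "A \<in> sets borel"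
  shows "l2sq A (\<lambda>x. f x - g x) \<le> 2 * (l2sq A f + l2sq A g)"
  using l2sq_add[of f "\<lambda>x. - 1 * g x" A] assms l2sq_cmult[of g A "-1"] by simp

lemma l2sq_bounded:
  assumes "\<And>x. x \<in> {a..b} \<Longrightarrow> cmod (g x) \<le> B" "a \<le> b"
  shows "l2sq {a..b} g \<le> ennreal (B\<^sup>2 * (b - a))"
proof -
  have "l2sq {a..b} g \<le> (\<integral>\<^sup>+x. ennreal (B\<^sup>2) * indicator {a..b} x \<partial>lborel)"
    unfolding l2sq_def
    by (intro nn_integral_mono) (auto simp: indicator_def intro!: power_mono assms)
  also have "\<dots> = ennreal (B\<^sup>2 * (b - a))"
    using assms(2) by (simp add: nn_integral_cmult_indicator ennreal_mult)
  finally show ?thesis .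
qed

lemma l2sq_affine:
  fixes c h :: real
  assumes [measurable]: "g \<in> borel_measurable borel" and h: "h > 0"
  shows "l2sq {c + h * a..c + h * b} g = ennreal h * l2sq {a..b} (\<lambda>t. g (c + h * t))"
proof -
  have "l2sq {c + h * a..c + h * b} g
     = ennreal \<bar>h\<bar> * (\<integral>\<^sup>+t. ennreal ((cmod (g (c + h * t)))\<^sup>2) * indicator {c + h * a..c + h * b} (c + h * t) \<partial>lborel)"
    unfolding l2sq_def by (subst nn_integral_real_affine[where c = h and t = c]) (use h in auto)
  also have "(\<integral>\<^sup>+t. ennreal ((cmod (g (c + h * t)))\<^sup>2) * indicator {c + h * a..c + h * b} (c + h * t) \<partial>lborel) = l2sq {a..b} (\<lambda>t. g (c + h * t))"
    unfolding l2sq_def using h by (intro nn_integral_cong) (auto simp: indicator_def)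
  finally show ?thesis using h by simp
qed

section \<open>Polynomials on intervals\<close>

abbreviation pol :: "complex poly \<Rightarrow> real \<Rightarrow> complex" where
  "pol p x \<equiv> poly p (of_real x)"

text \<open>Phrased by coefficients, so that closure under linear combinations is immediate and 0 is
  the only member for r = 0.\<close>

definition deg_less :: "nat \<Rightarrow> complex poly \<Rightarrow> bool" where
  "deg_less r p \<longleftrightarrow> (\<forall>k\<ge>r. coeff p k = 0)"

lemma deg_less_diff: "deg_less r p \<Longrightarrow> deg_less r q \<Longrightarrow> deg_less r (p - q)"
  by (simp add: deg_less_def)

lemma deg_less_smult: "deg_less r p \<Longrightarrow> deg_less r (smult c p)"
  by (simp add: deg_less_def)

lemma deg_less_sum: "(\<And>j. j \<in> J \<Longrightarrow> deg_less r (p j)) \<Longrightarrow> deg_less r (\<Sum>j\<in>J. p j)"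
  by (simp add: deg_less_def coeff_sum)

lemma deg_less_iff: "deg_less r p \<longleftrightarrow> p = 0 \<or> degree p < r"
  unfolding deg_less_def
  by (metis coeff_eq_0 coeff_0 leading_coeff_0_iff linorder_not_le order_less_le_trans)

lemma deg_less_pcompose: 
  assumes "deg_less r p" shows "deg_less r (p \<circ>\<^sub>p [:u, v:])"
proof (cases "p = 0")
  case False
  then have "degree p < r" using assms by (simp add: deg_less_iff)
  moreover have "degree (p \<circ>\<^sub>p [:u, v:]) \<le> degree p"
  proof -
    have "degree (p \<circ>\<^sub>p [:u, v:]) \<le> degree p * degree [:u, v:]" by (rule degree_pcompose_le)
    also have "\<dots> \<le> degree p * 1" by (intro mult_le_mono2) simp
    finally show ?thesis by simp
  qed
  ultimately show ?thesis by (simp add: deg_less_iff)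
qed (simp add: deg_less_def)

lemma pol_eq_sum: "deg_less r p \<Longrightarrow> pol p x = (\<Sum>k<r. coeff p k * of_real x ^ k)"
  unfolding poly_altdef
  by (rule sum.mono_neutral_cong) (auto simp: deg_less_def coeff_eq_0 not_less)

lemma borel_measurable_poly [measurable (raw)]:
  fixes p :: "complex poly"
  assumes "f \<in> borel_measurable M"
  shows "(\<lambda>x. poly p (f x)) \<in> borel_measurable M"
  by (rule borel_measurable_continuous_on[OF _ assms]) (intro continuous_intros)

lemma coeff_pcompose_scale:
  fixes c :: complex
  shows "coeff (p \<circ>\<^sub>p [:0, c:]) k = c ^ k * coeff p k"
proof (induction p arbitrary: k)
  case (pCons a p)
  then show ?case by (cases k) (simp_all add: pcompose_pCons coeff_pCons mult.assoc)
qed simp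

text \<open>The polynomial \<open>p(t) - 2\<^sup>r p(t/2)\<close> has no term of degree \<open>r\<close>, which gives an induction on the degree.\<close>

lemma coeff_le_l2sq_unit:
  "\<exists>K\<ge>0. \<forall>p k. deg_less r p \<longrightarrow> ennreal ((cmod (coeff p k))\<^sup>2) \<le> ennreal K * l2sq {-1..1} (pol p)"
proof (induction r)
  case 0
  show ?case by (intro exI[of _ 0]) (simp add: deg_less_def)
next
  case (Suc r)
  then obtain K where K: "K \<ge> 0" "\<And>p k. deg_less r p \<Longrightarrow> ennreal ((cmod (coeff p k))\<^sup>2) \<le> ennreal K * l2sq {-1..1} (pol p)"
    by blast
  define K1 where "K1 = K * (2 * (1 + 4 ^ r * 2))"
  define K2 where "K2 = 2 ^ (2 * r + 1) * (2 * (1 + 2 * (real r)\<^sup>2 * K1))"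
  have K12: "K1 \<ge> 0" "K2 \<ge> 0" using K by (auto simp: K1_def K2_def)
  have low: "ennreal ((cmod (coeff p k))\<^sup>2) \<le> ennreal K1 * l2sq {-1..1} (pol p)" if p: "deg_less (Suc r) p" and k: "k < r" for p k
  proof -
    define q where "q = p - smult (2 ^ r) (p \<circ>\<^sub>p [:0, 1/2:])"
    have cq: "coeff q k = (1 - 2 ^ r * (1/2) ^ k) * coeff p k" for k
      by (simp add: q_def coeff_pcompose_scale algebra_simps)
    have dq: "deg_less r q"
      unfolding deg_less_def
    proof (intro allI impI)
      fix k assume "r \<le> k"
      then show "coeff q k = 0" using p by (cases "k = r") (auto simp: cq deg_less_def power_one_over)
    qed
    \<comment> \<open>Passing to \<open>q\<close> multiplies the k-th coefficient by 1 - 2^(r - k),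
      of modulus at least 1 for k < r, so the coefficients of \<open>p\<close> are no larger than
      those of \<open>q\<close>.\<close>
    have "(1::real) \<le> 2 ^ (r - k) - 1" using k self_le_power[of "2::real" "r - k"] by simp
    then have ge: "1 \<le> cmod (1 - 2 ^ r * (1/2) ^ k)"
    proof -
      have "(2::complex) ^ r * (1/2) ^ k = of_real (2 ^ (r - k))"
        using k by (simp add: power_diff power_one_over field_simps)
      then have "cmod (1 - 2 ^ r * (1/2) ^ k) = \<bar>1 - 2 ^ (r - k)\<bar>"
        by (metis norm_of_real of_real_1 of_real_diff)
      then show ?thesis using \<open>1 \<le> 2 ^ (r - k) - 1\<close> by simp
    qed
    have "cmod (coeff p k) \<le> cmod (coeff q k)"
      unfolding cq norm_mult using mult_right_mono[OF ge, of "cmod (coeff p k)"] by simp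
    then have "ennreal ((cmod (coeff p k))\<^sup>2) \<le> ennreal ((cmod (coeff q k))\<^sup>2)"
      by (intro ennreal_leI power_mono) auto
    also have "\<dots> \<le> ennreal K * l2sq {-1..1} (pol q)" by (rule K(2)[OF dq])
    also have "l2sq {-1..1} (pol q) \<le> 2 * (l2sq {-1..1} (pol p) + l2sq {-1..1} (\<lambda>x. 2 ^ r * pol p (x / 2)))"
    proof -
      have "pol q = (\<lambda>x. pol p x - 2 ^ r * pol p (x / 2))"
        by (auto simp: q_def poly_pcompose)
      moreover have "(\<lambda>x. 2 ^ r * pol p (x / 2)) \<in> borel_measurable borel"
        by measurable
      ultimately show ?thesis using l2sq_diff[of "pol p" "\<lambda>x. 2 ^ r * pol p (x / 2)" "{-1..1}"] by simp
    qed
    also have "l2sq {-1..1} (\<lambda>x. 2 ^ r * pol p (x / 2)) = ennreal (4 ^ r) * l2sq {-1..1} (\<lambda>x. pol p (x / 2))"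
    proof -
      have "(cmod (2 ^ r))\<^sup>2 = 4 ^ r" by (simp add: norm_power power2_eq_square flip: power_mult_distrib)
      then show ?thesis using l2sq_cmult[of "\<lambda>x. pol p (x / 2)" "{-1..1}" "2 ^ r"] by simp
    qed
    also have "l2sq {-1..1} (\<lambda>x. pol p (x / 2)) = ennreal 2 * l2sq {-1/2..1/2} (pol p)"
      using l2sq_affine[of "\<lambda>x. pol p (x / 2)" 2 0 "-1/2" "1/2"] by simp
    also have "l2sq {-1/2..1/2} (pol p) \<le> l2sq {-1..1} (pol p)" by (rule l2sq_mono_set) auto
    finally have "ennreal ((cmod (coeff p k))\<^sup>2) \<le> ennreal K * (2 * (l2sq {-1..1} (pol p) + ennreal (4 ^ r) * (ennreal 2 * l2sq {-1..1} (pol p))))"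
      by (simp add: mult_left_mono add_left_mono)
    also have "\<dots> = ennreal K1 * l2sq {-1..1} (pol p)"
    proof -
      have "ennreal K1 = ennreal K * (2 * (1 + ennreal (4 ^ r) * ennreal 2))"
        unfolding K1_def using K(1) by (subst ennreal_mult, simp, simp, subst ennreal_mult, simp, simp, subst ennreal_plus, simp, simp, subst ennreal_mult) simp_all
      then show ?thesis by (simp add: algebra_simps)
    qed
    finally show ?thesis .
  qed
  \<comment> \<open>The leading term is \<open>p\<close> minus lower terms already under control. On
    [1/2, 1], of length 1/2, the square of t^r is at least 2^(-2 r), which is the origin of 2^(2 r +
    1) in \<open>K2\<close>.\<close>
  have top: "ennreal ((cmod (coeff p r))\<^sup>2) \<le> ennreal K2 * l2sq {-1..1} (pol p)" if p: "deg_less (Suc r) p" for p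
  proof -
    let ?N = "l2sq {-1..1} (pol p)"
    let ?t = "\<lambda>k x. coeff p k * of_real x ^ k"
    have tN: "l2sq {-1..1} (?t k) \<le> ennreal (2 * K1) * ?N" if "k < r" for k
    proof -
      have "l2sq {-1..1} (?t k) \<le> ennreal ((cmod (coeff p k))\<^sup>2 * (1 - (-1)))"
        by (rule l2sq_bounded) (auto simp: norm_mult norm_power intro!: mult_left_le power_le_one)
      also have "\<dots> = 2 * ennreal ((cmod (coeff p k))\<^sup>2)" by (simp add: ennreal_mult mult.commute)
      also have "\<dots> \<le> 2 * (ennreal K1 * ?N)" by (intro mult_left_mono low p that) simp
      finally show ?thesis using K12 by (simp add: ennreal_mult mult.assoc)
    qed
    have "ennreal ((cmod (coeff p r))\<^sup>2) = ennreal (2 ^ (2 * r + 1)) * ennreal ((cmod (coeff p r))\<^sup>2 * (1 / 2) ^ (2 * r) * (1 / 2))"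
      by (simp flip: ennreal_mult add: power_one_over)
    also have "ennreal ((cmod (coeff p r))\<^sup>2 * (1 / 2) ^ (2 * r) * (1 / 2)) = (\<integral>\<^sup>+x. ennreal ((cmod (coeff p r))\<^sup>2 * (1 / 2) ^ (2 * r)) * indicator {1/2..1::real} x \<partial>lborel)"
      by (subst nn_integral_cmult_indicator, simp, subst ennreal_mult) simp_all
    also have "\<dots> \<le> l2sq {-1..1} (?t r)"
      unfolding l2sq_def
    proof (rule nn_integral_mono)
      fix x :: real
      have "(1 / 2) ^ (2 * r) \<le> x ^ (2 * r)" if "1 / 2 \<le> x" using that by (intro power_mono) auto
      then show "ennreal ((cmod (coeff p r))\<^sup>2 * (1 / 2) ^ (2 * r)) * indicator {1/2..1::real} x \<le> ennreal ((cmod (?t r x))\<^sup>2) * indicator {-1..1} x"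
        by (auto simp: indicator_def norm_mult norm_power power_mult_distrib power_mult[symmetric] mult.commute[of r] intro!: ennreal_leI mult_left_mono)
    qed
    also have "?t r = (\<lambda>x. pol p x - (\<Sum>k<r. ?t k x))"
      using pol_eq_sum[OF p] by auto
    also have "l2sq {-1..1} \<dots> \<le> 2 * (?N + l2sq {-1..1} (\<lambda>x. \<Sum>k<r. ?t k x))"
      by (rule l2sq_diff) measurable
    also have "l2sq {-1..1} (\<lambda>x. \<Sum>k<r. ?t k x) \<le> of_nat r * (\<Sum>k<r. l2sq {-1..1} (?t k))"
      using l2sq_sum[of "{..<r}" ?t "{-1..1}"] by simp
    also have "(\<Sum>k<r. l2sq {-1..1} (?t k)) \<le> (\<Sum>k<r. ennreal (2 * K1) * ?N)"
      by (intro sum_mono tN) simp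
    finally have "ennreal ((cmod (coeff p r))\<^sup>2) \<le> ennreal (2 ^ (2 * r + 1)) * (2 * (?N + of_nat r * (of_nat r * (ennreal (2 * K1) * ?N))))"
      by (simp add: mult_left_mono add_left_mono)
    also have "\<dots> = ennreal K2 * ?N"
    proof -
      have "ennreal K2 = ennreal (2 ^ (2 * r + 1)) * (2 * (1 + of_nat r * (of_nat r * ennreal (2 * K1))))"
      proof -
        have "ennreal (2 * (real r)\<^sup>2 * K1) = of_nat r * (of_nat r * ennreal (2 * K1))"
          using K12 by (simp add: ennreal_of_nat_eq_real_of_nat power2_eq_square mult_ac flip: ennreal_mult)
        then show ?thesis
          unfolding K2_def using K12 by (subst ennreal_mult, simp, simp, subst ennreal_mult, simp, simp, subst ennreal_plus) simp_all
      qed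
      then show ?thesis by (simp add: algebra_simps)
    qed
    finally show ?thesis .
  qed
  show ?case
  proof (intro exI[of _ "max K1 K2"] conjI allI impI)
    fix p k assume p: "deg_less (Suc r) p"
    consider "k < r" | "k = r" | "k > r" by linarith
    then show "ennreal ((cmod (coeff p k))\<^sup>2) \<le> ennreal (max K1 K2) * l2sq {-1..1} (pol p)"
    proof cases
      case 1
      from low[OF p this] show ?thesis by (rule order_trans) (auto intro!: mult_right_mono ennreal_leI)
    next
      case 2
      show ?thesis unfolding 2 by (rule order_trans[OF top[OF p]]) (auto intro!: mult_right_mono ennreal_leI)
    next
      case 3
      then show ?thesis using p by (simp add: deg_less_def)
    qed
  qed (use K12 in auto)
qed

text \<open>Rescaling to [-1, 1] reduces this to the coefficient bound. The top degree is r - 1,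
  hence the growth T^(2 (r - 1)); the factor \<open>h\<close> on the left accounts for the change of
  variable.\<close>

lemma pol_le_l2sq:
  "\<exists>K\<ge>0. \<forall>p c h T t. deg_less r p \<longrightarrow> h > 0 \<longrightarrow> T \<ge> 1 \<longrightarrow> \<bar>t\<bar> \<le> T \<longrightarrow>
     ennreal ((cmod (pol p (c + h * t)))\<^sup>2 * h) \<le> ennreal (K * T ^ (2 * (r - 1))) * l2sq {c - h..c + h} (pol p)"
proof -
  obtain K where K: "K \<ge> 0" "\<And>p k. deg_less r p \<Longrightarrow> ennreal ((cmod (coeff p k))\<^sup>2) \<le> ennreal K * l2sq {-1..1} (pol p)"
    using coeff_le_l2sq_unit by blast
  show ?thesis
  proof (intro exI[of _ "(real r)\<^sup>2 * K"] conjI allI impI)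
    fix p c and h T t :: real assume p: "deg_less r p" and h: "h > 0" and T: "T \<ge> 1" "\<bar>t\<bar> \<le> T"
    define q where "q = p \<circ>\<^sub>p [:of_real c, of_real h:]"
    have q: "deg_less r q" unfolding q_def by (rule deg_less_pcompose[OF p])
    have pq: "pol q t = pol p (c + h * t)" for t by (simp add: q_def poly_pcompose mult.commute)
    have N: "ennreal h * l2sq {-1..1} (pol q) = l2sq {c - h..c + h} (pol p)"
      using l2sq_affine[of "pol p" h c "-1" 1] h by (simp add: pq)
    have "(cmod (pol p (c + h * t)))\<^sup>2 \<le> (\<Sum>k<r. cmod (coeff q k * of_real t ^ k))\<^sup>2"
      unfolding pq[symmetric] pol_eq_sum[OF q] by (intro power_mono norm_sum) auto
    also have "\<dots> \<le> r * (\<Sum>k<r. (cmod (coeff q k * of_real t ^ k))\<^sup>2)"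
      using sum_squared_le_card[of "\<lambda>k. cmod (coeff q k * of_real t ^ k)" "{..<r}"] by simp
    also have "\<dots> \<le> r * (\<Sum>k<r. (cmod (coeff q k))\<^sup>2 * T ^ (2 * (r - 1)))"
    proof (intro mult_left_mono sum_mono)
      fix k assume k: "k \<in> {..<r}"
      have "\<bar>t\<bar> ^ k \<le> T ^ k" using T by (intro power_mono) auto
      also have "\<dots> \<le> T ^ (r - 1)" using T k by (intro power_increasing) auto
      finally have "(cmod (coeff q k * of_real t ^ k))\<^sup>2 \<le> (cmod (coeff q k) * T ^ (r - 1))\<^sup>2"
        using T by (intro power_mono) (auto simp: norm_mult norm_power intro!: mult_left_mono)
      then show "(cmod (coeff q k * of_real t ^ k))\<^sup>2 \<le> (cmod (coeff q k))\<^sup>2 * T ^ (2 * (r - 1))"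
        by (simp add: power_mult_distrib power_mult[symmetric] mult.commute[of _ 2])
    qed simp
    finally have *: "(cmod (pol p (c + h * t)))\<^sup>2 * h \<le> r * (\<Sum>k<r. (cmod (coeff q k))\<^sup>2 * T ^ (2 * (r - 1))) * h"
      using h by (intro mult_right_mono) auto
    have "ennreal ((cmod (pol p (c + h * t)))\<^sup>2 * h) \<le> ennreal (r * (\<Sum>k<r. (cmod (coeff q k))\<^sup>2 * T ^ (2 * (r - 1))) * h)"
      using * by (rule ennreal_leI)
    also have "\<dots> = of_nat r * (\<Sum>k<r. ennreal ((cmod (coeff q k))\<^sup>2) * ennreal (T ^ (2 * (r - 1)))) * ennreal h"
      using T h by (simp add: ennreal_mult sum_nonneg ennreal_of_nat_eq_real_of_nat flip: sum_ennreal)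
    also have "\<dots> \<le> of_nat r * (\<Sum>k<r. ennreal K * l2sq {-1..1} (pol q) * ennreal (T ^ (2 * (r - 1)))) * ennreal h"
      by (intro mult_right_mono mult_left_mono sum_mono K q) auto
    also have "\<dots> = ennreal ((real r)\<^sup>2 * K * T ^ (2 * (r - 1))) * (ennreal h * l2sq {-1..1} (pol q))"
      using K T by (simp add: ennreal_mult power2_eq_square ennreal_of_nat_eq_real_of_nat mult_ac)
    finally show "ennreal ((cmod (pol p (c + h * t)))\<^sup>2 * h) \<le> ennreal ((real r)\<^sup>2 * K * T ^ (2 * (r - 1))) * l2sq {c - h..c + h} (pol p)"
      unfolding N .
  qed (use K in simp)
qed

text \<open>Integrates the pointwise bound over a length 2 T. For degree below i the exponent is 2
  (i - 1) + 1, and this is the source of i - 1 in max s (i - 1).\<close>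

lemma l2sq_pol_dilate:
  "\<exists>K\<ge>0. \<forall>p c h T. deg_less r p \<longrightarrow> h > 0 \<longrightarrow> T \<ge> 1 \<longrightarrow>
     l2sq {c - T * h..c + T * h} (pol p) \<le> ennreal (K * T ^ (2 * r - 1)) * l2sq {c - h..c + h} (pol p)"
proof (cases "r = 0")
  case True
  then have "deg_less r p \<Longrightarrow> p = 0" for p by (simp add: deg_less_iff)
  then have "deg_less r p \<Longrightarrow> pol p = (\<lambda>x. 0)" for p by fastforce
  then show ?thesis by (intro exI[of _ 0]) auto
next
  case False
  obtain K where K: "K \<ge> 0" "\<And>p c h T t. deg_less r p \<Longrightarrow> h > 0 \<Longrightarrow> T \<ge> 1 \<Longrightarrow> \<bar>t\<bar> \<le> T \<Longrightarrow>
     ennreal ((cmod (pol p (c + h * t)))\<^sup>2 * h) \<le> ennreal (K * T ^ (2 * (r - 1))) * l2sq {c - h..c + h} (pol p)"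
    using pol_le_l2sq by metis
  show ?thesis
  proof (intro exI[of _ "2 * K"] conjI allI impI)
    fix p c and h T :: real assume p: "deg_less r p" and h: "h > 0" and T: "T \<ge> 1"
    let ?N = "l2sq {c - h..c + h} (pol p)"
    have "l2sq {c - T * h..c + T * h} (pol p) = l2sq {c + h * (-T)..c + h * T} (pol p)"
      by (simp add: mult.commute)
    also have "\<dots> = ennreal h * l2sq {-T..T} (\<lambda>t. pol p (c + h * t))"
      by (rule l2sq_affine) (use h in auto)
    also have "\<dots> = (\<integral>\<^sup>+t\<in>{-T..T}. ennreal ((cmod (pol p (c + h * t)))\<^sup>2 * h) \<partial>lborel)"
      unfolding l2sq_def using h
      by (subst nn_integral_cmult[symmetric]) (auto simp: ennreal_mult mult_ac)
    also have "\<dots> \<le> (\<integral>\<^sup>+t. ennreal (K * T ^ (2 * (r - 1))) * ?N * indicator {-T..T} t \<partial>lborel)"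
    proof (rule nn_integral_mono)
      fix t
      show "ennreal ((cmod (pol p (c + h * t)))\<^sup>2 * h) * indicator {-T..T} t \<le> ennreal (K * T ^ (2 * (r - 1))) * ?N * indicator {-T..T} t"
        using K(2)[OF p h T, of t c] by (cases "t \<in> {-T..T}") (simp_all add: abs_le_iff)
    qed
    also have "\<dots> = ennreal (K * T ^ (2 * (r - 1))) * ?N * ennreal (2 * T)"
      using T by (subst nn_integral_cmult_indicator) auto
    also have "\<dots> = ennreal (2 * K * T ^ (2 * r - 1)) * ?N"
    proof -
      have "T ^ (2 * r - 1) = T * T ^ (2 * (r - 1))"
        using False by (simp flip: power_Suc add: Suc_diff_Suc numeral_2_eq_2)
      then have "ennreal (2 * K * T ^ (2 * r - 1)) = ennreal (K * T ^ (2 * (r - 1))) * ennreal (2 * T)"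
        using K T by (simp flip: ennreal_mult add: mult_ac)
      then show ?thesis by (simp add: mult_ac)
    qed
    finally show "l2sq {c - T * h..c + T * h} (pol p) \<le> ennreal (2 * K * T ^ (2 * r - 1)) * ?N" .
  qed (use K in simp)
qed

lemma coeff_le_l2sq:
  assumes "a < b"
  shows "\<exists>K\<ge>0. \<forall>p k. deg_less r p \<longrightarrow> ennreal ((cmod (coeff p k))\<^sup>2) \<le> ennreal K * l2sq {a..b} (pol p)"
proof -
  obtain K where K: "K \<ge> 0" "\<And>p k. deg_less r p \<Longrightarrow> ennreal ((cmod (coeff p k))\<^sup>2) \<le> ennreal K * l2sq {-1..1} (pol p)"
    using coeff_le_l2sq_unit by blast
  obtain K' where K': "K' \<ge> 0" "\<And>p c h T. deg_less r p \<Longrightarrow> h > 0 \<Longrightarrow> T \<ge> 1 \<Longrightarrow>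
     l2sq {c - T * h..c + T * h} (pol p) \<le> ennreal (K' * T ^ (2 * r - 1)) * l2sq {c - h..c + h} (pol p)"
    using l2sq_pol_dilate by metis
  define c where "c = (a + b) / 2"
  define h where "h = (b - a) / 2"
  have h: "h > 0" "{c - h..c + h} = {a..b}" using assms by (auto simp: c_def h_def field_simps)
  \<comment> \<open>Then T h = h + 1 + |c|, so the dilate about \<open>c\<close> contains
    [-1, 1].\<close>
  define T where "T = 1 + (1 + \<bar>c\<bar>) / h"
  have T: "T \<ge> 1" using h by (simp add: T_def)
  have "T * h = h + (1 + \<bar>c\<bar>)" unfolding T_def distrib_right using h(1) by simp
  then have sub: "{-1..1} \<subseteq> {c - T * h..c + T * h}" using h by auto
  show ?thesis
  proof (intro exI[of _ "K * (K' * T ^ (2 * r - 1))"] conjI allI impI)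
    fix p k assume p: "deg_less r p"
    have "ennreal ((cmod (coeff p k))\<^sup>2) \<le> ennreal K * l2sq {-1..1} (pol p)" by (rule K(2)[OF p])
    also have "\<dots> \<le> ennreal K * l2sq {c - T * h..c + T * h} (pol p)" by (intro mult_left_mono l2sq_mono_set sub) simp
    also have "\<dots> \<le> ennreal K * (ennreal (K' * T ^ (2 * r - 1)) * l2sq {c - h..c + h} (pol p))"
      by (intro mult_left_mono K' p h T) simp
    finally show "ennreal ((cmod (coeff p k))\<^sup>2) \<le> ennreal (K * (K' * T ^ (2 * r - 1))) * l2sq {a..b} (pol p)"
      unfolding h(2) using K K' T by (simp add: ennreal_mult mult.assoc)
  qed (use K K' T in auto)
qed

text \<open>Comparing the approximating polynomials on consecutive dyadic dilates of an interval.\<close>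

lemma campanato_growth:
  fixes s :: real and i :: nat
  assumes s: "s > -1/2"
  defines "\<tau> \<equiv> max s (real i - 1)"
  shows "\<exists>C\<ge>0. \<forall>f A c h. f \<in> borel_measurable borel \<longrightarrow> A \<ge> 0 \<longrightarrow> h > 0 \<longrightarrow>
    (\<forall>a b. a < b \<longrightarrow> (\<exists>P. deg_less i P \<and> l2sq {a..b} (\<lambda>x. f x - pol P x) \<le> ennreal (A\<^sup>2 * (b - a) powr (2 * s + 1)))) \<longrightarrow>
    (\<exists>P. deg_less i P \<and> (\<forall>k::nat. l2sq {c - 2 ^ k * h..c + 2 ^ k * h} (\<lambda>x. f x - pol P x)
      \<le> ennreal (C * (real k + 1)\<^sup>2 * 2 powr (real k * (2 * \<tau> + 1)) * h powr (2 * s + 1) * A\<^sup>2)))"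
proof -
  obtain K where K: "K \<ge> 0" "\<And>p c h T. deg_less i p \<Longrightarrow> h > 0 \<Longrightarrow> T \<ge> 1 \<Longrightarrow>
     l2sq {c - T * h..c + T * h} (pol p) \<le> ennreal (K * T ^ (2 * i - 1)) * l2sq {c - h..c + h} (pol p)"
    using l2sq_pol_dilate by metis
  define e where "e = 2 * s + 1"
  define g where "g = 2 * \<tau> + 1"
  define C1 where "C1 = 4 * 4 powr e"
  have e: "e > 0" "e \<le> g" using s by (auto simp: e_def g_def \<tau>_def)
  have ig: "real (2 * i - 1) \<le> g" 
  proof (cases "i = 0")
    case False
    then have "real (2 * i - 1) = 2 * real i - 1" by (simp add: of_nat_diff)
    moreover have "real i - 1 \<le> \<tau>" unfolding \<tau>_def by (rule max.cobounded2)
    ultimately show ?thesis unfolding g_def by linarith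
  qed (use e in simp)
  have C1: "C1 \<ge> 0" by (simp add: C1_def)
  show ?thesis
  proof (intro exI[of _ "(1 + K) * C1"] conjI allI impI)
    fix f and A c h :: real
    assume f [measurable]: "f \<in> borel_measurable borel" and A: "A \<ge> 0" and h: "h > 0"
      and hyp: "\<forall>a b. a < b \<longrightarrow> (\<exists>P. deg_less i P \<and> l2sq {a..b} (\<lambda>x. f x - pol P x) \<le> ennreal (A\<^sup>2 * (b - a) powr (2 * s + 1)))"
    let ?R = "\<lambda>(k::nat) P. deg_less i P \<and> l2sq {c - 2 ^ k * h..c + 2 ^ k * h} (\<lambda>x. f x - pol P x)
       \<le> ennreal (A\<^sup>2 * ((c + 2 ^ k * h) - (c - 2 ^ k * h)) powr (2 * s + 1))"
    have "\<forall>k. \<exists>P. ?R k P"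
    proof
      fix k
      have "0 < 2 ^ k * h" using h by simp
      then have "c - 2 ^ k * h < c + 2 ^ k * h" by linarith
      from hyp[rule_format, OF this] show "\<exists>P. ?R k P" .
    qed
    from choice[OF this] obtain P where R: "\<forall>k. ?R k (P k)" ..
    note P = R[rule_format, THEN conjunct1] R[rule_format, THEN conjunct2]
    define H where "H = h powr e * A\<^sup>2"
    have H: "H \<ge> 0" by (simp add: H_def)
    let ?J = "\<lambda>k::nat. {c - 2 ^ k * h..c + 2 ^ k * h}"
    let ?E = "\<lambda>k::nat. 2 powr e * 2 powr (real k * e) * H"
    have PE: "l2sq (?J k) (\<lambda>x. f x - pol (P k) x) \<le> ennreal (?E k)" for k
    proof -
      have "(c + 2 ^ k * h) - (c - 2 ^ k * h) = 2 * 2 powr real k * h" by (simp add: powr_realpow)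
      then have "((c + 2 ^ k * h) - (c - 2 ^ k * h)) powr e = 2 powr e * 2 powr (real k * e) * h powr e"
        using h by (simp add: powr_mult powr_powr)
      then have "A\<^sup>2 * ((c + 2 ^ k * h) - (c - 2 ^ k * h)) powr e = ?E k" by (simp only: H_def mult_ac)
      then show ?thesis using P(2)[of k] unfolding e_def[symmetric] by (simp only:)
    qed
    define u where "u l x = pol (P (Suc l)) x - pol (P l) x" for l x
    have [measurable]: "u l \<in> borel_measurable borel" for l unfolding u_def by measurable
    have u_pol: "u l = pol (P (Suc l) - P l)" for l by (auto simp: u_def)
    have uJ: "l2sq (?J l) (u l) \<le> ennreal (C1 * 2 powr (real l * e) * H)" for l
    proof -
      have "u l = (\<lambda>x. (f x - pol (P l) x) - (f x - pol (P (Suc l)) x))" by (auto simp: u_def)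
      then have "l2sq (?J l) (u l) \<le> 2 * (l2sq (?J l) (\<lambda>x. f x - pol (P l) x) + l2sq (?J l) (\<lambda>x. f x - pol (P (Suc l)) x))"
        using l2sq_diff[of "\<lambda>x. f x - pol (P l) x" "\<lambda>x. f x - pol (P (Suc l)) x" "?J l"] by simp
      also have "\<dots> \<le> 2 * (ennreal (?E l) + l2sq (?J (Suc l)) (\<lambda>x. f x - pol (P (Suc l)) x))"
        using h by (intro mult_left_mono add_mono PE l2sq_mono_set) auto
      also have "\<dots> \<le> 2 * (ennreal (?E l) + ennreal (?E (Suc l)))"
        by (intro mult_left_mono add_mono PE order_refl) auto
      also have "\<dots> \<le> 2 * (ennreal (?E (Suc l)) + ennreal (?E (Suc l)))"
        using e H by (intro mult_left_mono add_mono ennreal_leI mult_right_mono mult_left_mono powr_mono) (auto intro: mult_right_mono)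
      also have "\<dots> = ennreal (4 * ?E (Suc l))"
      proof -
        have "2 * (x + x) = ennreal 4 * x" for x by (simp add: mult_2[symmetric] flip: mult.assoc)
        then show ?thesis by (simp only: ennreal_mult' zero_le_numeral)
      qed
      also have "4 * ?E (Suc l) = C1 * 2 powr (real l * e) * H"
      proof -
        have "4 powr e = 2 powr e * 2 powr e" by (simp flip: powr_mult)
        then show ?thesis unfolding C1_def by (simp add: distrib_right powr_add)
      qed
      finally show ?thesis .
    qed
    \<comment> \<open>The correction of level l is small on its own interval and grows by at most
      2^((k - l) (2 i - 1)) up to level k. As \<open>e\<close> and \<open>2 * i - 1\<close> are both
      at most \<open>g\<close>, the resulting bound 2^(k g) is independent of l.\<close>
    have uk: "l2sq (?J k) (u l) \<le> ennreal ((1 + K) * C1 * 2 powr (real k * g) * H)" if "l < k" for l k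
    proof -
      have "l2sq (?J k) (u l) = l2sq {c - 2 ^ (k - l) * (2 ^ l * h)..c + 2 ^ (k - l) * (2 ^ l * h)} (u l)"
        using that by (simp flip: mult.assoc power_add)
      also have "\<dots> \<le> ennreal (K * (2 ^ (k - l)) ^ (2 * i - 1)) * l2sq (?J l) (u l)"
        unfolding u_pol using h by (intro K deg_less_diff P) auto
      also have "\<dots> \<le> ennreal (K * (2 ^ (k - l)) ^ (2 * i - 1)) * ennreal (C1 * 2 powr (real l * e) * H)"
        by (intro mult_left_mono uJ) simp
      also have "\<dots> = ennreal (K * (2 ^ (k - l)) ^ (2 * i - 1) * (C1 * 2 powr (real l * e) * H))"
        using K C1 H by (simp add: ennreal_mult)
      also have "\<dots> \<le> ennreal ((1 + K) * 2 powr (real (k - l) * g) * (C1 * 2 powr (real l * g) * H))"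
      proof (intro ennreal_leI mult_mono)
        have "(2 ^ (k - l)) ^ (2 * i - 1) = (2::real) powr (real (k - l) * real (2 * i - 1))"
          by (simp add: powr_realpow power_mult flip: of_nat_mult)
        also have "\<dots> \<le> 2 powr (real (k - l) * g)" using ig by (intro powr_mono mult_left_mono) auto
        finally show "(2 ^ (k - l)) ^ (2 * i - 1) \<le> (2::real) powr (real (k - l) * g)" .
      qed (use K C1 H e in \<open>auto intro!: powr_mono mult_left_mono\<close>)
      also have "(1 + K) * 2 powr (real (k - l) * g) * (C1 * 2 powr (real l * g) * H) = (1 + K) * C1 * 2 powr (real k * g) * H"
      proof -
        have "real k * g = real (k - l) * g + real l * g" using that by (simp add: of_nat_diff algebra_simps)
        then show ?thesis by (simp add: powr_add)
      qed
      finally show ?thesis .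
    qed
    have fk: "l2sq (?J k) (\<lambda>x. f x - pol (P k) x) \<le> ennreal ((1 + K) * C1 * 2 powr (real k * g) * H)" for k
    proof (rule order_trans[OF PE], intro ennreal_leI mult_right_mono H mult_mono)
      have "2 powr e \<le> C1" using e by (auto simp: C1_def intro!: order_trans[OF powr_mono2[of e 2 4]])
      then show "2 powr e \<le> (1 + K) * C1" using K C1 mult_right_mono[of 1 "1 + K" C1] by auto
    qed (use K C1 e in \<open>auto intro!: powr_mono mult_left_mono\<close>)
    show "\<exists>P. deg_less i P \<and> (\<forall>k::nat. l2sq (?J k) (\<lambda>x. f x - pol P x)
      \<le> ennreal ((1 + K) * C1 * (real k + 1)\<^sup>2 * 2 powr (real k * (2 * \<tau> + 1)) * h powr (2 * s + 1) * A\<^sup>2))"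
    proof (intro exI[of _ "P 0"] conjI P allI)
      fix k
      \<comment> \<open>k corrections and the error f - P_k make k + 1 terms with one common bound,
        so Cauchy-Schwarz costs (k + 1)^2. In the critical case s = i - 1 the exponents
        \<open>e\<close> and \<open>g\<close> coincide.\<close>
      let ?v = "\<lambda>l x. if l = k then f x - pol (P k) x else u l x"
      have "f x - pol (P 0) x = (\<Sum>l\<le>k. ?v l x)" for x
      proof -
        have "(\<Sum>l\<le>k. ?v l x) = (f x - pol (P k) x) + (\<Sum>l<k. u l x)"
          by (simp add: lessThan_Suc_atMost[symmetric] add.commute)
        also have "(\<Sum>l<k. u l x) = pol (P k) x - pol (P 0) x"
          unfolding u_def by (rule sum_lessThan_telescope)
        finally show ?thesis by simp
      qed
      then have "l2sq (?J k) (\<lambda>x. f x - pol (P 0) x) = l2sq (?J k) (\<lambda>x. \<Sum>l\<le>k. ?v l x)" by simp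
      also have "\<dots> \<le> of_nat (card {..k}) * (\<Sum>l\<le>k. l2sq (?J k) (?v l))"
        by (rule l2sq_sum) auto
      also have "\<dots> \<le> of_nat (card {..k}) * (\<Sum>l\<le>k. ennreal ((1 + K) * C1 * 2 powr (real k * g) * H))"
      proof (intro mult_left_mono sum_mono)
        fix l assume "l \<in> {..k}"
        then show "l2sq (?J k) (?v l) \<le> ennreal ((1 + K) * C1 * 2 powr (real k * g) * H)"
          using uk[of l k] fk[of k] by (cases "l = k") auto
      qed simp
      also have "\<dots> = ennreal ((real k + 1) * ((real k + 1) * ((1 + K) * C1 * 2 powr (real k * g) * H)))"
      proof -
        have "of_nat (Suc k) = ennreal (real k + 1)" by (metis ennreal_of_nat_eq_real_of_nat of_nat_Suc add.commute)
        then show ?thesis using K C1 H by (simp add: ennreal_mult del: of_nat_Suc)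
      qed
      finally show "l2sq (?J k) (\<lambda>x. f x - pol (P 0) x) \<le> ennreal ((1 + K) * C1 * (real k + 1)\<^sup>2 * 2 powr (real k * (2 * \<tau> + 1)) * h powr (2 * s + 1) * A\<^sup>2)"
        by (simp add: H_def e_def g_def power2_eq_square mult_ac)
    qed
  qed (use K C1 in simp)
qed

section \<open>Derivatives of convolutions and their Taylor polynomials\<close>

definition mq :: "nat \<Rightarrow> (real \<Rightarrow> complex) \<Rightarrow> real \<Rightarrow> complex" where
  "mq q \<theta> t = (2 * pi * \<i> * of_real t) ^ q * \<theta> t"

text \<open>The q-th derivative of the convolution of \<open>g\<close> with the kernel of \<theta>,
  encoded by the multiplier (2 pi i t)^q instead of by iterated differentiation.\<close>

definition conv :: "(real \<Rightarrow> complex) \<Rightarrow> (real \<Rightarrow> complex) \<Rightarrow> nat \<Rightarrow> real \<Rightarrow> complex" where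
  "conv g \<theta> q x = (LINT y|lborel. g y * inv_fourier (mq q \<theta>) (x - y))"

definition taylor :: "(real \<Rightarrow> complex) \<Rightarrow> (real \<Rightarrow> complex) \<Rightarrow> nat \<Rightarrow> real \<Rightarrow> complex poly" where
  "taylor g \<theta> r a = (\<Sum>q<r. smult (conv g \<theta> q a / fact q) ([:- of_real a, 1:] ^ q))"

lemma mq_schwartz:
  assumes "\<theta> \<in> schwartz"
  shows "mq q \<theta> \<in> schwartz"
proof (induction q)
  case 0
  then show ?case using assms by (simp add: mq_def[abs_def])
next
  case (Suc q)
  have "mq (Suc q) \<theta> = (\<lambda>t. (2 * pi * \<i>) * (of_real t * mq q \<theta> t))"
    by (simp add: mq_def fun_eq_iff mult_ac)
  then show ?case using schwartz_cmult[OF schwartz_mult_id[OF Suc]] by simp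
qed

lemma mq_kernel:
  assumes "\<theta> \<in> schwartz"
  shows "rapid (inv_fourier (mq q \<theta>))" "continuous_on UNIV (inv_fourier (mq q \<theta>))"
    "(inv_fourier (mq q \<theta>) has_vector_derivative inv_fourier (mq (Suc q) \<theta>) x) (at x)"
proof -
  have s: "mq q \<theta> \<in> schwartz" by (rule mq_schwartz[OF assms])
  show "rapid (inv_fourier (mq q \<theta>))" by (rule inv_fourier_rapid[OF s])
  show "continuous_on UNIV (inv_fourier (mq q \<theta>))"
    by (intro inv_fourier_continuous schwartz_rapid_continuous s)
  have "mq (Suc q) \<theta> = (\<lambda>t. (2 * pi * \<i>) * (of_real t * mq q \<theta> t))"
    by (simp add: mq_def fun_eq_iff mult_ac)
  then show "(inv_fourier (mq q \<theta>) has_vector_derivative inv_fourier (mq (Suc q) \<theta>) x) (at x)"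
    using has_vector_derivative_inv_fourier[OF s, of x] by simp
qed

lemma conv_integrable:
  assumes "tempered g" "\<theta> \<in> schwartz"
  shows "integrable lborel (\<lambda>y. g y * inv_fourier (mq q \<theta>) (x - y))"
  by (intro tempered_integrable mq_kernel assms)

lemma conv_derivative:
  assumes "tempered g" "\<theta> \<in> schwartz"
  shows "(conv g \<theta> q has_vector_derivative conv g \<theta> (Suc q) x) (at x)"
  unfolding conv_def[abs_def] by (intro has_vector_derivative_convolution mq_kernel assms)

lemma conv_continuous:
  assumes "tempered g" "\<theta> \<in> schwartz"
  shows "continuous_on UNIV (conv g \<theta> q)"
  using conv_derivative[OF assms]
  by (meson continuous_at_imp_continuous_on has_vector_derivative_continuous)

lemma conv_add:
  assumes "tempered f" "tempered g" "\<theta> \<in> schwartz"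
  shows "conv (\<lambda>y. f y + g y) \<theta> q x = conv f \<theta> q x + conv g \<theta> q x"
  unfolding conv_def using conv_integrable[OF assms(1,3)] conv_integrable[OF assms(2,3)]
  by (simp add: distrib_right)

lemma deg_less_taylor: "deg_less r (taylor g \<theta> r a)"
  unfolding taylor_def
proof (intro deg_less_sum deg_less_smult)
  fix q assume "q \<in> {..<r}"
  moreover have "degree ([:- complex_of_real a, 1:] ^ q) = q" by (rule degree_linear_power)
  ultimately show "deg_less r ([:- complex_of_real a, 1:] ^ q)" by (simp add: deg_less_iff)
qed

lemma pol_taylor: "pol (taylor g \<theta> r a) x = (\<Sum>q<r. ((x - a) ^ q / fact q) *\<^sub>R conv g \<theta> q a)"
  unfolding taylor_def poly_sum
  by (intro sum.cong refl) (simp add: scaleR_conv_of_real mult_ac)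

text \<open>Integral form of the remainder, with 1 / (r - 1)! dropped. The bound is left as an L^1
  integral in u so that the dyadic pieces can be summed under it before squaring.\<close>

lemma taylor_remainder:
  assumes g: "tempered g" and \<theta>: "\<theta> \<in> schwartz" and r: "r \<ge> 1" and x: "x \<in> {a..b}"
  shows "ennreal (cmod (conv g \<theta> 0 x - pol (taylor g \<theta> r a) x))
    \<le> ennreal ((b - a) ^ (r - 1)) * (\<integral>\<^sup>+u\<in>{a..b}. ennreal (cmod (conv g \<theta> r u)) \<partial>lborel)"
proof -
  define R where "R u = ((x - u) ^ (r - 1) / fact (r - 1)) *\<^sub>R conv g \<theta> r u" for u
  have ax: "a \<le> x" "x \<le> b" using x by auto
  have [measurable]: "conv g \<theta> r \<in> borel_measurable borel"
    by (intro borel_measurable_continuous_onI conv_continuous g \<theta>)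
  have Rc: "continuous_on {a..x} R"
    unfolding R_def by (intro continuous_intros continuous_on_subset[OF conv_continuous[OF g \<theta>]]) auto
  have "conv g \<theta> 0 x = (\<Sum>q<r. ((x - a) ^ q / fact q) *\<^sub>R conv g \<theta> q a) + integral {a..x} R"
    unfolding R_def
    by (rule Taylor_integral[where Df = "conv g \<theta>" and p = r, OF _ refl has_vector_derivative_at_within[OF conv_derivative[OF g \<theta>]] ax(1)])
      (use r in simp)
  then have "conv g \<theta> 0 x - pol (taylor g \<theta> r a) x = integral {a..x} R" by (simp add: pol_taylor)
  also have "\<dots> = (LINT u:{a..x}|lborel. R u)"
    by (rule set_borel_integral_eq_integral(2)[symmetric]) (rule borel_integrable_atLeastAtMost', rule Rc)
  finally have "ennreal (cmod (conv g \<theta> 0 x - pol (taylor g \<theta> r a) x)) \<le> (\<integral>\<^sup>+u. ennreal (cmod (indicator {a..x} u *\<^sub>R R u)) \<partial>lborel)"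
    unfolding set_lebesgue_integral_def using norm_integral_le_nn_integral[of lborel "\<lambda>u. indicator {a..x} u *\<^sub>R R u"] by simp
  also have "\<dots> \<le> (\<integral>\<^sup>+u. ennreal ((b - a) ^ (r - 1)) * (ennreal (cmod (conv g \<theta> r u)) * indicator {a..b} u) \<partial>lborel)"
  proof (rule nn_integral_mono)
    fix u
    show "ennreal (cmod (indicator {a..x} u *\<^sub>R R u)) \<le> ennreal ((b - a) ^ (r - 1)) * (ennreal (cmod (conv g \<theta> r u)) * indicator {a..b} u)"
    proof (cases "u \<in> {a..x}")
      case True
      then have u: "a \<le> u" "u \<le> x" "u \<in> {a..b}" using ax by auto
      have "\<bar>(x - u) ^ (r - 1) / fact (r - 1)\<bar> \<le> (x - u) ^ (r - 1)"
        using u by (simp add: divide_le_eq mult_le_cancel_left1 fact_ge_1)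
      also have "\<dots> \<le> (b - a) ^ (r - 1)" using u ax by (intro power_mono) auto
      finally have "cmod (R u) \<le> (b - a) ^ (r - 1) * cmod (conv g \<theta> r u)"
        unfolding R_def norm_scaleR by (intro mult_right_mono) auto
      then have "ennreal (cmod (R u)) \<le> ennreal ((b - a) ^ (r - 1)) * ennreal (cmod (conv g \<theta> r u))"
        using ax by (simp flip: ennreal_mult)
      then show ?thesis using True u by simp
    qed simp
  qed
  also have "\<dots> = ennreal ((b - a) ^ (r - 1)) * (\<integral>\<^sup>+u\<in>{a..b}. ennreal (cmod (conv g \<theta> r u)) \<partial>lborel)"
    by (rule nn_integral_cmult) measurable
  finally show ?thesis .
qed

section \<open>A single dyadic piece\<close>

lemma vderiv_scale:
  fixes \<sigma> :: real
  assumes f: "f \<in> schwartz" and \<sigma>: "\<sigma> \<noteq> 0"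
  shows "(vderiv ^^ n) (\<lambda>t. c * f (t / \<sigma>)) = (\<lambda>t. c / of_real (\<sigma> ^ n) * (vderiv ^^ n) f (t / \<sigma>))"
proof (induction n)
  case (Suc n)
  have "vderiv (\<lambda>t. c / of_real (\<sigma> ^ n) * (vderiv ^^ n) f (t / \<sigma>)) t = c / of_real (\<sigma> ^ Suc n) * (vderiv ^^ Suc n) f (t / \<sigma>)" for t
  proof -
    have 1: "((\<lambda>t. t / \<sigma>) has_vector_derivative 1 / \<sigma>) (at t)"
      unfolding has_real_derivative_iff_has_vector_derivative[symmetric]
      by (auto intro!: derivative_eq_intros simp: \<sigma>)
    have "(((vderiv ^^ n) f \<circ> (\<lambda>t. t / \<sigma>)) has_vector_derivative (1 / \<sigma>) *\<^sub>R vderiv ((vderiv ^^ n) f) (t / \<sigma>)) (at t)"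
      by (rule vector_diff_chain_at[OF 1 schwartz_vderiv(2)[OF schwartz_vderiv_funpow[OF f]]])
    then have "((\<lambda>t. (vderiv ^^ n) f (t / \<sigma>)) has_vector_derivative (1 / \<sigma>) *\<^sub>R (vderiv ^^ Suc n) f (t / \<sigma>)) (at t)"
      by (simp add: o_def)
    from has_vector_derivative_mult_right[OF this, of "c / of_real (\<sigma> ^ n)"]
    have "((\<lambda>t. c / of_real (\<sigma> ^ n) * (vderiv ^^ n) f (t / \<sigma>)) has_vector_derivative
       c / of_real (\<sigma> ^ n) * ((1 / \<sigma>) *\<^sub>R (vderiv ^^ Suc n) f (t / \<sigma>))) (at t)" .
    from vector_derivative_at[OF this] show ?thesis
      unfolding vderiv_def[of "\<lambda>t. c / of_real (\<sigma> ^ n) * (vderiv ^^ n) f (t / \<sigma>)"]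
      by (simp add: scaleR_conv_of_real mult_ac)
  qed
  then show ?case by (simp only: funpow.simps(2) o_apply Suc fun_eq_iff) simp
qed simp

lemma l2sq_scaled_bump:
  fixes \<sigma> :: real
  assumes \<sigma>: "\<sigma> \<noteq> 0" and f: "f \<in> borel_measurable borel" and B: "\<And>t. cmod (f t) \<le> B"
    and supp: "\<And>t. t \<notin> {0<..<1} \<Longrightarrow> f t = 0"
  shows "l2sq UNIV (\<lambda>t. c * f (t / \<sigma>)) \<le> ennreal ((cmod c * B)\<^sup>2 * \<bar>\<sigma>\<bar>)"
proof -
  \<comment> \<open>\<sigma> is negative at right end points, hence the minimum and maximum.\<close>
  have sub: "{t. t / \<sigma> \<in> {0<..<1}} \<subseteq> {min 0 \<sigma>..max 0 \<sigma>}"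
    using \<sigma> by (cases "\<sigma> > 0") (auto simp: field_simps)
  have B0: "B \<ge> 0" using order_trans[OF norm_ge_zero B] .
  have "l2sq UNIV (\<lambda>t. c * f (t / \<sigma>)) = l2sq {min 0 \<sigma>..max 0 \<sigma>} (\<lambda>t. c * f (t / \<sigma>))"
  proof -
    have "f (x / \<sigma>) = 0" if "x \<notin> {min 0 \<sigma>..max 0 \<sigma>}" for x using that sub supp by blast
    then show ?thesis unfolding l2sq_def by (intro nn_integral_cong) (auto simp only: indicator_def split: if_splits, simp_all)
  qed
  also have "\<dots> \<le> ennreal ((cmod c * B)\<^sup>2 * (max 0 \<sigma> - min 0 \<sigma>))"
    by (rule l2sq_bounded) (auto simp: norm_mult intro!: mult_left_mono B)
  also have "max 0 \<sigma> - min 0 \<sigma> = \<bar>\<sigma>\<bar>" by auto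
  finally show ?thesis .
qed

text \<open>At y = u division by zero gives the value 0; the weight is used only for functions
  \<open>g\<close> with g u = 0.\<close>

definition weighted :: "(real \<Rightarrow> complex) \<Rightarrow> nat \<Rightarrow> real \<Rightarrow> real \<Rightarrow> complex" where
  "weighted g N u y = g y / of_real ((u - y) ^ N)"

text \<open>Two bounds for a piece at frequency scale \<open>\<sigma>\<close>: the plain one for low frequencies, and for high
  frequencies one with the weight \<open>(u - y)\<^sup>-\<^sup>N\<close> moved onto \<open>g\<close>, which costs \<open>N\<close> derivatives of the
  multiplier but keeps its support.\<close>

lemma piece_bounds:
  assumes \<eta>: "\<eta> \<in> schwartz" and supp: "\<And>t. t \<notin> {1/6..2/3} \<Longrightarrow> \<eta> t = 0"
  shows "\<exists>B\<ge>0. \<forall>(g :: real \<Rightarrow> complex) \<sigma> (V :: real set) u. integrable lborel g \<longrightarrow> \<sigma> \<noteq> 0 \<longrightarrow> V \<in> sets borel \<longrightarrow> (\<forall>t. t / \<sigma> \<in> {1/6..2/3} \<longrightarrow> t \<in> V) \<longrightarrow>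
    ennreal ((cmod (conv g (\<lambda>t. \<eta> (t / \<sigma>)) r u))\<^sup>2) \<le> ennreal (B * \<bar>\<sigma>\<bar> ^ (2 * r + 1)) * l2sq V (fourier g) \<and>
    (integrable lborel (weighted g (r + 2) u) \<longrightarrow> g u = 0 \<longrightarrow>
     ennreal ((cmod (conv g (\<lambda>t. \<eta> (t / \<sigma>)) r u))\<^sup>2) \<le> ennreal (B / \<bar>\<sigma>\<bar> ^ 3) * l2sq V (fourier (weighted g (r + 2) u)))"
proof -
  \<comment> \<open>Two more than r: the differentiated multiplier has size \<sigma>^(r - N) =
    \<sigma>^(-2), so its squared L^2 norm is of order |\<sigma>|^(-3), enough decay at high
    frequencies.\<close>
  define N where "N = r + 2"
  define \<rho> where "\<rho> n = (vderiv ^^ n) (mq r \<eta>)" for n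
  have mqs: "mq r \<eta> \<in> schwartz" by (rule mq_schwartz[OF \<eta>])
  have \<rho>s: "\<rho> n \<in> schwartz" for n unfolding \<rho>_def by (rule schwartz_vderiv_funpow[OF mqs])
  have \<rho>0: "\<rho> n t = 0" if "t \<notin> {1/6..2/3}" for n t
    unfolding \<rho>_def
    by (rule vderiv_zero_on_open[of "- {1/6..2/3}"]) (use that supp in \<open>auto simp: mq_def open_Compl\<close>)
  obtain B0 where B0: "\<And>t. cmod (\<rho> 0 t) \<le> B0" using rapid_bounded[OF schwartz_rapid_continuous(1)[OF \<rho>s]] by metis
  obtain B1 where B1: "\<And>t. cmod (\<rho> N t) \<le> B1" using rapid_bounded[OF schwartz_rapid_continuous(1)[OF \<rho>s]] by metis
  have [measurable]: "\<rho> n \<in> borel_measurable borel" for n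
    by (intro borel_measurable_continuous_UNIV schwartz_rapid_continuous \<rho>s)
  have "B0 \<ge> 0" "B1 \<ge> 0" using order_trans[OF norm_ge_zero B0] order_trans[OF norm_ge_zero B1] .
  show ?thesis
  proof (intro exI[of _ "B0\<^sup>2 + B1\<^sup>2"] conjI allI impI)
    fix g :: "real \<Rightarrow> complex" and V :: "real set" and \<sigma> u :: real
    assume g: "integrable lborel g" and \<sigma>: "\<sigma> \<noteq> 0" and V: "V \<in> sets borel" and "\<forall>t. t / \<sigma> \<in> {1/6..2/3} \<longrightarrow> t \<in> V"
    then have VI: "\<And>t. t \<notin> V \<Longrightarrow> t / \<sigma> \<notin> {1/6..2/3}" by blast
    have z: "\<rho> n (t / \<sigma>) = 0" if "t \<notin> V" for n t by (rule \<rho>0[OF VI[OF that]])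
    let ?\<theta> = "\<lambda>t. \<eta> (t / \<sigma>)"
    have \<theta>s: "?\<theta> \<in> schwartz" using schwartz_affine[OF \<eta> \<sigma>, of 0] by simp
    have mqe: "mq r ?\<theta> = (\<lambda>t. of_real (\<sigma> ^ r) * \<rho> 0 (t / \<sigma>))"
      using \<sigma> by (simp add: mq_def \<rho>_def fun_eq_iff power_divide power_mult_distrib)
    have \<Phi>s: "mq r ?\<theta> \<in> schwartz" by (rule mq_schwartz[OF \<theta>s])
    have "ennreal ((cmod (conv g ?\<theta> r u))\<^sup>2) \<le> l2sq V (fourier g) * l2sq UNIV (mq r ?\<theta>)"
      unfolding conv_def
      by (rule inv_fourier_product_bound[OF g schwartz_integrable[OF \<Phi>s] V]) (simp add: mqe z)
    also have "l2sq UNIV (mq r ?\<theta>) \<le> ennreal ((cmod (of_real (\<sigma> ^ r)) * B0)\<^sup>2 * \<bar>\<sigma>\<bar>)"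
      unfolding mqe by (rule l2sq_scaled_bump[OF \<sigma> _ B0]) (auto intro!: \<rho>0)
    also have "(cmod (of_real (\<sigma> ^ r)) * B0)\<^sup>2 * \<bar>\<sigma>\<bar> = B0\<^sup>2 * \<bar>\<sigma>\<bar> ^ (2 * r + 1)"
      by (simp add: norm_power power_mult_distrib power_even_eq mult_ac power_abs flip: power_mult)
    also have "ennreal (B0\<^sup>2 * \<bar>\<sigma>\<bar> ^ (2 * r + 1)) \<le> ennreal ((B0\<^sup>2 + B1\<^sup>2) * \<bar>\<sigma>\<bar> ^ (2 * r + 1))"
      by (intro ennreal_leI mult_right_mono) auto
    finally show "ennreal ((cmod (conv g ?\<theta> r u))\<^sup>2) \<le> ennreal ((B0\<^sup>2 + B1\<^sup>2) * \<bar>\<sigma>\<bar> ^ (2 * r + 1)) * l2sq V (fourier g)"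
      by (simp add: mult.commute mult_left_mono mult_right_mono)
    assume gu: "integrable lborel (weighted g (r + 2) u)" and gz: "g u = 0"
    define K where "K = inv_fourier (mq r ?\<theta>)"
    define \<Phi> where "\<Phi> = (vderiv ^^ N) (mq r ?\<theta>)"
    have \<Phi>e: "\<Phi> = (\<lambda>t. of_real (\<sigma> ^ r) / of_real (\<sigma> ^ N) * \<rho> N (t / \<sigma>))"
      unfolding \<Phi>_def mqe by (subst vderiv_scale[OF \<rho>s \<sigma>]) (simp add: \<rho>_def)
    have \<Phi>ss: "\<Phi> \<in> schwartz" unfolding \<Phi>_def by (rule schwartz_vderiv_funpow[OF \<Phi>s])
    define k where "k = 1 / (- (2 * pi) * \<i>) ^ N"
    have "g y * K (u - y) = k * (weighted g N u y * inv_fourier \<Phi> (u - y))" for y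
    proof (cases "u = y")
      case False
      then have nz: "complex_of_real ((u - y) ^ N) \<noteq> 0" by simp
      have "inv_fourier \<Phi> (u - y) = (- (2 * pi * (u - y)) * \<i>) ^ N * K (u - y)"
        unfolding \<Phi>_def K_def by (rule inv_fourier_vderiv_funpow[OF \<Phi>s])
      also have "(- (2 * pi * (u - y)) * \<i>) ^ N = (- (2 * pi) * \<i>) ^ N * of_real ((u - y) ^ N)"
        by (simp flip: power_mult_distrib add: mult_ac)
      finally have e: "inv_fourier \<Phi> (u - y) = (- (2 * pi) * \<i>) ^ N * of_real ((u - y) ^ N) * K (u - y)" .
      have alg: "v * K' = 1 / c * (v / d * (c * d * K'))" if "c \<noteq> 0" "d \<noteq> 0" for c d v K' :: complex
        using that by simp
      show ?thesis unfolding e weighted_def k_def by (rule alg[OF _ nz]) simp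
    qed (use gz in \<open>simp add: weighted_def\<close>)
    then have "conv g ?\<theta> r u = k * (LINT y|lborel. weighted g N u y * inv_fourier \<Phi> (u - y))"
      unfolding conv_def K_def[symmetric] by simp
    moreover have "cmod k \<le> 1"
    proof -
      have "1 \<le> (2 * pi) ^ N" using pi_gt3 by (intro one_le_power) linarith
      then show ?thesis unfolding k_def by (simp add: norm_divide norm_power norm_mult)
    qed
    ultimately have "cmod (conv g ?\<theta> r u) \<le> cmod (LINT y|lborel. weighted g N u y * inv_fourier \<Phi> (u - y))"
      by (simp add: norm_mult mult_left_le_one_le)
    then have "ennreal ((cmod (conv g ?\<theta> r u))\<^sup>2) \<le> ennreal ((cmod (LINT y|lborel. weighted g N u y * inv_fourier \<Phi> (u - y)))\<^sup>2)"
      by (intro ennreal_leI power_mono) auto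
    also have "\<dots> \<le> l2sq V (fourier (weighted g N u)) * l2sq UNIV \<Phi>"
      by (rule inv_fourier_product_bound[OF _ schwartz_integrable[OF \<Phi>ss] V])
        (use gu in \<open>simp add: N_def\<close>, simp add: \<Phi>e z)
    also have "l2sq UNIV \<Phi> \<le> ennreal ((cmod (of_real (\<sigma> ^ r) / of_real (\<sigma> ^ N)) * B1)\<^sup>2 * \<bar>\<sigma>\<bar>)"
      unfolding \<Phi>e by (rule l2sq_scaled_bump[OF \<sigma> _ B1]) (auto intro!: \<rho>0)
    also have "(cmod (of_real (\<sigma> ^ r) / of_real (\<sigma> ^ N)) * B1)\<^sup>2 * \<bar>\<sigma>\<bar> = B1\<^sup>2 / \<bar>\<sigma>\<bar> ^ 3"
    proof -
      have "\<sigma> ^ r / \<sigma> ^ N = 1 / \<sigma>\<^sup>2" using \<sigma> by (simp add: N_def power_add power2_eq_square)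
      then have "cmod (of_real (\<sigma> ^ r) / of_real (\<sigma> ^ N)) = 1 / \<bar>\<sigma>\<bar>\<^sup>2"
        by (metis norm_of_real of_real_divide abs_divide abs_one power_abs)
      moreover have "(1 / x\<^sup>2 * B1)\<^sup>2 * x = B1\<^sup>2 / x ^ 3" if "x \<noteq> 0" for x :: real
        using that by (simp add: field_simps eval_nat_numeral)
      ultimately show ?thesis using \<sigma> by (simp only: abs_eq_0 simp_thms)
    qed
    also have "ennreal (B1\<^sup>2 / \<bar>\<sigma>\<bar> ^ 3) \<le> ennreal ((B0\<^sup>2 + B1\<^sup>2) / \<bar>\<sigma>\<bar> ^ 3)"
      by (intro ennreal_leI divide_right_mono) auto
    finally show "ennreal ((cmod (conv g ?\<theta> r u))\<^sup>2) \<le> ennreal ((B0\<^sup>2 + B1\<^sup>2) / \<bar>\<sigma>\<bar> ^ 3) * l2sq V (fourier (weighted g (r + 2) u))"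
      unfolding N_def by (simp add: mult.commute mult_left_mono mult_right_mono)
  qed simp
qed

section \<open>Summation over dyadic pieces and shells\<close>

text \<open>Here z stands for frequency scale times distance. The factors z^(2 r + 1) for z \<le> 1
  and z^(-3) for z > 1, which come from the two piece bounds, are at most the square of this
  function when r \<ge> 1.\<close>

definition omega :: "real \<Rightarrow> real" where "omega z = min z (1 / z)"

text \<open>The right-hand side is shaped to close the induction that splits off j = 0 and halves y:
  the bound 2 y is geometric, and the term -1 / y absorbs omega y in the regime y > 1.\<close>

lemma omega_sum:
  assumes "y > 0"
  shows "(\<Sum>j<n. omega (y / 2 ^ j)) \<le> (if y \<le> 1 then 2 * y else 4 - 1 / y)"
  using assms
proof (induction n arbitrary: y)
  case 0
  then show ?case by (auto simp: divide_le_eq)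
next
  case (Suc n)
  have "(\<Sum>j<Suc n. omega (y / 2 ^ j)) = omega y + (\<Sum>j<n. omega ((y / 2) / 2 ^ j))"
    unfolding sum.lessThan_Suc_shift by simp
  also have "\<dots> \<le> omega y + (if y / 2 \<le> 1 then 2 * (y / 2) else 4 - 1 / (y / 2))"
    using Suc.IH[of "y / 2"] Suc.prems by simp
  also have "\<dots> \<le> (if y \<le> 1 then 2 * y else 4 - 1 / y)"
  proof -
    consider "y \<le> 1" | "1 < y" "y \<le> 2" | "2 < y" by linarith
    then show ?thesis
    proof cases
      case 2
      then have "1 / y \<le> 1" by simp
      moreover have "omega y \<le> 1 / y" by (simp add: omega_def)
      ultimately have "omega y + y \<le> 4 - 1 / y" using 2 by linarith
      then show ?thesis using 2 by simp
    next
      case 3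
      have "omega y \<le> 1 / y" by (simp add: omega_def)
      then show ?thesis using 3 by simp
    qed (auto simp: omega_def)
  qed
  finally show ?case .
qed

lemma omega_pos: "y > 0 \<Longrightarrow> omega y > 0"
  by (simp add: omega_def)

lemma omega_suminf:
  assumes "y > 0"
  shows "(\<Sum>j. ennreal (omega (y / 2 ^ j))) \<le> 4"
proof (rule suminf_le_const)
  fix n
  have pos: "omega (y / 2 ^ j) \<ge> 0" for j using omega_pos[of "y / 2 ^ j"] assms by simp
  have "(\<Sum>j<n. omega (y / 2 ^ j)) \<le> 4"
    using omega_sum[OF assms, of n] assms by (auto split: if_splits intro: order_trans)
  then show "(\<Sum>j<n. ennreal (omega (y / 2 ^ j))) \<le> 4"
    using pos by (simp add: sum_ennreal) (metis ennreal_leI ennreal_numeral)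
qed simp

text \<open>Cauchy-Schwarz over the pairs (j, k) with weights w^k omega (z_k / 2^j). The sum over j
  of \<open>omega\<close> is at most 4 in each of the two factors, which gives 16; the sum over k of
  w^k gives 1 / (1 - w), and 1 / w^k is the price left on the shells.\<close>

lemma double_sum_bound:
  fixes a :: "nat \<Rightarrow> nat \<Rightarrow> real" and z :: "nat \<Rightarrow> real" and X :: "nat \<Rightarrow> ennreal"
  assumes a0: "\<And>j k. a j k \<ge> 0" and z: "\<And>k. z k > 0" and w: "0 < w" "w < 1" and B: "B \<ge> 0"
    and a: "\<And>j k. ennreal ((a j k)\<^sup>2) \<le> ennreal (B * (omega (z k / 2 ^ j))\<^sup>2) * X k"
  shows "(\<Sum>j. \<Sum>k. ennreal (a j k))\<^sup>2 \<le> ennreal (16 * B / (1 - w)) * (\<Sum>k. ennreal (1 / w ^ k) * X k)"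
proof -
  define om where "om j k = omega (z k / 2 ^ j)" for j k
  have om: "om j k > 0" for j k unfolding om_def using z by (intro omega_pos) simp
  have oms: "(\<Sum>j. ennreal (om j k)) \<le> 4" for k unfolding om_def by (rule omega_suminf[OF z])
  let ?v = "\<lambda>(j, k). sqrt (w ^ k * om j k)"
  let ?b = "\<lambda>(j, k). a j k / sqrt (w ^ k * om j k)"
  have wpos: "w ^ k * om j k > 0" for j k using w om by simp
  have swap: "(\<Sum>j. \<Sum>k. h j k) = (\<Sum>k. \<Sum>j. h j k)" for h :: "nat \<Rightarrow> nat \<Rightarrow> ennreal"
    using nn_integral_fst_count_space[of "\<lambda>(j, k). h j k"] nn_integral_snd_count_space[of "\<lambda>(j, k). h j k"]
    by (simp add: nn_integral_count_space_nat)
  have conv: "(\<integral>\<^sup>+p. h p \<partial>count_space UNIV) = (\<Sum>j. \<Sum>k. h (j, k))" for h :: "nat \<times> nat \<Rightarrow> ennreal"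
    using nn_integral_fst_count_space[of h] by (simp add: nn_integral_count_space_nat)
  have e: "ennreal \<bar>?v p * ?b p\<bar> = ennreal (a (fst p) (snd p))" for p
  proof (cases p)
    case (Pair j k)
    have "sqrt (w ^ k * om j k) > 0" using wpos[of k j] by (rule real_sqrt_gt_zero)
    moreover have "x * (c / x) = c" if "x > 0" for x c :: real using that by simp
    ultimately have "sqrt (w ^ k * om j k) * (a j k / sqrt (w ^ k * om j k)) = a j k" by blast
    then show ?thesis unfolding Pair prod.case using a0[of j k] by (simp only: abs_of_nonneg fst_conv snd_conv)
  qed
  have "(\<Sum>j. \<Sum>k. ennreal (a j k)) = (\<integral>\<^sup>+p. ennreal \<bar>?v p * ?b p\<bar> \<partial>count_space UNIV)"
    unfolding e conv by simp
  also have "\<dots>\<^sup>2 \<le> (\<integral>\<^sup>+p. ennreal ((?v p)\<^sup>2) \<partial>count_space UNIV) * (\<integral>\<^sup>+p. ennreal ((?b p)\<^sup>2) \<partial>count_space UNIV)"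
    by (rule Cauchy_Schwarz_nn_integral) simp_all
  also have "(\<integral>\<^sup>+p. ennreal ((?v p)\<^sup>2) \<partial>count_space UNIV) = (\<Sum>j. \<Sum>k. ennreal (w ^ k) * ennreal (om j k))"
    unfolding conv using wpos w om by (simp add: less_imp_le ennreal_mult)
  also have "\<dots> = (\<Sum>k. ennreal (w ^ k) * (\<Sum>j. ennreal (om j k)))"
    by (subst swap) simp
  also have "\<dots> \<le> (\<Sum>k. ennreal (w ^ k) * 4)"
    by (intro suminf_le mult_left_mono oms) auto
  also have "\<dots> = (\<Sum>k. ennreal (w ^ k)) * 4" by simp
  also have "(\<Sum>k. ennreal (w ^ k)) = ennreal (1 / (1 - w))"
    using w by (intro suminf_ennreal_eq geometric_sums) auto
  also have "(\<integral>\<^sup>+p. ennreal ((?b p)\<^sup>2) \<partial>count_space UNIV) \<le> (\<Sum>j. \<Sum>k. ennreal (B / w ^ k) * X k * ennreal (om j k))"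
    unfolding conv
  proof (intro suminf_le)
    fix j k
    have "ennreal ((?b (j, k))\<^sup>2) = ennreal (1 / (w ^ k * om j k)) * ennreal ((a j k)\<^sup>2)"
      using wpos[of k j] by (simp add: power_divide flip: ennreal_mult)
    also have "\<dots> \<le> ennreal (1 / (w ^ k * om j k)) * (ennreal (B * (om j k)\<^sup>2) * X k)"
      unfolding om_def by (intro mult_left_mono a) auto
    also have "\<dots> = ennreal (1 / (w ^ k * om j k) * (B * (om j k)\<^sup>2)) * X k"
    proof -
      have "ennreal p * (ennreal q * x) = ennreal (p * q) * x" if "p \<ge> 0" "q \<ge> 0" for p q x
        using that by (simp add: ennreal_mult mult.assoc)
      then show ?thesis using wpos[of k j] B by (simp only: zero_le_divide_1_iff less_imp_le zero_le_power2 mult_nonneg_nonneg)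
    qed
    also have "1 / (w ^ k * om j k) * (B * (om j k)\<^sup>2) = B / w ^ k * om j k"
      using om[of j k] w by (simp add: power2_eq_square)
    also have "ennreal (B / w ^ k * om j k) * X k = ennreal (B / w ^ k) * X k * ennreal (om j k)"
      using om[of j k] w B by (subst ennreal_mult) (simp_all add: mult_ac)
    finally show "ennreal ((?b (j, k))\<^sup>2) \<le> ennreal (B / w ^ k) * X k * ennreal (om j k)" .
  qed auto
  also have "(\<Sum>j. \<Sum>k. ennreal (B / w ^ k) * X k * ennreal (om j k)) = (\<Sum>k. ennreal (B / w ^ k) * X k * (\<Sum>j. ennreal (om j k)))"
    by (subst swap) simp
  also have "\<dots> \<le> (\<Sum>k. ennreal (B / w ^ k) * X k * 4)"
    by (intro suminf_le mult_left_mono oms) auto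
  also have "\<dots> = ennreal B * (\<Sum>k. ennreal (1 / w ^ k) * X k) * 4"
  proof -
    have "ennreal (B / w ^ k) = ennreal B * ennreal (1 / w ^ k)" for k
      using B w by (simp flip: ennreal_mult)
    then show ?thesis
      by (simp only: ennreal_suminf_multc mult.assoc[of "ennreal B"] ennreal_suminf_cmult)
  qed
  finally have "(\<Sum>j. \<Sum>k. ennreal (a j k))\<^sup>2 \<le> ennreal (1 / (1 - w)) * 4 * (ennreal B * (\<Sum>k. ennreal (1 / w ^ k) * X k) * 4)"
    by (simp add: mult_mono)
  also have "\<dots> = ennreal (16 * B / (1 - w)) * (\<Sum>k. ennreal (1 / w ^ k) * X k)"
  proof -
    have "ennreal (16 * B / (1 - w)) = ennreal (1 / (1 - w)) * 4 * (ennreal B * 4)"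
      using B w by (simp add: mult_ac flip: ennreal_mult ennreal_numeral)
    then show ?thesis by (simp add: mult_ac)
  qed
  finally show ?thesis .
qed

text \<open>The shells begin at distance 2 L, so that every point of [a, a + L] keeps distance at
  least 2^k L from the k-th one.\<close>

definition shell :: "real \<Rightarrow> real \<Rightarrow> nat \<Rightarrow> real set" where
  "shell a L k = {y. 2 ^ (k + 1) * L \<le> \<bar>y - a\<bar> \<and> \<bar>y - a\<bar> < 2 ^ (k + 2) * L}"

definition restr :: "real set \<Rightarrow> (real \<Rightarrow> complex) \<Rightarrow> real \<Rightarrow> complex" where
  "restr A g y = indicator A y * g y"

text \<open>\<kappa> is the signed length of the band, measured from the end point under
  consideration; j counts the dyadic steps towards that end point.\<close>

definition piece :: "(real \<Rightarrow> complex) \<Rightarrow> real \<Rightarrow> nat \<Rightarrow> real \<Rightarrow> complex" where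
  "piece \<eta> \<kappa> j t = \<eta> (t / (\<kappa> / 2 ^ j))"

lemma shell_measurable [measurable]: "shell a L k \<in> sets borel"
  unfolding shell_def by measurable

lemma restr_measurable [measurable (raw)]:
  assumes [measurable]: "g \<in> borel_measurable borel" "A \<in> sets borel" shows "restr A g \<in> borel_measurable borel"
  unfolding restr_def[abs_def] by measurable

lemma weighted_measurable [measurable (raw)]:
  assumes [measurable]: "g \<in> borel_measurable borel" shows "weighted g N u \<in> borel_measurable borel"
  unfolding weighted_def[abs_def] by measurable

lemma piece_schwartz: "\<eta> \<in> schwartz \<Longrightarrow> \<kappa> \<noteq> 0 \<Longrightarrow> piece \<eta> \<kappa> j \<in> schwartz"
  unfolding piece_def[abs_def] using schwartz_affine[of \<eta> "\<kappa> / 2 ^ j" 0] by simp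

lemma disjoint_family_shell:
  assumes "L > 0"
  shows "disjoint_family (shell a L)"
proof -
  have *: False if "k < k'" "y \<in> shell a L k" "y \<in> shell a L k'" for k k' y
  proof -
    have "2 ^ (k + 2) * L \<le> 2 ^ (k' + 1) * L" using that assms by (intro mult_right_mono power_increasing) auto
    moreover have "2 ^ (k' + 1) * L \<le> \<bar>y - a\<bar>" "\<bar>y - a\<bar> < 2 ^ (k + 2) * L"
      using that(2,3) by (simp_all only: shell_def mem_Collect_eq)
    ultimately show False by linarith
  qed
  show ?thesis unfolding disjoint_family_on_def
    using * by (metis disjoint_iff nat_neq_iff)
qed

lemma shell_cover:
  assumes "L > 0" "\<bar>y - a\<bar> \<ge> 2 * L"
  shows "\<exists>k. y \<in> shell a L k"
proof -
  let ?P = "\<lambda>n::nat. \<bar>y - a\<bar> < 2 ^ (n + 1) * L"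
  obtain n where "\<bar>y - a\<bar> / L < 2 ^ n" using real_arch_pow[of 2 "\<bar>y - a\<bar> / L"] by auto
  also have "(2::real) ^ n \<le> 2 ^ (n + 1)" by simp
  finally have ex: "?P n" using assms by (simp add: divide_less_eq)
  define m where "m = (LEAST n. ?P n)"
  have m: "?P m" unfolding m_def using ex by (rule LeastI)
  have "m \<noteq> 0" using m assms(2) by (intro notI) simp
  then obtain k where k: "m = Suc k" by (cases m) auto
  have "\<not> ?P k" by (rule not_less_Least) (unfold m_def[symmetric] k, simp)
  then show ?thesis using m k by (intro exI[of _ k]) (auto simp: shell_def)
qed

text \<open>By disjointness each partial sum is \<open>h\<close> cut off to finitely many of the
  sets, so \<open>cmod h\<close> itself serves as majorant.\<close>

lemma norm_integral_le_suminf: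
  fixes h :: "real \<Rightarrow> complex"
  assumes h: "integrable lborel h" and A: "\<And>k. A k \<in> sets borel" "disjoint_family A"
    and cover: "\<And>x. h x \<noteq> 0 \<Longrightarrow> \<exists>k::nat. x \<in> A k"
  shows "ennreal (cmod (LINT x|lborel. h x)) \<le> (\<Sum>k. ennreal (cmod (LINT x|lborel. indicator (A k) x * h x)))"
proof -
  let ?h = "\<lambda>n x. \<Sum>k<n. indicator (A k) x * h x"
  have i: "integrable lborel (\<lambda>x. indicator (A k) x * h x)" for k
    by (rule Bochner_Integration.integrable_bound[OF h])
      (use A h in \<open>auto simp: indicator_def norm_mult\<close>)
  have lim: "(\<lambda>n. LINT x|lborel. ?h n x) \<longlonglongrightarrow> (LINT x|lborel. h x)"
  proof (rule integral_dominated_convergence[where w = "\<lambda>x. cmod (h x)"])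
    have *: "?h n x = (if \<exists>k<n. x \<in> A k then h x else 0)" for n x
    proof (cases "\<exists>k<n. x \<in> A k")
      case True
      then obtain k where k: "k < n" "x \<in> A k" by blast
      have z: "indicator (A j) x * h x = 0" if "j \<noteq> k" for j
        using A(2) k that by (auto simp: disjoint_family_on_def indicator_def)
      have "indicator (A j) x * h x = (if j = k then h x else 0)" for j
        using k(2) z[of j] by (cases "j = k") simp_all
      then have "?h n x = h x" using k(1) by simp
      then show ?thesis using k by auto
    qed (auto intro!: sum.neutral)
    have "(\<lambda>n. ?h n x) \<longlonglongrightarrow> h x" for x
    proof (cases "h x = 0")
      case False
      then obtain k where "x \<in> A k" using cover by blast
      then have "eventually (\<lambda>n. ?h n x = h x) sequentially"
        unfolding * eventually_sequentially by (intro exI[of _ "Suc k"]) auto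
      then show ?thesis by (rule tendsto_eventually)
    qed simp
    then show "AE x in lborel. (\<lambda>n. ?h n x) \<longlonglongrightarrow> h x" by simp
    show "AE x in lborel. norm (?h n x) \<le> cmod (h x)" for n unfolding * by simp
    show "?h n \<in> borel_measurable lborel" for n using i by (intro borel_measurable_sum) auto
  qed (use h in auto)
  have bnd: "ennreal (cmod (LINT x|lborel. ?h n x)) \<le> (\<Sum>k. ennreal (cmod (LINT x|lborel. indicator (A k) x * h x)))" for n
  proof -
    have "cmod (LINT x|lborel. ?h n x) \<le> (\<Sum>k<n. cmod (LINT x|lborel. indicator (A k) x * h x))"
      unfolding Bochner_Integration.integral_sum[OF i] by (rule norm_sum)
    then have "ennreal (cmod (LINT x|lborel. ?h n x)) \<le> (\<Sum>k<n. ennreal (cmod (LINT x|lborel. indicator (A k) x * h x)))"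
      by (simp add: ennreal_leI)
    also have "\<dots> \<le> (\<Sum>k. ennreal (cmod (LINT x|lborel. indicator (A k) x * h x)))"
      by (rule sum_le_suminf) auto
    finally show ?thesis .
  qed
  have "(\<lambda>n. ennreal (cmod (LINT x|lborel. ?h n x))) \<longlonglongrightarrow> ennreal (cmod (LINT x|lborel. h x))"
    by (intro tendsto_ennrealI tendsto_norm lim)
  from LIMSEQ_le_const2[OF this exI[of _ 0]] bnd show ?thesis by blast
qed

text \<open>The powers of R normalise the two piece bounds: each becomes a constant times the square
  of \<open>omega\<close> at |\<sigma>| R, times this quantity.\<close>

definition shell_bound :: "nat \<Rightarrow> real set \<Rightarrow> (real \<Rightarrow> complex) \<Rightarrow> real \<Rightarrow> real \<Rightarrow> ennreal" where
  "shell_bound r V g R u = ennreal (1 / R ^ (2 * r + 1)) * l2sq V (fourier g)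
     + ennreal (R ^ 3) * l2sq V (fourier (weighted g (r + 2) u))"

lemma weighted_bound:
  assumes "L > 0" "u \<in> {a..a + L}"
  shows "cmod (weighted (restr (shell a L k) g) N u y) \<le> (1 / (2 ^ k * L)) ^ N * cmod (restr (shell a L k) g y)"
proof (cases "y \<in> shell a L k")
  case True
  have "L \<le> 2 ^ k * L" using assms mult_right_mono[of 1 "2 ^ k" L] by simp
  moreover have "2 ^ (k + 1) * L \<le> \<bar>y - a\<bar>" using True by (simp add: shell_def)
  moreover have "2 ^ (k + 1) * L = 2 * (2 ^ k * L)" by simp
  moreover have "a \<le> u" "u \<le> a + L" using assms by auto
  ultimately have *: "2 ^ k * L \<le> \<bar>u - y\<bar>" by linarith
  have "1 / \<bar>u - y\<bar> ^ N \<le> 1 / (2 ^ k * L) ^ N"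
  proof -
    have p: "0 < 2 ^ k * L" using assms(1) by simp
    then have "0 < \<bar>u - y\<bar>" using * by linarith
    then show ?thesis using p by (intro divide_left_mono power_mono * mult_pos_pos zero_less_power) (use assms(1) in auto)
  qed
  then have "cmod (restr (shell a L k) g y) * (1 / \<bar>u - y\<bar> ^ N) \<le> cmod (restr (shell a L k) g y) * (1 / (2 ^ k * L) ^ N)"
    by (rule mult_left_mono) simp
  then show ?thesis
    unfolding weighted_def norm_divide norm_of_real power_abs by (simp add: power_one_over mult.commute)
qed (simp add: weighted_def restr_def)

text \<open>For every pair of a scale and a shell the better of the two piece bounds is taken: the
  plain one if scale times radius is at most 1, the weighted one otherwise. \<open>V\<close>
  contains the supports of all pieces, so one frequency set serves all scales.\<close>

lemma far_series_bound:
  assumes \<eta>: "\<eta> \<in> schwartz" and supp: "\<And>t. t \<notin> {1/6..2/3} \<Longrightarrow> \<eta> t = 0" and r: "r \<ge> 1"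
  shows "\<exists>B\<ge>0. \<forall>g \<kappa> V a L w u. tempered g \<longrightarrow> (\<forall>k. integrable lborel (restr (shell a L k) g)) \<longrightarrow>
    (\<forall>y. \<bar>y - a\<bar> < 2 * L \<longrightarrow> g y = 0) \<longrightarrow> L > 0 \<longrightarrow> 0 < w \<longrightarrow> w < 1 \<longrightarrow> \<kappa> \<noteq> 0 \<longrightarrow> V \<in> sets borel \<longrightarrow>
    (\<forall>t. t / \<kappa> \<in> {0<..<1} \<longrightarrow> t \<in> V) \<longrightarrow> u \<in> {a..a + L} \<longrightarrow>
    (\<Sum>j. ennreal (cmod (conv g (piece \<eta> \<kappa> j) r u)))\<^sup>2
      \<le> ennreal (B / (1 - w)) * (\<Sum>k. ennreal (1 / w ^ k) * shell_bound r V (restr (shell a L k) g) (2 ^ (k + 1) * L) u)"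
proof -
  obtain B where B: "B \<ge> 0" and piece: "\<And>g \<sigma> V u. integrable lborel g \<Longrightarrow> \<sigma> \<noteq> 0 \<Longrightarrow> V \<in> sets borel \<Longrightarrow> (\<forall>t. t / \<sigma> \<in> {1/6..2/3} \<longrightarrow> t \<in> V) \<Longrightarrow>
    ennreal ((cmod (conv g (\<lambda>t. \<eta> (t / \<sigma>)) r u))\<^sup>2) \<le> ennreal (B * \<bar>\<sigma>\<bar> ^ (2 * r + 1)) * l2sq V (fourier g) \<and>
    (integrable lborel (weighted g (r + 2) u) \<longrightarrow> g u = 0 \<longrightarrow>
     ennreal ((cmod (conv g (\<lambda>t. \<eta> (t / \<sigma>)) r u))\<^sup>2) \<le> ennreal (B / \<bar>\<sigma>\<bar> ^ 3) * l2sq V (fourier (weighted g (r + 2) u)))"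
    using piece_bounds[OF \<eta> supp, where r = r] by blast
  show ?thesis
  proof (intro exI[of _ "16 * B"] conjI allI impI)
    fix g V and \<kappa> a L w u :: real
    assume g: "tempered g" and gk: "\<forall>k. integrable lborel (restr (shell a L k) g)"
      and far: "\<forall>y. \<bar>y - a\<bar> < 2 * L \<longrightarrow> g y = 0" and L: "L > 0" and w: "0 < w" "w < 1"
      and \<kappa>: "\<kappa> \<noteq> 0" and V: "V \<in> sets borel" "\<forall>t. t / \<kappa> \<in> {0<..<1} \<longrightarrow> t \<in> V" and u: "u \<in> {a..a + L}"
    note [measurable] = tempered_measurable[OF g]
    let ?g = "\<lambda>k. restr (shell a L k) g"
    let ?R = "\<lambda>k::nat. 2 ^ (k + 1) * L"
    define A where "A j k = cmod (conv (?g k) (piece \<eta> \<kappa> j) r u)" for j k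
    have Rpos: "?R k > 0" for k using L by simp
    have bound: "ennreal ((A j k)\<^sup>2) \<le> ennreal (B * (omega (\<bar>\<kappa>\<bar> * ?R k / 2 ^ j))\<^sup>2) * shell_bound r V (?g k) (?R k) u" for j k
    proof -
      define \<sigma> where "\<sigma> = \<kappa> / 2 ^ j"
      have \<sigma>: "\<sigma> \<noteq> 0" using \<kappa> by (simp add: \<sigma>_def)
      have sub: "\<forall>t. t / \<sigma> \<in> {1/6..2/3} \<longrightarrow> t \<in> V"
      proof (intro allI impI)
        fix t assume t: "t / \<sigma> \<in> {1/6..2/3}"
        have e: "t / \<kappa> = (t / \<sigma>) / 2 ^ j" by (simp add: \<sigma>_def)
        have "0 < t / \<sigma>" "t / \<sigma> < 1" using t unfolding atLeastAtMost_iff by linarith+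
        moreover have "x / 2 ^ j \<le> x" if "0 < x" for x :: real
          using that mult_left_mono[of 1 "2 ^ j" x] by (simp add: divide_le_eq)
        then have "(t / \<sigma>) / 2 ^ j \<le> t / \<sigma>" using \<open>0 < t / \<sigma>\<close> by blast
        moreover have "0 < (t / \<sigma>) / 2 ^ j" using \<open>0 < t / \<sigma>\<close> by (rule divide_pos_pos) simp
        ultimately have "t / \<kappa> \<in> {0<..<1}" unfolding e greaterThanLessThan_iff by linarith
        then show "t \<in> V" using V by blast
      qed
      define z where "z = \<bar>\<sigma>\<bar> * ?R k"
      have z: "z > 0" using \<sigma> Rpos[of k] by (simp add: z_def)
      have ze: "\<bar>\<kappa>\<bar> * ?R k / 2 ^ j = z" by (simp add: z_def \<sigma>_def abs_divide)
      have pe: "piece \<eta> \<kappa> j = (\<lambda>t. \<eta> (t / \<sigma>))" by (simp add: piece_def fun_eq_iff \<sigma>_def)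
      have wi: "integrable lborel (weighted (?g k) (r + 2) u)"
      proof (rule Bochner_Integration.integrable_bound)
        show "integrable lborel (\<lambda>y. (1 / (2 ^ k * L)) ^ (r + 2) * cmod (?g k y))"
          by (intro integrable_mult_right integrable_norm gk[rule_format])
        show "AE y in lborel. norm (weighted (?g k) (r + 2) u y) \<le> norm ((1 / (2 ^ k * L)) ^ (r + 2) * cmod (?g k y))"
          unfolding real_norm_def by (intro AE_I2 order_trans[OF weighted_bound[OF L u] abs_ge_self])
      qed simp
      have gu: "?g k u = 0"
      proof -
        have "\<bar>u - a\<bar> < 2 * L" using u L by auto
        then show ?thesis using far by (simp add: restr_def)
      qed
      note p = piece[OF gk[rule_format] \<sigma> V(1) sub, of k u]
      show ?thesis
      proof (cases "z \<le> 1")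
        case True
        have "ennreal ((A j k)\<^sup>2) \<le> ennreal (B * \<bar>\<sigma>\<bar> ^ (2 * r + 1)) * l2sq V (fourier (?g k))"
          unfolding A_def pe using p by blast
        also have "B * \<bar>\<sigma>\<bar> ^ (2 * r + 1) = B * z ^ (2 * r + 1) * (1 / ?R k ^ (2 * r + 1))"
          unfolding z_def power_mult_distrib using L by simp
        also have "ennreal (B * z ^ (2 * r + 1) * (1 / ?R k ^ (2 * r + 1))) \<le> ennreal (B * (omega z)\<^sup>2 * (1 / ?R k ^ (2 * r + 1)))"
        proof (intro ennreal_leI mult_right_mono mult_left_mono B)
          have "omega z = z" using True z by (simp add: omega_def min_def field_simps) (metis mult_le_one less_imp_le mult.commute)
          \<comment> \<open>Here r \<ge> 1 enters: the plain bound must decay at least quadratically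
            in z.\<close>
          moreover have "z ^ (2 * r + 1) \<le> z ^ 2" using True z r by (intro power_decreasing) auto
          ultimately show "z ^ (2 * r + 1) \<le> (omega z)\<^sup>2" by simp
        qed (use Rpos[of k] in simp)
        also have "\<dots> = ennreal (B * (omega z)\<^sup>2) * ennreal (1 / ?R k ^ (2 * r + 1))"
          using B Rpos[of k] by (intro ennreal_mult) auto
        also have "ennreal (B * (omega z)\<^sup>2) * ennreal (1 / ?R k ^ (2 * r + 1)) * l2sq V (fourier (?g k))
           \<le> ennreal (B * (omega z)\<^sup>2) * shell_bound r V (?g k) (?R k) u"
          unfolding shell_bound_def mult.assoc by (intro mult_left_mono) auto
        finally show ?thesis unfolding ze by (simp add: mult_right_mono)
      next
        case False
        have "ennreal ((A j k)\<^sup>2) \<le> ennreal (B / \<bar>\<sigma>\<bar> ^ 3) * l2sq V (fourier (weighted (?g k) (r + 2) u))"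
          unfolding A_def pe using p wi gu by blast
        also have "B / \<bar>\<sigma>\<bar> ^ 3 = B * (1 / z) ^ 3 * ?R k ^ 3"
          unfolding z_def using L \<sigma> by (simp add: power_mult_distrib power_divide)
        also have "ennreal (B * (1 / z) ^ 3 * ?R k ^ 3) \<le> ennreal (B * (omega z)\<^sup>2 * ?R k ^ 3)"
        proof (intro ennreal_leI mult_right_mono mult_left_mono B)
          have "1 / z \<le> 1" "1 \<le> z" using False by auto
          then have "omega z = 1 / z" unfolding omega_def by (intro min_absorb2) linarith
          moreover have "(1 / z) ^ 3 \<le> (1 / z) ^ 2" using False by (intro power_decreasing) auto
          ultimately show "(1 / z) ^ 3 \<le> (omega z)\<^sup>2" by simp
        qed (use Rpos[of k] in simp)
        also have "\<dots> = ennreal (B * (omega z)\<^sup>2) * ennreal (?R k ^ 3)"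
          using B Rpos[of k] by (intro ennreal_mult) auto
        also have "ennreal (B * (omega z)\<^sup>2) * ennreal (?R k ^ 3) * l2sq V (fourier (weighted (?g k) (r + 2) u))
           \<le> ennreal (B * (omega z)\<^sup>2) * shell_bound r V (?g k) (?R k) u"
          unfolding shell_bound_def mult.assoc by (intro mult_left_mono) auto
        finally show ?thesis unfolding ze by (simp add: mult_right_mono)
      qed
    qed
    have "ennreal (cmod (conv g (piece \<eta> \<kappa> j) r u)) \<le> (\<Sum>k. ennreal (A j k))" for j
    proof -
      have "ennreal (cmod (conv g (piece \<eta> \<kappa> j) r u)) \<le> (\<Sum>k. ennreal (cmod (LINT y|lborel. indicator (shell a L k) y * (g y * inv_fourier (mq r (piece \<eta> \<kappa> j)) (u - y)))))"
        unfolding conv_def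
      proof (rule norm_integral_le_suminf)
        show "integrable lborel (\<lambda>y. g y * inv_fourier (mq r (piece \<eta> \<kappa> j)) (u - y))"
          by (intro conv_integrable g piece_schwartz \<eta> \<kappa>)
        show "\<exists>k. y \<in> shell a L k" if "g y * inv_fourier (mq r (piece \<eta> \<kappa> j)) (u - y) \<noteq> 0" for y
        proof (rule shell_cover[OF L])
          show "2 * L \<le> \<bar>y - a\<bar>" using that far by (metis mult_zero_left not_le)
        qed
      qed (auto intro: disjoint_family_shell L)
      then show ?thesis unfolding A_def conv_def restr_def by (simp add: mult.assoc)
    qed
    then have "(\<Sum>j. ennreal (cmod (conv g (piece \<eta> \<kappa> j) r u))) \<le> (\<Sum>j. \<Sum>k. ennreal (A j k))"
      by (intro suminf_le) auto
    then have "(\<Sum>j. ennreal (cmod (conv g (piece \<eta> \<kappa> j) r u)))\<^sup>2 \<le> (\<Sum>j. \<Sum>k. ennreal (A j k))\<^sup>2"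
      by (rule power_mono) simp
    also have "\<dots> \<le> ennreal (16 * B / (1 - w)) * (\<Sum>k. ennreal (1 / w ^ k) * shell_bound r V (?g k) (?R k) u)"
      by (rule double_sum_bound[OF _ _ w B bound]) (use \<kappa> Rpos in \<open>auto simp: A_def\<close>)
    finally show "(\<Sum>j. ennreal (cmod (conv g (piece \<eta> \<kappa> j) r u)))\<^sup>2
      \<le> ennreal (16 * B / (1 - w)) * (\<Sum>k. ennreal (1 / w ^ k) * shell_bound r V (?g k) (?R k) u)" .
  qed (use B in simp)
qed

lemma nn_integral_square_le:
  assumes [measurable]: "S \<in> borel_measurable borel" and ab: "a \<le> b"
  shows "(\<integral>\<^sup>+u\<in>{a..b}. S u \<partial>lborel)\<^sup>2 \<le> ennreal (b - a) * (\<integral>\<^sup>+u\<in>{a..b}. (S u)\<^sup>2 \<partial>lborel)"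
proof (cases "(\<integral>\<^sup>+u\<in>{a..b}. (S u)\<^sup>2 \<partial>lborel) = \<infinity>")
  case True
  show ?thesis
  proof (cases "a = b")
    case True
    have "AE u in lborel. S u * indicator {b..b} u = 0"
      using AE_lborel_singleton[of b] by eventually_elim auto
    then have "(\<integral>\<^sup>+u\<in>{a..b}. S u \<partial>lborel) = 0" unfolding True by (subst nn_integral_0_iff_AE) auto
    then show ?thesis by simp
  next
    case False
    then show ?thesis using True ab by (simp add: ennreal_mult_top)
  qed
next
  case False
  then have fin: "AE u in lborel. (S u)\<^sup>2 * indicator {a..b} u \<noteq> \<infinity>"
    by (intro nn_integral_PInf_AE) auto
  define T where "T u = enn2real (S u) * indicator {a..b} u" for u
  have [measurable]: "T \<in> borel_measurable borel" unfolding T_def by measurable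
  have ST: "AE u in lborel. S u * indicator {a..b} u = ennreal \<bar>indicator {a..b} u * T u\<bar>"
    using fin
  proof eventually_elim
    case (elim u)
    show ?case
    proof (cases "u \<in> {a..b}")
      case True
      then have "S u < \<infinity>" using elim by (auto simp: power2_eq_square less_top ennreal_mult_eq_top_iff)
      then show ?thesis using True by (simp add: T_def)
    qed simp
  qed
  have ST2: "AE u in lborel. (S u)\<^sup>2 * indicator {a..b} u = ennreal ((T u)\<^sup>2)"
    using fin
  proof eventually_elim
    case (elim u)
    show ?case
    proof (cases "u \<in> {a..b}")
      case True
      then have "S u < \<infinity>" using elim by (auto simp: power2_eq_square less_top ennreal_mult_eq_top_iff)
      then show ?thesis using True by (simp add: T_def ennreal_power[symmetric])
    qed (simp add: T_def)
  qed
  have "(\<integral>\<^sup>+u\<in>{a..b}. S u \<partial>lborel)\<^sup>2 = (\<integral>\<^sup>+u. ennreal \<bar>indicator {a..b} u * T u\<bar> \<partial>lborel)\<^sup>2"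
    using nn_integral_cong_AE[OF ST] by simp
  also have "\<dots> \<le> (\<integral>\<^sup>+u. ennreal ((indicator {a..b} u)\<^sup>2) \<partial>lborel) * (\<integral>\<^sup>+u. ennreal ((T u)\<^sup>2) \<partial>lborel)"
    by (rule Cauchy_Schwarz_nn_integral) measurable
  also have "(\<integral>\<^sup>+u. ennreal ((indicator {a..b} u)\<^sup>2) \<partial>lborel) = (\<integral>\<^sup>+u. indicator {a..b} u \<partial>lborel)"
    by (intro nn_integral_cong) (auto simp: indicator_def)
  also have "\<dots> = ennreal (b - a)" using ab by simp
  also have "(\<integral>\<^sup>+u. ennreal ((T u)\<^sup>2) \<partial>lborel) = (\<integral>\<^sup>+u\<in>{a..b}. (S u)\<^sup>2 \<partial>lborel)"
    by (rule nn_integral_cong_AE[OF ST2, symmetric])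
  finally show ?thesis .
qed

text \<open>The sum over the pieces goes under the integral in u, and Cauchy-Schwarz in u
  contributes a factor L: (L^(r - 1))^2 L = L^(2 r - 1).\<close>

lemma remainder_series_bound:
  assumes g: "tempered g" and \<theta>: "\<And>j. \<theta> j \<in> schwartz" and r: "r \<ge> 1" and L: "L > 0"
    and Y: "\<And>u. u \<in> {a..a + L} \<Longrightarrow> (\<Sum>j. ennreal (cmod (conv g (\<theta> j) r u)))\<^sup>2 \<le> Y u"
    and x: "x \<in> {a..a + L}"
  shows "(\<Sum>j. ennreal (cmod (conv g (\<theta> j) 0 x - pol (taylor g (\<theta> j) r a) x)))\<^sup>2
    \<le> ennreal (L ^ (2 * r - 1)) * (\<integral>\<^sup>+u\<in>{a..a + L}. Y u \<partial>lborel)"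
proof -
  have [measurable]: "conv g (\<theta> j) r \<in> borel_measurable borel" for j
    by (intro borel_measurable_continuous_onI conv_continuous g \<theta>)
  let ?S = "\<lambda>u. \<Sum>j. ennreal (cmod (conv g (\<theta> j) r u))"
  have "(\<Sum>j. ennreal (cmod (conv g (\<theta> j) 0 x - pol (taylor g (\<theta> j) r a) x)))
     \<le> (\<Sum>j. ennreal (L ^ (r - 1)) * (\<integral>\<^sup>+u\<in>{a..a + L}. ennreal (cmod (conv g (\<theta> j) r u)) \<partial>lborel))"
    using taylor_remainder[OF g \<theta> r x] by (intro suminf_le) auto
  also have "\<dots> = ennreal (L ^ (r - 1)) * (\<integral>\<^sup>+u\<in>{a..a + L}. ?S u \<partial>lborel)"
  proof -
    have "(\<Sum>j. \<integral>\<^sup>+u\<in>{a..a + L}. ennreal (cmod (conv g (\<theta> j) r u)) \<partial>lborel)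
       = (\<integral>\<^sup>+u. (\<Sum>j. ennreal (cmod (conv g (\<theta> j) r u)) * indicator {a..a + L} u) \<partial>lborel)"
      by (rule nn_integral_suminf[symmetric]) measurable
    then show ?thesis by (simp only: ennreal_suminf_cmult ennreal_suminf_multc)
  qed
  finally have "(\<Sum>j. ennreal (cmod (conv g (\<theta> j) 0 x - pol (taylor g (\<theta> j) r a) x)))\<^sup>2
      \<le> (ennreal (L ^ (r - 1)) * (\<integral>\<^sup>+u\<in>{a..a + L}. ?S u \<partial>lborel))\<^sup>2"
    by (rule power_mono) simp
  also have "\<dots> = ennreal ((L ^ (r - 1))\<^sup>2) * (\<integral>\<^sup>+u\<in>{a..a + L}. ?S u \<partial>lborel)\<^sup>2"
    using L by (simp add: power_mult_distrib ennreal_power)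
  also have "\<dots> \<le> ennreal ((L ^ (r - 1))\<^sup>2) * (ennreal (a + L - a) * (\<integral>\<^sup>+u\<in>{a..a + L}. (?S u)\<^sup>2 \<partial>lborel))"
    using L by (intro mult_left_mono nn_integral_square_le) auto
  also have "\<dots> \<le> ennreal ((L ^ (r - 1))\<^sup>2) * (ennreal (a + L - a) * (\<integral>\<^sup>+u\<in>{a..a + L}. Y u \<partial>lborel))"
  proof -
    have "(?S u)\<^sup>2 * indicator {a..a + L} u \<le> Y u * indicator {a..a + L} u" for u
    proof (cases "u \<in> {a..a + L}")
      case True
      then show ?thesis using Y[OF True] by (simp only: indicator_simps mult_1_right)
    next
      case False
      show ?thesis unfolding indicator_simps(2)[OF False] mult_zero_right by (rule order_refl)
    qed
    then show ?thesis by (intro mult_left_mono nn_integral_mono zero_le)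
  qed
  also have "\<dots> = ennreal (L ^ (2 * r - 1)) * (\<integral>\<^sup>+u\<in>{a..a + L}. Y u \<partial>lborel)"
  proof -
    have "2 * r - 1 = Suc ((r - 1) * 2)" using r by simp
    then have e: "L ^ (2 * r - 1) = (L ^ (r - 1))\<^sup>2 * L"
      by (simp only: power_Suc power_mult mult.commute)
    show ?thesis unfolding e using L by (subst ennreal_mult) (simp_all add: mult.assoc)
  qed
  finally show ?thesis .
qed

lemma conv_sum:
  assumes g: "tempered g" and \<theta>: "\<And>j. \<theta> j \<in> schwartz"
  shows "(\<Sum>j<n. conv g (\<theta> j) q x) = conv g (\<lambda>t. \<Sum>j<n. \<theta> j t) q x"
proof -
  have "inv_fourier (mq q (\<lambda>t. \<Sum>j<n. \<theta> j t)) z = (\<Sum>j<n. inv_fourier (mq q (\<theta> j)) z)" for z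
  proof -
    have "integrable lborel (\<lambda>\<xi>. mq q (\<theta> j) \<xi> * cis (2 * pi * z * \<xi>))" for j
      by (rule integrable_mult_cis[OF schwartz_integrable[OF mq_schwartz[OF \<theta>]]]) simp
    then show ?thesis
      unfolding inv_fourier_def by (simp add: mq_def sum_distrib_left sum_distrib_right)
  qed
  then show ?thesis
    unfolding conv_def using conv_integrable[OF g \<theta>] by (simp add: sum_distrib_left)
qed

text \<open>The j-th multiplier has L^1 norm proportional to 2^(-j). The bound depends on
  \<open>g\<close> and \<kappa> and is purely qualitative: it provides pointwise convergence, while
  the estimates come from \<open>near_l2_bound\<close>.\<close>

lemma near_sup_bound:
  assumes \<eta>: "\<eta> \<in> schwartz" and supp: "\<And>t. t \<notin> {1/6..2/3} \<Longrightarrow> \<eta> t = 0"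
    and g: "integrable lborel g" and \<kappa>: "\<kappa> \<noteq> 0"
  shows "\<exists>B. \<forall>x. (\<Sum>j. ennreal (cmod (conv g (piece \<eta> \<kappa> j) 0 x))) \<le> ennreal B"
proof -
  obtain C where C: "C > 0" "\<And>t. cmod (\<eta> t) \<le> C"
    using rapid_bounded[OF schwartz_rapid_continuous(1)[OF \<eta>]] by blast
  let ?G = "LINT y|lborel. cmod (g y)"
  let ?N = "\<lambda>j. LINT t|lborel. cmod (piece \<eta> \<kappa> j t)"
  have s: "piece \<eta> \<kappa> j \<in> schwartz" for j by (rule piece_schwartz[OF \<eta> \<kappa>])
  have N: "?N j = (LINT t|lborel. cmod (\<eta> t)) * \<bar>\<kappa>\<bar> * (1 / 2) ^ j" for j
  proof -
    have "?N j = \<bar>\<kappa> / 2 ^ j\<bar> *\<^sub>R (LINT t|lborel. cmod (piece \<eta> \<kappa> j (0 + \<kappa> / 2 ^ j * t)))"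
      by (rule lborel_integral_real_affine) (use \<kappa> in simp)
    also have "(\<lambda>t. cmod (piece \<eta> \<kappa> j (0 + \<kappa> / 2 ^ j * t))) = (\<lambda>t. cmod (\<eta> t))"
      using \<kappa> by (simp add: piece_def fun_eq_iff)
    finally show ?thesis by (simp add: power_one_over abs_divide)
  qed
  have "cmod (conv g (piece \<eta> \<kappa> j) 0 x) \<le> ?G * ?N j" for j x
  proof -
    have K: "cmod (inv_fourier (mq 0 (piece \<eta> \<kappa> j)) z) \<le> ?N j" for z
      using inv_fourier_bound[OF schwartz_rapid_continuous[OF s[of j]], of z] by (simp add: mq_def[abs_def])
    have "cmod (conv g (piece \<eta> \<kappa> j) 0 x) \<le> (LINT y|lborel. cmod (g y) * ?N j)"
      unfolding conv_def
    proof (rule Bochner_Integration.integral_norm_bound_integral)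
      have m: "inv_fourier (mq 0 (piece \<eta> \<kappa> j)) \<in> borel_measurable borel"
        by (intro borel_measurable_continuous_UNIV mq_kernel s)
      show i: "integrable lborel (\<lambda>y. cmod (g y) * ?N j)" using g by simp
      show "norm (g y * inv_fourier (mq 0 (piece \<eta> \<kappa> j)) (x - y)) \<le> cmod (g y) * ?N j" for y
        unfolding norm_mult by (intro mult_left_mono K) simp
      then show "integrable lborel (\<lambda>y. g y * inv_fourier (mq 0 (piece \<eta> \<kappa> j)) (x - y))"
        using g m by (intro Bochner_Integration.integrable_bound[OF i]) (auto intro!: AE_I2 order_trans[OF _ abs_ge_self])
    qed
    then show ?thesis by simp
  qed
  then have *: "(\<Sum>j. ennreal (cmod (conv g (piece \<eta> \<kappa> j) 0 x))) \<le> (\<Sum>j. ennreal (?G * ((LINT t|lborel. cmod (\<eta> t)) * \<bar>\<kappa>\<bar> * (1 / 2) ^ j)))" for x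
    unfolding N by (intro suminf_le ennreal_leI) auto
  have "(\<Sum>j. ennreal (?G * ((LINT t|lborel. cmod (\<eta> t)) * \<bar>\<kappa>\<bar> * (1 / 2) ^ j))) = ennreal (?G * ((LINT t|lborel. cmod (\<eta> t)) * \<bar>\<kappa>\<bar> * (1 / (1 - 1 / 2))))"
    by (intro suminf_ennreal_eq sums_mult geometric_sums mult_nonneg_nonneg Bochner_Integration.integral_nonneg) auto
  with * show ?thesis by metis
qed

text \<open>The pieces are added before Plancherel is applied, since the partial sums of the
  multipliers are bounded uniformly in n.\<close>

lemma near_l2_bound:
  assumes \<theta>: "\<And>j. \<theta> j \<in> schwartz" and g: "tempered g" "integrable lborel g"
    and V: "V \<in> sets borel" "\<And>j t. t \<notin> V \<Longrightarrow> \<theta> j t = 0" and B: "\<And>t. cmod (\<Sum>j<n. \<theta> j t) \<le> B"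
  shows "l2sq UNIV (\<lambda>x. \<Sum>j<n. conv g (\<theta> j) 0 x) \<le> ennreal (B\<^sup>2) * l2sq V (fourier g)"
proof -
  let ?\<Theta> = "\<lambda>t. \<Sum>j<n. \<theta> j t"
  have s: "?\<Theta> \<in> schwartz" by (intro schwartz_sum \<theta>)
  have "(\<lambda>x. \<Sum>j<n. conv g (\<theta> j) 0 x) = (\<lambda>u. LINT y|lborel. g y * inv_fourier ?\<Theta> (u - y))"
    unfolding conv_sum[OF g(1) \<theta>] by (simp add: conv_def[abs_def] mq_def[abs_def])
  then show ?thesis
    using inv_fourier_product_l2_bound[OF g(2) schwartz_integrable[OF s] V(1) _ B] V(2) by simp
qed

section \<open>Growth and integrability\<close>

lemma tempered_mono:
  assumes "g \<in> borel_measurable borel" "integrable lborel (\<lambda>y. cmod (g y) / (1 + \<bar>y\<bar>) ^ N)" "N \<le> N'"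
  shows "integrable lborel (\<lambda>y. cmod (g y) / (1 + \<bar>y\<bar>) ^ N')"
proof (rule Bochner_Integration.integrable_bound[OF assms(2)])
  have "cmod (g y) / (1 + \<bar>y\<bar>) ^ N' \<le> cmod (g y) / (1 + \<bar>y\<bar>) ^ N" for y
    using assms(3) by (intro divide_left_mono power_increasing mult_pos_pos zero_less_power) auto
  then show "AE y in lborel. norm (cmod (g y) / (1 + \<bar>y\<bar>) ^ N') \<le> norm (cmod (g y) / (1 + \<bar>y\<bar>) ^ N)"
    by (intro AE_I2) simp
qed (use assms(1) in simp)

lemma tempered_add:
  assumes f: "tempered f" and g: "tempered g"
  shows "tempered (\<lambda>y. f y + g y)"
proof -
  note [measurable] = tempered_measurable[OF f] tempered_measurable[OF g]
  obtain N N' where N: "integrable lborel (\<lambda>y. cmod (f y) / (1 + \<bar>y\<bar>) ^ N)" "integrable lborel (\<lambda>y. cmod (g y) / (1 + \<bar>y\<bar>) ^ N')"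
    using f g by (auto simp: tempered_def)
  let ?M = "max N N'"
  have i: "integrable lborel (\<lambda>y. cmod (f y) / (1 + \<bar>y\<bar>) ^ ?M + cmod (g y) / (1 + \<bar>y\<bar>) ^ ?M)"
    by (intro Bochner_Integration.integrable_add tempered_mono[OF _ N(1)] tempered_mono[OF _ N(2)]) auto
  have "integrable lborel (\<lambda>y. cmod (f y + g y) / (1 + \<bar>y\<bar>) ^ ?M)"
  proof (rule Bochner_Integration.integrable_bound[OF i])
    have "cmod (f y + g y) / (1 + \<bar>y\<bar>) ^ ?M \<le> cmod (f y) / (1 + \<bar>y\<bar>) ^ ?M + cmod (g y) / (1 + \<bar>y\<bar>) ^ ?M" for y
      unfolding add_divide_distrib[symmetric] by (intro divide_right_mono norm_triangle_ineq) simp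
    then show "AE y in lborel. norm (cmod (f y + g y) / (1 + \<bar>y\<bar>) ^ ?M) \<le> norm (cmod (f y) / (1 + \<bar>y\<bar>) ^ ?M + cmod (g y) / (1 + \<bar>y\<bar>) ^ ?M)"
      by (intro AE_I2) simp
  qed simp
  then show ?thesis unfolding tempered_def by auto
qed

lemma tempered_pol: "tempered (pol p)"
proof -
  define d where "d = degree p"
  define C where "C = (\<Sum>k\<le>d. cmod (coeff p k))"
  have bound: "cmod (pol p y) \<le> C * (1 + \<bar>y\<bar>) ^ d" for y
  proof -
    have "cmod (pol p y) \<le> (\<Sum>k\<le>d. cmod (coeff p k * of_real y ^ k))"
      unfolding poly_altdef d_def by (rule norm_sum)
    also have "\<dots> \<le> (\<Sum>k\<le>d. cmod (coeff p k) * (1 + \<bar>y\<bar>) ^ d)"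
    proof (rule sum_mono)
      fix k assume k: "k \<in> {..d}"
      have "\<bar>y\<bar> ^ k \<le> (1 + \<bar>y\<bar>) ^ k" by (intro power_mono) auto
      also have "\<dots> \<le> (1 + \<bar>y\<bar>) ^ d" using k by (intro power_increasing) auto
      finally show "cmod (coeff p k * of_real y ^ k) \<le> cmod (coeff p k) * (1 + \<bar>y\<bar>) ^ d"
        by (simp add: norm_mult norm_power mult_left_mono)
    qed
    finally show ?thesis by (simp add: C_def sum_distrib_right)
  qed
  have "integrable lborel (\<lambda>y. cmod (pol p y) / (1 + \<bar>y\<bar>) ^ (d + 2))"
  proof (rule Bochner_Integration.integrable_bound)
    show "integrable lborel (\<lambda>y::real. C * (1 / (1 + \<bar>y\<bar>)\<^sup>2))"
      by (intro integrable_mult_right integrable_weight)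
    have "cmod (pol p y) / (1 + \<bar>y\<bar>) ^ (d + 2) \<le> C * (1 / (1 + \<bar>y\<bar>)\<^sup>2)" for y
    proof -
      have "cmod (pol p y) / (1 + \<bar>y\<bar>) ^ (d + 2) \<le> C * (1 + \<bar>y\<bar>) ^ d / (1 + \<bar>y\<bar>) ^ (d + 2)"
        by (intro divide_right_mono bound) simp
      also have "\<dots> = C * (1 / (1 + \<bar>y\<bar>)\<^sup>2)"
      proof -
        have "x ^ d / x ^ (d + 2) = 1 / x\<^sup>2" if "x > 0" for x :: real
          using that by (simp add: power_add power2_eq_square)
        from this[of "1 + \<bar>y\<bar>"] show ?thesis by (simp only: times_divide_eq_right[symmetric] add_pos_nonneg zero_less_one abs_ge_zero)
      qed
      finally show ?thesis .
    qed
    then show "AE y in lborel. norm (cmod (pol p y) / (1 + \<bar>y\<bar>) ^ (d + 2)) \<le> norm (C * (1 / (1 + \<bar>y\<bar>)\<^sup>2))"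
      unfolding real_norm_def by (intro AE_I2, subst abs_of_nonneg, simp) (rule order_trans[OF _ abs_ge_self])
  qed simp
  moreover have "pol p \<in> borel_measurable borel" by measurable
  ultimately show ?thesis unfolding tempered_def by blast
qed

lemma tempered_integrable_restr:
  assumes g: "tempered g" and A: "A \<in> sets borel" "\<And>y. y \<in> A \<Longrightarrow> \<bar>y\<bar> \<le> R"
  shows "integrable lborel (restr A g)"
proof -
  note [measurable] = tempered_measurable[OF g] A(1)
  obtain N where N: "integrable lborel (\<lambda>y. cmod (g y) / (1 + \<bar>y\<bar>) ^ N)"
    using g by (auto simp: tempered_def)
  show ?thesis
  proof (rule Bochner_Integration.integrable_bound)
    show "integrable lborel (\<lambda>y. (1 + R) ^ N * (cmod (g y) / (1 + \<bar>y\<bar>) ^ N))" by (intro integrable_mult_right N)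
    have "norm (restr A g y) \<le> (1 + R) ^ N * (cmod (g y) / (1 + \<bar>y\<bar>) ^ N)" if "y \<in> A" for y
    proof -
      have "(1 + \<bar>y\<bar>) ^ N \<le> (1 + R) ^ N" using A(2)[OF that] by (intro power_mono) auto
      then have "cmod (g y) * (1 + \<bar>y\<bar>) ^ N \<le> cmod (g y) * (1 + R) ^ N" by (rule mult_left_mono) simp
      moreover have "0 < (1 + \<bar>y\<bar>) ^ N" by (intro zero_less_power) linarith
      ultimately have "cmod (g y) \<le> cmod (g y) * (1 + R) ^ N / (1 + \<bar>y\<bar>) ^ N" by (simp only: le_divide_eq if_True)
      then show ?thesis using that by (simp add: restr_def mult.commute)
    qed
    then have "norm (restr A g y) \<le> norm ((1 + R) ^ N * (cmod (g y) / (1 + \<bar>y\<bar>) ^ N))" for y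
    proof (cases "y \<in> A")
      case True
      with \<open>\<And>y. y \<in> A \<Longrightarrow> norm (restr A g y) \<le> (1 + R) ^ N * (cmod (g y) / (1 + \<bar>y\<bar>) ^ N)\<close>
      show ?thesis unfolding real_norm_def by (intro order_trans[OF _ abs_ge_self])
    qed (simp add: restr_def)
    then show "AE y in lborel. norm (restr A g y) \<le> norm ((1 + R) ^ N * (cmod (g y) / (1 + \<bar>y\<bar>) ^ N))" by simp
  qed measurable
qed

lemma tempered_restr: "tempered g \<Longrightarrow> A \<in> sets borel \<Longrightarrow> tempered (restr A g)"
  by (rule tempered_bound[of g]) (auto simp: restr_def indicator_def tempered_measurable)

lemma shell_abs_bound: "y \<in> shell a L k \<Longrightarrow> \<bar>y\<bar> \<le> \<bar>a\<bar> + 2 ^ (k + 2) * L"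
  unfolding shell_def mem_Collect_eq by linarith

lemma le_one_plus_square: "c \<le> 1 + c\<^sup>2" for c :: real
proof -
  have "2 * c \<le> c\<^sup>2 + 1" using sum_squares_bound[of c 1] by simp
  moreover have "0 \<le> c\<^sup>2" by simp
  ultimately show ?thesis by linarith
qed

lemma l2sq_restr: "l2sq V (restr A g) = l2sq (A \<inter> V) g"
  unfolding l2sq_def restr_def by (intro nn_integral_cong) (auto simp: indicator_def)

text \<open>Dyadic shells together with |g| \<le> 1 + |g|^2. On the k-th shell the weight 2^(-k (N +
  2)) beats both the length, of order 2^k, and the growth 2^(k N), leaving a geometric
  series.\<close>

lemma tempered_of_growth:
  assumes g [measurable]: "g \<in> borel_measurable borel"
    and growth: "\<And>k. l2sq {- (2 ^ k)..2 ^ k} g \<le> ennreal (E * (2 ^ k) ^ N)" and E: "E \<ge> 0"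
  shows "tempered g"
proof -
  let ?h = "\<lambda>y. ennreal (cmod (g y) / (1 + \<bar>y\<bar>) ^ (N + 2))"
  have h_le: "?h y \<le> 1 + ennreal ((cmod (g y))\<^sup>2)" if "c \<le> (1::real)" for y c
  proof -
    have "cmod (g y) \<le> 1 + (cmod (g y))\<^sup>2"
      by (rule le_one_plus_square)
    moreover have "cmod (g y) / (1 + \<bar>y\<bar>) ^ (N + 2) \<le> cmod (g y)"
    proof -
      have "1 \<le> (1 + \<bar>y\<bar>) ^ (N + 2)" by (rule one_le_power) simp
      then have "cmod (g y) / (1 + \<bar>y\<bar>) ^ (N + 2) \<le> cmod (g y) / 1"
        by (intro divide_left_mono) auto
      then show ?thesis by simp
    qed
    ultimately show ?thesis by (simp flip: ennreal_1 ennreal_plus add: ennreal_leI)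
  qed
  have int: "(\<integral>\<^sup>+y\<in>{- (2 ^ k)..2 ^ k}. (1 + ennreal ((cmod (g y))\<^sup>2)) \<partial>lborel) \<le> ennreal (2 * 2 ^ k + E * (2 ^ k) ^ N)" for k
  proof -
    have "(\<integral>\<^sup>+y\<in>{- (2 ^ k)..2 ^ k}. (1 + ennreal ((cmod (g y))\<^sup>2)) \<partial>lborel) = (\<integral>\<^sup>+y. indicator {- (2 ^ k)..2 ^ k::real} y \<partial>lborel) + l2sq {- (2 ^ k)..2 ^ k} g"
      unfolding l2sq_def distrib_right by (subst nn_integral_add) auto
    also have "\<dots> \<le> ennreal (2 * 2 ^ k) + ennreal (E * (2 ^ k) ^ N)"
      by (intro add_mono growth) simp
    finally show ?thesis using E by simp
  qed
  have pt: "?h y \<le> (1 + ennreal ((cmod (g y))\<^sup>2)) * indicator {- (2 ^ 1)..2 ^ 1} y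
     + (\<Sum>k. ennreal (1 / (2 ^ k) ^ (N + 2)) * ((1 + ennreal ((cmod (g y))\<^sup>2)) * indicator {- (2 ^ (k + 2))..2 ^ (k + 2)} y))" for y :: real
  proof (cases "\<bar>y\<bar> < 2")
    case True
    then have "y \<in> {- (2 ^ 1)..2 ^ 1}" by auto
    then show ?thesis using h_le[of 1 y] by (simp add: add_increasing2)
  next
    case False
    then obtain k where k: "y \<in> shell 0 1 k" using shell_cover[of 1 y 0] by auto
    then have y: "2 ^ (k + 1) \<le> \<bar>y\<bar>" "\<bar>y\<bar> < 2 ^ (k + 2)" by (simp_all add: shell_def)
    have "(2::real) ^ k \<le> 2 ^ (k + 1)" by simp
    then have "(2 ^ k) ^ (N + 2) \<le> (1 + \<bar>y\<bar>) ^ (N + 2)" using y by (intro power_mono) auto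
    then have "cmod (g y) / (1 + \<bar>y\<bar>) ^ (N + 2) \<le> cmod (g y) / (2 ^ k) ^ (N + 2)"
      by (intro divide_left_mono mult_pos_pos zero_less_power) auto
    also have "\<dots> \<le> (1 + (cmod (g y))\<^sup>2) / (2 ^ k) ^ (N + 2)"
      by (intro divide_right_mono le_one_plus_square) auto
    finally have "?h y \<le> ennreal (1 / (2 ^ k) ^ (N + 2) * (1 + (cmod (g y))\<^sup>2))" by (simp add: ennreal_leI)
    also have "\<dots> = ennreal (1 / (2 ^ k) ^ (N + 2)) * (1 + ennreal ((cmod (g y))\<^sup>2))"
      by (subst ennreal_mult) auto
    also have "\<dots> = ennreal (1 / (2 ^ k) ^ (N + 2)) * ((1 + ennreal ((cmod (g y))\<^sup>2)) * indicator {- (2 ^ (k + 2))..2 ^ (k + 2)} y)"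
    proof -
      have "y \<in> {- (2 ^ (k + 2))..2 ^ (k + 2)}" using y(2) unfolding atLeastAtMost_iff by linarith
      then show ?thesis by simp
    qed
    also have "\<dots> \<le> (\<Sum>k. ennreal (1 / (2 ^ k) ^ (N + 2)) * ((1 + ennreal ((cmod (g y))\<^sup>2)) * indicator {- (2 ^ (k + 2))..2 ^ (k + 2)} y))"
      using sum_le_suminf[of "\<lambda>k. ennreal (1 / (2 ^ k) ^ (N + 2)) * ((1 + ennreal ((cmod (g y))\<^sup>2)) * indicator {- (2 ^ (k + 2))..2 ^ (k + 2)} y)" "{k}"] by simp
    finally show ?thesis by (rule order_trans) simp
  qed
  have "(\<integral>\<^sup>+y. ?h y \<partial>lborel) \<le> (\<integral>\<^sup>+y. (1 + ennreal ((cmod (g y))\<^sup>2)) * indicator {- (2 ^ 1)..2 ^ 1} y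
     + (\<Sum>k. ennreal (1 / (2 ^ k) ^ (N + 2)) * ((1 + ennreal ((cmod (g y))\<^sup>2)) * indicator {- (2 ^ (k + 2))..2 ^ (k + 2)} y)) \<partial>lborel)"
    by (rule nn_integral_mono) (rule pt)
  also have "\<dots> = (\<integral>\<^sup>+y\<in>{- (2 ^ 1)..2 ^ 1}. (1 + ennreal ((cmod (g y))\<^sup>2)) \<partial>lborel)
     + (\<Sum>k. ennreal (1 / (2 ^ k) ^ (N + 2)) * (\<integral>\<^sup>+y\<in>{- (2 ^ (k + 2))..2 ^ (k + 2)}. (1 + ennreal ((cmod (g y))\<^sup>2)) \<partial>lborel))"
    by (subst nn_integral_add, measurable, subst nn_integral_suminf, measurable, subst nn_integral_cmult) auto
  also have "\<dots> \<le> ennreal (2 * 2 ^ 1 + E * (2 ^ 1) ^ N)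
     + (\<Sum>k. ennreal (1 / (2 ^ k) ^ (N + 2)) * ennreal (2 * 2 ^ (k + 2) + E * (2 ^ (k + 2)) ^ N))"
    by (intro add_mono int suminf_le mult_left_mono) auto
  also have "\<dots> \<le> ennreal (2 * 2 ^ 1 + E * (2 ^ 1) ^ N) + (\<Sum>k. ennreal ((8 + E * 4 ^ N) * (1 / 2) ^ k))"
  proof (intro add_mono order_refl suminf_le)
    fix k :: nat
    define x :: real where "x = 2 ^ k"
    have x: "x \<ge> 1" by (simp add: x_def)
    have "1 / x ^ (N + 2) * (2 * (4 * x) + E * (4 * x) ^ N) = (8 * x / x ^ (N + 1) + E * 4 ^ N * (x ^ N / x ^ (N + 1))) / x"
      using x by (simp add: field_simps power_mult_distrib)
    also have "\<dots> \<le> (8 * 1 + E * 4 ^ N * 1) / x"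
    proof (intro divide_right_mono add_mono mult_left_mono)
      have "x \<le> x ^ (N + 1)" using x by (intro self_le_power) auto
      then show "8 * x / x ^ (N + 1) \<le> 8 * 1" using x by (simp add: divide_le_eq)
      show "x ^ N / x ^ (N + 1) \<le> 1" using x by (simp add: divide_le_eq mult_le_cancel_right1)
    qed (use x E in auto)
    finally have "1 / x ^ (N + 2) * (2 * (4 * x) + E * (4 * x) ^ N) \<le> (8 + E * 4 ^ N) * (1 / 2) ^ k"
      by (simp add: x_def power_one_over)
    then have "1 / (2 ^ k) ^ (N + 2) * (2 * 2 ^ (k + 2) + E * (2 ^ (k + 2)) ^ N) \<le> (8 + E * 4 ^ N) * (1 / 2) ^ k"
      by (simp add: x_def mult.commute)
    then show "ennreal (1 / (2 ^ k) ^ (N + 2)) * ennreal (2 * 2 ^ (k + 2) + E * (2 ^ (k + 2)) ^ N) \<le> ennreal ((8 + E * 4 ^ N) * (1 / 2) ^ k)"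
      using E by (subst ennreal_mult[symmetric]) (auto intro!: ennreal_leI)
  qed auto
  also have "(\<Sum>k. ennreal ((8 + E * 4 ^ N) * (1 / 2) ^ k)) = ennreal ((8 + E * 4 ^ N) * (1 / (1 - 1 / 2)))"
    using E by (intro suminf_ennreal_eq sums_mult geometric_sums) auto
  finally have "(\<integral>\<^sup>+y. ?h y \<partial>lborel) < \<infinity>"
    by (auto simp: less_top[symmetric] top_unique)
  then have "integrable lborel (\<lambda>y. cmod (g y) / (1 + \<bar>y\<bar>) ^ (N + 2))"
    by (intro integrableI_nonneg) auto
  then show ?thesis unfolding tempered_def using g by blast
qed

section \<open>Modulation and disjoint frequency bands\<close>

definition modulate :: "real \<Rightarrow> (real \<Rightarrow> complex) \<Rightarrow> real \<Rightarrow> complex" where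
  "modulate \<alpha> g y = g y * cis (- (2 * pi * \<alpha> * y))"

text \<open>For nonzero \<kappa> of either sign, the open interval between \<alpha> and \<alpha> +
  \<kappa>.\<close>

definition freq :: "real \<Rightarrow> real \<Rightarrow> real set" where
  "freq \<alpha> \<kappa> = {\<xi>. (\<xi> - \<alpha>) / \<kappa> \<in> {0<..<1}}"

lemma freq_measurable [measurable]: "freq \<alpha> \<kappa> \<in> sets borel"
  unfolding freq_def greaterThanLessThan_iff by measurable

lemma modulate_measurable [measurable (raw)]: "g \<in> borel_measurable borel \<Longrightarrow> modulate \<alpha> g \<in> borel_measurable borel"
  unfolding modulate_def[abs_def] by (intro borel_measurable_times borel_measurable_cis) auto

lemma cmod_modulate [simp]: "cmod (modulate \<alpha> g y) = cmod (g y)"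
  by (simp add: modulate_def norm_mult)

lemma tempered_modulate: "tempered g \<Longrightarrow> tempered (modulate \<alpha> g)"
  by (rule tempered_bound[of g]) (auto simp: tempered_measurable)

lemma integrable_modulate: "integrable lborel g \<Longrightarrow> integrable lborel (modulate \<alpha> g)"
  unfolding modulate_def[abs_def] by (rule integrable_mult_cis) auto

lemma restr_modulate: "restr A (modulate \<alpha> g) = modulate \<alpha> (restr A g)"
  by (simp add: restr_def modulate_def fun_eq_iff)

lemma weighted_modulate: "weighted (modulate \<alpha> g) N u = modulate \<alpha> (weighted g N u)"
  by (simp add: weighted_def modulate_def fun_eq_iff)

lemma fourier_modulate: "fourier (modulate \<alpha> g) \<xi> = fourier g (\<xi> + \<alpha>)"
  unfolding fourier_def modulate_def
  by (intro Bochner_Integration.integral_cong refl) (simp add: mult.assoc cis_mult algebra_simps)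

lemma l2sq_fourier_modulate:
  assumes [measurable]: "g \<in> borel_measurable borel"
  shows "l2sq (freq 0 \<kappa>) (fourier (modulate \<alpha> g)) = l2sq (freq \<alpha> \<kappa>) (fourier g)"
proof -
  have "l2sq (freq \<alpha> \<kappa>) (fourier g) = (\<integral>\<^sup>+\<xi>. ennreal ((cmod (fourier g (\<alpha> + 1 * \<xi>)))\<^sup>2) * indicator (freq \<alpha> \<kappa>) (\<alpha> + 1 * \<xi>) \<partial>lborel)"
    unfolding l2sq_def by (subst nn_integral_real_affine[where c = 1 and t = \<alpha>]) auto
  also have "\<dots> = l2sq (freq 0 \<kappa>) (fourier (modulate \<alpha> g))"
    unfolding l2sq_def fourier_modulate by (intro nn_integral_cong) (simp add: freq_def indicator_def add.commute)
  finally show ?thesis by simp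
qed

lemma shell_bound_modulate:
  assumes "g \<in> borel_measurable borel"
  shows "shell_bound r (freq 0 \<kappa>) (modulate \<alpha> g) R u = shell_bound r (freq \<alpha> \<kappa>) g R u"
  unfolding shell_bound_def weighted_modulate using assms by (simp add: l2sq_fourier_modulate)

lemma inv_fourier_shift: "inv_fourier (\<lambda>\<xi>. \<Phi> (\<xi> - \<alpha>)) z = cis (2 * pi * \<alpha> * z) * inv_fourier \<Phi> z"
proof -
  have "inv_fourier (\<lambda>\<xi>. \<Phi> (\<xi> - \<alpha>)) z = \<bar>1\<bar> *\<^sub>R (LINT \<xi>|lborel. \<Phi> (\<alpha> + 1 * \<xi> - \<alpha>) * cis (2 * pi * z * (\<alpha> + 1 * \<xi>)))"
    unfolding inv_fourier_def by (rule lborel_integral_real_affine) simp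
  also have "\<dots> = (LINT \<xi>|lborel. cis (2 * pi * \<alpha> * z) * (\<Phi> \<xi> * cis (2 * pi * z * \<xi>)))"
  proof -
    have "cis (2 * pi * z * (\<alpha> + \<xi>)) = cis (2 * pi * \<alpha> * z) * cis (2 * pi * z * \<xi>)" for \<xi>
      by (simp add: cis_mult algebra_simps)
    then show ?thesis by (simp add: mult_ac)
  qed
  also have "\<dots> = cis (2 * pi * \<alpha> * z) * inv_fourier \<Phi> z"
    unfolding inv_fourier_def by (rule integral_mult_right_zero)
  finally show ?thesis .
qed

definition band :: "(real \<Rightarrow> complex) \<Rightarrow> (real \<Rightarrow> complex) \<Rightarrow> real \<Rightarrow> real \<Rightarrow> nat \<Rightarrow> real \<Rightarrow> complex" where
  "band \<eta> f \<alpha> \<kappa> j x = cis (- (2 * pi * \<alpha> * x)) * (LINT y|lborel. f y * inv_fourier (\<lambda>\<xi>. piece \<eta> \<kappa> j (\<xi> - \<alpha>)) (x - y))"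

text \<open>With the exponential on \<open>f\<close>, the end point \<alpha> sits at frequency 0,
  where r derivatives of the j-th piece gain the factor (\<kappa> / 2^j)^r.\<close>

lemma band_eq_conv: "band \<eta> f \<alpha> \<kappa> j x = conv (modulate \<alpha> f) (piece \<eta> \<kappa> j) 0 x"
proof -
  have "cis (- (2 * pi * \<alpha> * x)) * cis (2 * pi * \<alpha> * (x - y)) = cis (- (2 * pi * \<alpha> * y))" for y
    by (simp add: cis_mult algebra_simps)
  then have "cis (- (2 * pi * \<alpha> * x)) * (f y * inv_fourier (\<lambda>\<xi>. piece \<eta> \<kappa> j (\<xi> - \<alpha>)) (x - y)) = modulate \<alpha> f y * inv_fourier (mq 0 (piece \<eta> \<kappa> j)) (x - y)" for y
    unfolding inv_fourier_shift modulate_def by (simp add: mq_def[abs_def] mult_ac)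
  then show ?thesis
    unfolding band_def conv_def integral_mult_right_zero[symmetric] by simp
qed

text \<open>The polynomial disappears because the multiplier vanishes in a neighbourhood of the frequency 0.\<close>

lemma conv_minus_pol:
  assumes \<eta>: "\<eta> \<in> schwartz" and supp: "\<And>t. t \<notin> {1/6..2/3} \<Longrightarrow> \<eta> t = 0" and \<kappa>: "\<kappa> \<noteq> 0"
    and zero: "0 \<notin> freq \<alpha> \<kappa>" and f: "tempered f"
  shows "conv (modulate \<alpha> (\<lambda>y. f y - pol P y)) (piece \<eta> \<kappa> j) 0 x = conv (modulate \<alpha> f) (piece \<eta> \<kappa> j) 0 x"
proof -
  let ?\<Psi> = "\<lambda>\<xi>. piece \<eta> \<kappa> j (\<xi> - \<alpha>)"
  have s: "?\<Psi> \<in> schwartz" using schwartz_affine[OF piece_schwartz[OF \<eta> \<kappa>, of j], of 1 \<alpha>] by simp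
  \<comment> \<open>In units of \<kappa> / 2^j the support [1/6, 2/3] has distance at least 1/6 from
    both ends of (0, 1). A support point this close to frequency 0 would therefore put 0 inside the
    band.\<close>
  define \<delta> where "\<delta> = \<bar>\<kappa>\<bar> / 2 ^ j / 6"
  have \<delta>: "\<delta> > 0" using \<kappa> by (simp add: \<delta>_def)
  have z: "?\<Psi> \<xi> = 0" if "\<bar>\<xi>\<bar> < \<delta>" for \<xi>
  proof (rule ccontr)
    assume "?\<Psi> \<xi> \<noteq> 0"
    define \<sigma> where "\<sigma> = \<kappa> / 2 ^ j"
    have \<sigma>: "\<sigma> \<noteq> 0" using \<kappa> by (simp add: \<sigma>_def)
    define t where "t = (\<xi> - \<alpha>) / \<sigma>"
    have t: "t \<in> {1/6..2/3}" using \<open>?\<Psi> \<xi> \<noteq> 0\<close> supp unfolding piece_def t_def \<sigma>_def by blast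
    define e where "e = \<xi> / \<sigma>"
    have e: "\<bar>e\<bar> < 1 / 6" using that \<sigma> by (simp add: e_def \<delta>_def \<sigma>_def field_simps abs_mult)
    have "(0 - \<alpha>) / \<kappa> = (t - e) / 2 ^ j" using \<sigma> by (simp add: t_def e_def \<sigma>_def field_simps)
    moreover have "0 < t - e" "t - e < 1" using t e unfolding atLeastAtMost_iff by linarith+
    moreover have "y / 2 ^ j \<le> y" if "0 < y" for y :: real
      using that mult_left_mono[of 1 "2 ^ j" y] by (simp add: divide_le_eq)
    ultimately have "(0 - \<alpha>) / \<kappa> \<in> {0<..<1}" by (smt (verit) divide_pos_pos greaterThanLessThan_iff zero_less_power)
    then show False using zero by (simp add: freq_def)
  qed
  have "band \<eta> (\<lambda>y. f y - pol P y) \<alpha> \<kappa> j x = band \<eta> f \<alpha> \<kappa> j x"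
  proof -
    have i: "integrable lborel (\<lambda>y. f y * inv_fourier ?\<Psi> (x - y))"
      by (intro tempered_integrable f inv_fourier_rapid inv_fourier_continuous schwartz_rapid_continuous s)
    note p = poly_convolution_zero[OF s \<delta> z, of P x]
    have "(LINT y|lborel. (f y - pol P y) * inv_fourier ?\<Psi> (x - y)) = (LINT y|lborel. f y * inv_fourier ?\<Psi> (x - y))"
      unfolding left_diff_distrib using i p by (subst Bochner_Integration.integral_diff) auto
    then show ?thesis unfolding band_def by simp
  qed
  then show ?thesis by (simp only: band_eq_conv)
qed

lemma suminf_l2sq_disjoint:
  assumes U: "\<And>m. U m \<in> sets borel" "disjoint_family U" and [measurable]: "h \<in> borel_measurable borel"
  shows "(\<Sum>m. l2sq (U m) h) \<le> l2sq UNIV h"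
proof -
  note [measurable] = U(1)
  have "(\<Sum>m. l2sq (U m) h) = (\<integral>\<^sup>+x. (\<Sum>m. ennreal ((cmod (h x))\<^sup>2) * indicator (U m) x) \<partial>lborel)"
    unfolding l2sq_def by (rule nn_integral_suminf[symmetric]) measurable
  also have "\<dots> \<le> l2sq UNIV h"
    unfolding l2sq_def
  proof (rule nn_integral_mono)
    fix x
    show "(\<Sum>m. ennreal ((cmod (h x))\<^sup>2) * indicator (U m) x) \<le> ennreal ((cmod (h x))\<^sup>2) * indicator UNIV x"
    proof (cases "\<exists>m. x \<in> U m")
      case True
      then obtain m where "x \<in> U m" by blast
      then show ?thesis using suminf_cmult_indicator[OF U(2), of x m "\<lambda>_. ennreal ((cmod (h x))\<^sup>2)"] by simp
    qed simp
  qed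
  finally show ?thesis .
qed

lemma l2sq_cmono:
  assumes "\<And>x. cmod (f x) \<le> c * cmod (g x)" and [measurable]: "g \<in> borel_measurable borel" and "c \<ge> 0"
  shows "l2sq UNIV f \<le> ennreal (c\<^sup>2) * l2sq UNIV g"
proof -
  have "(cmod (f x))\<^sup>2 \<le> c\<^sup>2 * (cmod (g x))\<^sup>2" for x
    using power_mono[OF assms(1), of x 2] by (simp add: power_mult_distrib)
  then have "l2sq UNIV f \<le> (\<integral>\<^sup>+x. ennreal (c\<^sup>2) * ennreal ((cmod (g x))\<^sup>2) \<partial>lborel)"
    unfolding l2sq_def by (intro nn_integral_mono) (simp flip: ennreal_mult add: ennreal_leI)
  then show ?thesis by (simp add: l2sq_def nn_integral_cmult)
qed

text \<open>For fixed u both terms obey Plancherel and disjointness of the bands. With R the radius,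
  1 / (2^k L) = 2 / R, so the weighted term R^3 (2 / R)^(2 r + 4) = 4^(r + 2) / R^(2 r + 1) scales
  like the plain one.\<close>

lemma shell_bound_sum:
  assumes U: "\<And>m. U m \<in> sets borel" "disjoint_family U" and g: "tempered g" and L: "L > 0" and u: "u \<in> {a..a + L}"
  shows "(\<Sum>m. shell_bound r (U m) (restr (shell a L k) g) (2 ^ (k + 1) * L) u)
    \<le> ennreal ((1 + 4 ^ (r + 2)) / (2 ^ (k + 1) * L) ^ (2 * r + 1)) * l2sq UNIV (restr (shell a L k) g)"
proof -
  note [measurable] = tempered_measurable[OF g]
  let ?g = "restr (shell a L k) g" and ?R = "2 ^ (k + 1) * L"
  let ?w = "weighted ?g (r + 2) u"
  have R: "?R > 0" using L by simp
  have gi: "integrable lborel ?g" by (rule tempered_integrable_restr[OF g shell_measurable shell_abs_bound])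
  have wb: "cmod (?w y) \<le> (1 / (2 ^ k * L)) ^ (r + 2) * cmod (?g y)" for y by (rule weighted_bound[OF L u])
  have wi: "integrable lborel ?w"
  proof (rule Bochner_Integration.integrable_bound)
    show "integrable lborel (\<lambda>y. (1 / (2 ^ k * L)) ^ (r + 2) * cmod (?g y))" using gi by simp
    show "AE y in lborel. norm (?w y) \<le> norm ((1 / (2 ^ k * L)) ^ (r + 2) * cmod (?g y))"
      unfolding real_norm_def by (intro AE_I2 order_trans[OF wb abs_ge_self])
  qed measurable
  have 1: "(\<Sum>m. l2sq (U m) (fourier ?g)) \<le> l2sq UNIV ?g"
    by (rule order_trans[OF suminf_l2sq_disjoint[OF U] plancherel_le[OF gi]]) measurable
  have "(\<Sum>m. l2sq (U m) (fourier ?w)) \<le> l2sq UNIV ?w"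
    by (rule order_trans[OF suminf_l2sq_disjoint[OF U] plancherel_le[OF wi]]) measurable
  also have "\<dots> \<le> ennreal (((1 / (2 ^ k * L)) ^ (r + 2))\<^sup>2) * l2sq UNIV ?g"
    using L by (intro l2sq_cmono wb) auto
  finally have 2: "(\<Sum>m. l2sq (U m) (fourier ?w)) \<le> ennreal (((1 / (2 ^ k * L)) ^ (r + 2))\<^sup>2) * l2sq UNIV ?g" .
  have "(\<Sum>m. shell_bound r (U m) ?g ?R u) = ennreal (1 / ?R ^ (2 * r + 1)) * (\<Sum>m. l2sq (U m) (fourier ?g)) + ennreal (?R ^ 3) * (\<Sum>m. l2sq (U m) (fourier ?w))"
    unfolding shell_bound_def by (subst suminf_add[symmetric]) auto
  also have "\<dots> \<le> ennreal (1 / ?R ^ (2 * r + 1)) * l2sq UNIV ?g + ennreal (?R ^ 3) * (ennreal (((1 / (2 ^ k * L)) ^ (r + 2))\<^sup>2) * l2sq UNIV ?g)"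
    by (intro add_mono mult_left_mono 1 2) auto
  also have "\<dots> = ennreal (1 / ?R ^ (2 * r + 1) + ?R ^ 3 * ((1 / (2 ^ k * L)) ^ (r + 2))\<^sup>2) * l2sq UNIV ?g"
    using R L by (simp add: ennreal_mult distrib_right mult.assoc)
  also have "1 / ?R ^ (2 * r + 1) + ?R ^ 3 * ((1 / (2 ^ k * L)) ^ (r + 2))\<^sup>2 = (1 + 4 ^ (r + 2)) / ?R ^ (2 * r + 1)"
  proof -
    have "x ^ 3 * ((2 / x) ^ (r + 2))\<^sup>2 = 4 ^ (r + 2) / x ^ (2 * r + 1)" if "x > 0" for x :: real
    proof -
      have "((2 / x) ^ (r + 2))\<^sup>2 = 4 ^ (r + 2) / x ^ (2 * r + 4)"
      proof -
        have "((2 / x) ^ (r + 2))\<^sup>2 = ((2 / x)\<^sup>2) ^ (r + 2)" by (simp only: power_mult[symmetric] mult.commute)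
        also have "(2 / x)\<^sup>2 = 4 / x\<^sup>2" by (simp add: power_divide)
        also have "(4 / x\<^sup>2) ^ (r + 2) = 4 ^ (r + 2) / x ^ (2 * (r + 2))" by (simp only: power_divide power_mult)
        finally show ?thesis by (simp only: distrib_left) simp
      qed
      moreover have "x ^ (2 * r + 4) = x ^ 3 * x ^ (2 * r + 1)"
      proof -
        have "2 * r + 4 = 3 + (2 * r + 1)" by simp
        then show ?thesis by (simp only: power_add)
      qed
      ultimately have e: "((2 / x) ^ (r + 2))\<^sup>2 = 4 ^ (r + 2) / (x ^ 3 * x ^ (2 * r + 1))" by (simp only:)
      have alg: "y * (z / (y * v)) = z / v" if "y \<noteq> 0" for y z v :: real using that by simp
      show ?thesis unfolding e by (rule alg) (use that in simp)
    qed
    from this[OF R] have "?R ^ 3 * ((2 / ?R) ^ (r + 2))\<^sup>2 = 4 ^ (r + 2) / ?R ^ (2 * r + 1)" .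
    moreover have "2 / ?R = 1 / (2 ^ k * L)" by simp
    ultimately show ?thesis by (simp only: add_divide_distrib)
  qed
  finally show ?thesis .
qed

section \<open>The uniform estimate on one interval\<close>

text \<open>The squared form of the seminorm bound with a polynomial actually chosen on each
  interval. It holds for every \<open>A\<close> strictly above the seminorm, because the infimum
  need not be attained; hence \<open>A\<close> is a variable throughout.\<close>

definition campanato_le :: "nat \<Rightarrow> real \<Rightarrow> real \<Rightarrow> (real \<Rightarrow> complex) \<Rightarrow> bool" where
  "campanato_le i s A f \<longleftrightarrow> (\<forall>a b. a < b \<longrightarrow>
     (\<exists>P. deg_less i P \<and> l2sq {a..b} (\<lambda>x. f x - pol P x) \<le> ennreal (A\<^sup>2 * (b - a) powr (2 * s + 1))))"

text \<open>Here \<open>F m j\<close> is the \<open>j\<close>-th dyadic piece of the \<open>m\<close>-th component and \<open>p m j\<close> the polynomial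
  subtracted from it on \<open>[a, b]\<close>.\<close>

definition good :: "nat set \<Rightarrow> nat \<Rightarrow> (nat \<Rightarrow> nat \<Rightarrow> real \<Rightarrow> complex) \<Rightarrow> (nat \<Rightarrow> nat \<Rightarrow> complex poly) \<Rightarrow>
    (nat \<Rightarrow> ennreal) \<Rightarrow> real \<Rightarrow> real \<Rightarrow> bool" where
  "good M r F p D a b \<longleftrightarrow> (\<forall>m j. deg_less r (p m j)) \<and>
     (\<forall>m\<in>M. \<exists>B. \<forall>x\<in>{a..b}. (\<Sum>j. ennreal (cmod (F m j x - pol (p m j) x))) \<le> ennreal B) \<and>
     (\<forall>m\<in>M. \<forall>n. l2sq {a..b} (\<lambda>x. \<Sum>j<n. F m j x - pol (p m j) x) \<le> D m)"

lemma suminf_swap_ennreal: "(\<Sum>j. \<Sum>k. h j k) = (\<Sum>k. \<Sum>j. h j k)" for h :: "nat \<Rightarrow> nat \<Rightarrow> ennreal"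
  using nn_integral_fst_count_space[of "\<lambda>(j, k). h j k"] nn_integral_snd_count_space[of "\<lambda>(j, k). h j k"]
  by (simp add: nn_integral_count_space_nat)

text \<open>Half of the exponent absorbs the square and the other half is a geometric
  series.\<close>

lemma summable_quadratic_geometric:
  fixes \<delta> :: real
  assumes "\<delta> > 0"
  shows "summable (\<lambda>k. (real k + 3)\<^sup>2 * 2 powr (- (\<delta> * real k)))"
proof -
  have lim: "((\<lambda>x::real. (x + 3)\<^sup>2 * 2 powr (- (\<delta> / 2 * x))) \<longlongrightarrow> 0) at_top"
    using assms by real_asymp
  have "(\<lambda>k. (real k + 3)\<^sup>2 * 2 powr (- (\<delta> / 2 * real k))) \<longlonglongrightarrow> 0"
    by (rule filterlim_compose[OF lim filterlim_real_sequentially])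
  then have "eventually (\<lambda>k. (real k + 3)\<^sup>2 * 2 powr (- (\<delta> / 2 * real k)) < 1) sequentially"
    by (rule order_tendstoD) simp
  then have "eventually (\<lambda>k. norm ((real k + 3)\<^sup>2 * 2 powr (- (\<delta> * real k))) \<le> (2 powr (- (\<delta> / 2))) ^ k) sequentially"
  proof eventually_elim
    case (elim k)
    have "2 powr (- (\<delta> * real k)) = 2 powr (- (\<delta> / 2 * real k)) * 2 powr (- (\<delta> / 2 * real k))"
      by (simp flip: powr_add)
    moreover have "2 powr (- (\<delta> / 2 * real k)) = (2 powr (- (\<delta> / 2))) ^ k"
      by (simp add: powr_powr flip: powr_realpow)
    ultimately show ?case
      using mult_right_mono[OF less_imp_le[OF elim], of "(2 powr (- (\<delta> / 2))) ^ k"] by (simp add: mult.assoc)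
  qed
  then show ?thesis
    by (rule summable_comparison_test_ev) (use assms in \<open>simp add: summable_geometric powr_less_one\<close>)
qed

lemma campanato_le_growth:
  fixes s :: real and i :: nat
  assumes s: "s > -1/2"
  obtains C where "C \<ge> 0" "\<And>f A c h. f \<in> borel_measurable borel \<Longrightarrow> A \<ge> 0 \<Longrightarrow> h > 0 \<Longrightarrow> campanato_le i s A f \<Longrightarrow>
    \<exists>P. deg_less i P \<and> (\<forall>k::nat. l2sq {c - 2 ^ k * h..c + 2 ^ k * h} (\<lambda>x. f x - pol P x)
      \<le> ennreal (C * (real k + 1)\<^sup>2 * 2 powr (real k * (2 * max s (real i - 1) + 1)) * h powr (2 * s + 1) * A\<^sup>2))"
proof -
  from campanato_growth[OF s, of i, folded campanato_le_def] obtain C where C: "C \<ge> 0"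
    and H: "\<forall>f A c h. f \<in> borel_measurable borel \<longrightarrow> A \<ge> 0 \<longrightarrow> h > 0 \<longrightarrow> campanato_le i s A f \<longrightarrow>
    (\<exists>P. deg_less i P \<and> (\<forall>k::nat. l2sq {c - 2 ^ k * h..c + 2 ^ k * h} (\<lambda>x. f x - pol P x)
      \<le> ennreal (C * (real k + 1)\<^sup>2 * 2 powr (real k * (2 * max s (real i - 1) + 1)) * h powr (2 * s + 1) * A\<^sup>2)))"
    by (elim exE conjE)
  show ?thesis
    by (rule that[OF C]) (rule H[THEN spec, THEN spec, THEN spec, THEN spec, THEN mp, THEN mp, THEN mp, THEN mp])
qed

lemma campanato_le_tempered:
  assumes f [measurable]: "f \<in> borel_measurable borel" and A: "A \<ge> 0" and s: "s > -1/2" and ap: "campanato_le i s A f"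
  shows "tempered f"
proof -
  define g where "g = 2 * max s (real i - 1) + 1"
  obtain C where C: "C \<ge> 0" and growth: "\<And>f A c h. f \<in> borel_measurable borel \<Longrightarrow> A \<ge> 0 \<Longrightarrow> h > 0 \<Longrightarrow> campanato_le i s A f \<Longrightarrow>
    \<exists>P. deg_less i P \<and> (\<forall>k::nat. l2sq {c - 2 ^ k * h..c + 2 ^ k * h} (\<lambda>x. f x - pol P x)
      \<le> ennreal (C * (real k + 1)\<^sup>2 * 2 powr (real k * g) * h powr (2 * s + 1) * A\<^sup>2))"
    by (rule campanato_le_growth[OF s, of i, folded g_def], rule that)
  obtain P where P: "\<And>k. l2sq {0 - 2 ^ k * 1..0 + 2 ^ k * 1} (\<lambda>x. f x - pol P x)
      \<le> ennreal (C * (real k + 1)\<^sup>2 * 2 powr (real k * g) * 1 powr (2 * s + 1) * A\<^sup>2)"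
    using growth[OF f A zero_less_one ap, of 0] by (elim exE conjE) (rule that, erule spec)
  \<comment> \<open>The growth bound becomes a pure power of 2^k: (k + 1)^2 is at most (2^k)^2, and
    the exponent \<open>g\<close> is rounded up to an integer.\<close>
  have "tempered (\<lambda>x. f x - pol P x)"
  proof (rule tempered_of_growth[where E = "C * A\<^sup>2" and N = "2 + nat \<lceil>g\<rceil>"])
    fix k
    have "real k + 1 \<le> 2 ^ k" using less_exp[of k] by (metis Suc_leI of_nat_Suc of_nat_le_iff of_nat_numeral of_nat_power add.commute)
    then have 1: "(real k + 1)\<^sup>2 \<le> (2 ^ k)\<^sup>2" by (intro power_mono) auto
    have e: "(2::real) powr (real k * real n) = (2 ^ k) ^ n" for n
      by (simp add: powr_powr[symmetric] powr_realpow)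
    have 2: "2 powr (real k * g) \<le> (2 ^ k) ^ nat \<lceil>g\<rceil>"
      unfolding e[symmetric] by (intro powr_mono mult_left_mono real_nat_ceiling_ge) simp_all
    have "(real k + 1)\<^sup>2 * 2 powr (real k * g) \<le> (2 ^ k)\<^sup>2 * (2 ^ k) ^ nat \<lceil>g\<rceil>"
      by (rule mult_mono[OF 1 2]) simp_all
    then have 3: "C * A\<^sup>2 * ((real k + 1)\<^sup>2 * 2 powr (real k * g)) \<le> C * A\<^sup>2 * ((2 ^ k) ^ (2 + nat \<lceil>g\<rceil>))"
      unfolding power_add by (rule mult_left_mono) (simp add: C)
    have e2: "C * (real k + 1)\<^sup>2 * 2 powr (real k * g) * 1 powr (2 * s + 1) * A\<^sup>2 = C * A\<^sup>2 * ((real k + 1)\<^sup>2 * 2 powr (real k * g))"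
      by simp
    have J: "{0 - 2 ^ k * 1..0 + 2 ^ k * 1} = {- (2 ^ k)..2 ^ k::real}" by simp
    show "l2sq {- (2 ^ k)..2 ^ k} (\<lambda>x. f x - pol P x) \<le> ennreal (C * A\<^sup>2 * (2 ^ k) ^ (2 + nat \<lceil>g\<rceil>))"
      by (rule order_trans[OF P[of k, unfolded J e2] ennreal_leI[OF 3]])
  qed (use C in auto)
  from tempered_add[OF this tempered_pol[of P]] show ?thesis by simp
qed

lemma shell_bound_measurable [measurable]:
  assumes [measurable]: "g \<in> borel_measurable borel" "V \<in> sets borel"
  shows "shell_bound r V g R \<in> borel_measurable borel"
  unfolding shell_bound_def[abs_def] l2sq_def fourier_def weighted_def by measurable

lemma le_one_plus_square_ennreal: "x \<le> 1 + x\<^sup>2" for x :: ennreal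
proof (cases x)
  case (real c)
  have "ennreal c \<le> ennreal (1 + c\<^sup>2)" by (intro ennreal_leI le_one_plus_square)
  then show ?thesis using real by (simp add: ennreal_power)
qed simp

lemma restr_restr: "A \<subseteq> B \<Longrightarrow> restr A (restr B g) = restr A g"
  by (auto simp: restr_def fun_eq_iff indicator_def)

text \<open>The bands enter only through their disjointness and the position of 0, so the constant
  does not see them. The polynomials are Taylor polynomials at \<open>a\<close> of the far part and
  thus depend on the interval, which \<open>band_limit\<close> repairs.\<close>

theorem band_estimate:
  fixes s :: real and i r :: nat
  assumes \<eta>: "\<eta> \<in> schwartz" and supp: "\<And>t. t \<notin> {1/6..2/3} \<Longrightarrow> \<eta> t = 0"
    and b\<eta>: "\<And>n t. cmod (\<Sum>j<n. \<eta> (t * 2 ^ j)) \<le> B\<eta>"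
    and r: "r \<ge> 1" and s: "s > -1/2" and rs: "real r > max s (real i - 1)"
  shows "\<exists>C\<ge>0. \<forall>f A M \<alpha> \<kappa> a b. f \<in> borel_measurable borel \<longrightarrow> A \<ge> 0 \<longrightarrow> campanato_le i s A f \<longrightarrow>
    (\<forall>m\<in>M. \<kappa> m \<noteq> 0 \<and> 0 \<notin> freq (\<alpha> m) (\<kappa> m)) \<longrightarrow> disjoint_family_on (\<lambda>m. freq (\<alpha> m) (\<kappa> m)) M \<longrightarrow> a < b \<longrightarrow>
    (\<exists>p D. good M r (\<lambda>m. band \<eta> f (\<alpha> m) (\<kappa> m)) p D a b \<and>
       (\<integral>\<^sup>+m. D m \<partial>count_space M) \<le> ennreal (C * (b - a) powr (2 * s + 1) * A\<^sup>2))"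
proof -

  \<comment> \<open>Exponents and constants\<close>
  define \<tau> where "\<tau> = max s (real i - 1)"
  define g where "g = 2 * \<tau> + 1"
  define e where "e = 2 * s + 1"
  define \<delta> where "\<delta> = real r - \<tau>"
  \<comment> \<open>Growth 2^(k g) of f - P against the factor 2^(-k (2 r + 1)) of the k-th shell
    leaves 2^(-2 \<delta> k). Half of it is spent on 1 / w^k, the other half on summing (k +
    3)^2.\<close>
  define w where "w = 2 powr (- \<delta>)"
  have \<delta>: "\<delta> > 0" using rs by (simp add: \<delta>_def \<tau>_def)
  have w: "0 < w" "w < 1" using \<delta> by (auto simp: w_def powr_less_one)
  have B0: "B\<eta> \<ge> 0" using order_trans[OF norm_ge_zero b\<eta>[of 0 0]] .
  obtain Cg where Cg: "Cg \<ge> 0" and growth: "\<And>f A c h. f \<in> borel_measurable borel \<Longrightarrow> A \<ge> 0 \<Longrightarrow> h > 0 \<Longrightarrow> campanato_le i s A f \<Longrightarrow>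
    \<exists>P. deg_less i P \<and> (\<forall>k::nat. l2sq {c - 2 ^ k * h..c + 2 ^ k * h} (\<lambda>x. f x - pol P x)
      \<le> ennreal (Cg * (real k + 1)\<^sup>2 * 2 powr (real k * g) * h powr e * A\<^sup>2))"
    by (rule campanato_le_growth[OF s, of i, folded g_def[unfolded \<tau>_def] e_def], rule that)
  have "\<exists>Bf\<ge>0. \<forall>g \<kappa> V a L w u. tempered g \<longrightarrow> (\<forall>k. integrable lborel (restr (shell a L k) g)) \<longrightarrow>
    (\<forall>y. \<bar>y - a\<bar> < 2 * L \<longrightarrow> g y = 0) \<longrightarrow> L > 0 \<longrightarrow> 0 < w \<longrightarrow> w < 1 \<longrightarrow> \<kappa> \<noteq> 0 \<longrightarrow> V \<in> sets borel \<longrightarrow>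
    (\<forall>t. t / \<kappa> \<in> {0<..<1} \<longrightarrow> t \<in> V) \<longrightarrow> u \<in> {a..a + L} \<longrightarrow>
    (\<Sum>j. ennreal (cmod (conv g (piece \<eta> \<kappa> j) r u)))\<^sup>2
      \<le> ennreal (Bf / (1 - w)) * (\<Sum>k. ennreal (1 / w ^ k) * shell_bound r V (restr (shell a L k) g) (2 ^ (k + 1) * L) u)"
    by (rule far_series_bound[OF \<eta> _ r]) (rule supp)
  then obtain Bf where Bf: "Bf \<ge> 0" and fb: "\<forall>g \<kappa> V a L w u. tempered g \<longrightarrow> (\<forall>k. integrable lborel (restr (shell a L k) g)) \<longrightarrow>
    (\<forall>y. \<bar>y - a\<bar> < 2 * L \<longrightarrow> g y = 0) \<longrightarrow> L > 0 \<longrightarrow> 0 < w \<longrightarrow> w < 1 \<longrightarrow> \<kappa> \<noteq> 0 \<longrightarrow> V \<in> sets borel \<longrightarrow>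
    (\<forall>t. t / \<kappa> \<in> {0<..<1} \<longrightarrow> t \<in> V) \<longrightarrow> u \<in> {a..a + L} \<longrightarrow>
    (\<Sum>j. ennreal (cmod (conv g (piece \<eta> \<kappa> j) r u)))\<^sup>2
      \<le> ennreal (Bf / (1 - w)) * (\<Sum>k. ennreal (1 / w ^ k) * shell_bound r V (restr (shell a L k) g) (2 ^ (k + 1) * L) u)"
    by (elim exE conjE) (rule that)
  note far_bound = fb[THEN spec, THEN spec, THEN spec, THEN spec, THEN spec, THEN spec, THEN spec,
    THEN mp, THEN mp, THEN mp, THEN mp, THEN mp, THEN mp, THEN mp, THEN mp, THEN mp, THEN mp]
  \<comment> \<open>The k-th shell lies in the dilate by 2^(k + 2), so the growth bound contributes
    ((k + 2) + 1)^2.\<close>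
  define q where "q k = (real k + 3)\<^sup>2 * 2 powr (- (\<delta> * real k))" for k
  have q: "summable q" "\<And>k. q k \<ge> 0" unfolding q_def[abs_def] using summable_quadratic_geometric[OF \<delta>] by auto
  define c\<^sub>r :: real where "c\<^sub>r = 1 + 4 ^ (r + 2)"
  \<comment> \<open>The power of 2 collects the offsets: 2 g from the dilate 2^(k + 2) and -(2 r +
    1) from the radius 2^(k + 1).\<close>
  define C0 where "C0 = c\<^sub>r * Cg * 2 powr (2 * g - 2 * real r - 1)"
  have C0: "C0 \<ge> 0" using Cg by (simp add: C0_def c\<^sub>r_def)
  \<comment> \<open>The near part lies in the dilate by 2^1, where the growth bound at k = 1 reads
    (1 + 1)^2 2^g.\<close>
  define C1 where "C1 = B\<eta>\<^sup>2 * (Cg * 4 * 2 powr g)"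
  define C2 where "C2 = Bf / (1 - w) * (C0 * suminf q)"
  have sq: "suminf q \<ge> 0" by (rule suminf_nonneg[OF q])
  have C12: "C1 \<ge> 0" "C2 \<ge> 0" using Cg Bf w sq C0
    unfolding C1_def C2_def by (auto intro!: mult_nonneg_nonneg divide_nonneg_nonneg)
  show ?thesis
  proof (intro exI[of _ "2 * (C1 + C2)"] conjI allI impI)
    fix f and A a b :: real and M and \<alpha> \<kappa> :: "nat \<Rightarrow> real"
    assume f [measurable]: "f \<in> borel_measurable borel" and A: "A \<ge> 0" and ap: "campanato_le i s A f"
      and M: "\<forall>m\<in>M. \<kappa> m \<noteq> 0 \<and> 0 \<notin> freq (\<alpha> m) (\<kappa> m)" and disj: "disjoint_family_on (\<lambda>m. freq (\<alpha> m) (\<kappa> m)) M" and ab: "a < b"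

    \<comment> \<open>Splitting of f - P into a near and a far part\<close>
    define L where "L = b - a"
    have L: "L > 0" and b: "b = a + L" using ab by (auto simp: L_def)
    obtain P where P: "\<And>k::nat. l2sq {a - 2 ^ k * L..a + 2 ^ k * L} (\<lambda>x. f x - pol P x)
      \<le> ennreal (Cg * (real k + 1)\<^sup>2 * 2 powr (real k * g) * L powr e * A\<^sup>2)"
      using growth[OF f A L ap, of a] by (elim exE conjE) (rule that, erule spec)
    have ft: "tempered f" by (rule campanato_le_tempered[OF f A s ap])
    define h where "h x = f x - pol P x" for x
    have ht: "tempered h"
      using tempered_add[OF ft tempered_pol[of "- P"]] by (simp add: h_def[abs_def])
    note [measurable] = tempered_measurable[OF ht]
    define N where "N = {y. \<bar>y - a\<bar> < 2 * L}"
    have [measurable]: "N \<in> sets borel" unfolding N_def by measurable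
    define near where "near = restr N h"
    define far where "far = restr (- N) h"
    have nt: "tempered near" "tempered far" unfolding near_def far_def by (intro tempered_restr ht; measurable)+
    note [measurable] = tempered_measurable[OF nt(1)] tempered_measurable[OF nt(2)]
    have ni: "integrable lborel near" unfolding near_def
      by (rule tempered_integrable_restr[OF ht, of N "\<bar>a\<bar> + 2 * L"]) (auto simp: N_def)
    have sub: "shell a L k \<subseteq> - N" for k
    proof
      fix y assume "y \<in> shell a L k"
      then have "2 ^ (k + 1) * L \<le> \<bar>y - a\<bar>" by (simp add: shell_def)
      moreover have "2 ^ 1 * L \<le> 2 ^ (k + 1) * L" using L by (intro mult_right_mono power_increasing) auto
      ultimately show "y \<in> - N" by (simp add: N_def)
    qed
    have fars: "restr (shell a L k) far = restr (shell a L k) h" for k unfolding far_def by (rule restr_restr[OF sub])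
    have hi: "integrable lborel (restr (shell a L k) h)" for k
      by (rule tempered_integrable_restr[OF ht shell_measurable shell_abs_bound])
    \<comment> \<open>Empty sets outside \<open>M\<close> allow all sums over m to run over the
      natural numbers.\<close>
    define U where "U m = (if m \<in> M then freq (\<alpha> m) (\<kappa> m) else {})" for m
    have U: "U m \<in> sets borel" "disjoint_family U" for m
      using disj by (auto simp: U_def disjoint_family_on_def)
    note [measurable] = U(1)
    define Y where "Y m u = ennreal (Bf / (1 - w)) * (\<Sum>k. ennreal (1 / w ^ k) * shell_bound r (U m) (restr (shell a L k) h) (2 ^ (k + 1) * L) u)" for m u
    have [measurable]: "Y m \<in> borel_measurable borel" for m unfolding Y_def[abs_def] by measurable
    define E where "E m = ennreal (L ^ (2 * r - 1)) * (\<integral>\<^sup>+u\<in>{a..a + L}. Y m u \<partial>lborel)" for m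
    \<comment> \<open>The near part is bounded directly in L^2; the square of the far remainder is
      bounded pointwise by \<open>E m\<close>, whence the length \<open>L\<close>. The outer 2 is
      that of \<open>l2sq_add\<close>.\<close>
    define D where "D m = 2 * (ennreal (B\<eta>\<^sup>2) * l2sq (U m) (fourier near) + ennreal L * E m)" for m
    define p where "p m j = taylor (modulate (\<alpha> m) far) (piece \<eta> (\<kappa> m) j) r a" for m j
    define rem where "rem m j x = conv (modulate (\<alpha> m) far) (piece \<eta> (\<kappa> m) j) 0 x - pol (p m j) x" for m j x
    let ?near = "\<lambda>m j. conv (modulate (\<alpha> m) near) (piece \<eta> (\<kappa> m) j) 0"
    have bandp: "band \<eta> f (\<alpha> m) (\<kappa> m) j x - pol (p m j) x = ?near m j x + rem m j x" if m: "m \<in> M" for m j x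
    proof -
      have s: "piece \<eta> (\<kappa> m) j \<in> schwartz" using M m by (intro piece_schwartz \<eta>) auto
      have "band \<eta> f (\<alpha> m) (\<kappa> m) j x = conv (modulate (\<alpha> m) h) (piece \<eta> (\<kappa> m) j) 0 x"
        unfolding band_eq_conv h_def[abs_def] using conv_minus_pol[OF \<eta> supp _ _ ft] M m by simp
      also have "modulate (\<alpha> m) h = (\<lambda>y. modulate (\<alpha> m) near y + modulate (\<alpha> m) far y)"
        by (auto simp: modulate_def near_def far_def restr_def indicator_def fun_eq_iff)
      also have "conv \<dots> (piece \<eta> (\<kappa> m) j) 0 x = ?near m j x + conv (modulate (\<alpha> m) far) (piece \<eta> (\<kappa> m) j) 0 x"
        by (rule conv_add[OF tempered_modulate[OF nt(1)] tempered_modulate[OF nt(2)] s])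
      finally show ?thesis by (simp add: rem_def)
    qed
    \<comment> \<open>\<open>far_bound\<close> is applied to the modulated far part with the band
      moved to 0; \<open>shell_bound_modulate\<close> carries the result back to the original
      band.\<close>
    have remE: "(\<Sum>j. ennreal (cmod (rem m j x)))\<^sup>2 \<le> E m" if m: "m \<in> M" and x: "x \<in> {a..b}" for m x
      unfolding rem_def p_def E_def
    proof (rule remainder_series_bound)
      show "tempered (modulate (\<alpha> m) far)" by (rule tempered_modulate[OF nt(2)])
      show "piece \<eta> (\<kappa> m) j \<in> schwartz" for j using M m by (intro piece_schwartz \<eta>) auto
      fix u assume u: "u \<in> {a..a + L}"
      have "(\<Sum>j. ennreal (cmod (conv (modulate (\<alpha> m) far) (piece \<eta> (\<kappa> m) j) r u)))\<^sup>2
        \<le> ennreal (Bf / (1 - w)) * (\<Sum>k. ennreal (1 / w ^ k) * shell_bound r (freq 0 (\<kappa> m)) (restr (shell a L k) (modulate (\<alpha> m) far)) (2 ^ (k + 1) * L) u)"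
      proof (rule far_bound)
        show "\<forall>k. integrable lborel (restr (shell a L k) (modulate (\<alpha> m) far))"
          unfolding restr_modulate fars by (intro allI integrable_modulate hi)
        show "\<forall>y. \<bar>y - a\<bar> < 2 * L \<longrightarrow> modulate (\<alpha> m) far y = 0" by (auto simp: modulate_def far_def restr_def N_def)
      qed (use M m w L u in \<open>auto simp: freq_def intro: tempered_modulate nt\<close>)
      also have "\<dots> = Y m u"
        unfolding Y_def restr_modulate fars U_def using m by (simp add: shell_bound_modulate)
      finally show "(\<Sum>j. ennreal (cmod (conv (modulate (\<alpha> m) far) (piece \<eta> (\<kappa> m) j) r u)))\<^sup>2 \<le> Y m u" .
    qed (use r L x b in auto)

    \<comment> \<open>Norms of the near part and of the shells, and summation over the bands\<close>
    have near_l2: "l2sq UNIV near \<le> ennreal (Cg * 4 * 2 powr g * L powr e * A\<^sup>2)"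
    proof -
      have "l2sq UNIV near = l2sq N h" unfolding near_def l2sq_restr by simp
      also have "\<dots> \<le> l2sq {a - 2 ^ 1 * L..a + 2 ^ 1 * L} h" by (intro l2sq_mono_set) (auto simp: N_def)
      also have "\<dots> \<le> ennreal (Cg * (real 1 + 1)\<^sup>2 * 2 powr (real 1 * g) * L powr e * A\<^sup>2)" using P[of 1] by (simp add: h_def[abs_def])
      finally show ?thesis by simp
    qed
    have shell_l2: "l2sq UNIV (restr (shell a L k) h) \<le> ennreal (Cg * (real k + 3)\<^sup>2 * 2 powr (real (k + 2) * g) * L powr e * A\<^sup>2)" for k
    proof -
      have "l2sq UNIV (restr (shell a L k) h) = l2sq (shell a L k) h" unfolding l2sq_restr by simp
      also have "\<dots> \<le> l2sq {a - 2 ^ (k + 2) * L..a + 2 ^ (k + 2) * L} h"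
      proof (intro l2sq_mono_set subsetI)
        fix y assume "y \<in> shell a L k"
        then have "\<bar>y - a\<bar> < 2 ^ (k + 2) * L" by (simp add: shell_def)
        then show "y \<in> {a - 2 ^ (k + 2) * L..a + 2 ^ (k + 2) * L}" unfolding atLeastAtMost_iff by linarith
      qed
      also have "\<dots> \<le> ennreal (Cg * (real (k + 2) + 1)\<^sup>2 * 2 powr (real (k + 2) * g) * L powr e * A\<^sup>2)" using P[of "k + 2"] by (simp add: h_def[abs_def])
      finally show ?thesis by (simp add: add.commute)
    qed
    \<comment> \<open>The order of summation is exchanged so that m is summed first, at fixed u and
      k: the weighted function depends on u but not on m, so one application of Plancherel covers
      all bands.\<close>
    have sumY: "(\<Sum>m. Y m u) \<le> ennreal (C2 * (L powr e * A\<^sup>2 / L ^ (2 * r + 1)))" if u: "u \<in> {a..a + L}" for u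
    proof -
      let ?T = "\<lambda>k. ennreal (1 / w ^ k) * (ennreal (c\<^sub>r / (2 ^ (k + 1) * L) ^ (2 * r + 1)) * ennreal (Cg * (real k + 3)\<^sup>2 * 2 powr (real (k + 2) * g) * L powr e * A\<^sup>2))"
      have "(\<Sum>m. Y m u) = ennreal (Bf / (1 - w)) * (\<Sum>k. ennreal (1 / w ^ k) * (\<Sum>m. shell_bound r (U m) (restr (shell a L k) h) (2 ^ (k + 1) * L) u))"
        unfolding Y_def ennreal_suminf_cmult by (subst suminf_swap_ennreal) (simp only: ennreal_suminf_cmult)
      also have "\<dots> \<le> ennreal (Bf / (1 - w)) * (\<Sum>k. ?T k)"
      proof (intro mult_left_mono suminf_le)
        fix k
        have "(\<Sum>m. shell_bound r (U m) (restr (shell a L k) h) (2 ^ (k + 1) * L) u) \<le> ennreal (c\<^sub>r / (2 ^ (k + 1) * L) ^ (2 * r + 1)) * l2sq UNIV (restr (shell a L k) h)"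
          unfolding c\<^sub>r_def by (rule shell_bound_sum[OF U ht L u])
        also have "\<dots> \<le> ennreal (c\<^sub>r / (2 ^ (k + 1) * L) ^ (2 * r + 1)) * ennreal (Cg * (real k + 3)\<^sup>2 * 2 powr (real (k + 2) * g) * L powr e * A\<^sup>2)"
          by (intro mult_left_mono shell_l2) simp
        finally show "(\<Sum>m. shell_bound r (U m) (restr (shell a L k) h) (2 ^ (k + 1) * L) u) \<le> \<dots>" .
      qed auto
      also have "(\<Sum>k. ?T k) = (\<Sum>k. ennreal (C0 * q k * (L powr e * A\<^sup>2 / L ^ (2 * r + 1))))"
      proof (intro suminf_cong)
        fix k
        have "?T k = ennreal (1 / w ^ k * (c\<^sub>r / (2 ^ (k + 1) * L) ^ (2 * r + 1) * (Cg * (real k + 3)\<^sup>2 * 2 powr (real (k + 2) * g) * L powr e * A\<^sup>2)))"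
        proof -
          have "ennreal x * (ennreal y * ennreal z) = ennreal (x * (y * z))" if "x \<ge> 0" "y \<ge> 0" "z \<ge> 0" for x y z
            using that by (simp add: ennreal_mult)
          then show ?thesis using w L Cg by (auto simp: c\<^sub>r_def)
        qed
        also have "1 / w ^ k * (c\<^sub>r / (2 ^ (k + 1) * L) ^ (2 * r + 1) * (Cg * (real k + 3)\<^sup>2 * 2 powr (real (k + 2) * g) * L powr e * A\<^sup>2))
           = C0 * q k * (L powr e * A\<^sup>2 / L ^ (2 * r + 1))"
        proof -
          have 1: "1 / w ^ k = 2 powr (\<delta> * real k)"
            by (simp add: w_def powr_powr powr_minus field_simps flip: powr_realpow)
          have 2: "(2 ^ (k + 1)) ^ (2 * r + 1) = 2 powr (real (k + 1) * (2 * real r + 1))"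
          proof -
            have "(2 ^ (k + 1)) ^ (2 * r + 1) = (2::real) ^ ((k + 1) * (2 * r + 1))" by (rule power_mult[symmetric])
            also have "\<dots> = 2 powr real ((k + 1) * (2 * r + 1))" by (rule powr_realpow[symmetric]) simp
            finally show ?thesis by (simp only: of_nat_mult of_nat_add of_nat_1 of_nat_numeral)
          qed
          have ex: "\<delta> * real k - real (k + 1) * (2 * real r + 1) + real (k + 2) * g = (2 * g - 2 * real r - 1) + - (\<delta> * real k)"
            by (simp add: \<delta>_def g_def algebra_simps)
          have "2 powr (\<delta> * real k) / 2 powr (real (k + 1) * (2 * real r + 1)) * 2 powr (real (k + 2) * g) = 2 powr (2 * g - 2 * real r - 1) * 2 powr (- (\<delta> * real k))"
            unfolding powr_diff[symmetric] powr_add[symmetric] ex ..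
          then have "2 powr (\<delta> * real k) / 2 powr (real (k + 1) * (2 * real r + 1)) * 2 powr (real (k + 2) * g) * (c\<^sub>r * Cg * (real k + 3)\<^sup>2 * (L powr e * A\<^sup>2 / L ^ (2 * r + 1)))
             = 2 powr (2 * g - 2 * real r - 1) * 2 powr (- (\<delta> * real k)) * (c\<^sub>r * Cg * (real k + 3)\<^sup>2 * (L powr e * A\<^sup>2 / L ^ (2 * r + 1)))" by (simp only:)
          then show ?thesis unfolding 1 power_mult_distrib 2 C0_def q_def by (simp add: mult_ac)
        qed
        finally show "?T k = ennreal (C0 * q k * (L powr e * A\<^sup>2 / L ^ (2 * r + 1)))" .
      qed
      also have "\<dots> = ennreal (C0 * suminf q * (L powr e * A\<^sup>2 / L ^ (2 * r + 1)))"
        using C0 L q by (intro suminf_ennreal_eq sums_mult2 sums_mult summable_sums) auto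
      also have "ennreal (Bf / (1 - w)) * \<dots> = ennreal (C2 * (L powr e * A\<^sup>2 / L ^ (2 * r + 1)))"
        using Bf w C0 q L sq unfolding C2_def by (subst ennreal_mult[symmetric]) (auto intro!: mult_nonneg_nonneg divide_nonneg_nonneg simp: mult.assoc)
      finally show ?thesis .
    qed
    \<comment> \<open>All powers of L except L powr e cancel in the far part: L from the length,
      L^(2 r - 1) from Taylor and L from the integral in u against L^(2 r + 1) from the
      shells.\<close>
    have sumD: "(\<Sum>m. D m) \<le> ennreal (2 * (C1 + C2) * L powr e * A\<^sup>2)"
    proof -
      have "(\<Sum>m. l2sq (U m) (fourier near)) \<le> l2sq UNIV near"
        by (rule order_trans[OF suminf_l2sq_disjoint[OF U] plancherel_le[OF ni]]) measurable
      then have 1: "(\<Sum>m. l2sq (U m) (fourier near)) \<le> ennreal (Cg * 4 * 2 powr g * L powr e * A\<^sup>2)" using near_l2 by (rule order_trans)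
      have "(\<Sum>m. \<integral>\<^sup>+u\<in>{a..a + L}. Y m u \<partial>lborel) = (\<integral>\<^sup>+u. (\<Sum>m. Y m u * indicator {a..a + L} u) \<partial>lborel)"
        by (rule nn_integral_suminf[symmetric]) measurable
      also have "\<dots> \<le> (\<integral>\<^sup>+u. ennreal (C2 * (L powr e * A\<^sup>2 / L ^ (2 * r + 1))) * indicator {a..a + L} u \<partial>lborel)"
        unfolding ennreal_suminf_multc
      proof (rule nn_integral_mono)
        fix u
        show "(\<Sum>m. Y m u) * indicator {a..a + L} u \<le> ennreal (C2 * (L powr e * A\<^sup>2 / L ^ (2 * r + 1))) * indicator {a..a + L} u"
        proof (cases "u \<in> {a..a + L}")
          case True
          show ?thesis by (intro mult_right_mono sumY True) simp
        next
          case False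
          show ?thesis unfolding indicator_simps(2)[OF False] by simp
        qed
      qed
      also have "\<dots> = ennreal (C2 * (L powr e * A\<^sup>2 / L ^ (2 * r + 1)) * L)"
      proof -
        have em: "emeasure lborel {a..a + L} = ennreal L" using L by simp
        show ?thesis by (subst nn_integral_cmult_indicator, simp, unfold em, rule ennreal_mult''[symmetric]) (use L in simp)
      qed
      finally have 2: "(\<Sum>m. \<integral>\<^sup>+u\<in>{a..a + L}. Y m u \<partial>lborel) \<le> ennreal (C2 * (L powr e * A\<^sup>2 / L ^ (2 * r + 1)) * L)" .
      have "(\<Sum>m. D m) = 2 * (ennreal (B\<eta>\<^sup>2) * (\<Sum>m. l2sq (U m) (fourier near)) + ennreal L * (ennreal (L ^ (2 * r - 1)) * (\<Sum>m. \<integral>\<^sup>+u\<in>{a..a + L}. Y m u \<partial>lborel)))"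
        unfolding D_def E_def by (simp only: ennreal_suminf_cmult suminf_add[OF summableI summableI, symmetric])
      also have "\<dots> \<le> 2 * (ennreal (B\<eta>\<^sup>2) * ennreal (Cg * 4 * 2 powr g * L powr e * A\<^sup>2) + ennreal L * (ennreal (L ^ (2 * r - 1)) * ennreal (C2 * (L powr e * A\<^sup>2 / L ^ (2 * r + 1)) * L)))"
        by (intro mult_left_mono add_mono 1 2) auto
      also have "\<dots> = ennreal (2 * (B\<eta>\<^sup>2 * (Cg * 4 * 2 powr g * L powr e * A\<^sup>2) + L * (L ^ (2 * r - 1) * (C2 * (L powr e * A\<^sup>2 / L ^ (2 * r + 1)) * L))))"
        using L Cg C12 by (simp flip: ennreal_mult ennreal_plus ennreal_numeral)
      also have "2 * (B\<eta>\<^sup>2 * (Cg * 4 * 2 powr g * L powr e * A\<^sup>2) + L * (L ^ (2 * r - 1) * (C2 * (L powr e * A\<^sup>2 / L ^ (2 * r + 1)) * L))) = 2 * (C1 + C2) * L powr e * A\<^sup>2"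
      proof -
        have "2 * r + 1 = Suc (Suc (2 * r - 1))" using r by simp
        then have "L ^ (2 * r + 1) = L * L ^ (2 * r - 1) * L" by (simp only: power_Suc mult_ac)
        then have "L * (L ^ (2 * r - 1) * (z / L ^ (2 * r + 1) * L)) = z" for z using L by (simp only:) simp
        from this[of "C2 * (L powr e * A\<^sup>2)"] show ?thesis by (simp add: C1_def algebra_simps)
      qed
      finally show ?thesis .
    qed
    \<comment> \<open>\<open>D m\<close> is a term of a finite sum and L > 0. Finiteness of
      \<open>E m\<close> supplies the absolute convergence at each point that \<open>good\<close>
      demands.\<close>
    have Efin: "E m < \<infinity>" for m
    proof -
      have "D m \<le> (\<Sum>m. D m)" using sum_le_suminf[of D "{m}"] by simp
      then have "D m < \<infinity>" using sumD by (auto simp: less_top[symmetric] top_unique)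
      show ?thesis
      proof (rule ccontr)
        assume "\<not> E m < \<infinity>"
        then have "E m = \<top>" by (simp add: less_top[symmetric])
        then have "D m = \<top>" unfolding D_def using L by (simp add: ennreal_mult_top)
        then show False using \<open>D m < \<infinity>\<close> by simp
      qed
    qed

    \<comment> \<open>Verification of \<open>good\<close>\<close>
    show "\<exists>p D. good M r (\<lambda>m. band \<eta> f (\<alpha> m) (\<kappa> m)) p D a b \<and>
       (\<integral>\<^sup>+m. D m \<partial>count_space M) \<le> ennreal (2 * (C1 + C2) * (b - a) powr (2 * s + 1) * A\<^sup>2)"
    proof (intro exI[of _ p] exI[of _ D] conjI)
      have "(\<integral>\<^sup>+m. D m \<partial>count_space M) = (\<integral>\<^sup>+m. D m * indicator M m \<partial>count_space UNIV)"
        by (rule nn_integral_count_space_indicator) simp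
      also have "\<dots> \<le> (\<integral>\<^sup>+m. D m \<partial>count_space UNIV)" by (intro nn_integral_mono) (auto simp: indicator_def)
      also have "\<dots> = (\<Sum>m. D m)" by (rule nn_integral_count_space_nat)
      finally show "(\<integral>\<^sup>+m. D m \<partial>count_space M) \<le> ennreal (2 * (C1 + C2) * (b - a) powr (2 * s + 1) * A\<^sup>2)"
        using sumD unfolding L_def e_def by (rule order_trans)
      show "good M r (\<lambda>m. band \<eta> f (\<alpha> m) (\<kappa> m)) p D a b"
        unfolding good_def
      proof (intro conjI ballI allI)
        show "deg_less r (p m j)" for m j unfolding p_def by (rule deg_less_taylor)
        fix m assume m: "m \<in> M"
        have \<kappa>: "\<kappa> m \<noteq> 0" using M m by blast
        obtain B where B: "\<And>x. (\<Sum>j. ennreal (cmod (?near m j x))) \<le> ennreal B"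
          using near_sup_bound[OF \<eta> supp integrable_modulate[OF ni] \<kappa>] by blast
        show "\<exists>B. \<forall>x\<in>{a..b}. (\<Sum>j. ennreal (cmod (band \<eta> f (\<alpha> m) (\<kappa> m) j x - pol (p m j) x))) \<le> ennreal B"
        proof (intro exI ballI)
          fix x assume x: "x \<in> {a..b}"
          have "(\<Sum>j. ennreal (cmod (band \<eta> f (\<alpha> m) (\<kappa> m) j x - pol (p m j) x))) \<le> (\<Sum>j. ennreal (cmod (?near m j x)) + ennreal (cmod (rem m j x)))"
            unfolding bandp[OF m] by (intro suminf_le) (auto simp flip: ennreal_plus intro!: ennreal_leI norm_triangle_ineq)
          also have "\<dots> = (\<Sum>j. ennreal (cmod (?near m j x))) + (\<Sum>j. ennreal (cmod (rem m j x)))"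
            by (rule suminf_add[symmetric]) auto
          \<comment> \<open>Only the square of the remainder series is known to be at most
            \<open>E m\<close>; x \<le> 1 + x^2 avoids a root in \<open>ennreal\<close>.\<close>
          also have "\<dots> \<le> ennreal B + (1 + E m)"
            by (rule add_mono[OF B order_trans[OF le_one_plus_square_ennreal add_left_mono[OF remE[OF m x]]]])
          also have "\<dots> = ennreal (enn2real (ennreal B + (1 + E m)))"
            using Efin[of m] by (intro ennreal_enn2real[symmetric]) (auto simp: less_top)
          finally show "(\<Sum>j. ennreal (cmod (band \<eta> f (\<alpha> m) (\<kappa> m) j x - pol (p m j) x))) \<le> ennreal (enn2real (ennreal B + (1 + E m)))" .
        qed
        fix n
        have sch: "piece \<eta> (\<kappa> m) j \<in> schwartz" for j by (rule piece_schwartz[OF \<eta> \<kappa>])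
        have cm [measurable]: "conv (modulate (\<alpha> m) near) (piece \<eta> (\<kappa> m) j) 0 \<in> borel_measurable borel" "conv (modulate (\<alpha> m) far) (piece \<eta> (\<kappa> m) j) 0 \<in> borel_measurable borel" for j
          by (intro borel_measurable_continuous_onI conv_continuous tempered_modulate nt sch)+
        have [measurable]: "rem m j \<in> borel_measurable borel" for j unfolding rem_def[abs_def] by measurable
        have "l2sq {a..b} (\<lambda>x. \<Sum>j<n. band \<eta> f (\<alpha> m) (\<kappa> m) j x - pol (p m j) x) = l2sq {a..b} (\<lambda>x. (\<Sum>j<n. ?near m j x) + (\<Sum>j<n. rem m j x))"
          unfolding bandp[OF m] sum.distrib ..
        also have "\<dots> \<le> 2 * (l2sq {a..b} (\<lambda>x. \<Sum>j<n. ?near m j x) + l2sq {a..b} (\<lambda>x. \<Sum>j<n. rem m j x))"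
          by (rule l2sq_add) measurable
        also have "\<dots> \<le> 2 * (ennreal (B\<eta>\<^sup>2) * l2sq (U m) (fourier near) + ennreal L * E m)"
        proof (intro mult_left_mono add_mono)
          have "l2sq {a..b} (\<lambda>x. \<Sum>j<n. ?near m j x) \<le> l2sq UNIV (\<lambda>x. \<Sum>j<n. ?near m j x)" by (rule l2sq_mono_set) simp
          also have "\<dots> \<le> ennreal (B\<eta>\<^sup>2) * l2sq (freq 0 (\<kappa> m)) (fourier (modulate (\<alpha> m) near))"
          proof (rule near_l2_bound[OF sch tempered_modulate[OF nt(1)] integrable_modulate[OF ni]])
            show "piece \<eta> (\<kappa> m) j t = 0" if "t \<notin> freq 0 (\<kappa> m)" for j t
            proof (rule ccontr)
              assume nz: "piece \<eta> (\<kappa> m) j t \<noteq> 0"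
              define v where "v = t / (\<kappa> m / 2 ^ j)"
              have v: "v \<in> {1/6..2/3}" using nz supp unfolding piece_def v_def by blast
              then have "0 < v" "v < 1" by auto
              have e: "t / \<kappa> m = v / 2 ^ j" by (simp add: v_def)
              have "v / 2 ^ j \<le> v / 1" using \<open>0 < v\<close> by (intro divide_left_mono) auto
              moreover have "0 < v / 2 ^ j" using \<open>0 < v\<close> by simp
              ultimately have "t / \<kappa> m \<in> {0<..<1}" unfolding e greaterThanLessThan_iff using \<open>v < 1\<close> by linarith
              then show False using that by (simp add: freq_def)
            qed
            show "cmod (\<Sum>j<n. piece \<eta> (\<kappa> m) j t) \<le> B\<eta>" for t
              using b\<eta>[of "t / \<kappa> m" n] by (simp add: piece_def)
          qed measurable
          also have "l2sq (freq 0 (\<kappa> m)) (fourier (modulate (\<alpha> m) near)) = l2sq (U m) (fourier near)"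
            using m by (simp add: U_def l2sq_fourier_modulate)
          finally show "l2sq {a..b} (\<lambda>x. \<Sum>j<n. ?near m j x) \<le> ennreal (B\<eta>\<^sup>2) * l2sq (U m) (fourier near)" .
          have "l2sq {a..b} (\<lambda>x. \<Sum>j<n. rem m j x) \<le> (\<integral>\<^sup>+x. E m * indicator {a..b} x \<partial>lborel)"
            unfolding l2sq_def
          proof (rule nn_integral_mono)
            fix x
            show "ennreal ((cmod (\<Sum>j<n. rem m j x))\<^sup>2) * indicator {a..b} x \<le> E m * indicator {a..b} x"
            proof (cases "x \<in> {a..b}")
              case True
              have "ennreal (cmod (\<Sum>j<n. rem m j x)) \<le> ennreal (\<Sum>j<n. cmod (rem m j x))" by (intro ennreal_leI norm_sum)
              also have "\<dots> = (\<Sum>j<n. ennreal (cmod (rem m j x)))" by simp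
              also have "\<dots> \<le> (\<Sum>j. ennreal (cmod (rem m j x)))" by (rule sum_le_suminf) auto
              finally have "(ennreal (cmod (\<Sum>j<n. rem m j x)))\<^sup>2 \<le> (\<Sum>j. ennreal (cmod (rem m j x)))\<^sup>2" by (rule power_mono) simp
              also have "\<dots> \<le> E m" by (rule remE[OF m True])
              finally have "ennreal ((cmod (\<Sum>j<n. rem m j x))\<^sup>2) \<le> E m" by (simp add: ennreal_power)
              then show ?thesis by (rule mult_right_mono) simp
            next
              case False
              show ?thesis unfolding indicator_simps(2)[OF False] by simp
            qed
          qed
          also have "\<dots> = ennreal L * E m" using ab by (subst nn_integral_cmult_indicator) (auto simp: L_def mult.commute)
          finally show "l2sq {a..b} (\<lambda>x. \<Sum>j<n. rem m j x) \<le> ennreal L * E m" .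
        qed simp
        finally show "l2sq {a..b} (\<lambda>x. \<Sum>j<n. band \<eta> f (\<alpha> m) (\<kappa> m) j x - pol (p m j) x) \<le> D m" unfolding D_def .
      qed
    qed
  qed (use C12 in simp)
qed

section \<open>Passage to the limit and change of polynomials\<close>

text \<open>Multiplying by unimodular factors turns the coefficient of the sum into the sum of the moduli of the
  coefficients, so that the \<open>L\<^sup>2\<close> bound for coefficients gives absolute summability.\<close>

lemma summable_coeff:
  assumes d: "\<And>j. deg_less r (d j)" and ab: "a < b"
    and B: "\<And>x. x \<in> {a..b} \<Longrightarrow> (\<Sum>j. ennreal (cmod (pol (d j) x))) \<le> ennreal B"
  shows "summable (\<lambda>j. cmod (coeff (d j) k))"
proof -
  obtain K where K: "K \<ge> 0" "\<And>p k. deg_less r p \<Longrightarrow> ennreal ((cmod (coeff p k))\<^sup>2) \<le> ennreal K * l2sq {a..b} (pol p)"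
    using coeff_le_l2sq[OF ab, of r] by blast
  define \<epsilon> where "\<epsilon> j = cnj (sgn (coeff (d j) k))" for j
  have \<epsilon>: "cmod (\<epsilon> j) \<le> 1" "\<epsilon> j * coeff (d j) k = cmod (coeff (d j) k)" for j
  proof -
    show "cmod (\<epsilon> j) \<le> 1" by (simp add: \<epsilon>_def norm_sgn)
    show "\<epsilon> j * coeff (d j) k = cmod (coeff (d j) k)"
    proof (cases "coeff (d j) k = 0")
      case False
      have "\<epsilon> j * coeff (d j) k = coeff (d j) k * cnj (coeff (d j) k) / cmod (coeff (d j) k)"
        by (simp add: \<epsilon>_def sgn_eq)
      also have "\<dots> = cmod (coeff (d j) k)"
        unfolding complex_norm_square[symmetric] using False by (simp add: power2_eq_square)
      finally show ?thesis .
    qed (simp add: \<epsilon>_def)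
  qed
  define B' where "B' = max B 0"
  have "(\<Sum>j<n. cmod (coeff (d j) k)) \<le> sqrt (K * (B'\<^sup>2 * (b - a)))" for n
  proof -
    define q where "q = (\<Sum>j<n. smult (\<epsilon> j) (d j))"
    have dq: "deg_less r q" unfolding q_def by (intro deg_less_sum deg_less_smult d)
    have "cmod (pol q x) \<le> B'" if x: "x \<in> {a..b}" for x
    proof -
      have "cmod (pol q x) \<le> (\<Sum>j<n. cmod (\<epsilon> j * pol (d j) x))"
        unfolding q_def poly_sum poly_smult by (rule norm_sum)
      also have "\<dots> \<le> (\<Sum>j<n. cmod (pol (d j) x))"
        unfolding norm_mult by (intro sum_mono mult_left_le_one_le \<epsilon>) auto
      finally have "ennreal (cmod (pol q x)) \<le> (\<Sum>j<n. ennreal (cmod (pol (d j) x)))" by (simp add: ennreal_leI)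
      also have "\<dots> \<le> (\<Sum>j. ennreal (cmod (pol (d j) x)))" by (rule sum_le_suminf) auto
      also have "\<dots> \<le> ennreal B" by (rule B[OF x])
      also have "\<dots> \<le> ennreal B'" by (intro ennreal_leI) (simp add: B'_def)
      finally show ?thesis by (subst (asm) ennreal_le_iff) (simp add: B'_def)
    qed
    then have l2: "l2sq {a..b} (pol q) \<le> ennreal (B'\<^sup>2 * (b - a))" using ab by (intro l2sq_bounded) auto
    have cq: "coeff q k = of_real (\<Sum>j<n. cmod (coeff (d j) k))" by (simp add: q_def coeff_sum \<epsilon>)
    have "cmod (coeff q k) = (\<Sum>j<n. cmod (coeff (d j) k))"
      unfolding cq norm_of_real by (intro abs_of_nonneg sum_nonneg) simp
    then have "ennreal ((\<Sum>j<n. cmod (coeff (d j) k))\<^sup>2) \<le> ennreal K * l2sq {a..b} (pol q)"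
      using K(2)[OF dq, of k] by simp
    also have "\<dots> \<le> ennreal K * ennreal (B'\<^sup>2 * (b - a))" by (intro mult_left_mono l2) simp
    also have "\<dots> = ennreal (K * (B'\<^sup>2 * (b - a)))" using K ab by (intro ennreal_mult[symmetric]) auto
    finally have "(\<Sum>j<n. cmod (coeff (d j) k))\<^sup>2 \<le> K * (B'\<^sup>2 * (b - a))"
      by (subst (asm) ennreal_le_iff) (use K ab in auto)
    then show ?thesis by (rule real_le_rsqrt)
  qed
  then show ?thesis by (intro summableI_nonneg_bounded[where x = "sqrt (K * (B'\<^sup>2 * (b - a)))"]) auto
qed

lemma ennreal_add_finite_bound:
  assumes "x \<le> ennreal B" "y \<le> ennreal C" shows "x + y \<le> ennreal (max B 0 + max C 0)"
proof -
  have "x + y \<le> ennreal (max B 0) + ennreal (max C 0)"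
    by (intro add_mono order_trans[OF assms(1)] order_trans[OF assms(2)] ennreal_leI) auto
  then show ?thesis by simp
qed

lemma suminf_cmod_triangle:
  assumes "(\<Sum>j. ennreal (cmod (f j))) \<le> ennreal B" "(\<Sum>j. ennreal (cmod (g j))) \<le> ennreal C"
    and "\<And>j::nat. cmod (h j) \<le> cmod (f j) + cmod (g j)"
  shows "(\<Sum>j. ennreal (cmod (h j))) \<le> ennreal (max B 0 + max C 0)"
proof -
  have "(\<Sum>j. ennreal (cmod (h j))) \<le> (\<Sum>j. ennreal (cmod (f j)) + ennreal (cmod (g j)))"
    by (intro suminf_le) (auto simp flip: ennreal_plus intro!: ennreal_leI assms(3))
  also have "\<dots> = (\<Sum>j. ennreal (cmod (f j))) + (\<Sum>j. ennreal (cmod (g j)))" by (rule suminf_add[symmetric]) auto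
  also have "\<dots> \<le> ennreal (max B 0 + max C 0)" by (rule ennreal_add_finite_bound[OF assms(1,2)])
  finally show ?thesis .
qed

text \<open>In the difference of two admissible choices of polynomials \<open>F\<close> cancels, so
  the difference inherits both bounds; being a polynomial of bounded degree, it has its coefficients
  controlled as well.\<close>

lemma good_coeff:
  assumes F: "\<And>m j. F m j \<in> borel_measurable borel"
    and g: "good M r F p D a b" and g': "good M r F p' D' a b" and ab: "a < b"
  shows "\<exists>K\<ge>0. \<forall>m\<in>M. (\<forall>k. summable (\<lambda>j. cmod (coeff (p m j - p' m j) k))) \<and>
    (\<forall>n. l2sq {a..b} (pol (\<Sum>j<n. p m j - p' m j)) \<le> ennreal 2 * (D m + D' m)) \<and>
    (\<forall>n k. ennreal ((cmod (coeff (\<Sum>j<n. p m j - p' m j) k))\<^sup>2) \<le> ennreal K * (D m + D' m))"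
proof -
  note [measurable] = F
  obtain K where K: "K \<ge> 0" "\<And>p k. deg_less r p \<Longrightarrow> ennreal ((cmod (coeff p k))\<^sup>2) \<le> ennreal K * l2sq {a..b} (pol p)"
    using coeff_le_l2sq[OF ab, of r] by blast
  have dl: "deg_less r (p m j - p' m j)" for m j using g g' unfolding good_def by (intro deg_less_diff) auto
  show ?thesis
  proof (intro exI[of _ "K * 2"] conjI ballI allI)
    fix m assume m: "m \<in> M"
    obtain B B' where B: "\<And>x. x \<in> {a..b} \<Longrightarrow> (\<Sum>j. ennreal (cmod (F m j x - pol (p m j) x))) \<le> ennreal B"
      and B': "\<And>x. x \<in> {a..b} \<Longrightarrow> (\<Sum>j. ennreal (cmod (F m j x - pol (p' m j) x))) \<le> ennreal B'"
      using g g' m unfolding good_def by meson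
    show "summable (\<lambda>j. cmod (coeff (p m j - p' m j) k))" for k
    proof (rule summable_coeff[OF dl ab])
      fix x assume x: "x \<in> {a..b}"
      show "(\<Sum>j. ennreal (cmod (pol (p m j - p' m j) x))) \<le> ennreal (max B' 0 + max B 0)"
      proof (rule suminf_cmod_triangle[OF B'[OF x] B[OF x]])
        fix j
        have "pol (p m j - p' m j) x = (F m j x - pol (p' m j) x) - (F m j x - pol (p m j) x)" by simp
        then show "cmod (pol (p m j - p' m j) x) \<le> cmod (F m j x - pol (p' m j) x) + cmod (F m j x - pol (p m j) x)"
          by (simp only: norm_triangle_ineq4)
      qed
    qed
    show l: "l2sq {a..b} (pol (\<Sum>j<n. p m j - p' m j)) \<le> ennreal 2 * (D m + D' m)" for n
    proof -
      have "pol (\<Sum>j<n. p m j - p' m j) = (\<lambda>x. (\<Sum>j<n. F m j x - pol (p' m j) x) - (\<Sum>j<n. F m j x - pol (p m j) x))"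
        by (simp add: fun_eq_iff poly_sum sum_subtractf)
      then have "l2sq {a..b} (pol (\<Sum>j<n. p m j - p' m j)) \<le> 2 * (l2sq {a..b} (\<lambda>x. \<Sum>j<n. F m j x - pol (p' m j) x) + l2sq {a..b} (\<lambda>x. \<Sum>j<n. F m j x - pol (p m j) x))"
        using l2sq_diff[of "\<lambda>x. \<Sum>j<n. F m j x - pol (p' m j) x" "\<lambda>x. \<Sum>j<n. F m j x - pol (p m j) x" "{a..b}"] by simp
      also have "\<dots> \<le> 2 * (D' m + D m)"
        using g g' m unfolding good_def by (intro mult_left_mono add_mono) auto
      finally show ?thesis by (simp add: add.commute)
    qed
    show "ennreal ((cmod (coeff (\<Sum>j<n. p m j - p' m j) k))\<^sup>2) \<le> ennreal (K * 2) * (D m + D' m)" for n k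
    proof -
      have "ennreal ((cmod (coeff (\<Sum>j<n. p m j - p' m j) k))\<^sup>2) \<le> ennreal K * l2sq {a..b} (pol (\<Sum>j<n. p m j - p' m j))"
        by (intro K deg_less_sum dl)
      also have "\<dots> \<le> ennreal K * (ennreal 2 * (D m + D' m))" by (intro mult_left_mono l) simp
      finally show ?thesis using K by (simp add: ennreal_mult mult.assoc)
    qed
  qed (use K in simp)
qed

lemma good_restrict:
  assumes "good M r F p D a b" "{a'..b'} \<subseteq> {a..b}"
  shows "good M r F p D a' b'"
  using assms unfolding good_def by (meson l2sq_mono_set order_trans subset_eq)

text \<open>On [-T, T] the polynomials of [-1, 1] differ from the ones adapted to [-T, T] by
  polynomials that are bounded on [-1, 1]. Dilation loses only a power of T; the loss is harmless
  because the bound on [-T, T] serves finiteness only.\<close>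

lemma good_extend:
  assumes F: "\<And>m j. F m j \<in> borel_measurable borel"
    and g0: "good M r F p D (-1) 1" and g': "good M r F p' D' (-T) T" and T: "T \<ge> 1"
  shows "\<exists>K\<ge>0. good M r F p (\<lambda>m. ennreal K * (D m + D' m)) (-T) T"
proof -
  note [measurable] = F
  have g1: "good M r F p' D' (-1) 1" by (rule good_restrict[OF g']) (use T in auto)
  obtain K where c: "\<And>m k. m \<in> M \<Longrightarrow> summable (\<lambda>j. cmod (coeff (p m j - p' m j) k))"
    and l: "\<And>m n. m \<in> M \<Longrightarrow> l2sq {-1..1} (pol (\<Sum>j<n. p m j - p' m j)) \<le> ennreal 2 * (D m + D' m)"
    using good_coeff[OF F g0 g1] by auto
  obtain K' where K': "K' \<ge> 0" "\<And>p c h T. deg_less r p \<Longrightarrow> h > 0 \<Longrightarrow> T \<ge> 1 \<Longrightarrow>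
     l2sq {c - T * h..c + T * h} (pol p) \<le> ennreal (K' * T ^ (2 * r - 1)) * l2sq {c - h..c + h} (pol p)"
    using l2sq_pol_dilate[of r] by blast
  define K2 where "K2 = 2 * (1 + K' * T ^ (2 * r - 1) * 2)"
  have dl: "deg_less r (p m j - p' m j)" for m j using g0 g' unfolding good_def by (intro deg_less_diff) auto
  have e: "F m j x - pol (p m j) x = (F m j x - pol (p' m j) x) - pol (p m j - p' m j) x" for m j x by simp
  show ?thesis
  proof (intro exI[of _ K2] conjI)
    show "K2 \<ge> 0" using K' T by (simp add: K2_def)
    show "good M r F p (\<lambda>m. ennreal K2 * (D m + D' m)) (-T) T"
      unfolding good_def
    proof (intro conjI ballI allI)
      show "deg_less r (p m j)" for m j using g0 unfolding good_def by blast
      fix m assume m: "m \<in> M"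
      obtain B' where B': "\<And>x. x \<in> {-T..T} \<Longrightarrow> (\<Sum>j. ennreal (cmod (F m j x - pol (p' m j) x))) \<le> ennreal B'"
        using g' m unfolding good_def by meson
      define S where "S = (\<Sum>k<r. T ^ k * (\<Sum>j. cmod (coeff (p m j - p' m j) k)))"
      have pd: "(\<Sum>j. ennreal (cmod (pol (p m j - p' m j) x))) \<le> ennreal S" if x: "x \<in> {-T..T}" for x
      proof -
        have "cmod (pol (p m j - p' m j) x) \<le> (\<Sum>k<r. T ^ k * cmod (coeff (p m j - p' m j) k))" for j
        proof -
          have "cmod (pol (p m j - p' m j) x) \<le> (\<Sum>k<r. cmod (coeff (p m j - p' m j) k * of_real x ^ k))"
            unfolding pol_eq_sum[OF dl] by (rule norm_sum)
          also have "\<dots> \<le> (\<Sum>k<r. T ^ k * cmod (coeff (p m j - p' m j) k))"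
          proof (rule sum_mono)
            fix k
            have "\<bar>x\<bar> ^ k \<le> T ^ k" using x by (intro power_mono) auto
            then show "cmod (coeff (p m j - p' m j) k * of_real x ^ k) \<le> T ^ k * cmod (coeff (p m j - p' m j) k)"
              using mult_right_mono[of "\<bar>x\<bar> ^ k" "T ^ k" "cmod (coeff (p m j - p' m j) k)"] by (simp add: norm_mult norm_power mult.commute)
          qed
          finally show ?thesis .
        qed
        then have "(\<Sum>j. ennreal (cmod (pol (p m j - p' m j) x))) \<le> (\<Sum>j. ennreal (\<Sum>k<r. T ^ k * cmod (coeff (p m j - p' m j) k)))"
          by (intro suminf_le ennreal_leI) auto
        also have "\<dots> = ennreal S"
          unfolding S_def using T by (intro suminf_ennreal_eq sums_sum sums_mult summable_sums c m) (auto intro!: sum_nonneg)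
        finally show ?thesis .
      qed
      show "\<exists>B. \<forall>x\<in>{-T..T}. (\<Sum>j. ennreal (cmod (F m j x - pol (p m j) x))) \<le> ennreal B"
      proof (intro exI ballI)
        fix x assume x: "x \<in> {-T..T}"
        show "(\<Sum>j. ennreal (cmod (F m j x - pol (p m j) x))) \<le> ennreal (max B' 0 + max S 0)"
          by (rule suminf_cmod_triangle[OF B'[OF x] pd[OF x]]) (subst e, rule norm_triangle_ineq4)
      qed
      fix n
      have "(\<lambda>x. \<Sum>j<n. F m j x - pol (p m j) x) = (\<lambda>x. (\<Sum>j<n. F m j x - pol (p' m j) x) - pol (\<Sum>j<n. p m j - p' m j) x)"
        by (simp add: fun_eq_iff poly_sum sum_subtractf)
      then have "l2sq {-T..T} (\<lambda>x. \<Sum>j<n. F m j x - pol (p m j) x) \<le> 2 * (l2sq {-T..T} (\<lambda>x. \<Sum>j<n. F m j x - pol (p' m j) x) + l2sq {-T..T} (pol (\<Sum>j<n. p m j - p' m j)))"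
        using l2sq_diff[of "\<lambda>x. \<Sum>j<n. F m j x - pol (p' m j) x" "pol (\<Sum>j<n. p m j - p' m j)" "{-T..T}"] by simp
      also have "\<dots> \<le> 2 * (D' m + ennreal (K' * T ^ (2 * r - 1)) * (ennreal 2 * (D m + D' m)))"
      proof (intro mult_left_mono add_mono)
        show "l2sq {-T..T} (\<lambda>x. \<Sum>j<n. F m j x - pol (p' m j) x) \<le> D' m" using g' m unfolding good_def by blast
        have "l2sq {0 - T * 1..0 + T * 1} (pol (\<Sum>j<n. p m j - p' m j)) \<le> ennreal (K' * T ^ (2 * r - 1)) * l2sq {0 - 1..0 + 1} (pol (\<Sum>j<n. p m j - p' m j))"
          by (intro K' deg_less_sum dl T) auto
        also have "\<dots> \<le> ennreal (K' * T ^ (2 * r - 1)) * (ennreal 2 * (D m + D' m))"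
          using l[OF m, of n] by (intro mult_left_mono) auto
        finally show "l2sq {-T..T} (pol (\<Sum>j<n. p m j - p' m j)) \<le> ennreal (K' * T ^ (2 * r - 1)) * (ennreal 2 * (D m + D' m))" by simp
      qed simp
      also have "\<dots> \<le> 2 * ((D m + D' m) + ennreal (K' * T ^ (2 * r - 1)) * (ennreal 2 * (D m + D' m)))"
        by (intro mult_left_mono add_right_mono) (auto simp: add_increasing)
      also have "\<dots> = ennreal K2 * (D m + D' m)"
      proof -
        have "ennreal K2 = 2 * (1 + ennreal (K' * T ^ (2 * r - 1)) * ennreal 2)"
          unfolding K2_def using K' T by (subst ennreal_mult, simp, simp, subst ennreal_plus, simp, simp, subst ennreal_mult) simp_all
        moreover have "2 * (x + y * (z * x)) = 2 * (1 + y * z) * x" for x y z :: ennreal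
          by (simp add: distrib_left distrib_right mult.assoc)
        ultimately show ?thesis by (simp only:)
      qed
      finally show "l2sq {-T..T} (\<lambda>x. \<Sum>j<n. F m j x - pol (p m j) x) \<le> ennreal K2 * (D m + D' m)" .
    qed
  qed
qed

lemma l2sq_tendsto_Fatou:
  assumes [measurable]: "\<And>n. g n \<in> borel_measurable borel" and lim: "\<And>x. x \<in> {a..b} \<Longrightarrow> (\<lambda>n. g n x) \<longlonglongrightarrow> h x"
    and D: "\<And>n. l2sq {a..b} (g n) \<le> D"
  shows "l2sq {a..b} h \<le> D"
proof -
  have "l2sq {a..b} h \<le> (\<integral>\<^sup>+x. liminf (\<lambda>n. ennreal ((cmod (g n x))\<^sup>2) * indicator {a..b} x) \<partial>lborel)"
    unfolding l2sq_def
  proof (rule nn_integral_mono)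
    fix x
    show "ennreal ((cmod (h x))\<^sup>2) * indicator {a..b} x \<le> liminf (\<lambda>n. ennreal ((cmod (g n x))\<^sup>2) * indicator {a..b} x)"
    proof (cases "x \<in> {a..b}")
      case True
      have "(\<lambda>n. ennreal ((cmod (g n x))\<^sup>2)) \<longlonglongrightarrow> ennreal ((cmod (h x))\<^sup>2)" by (intro tendsto_intros lim True)
      then have "liminf (\<lambda>n. ennreal ((cmod (g n x))\<^sup>2)) = ennreal ((cmod (h x))\<^sup>2)" by (intro lim_imp_Liminf) auto
      then show ?thesis using True by simp
    next
      case False
      show ?thesis unfolding indicator_simps(2)[OF False] by simp
    qed
  qed
  also have "\<dots> \<le> liminf (\<lambda>n. l2sq {a..b} (g n))" unfolding l2sq_def by (rule nn_integral_liminf) measurable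
  also have "\<dots> \<le> D" by (rule Liminf_le) (auto simp: D)
  finally show ?thesis .
qed

text \<open>For a single m the uniform bound on the absolute series is a constant majorant, which
  gives L^2 convergence on the interval. \<open>D m\<close> carries the estimate to the limit by
  Fatou and serves later as majorant in m.\<close>

lemma good_limit:
  assumes F: "\<And>m j. F m j \<in> borel_measurable borel" and g: "good M r F p D a b" and m: "m \<in> M"
    and S: "\<And>x. S x = (\<Sum>j. F m j x - pol (p m j) x)"
  shows "\<And>x. x \<in> {a..b} \<Longrightarrow> (\<lambda>n. \<Sum>j<n. F m j x - pol (p m j) x) \<longlonglongrightarrow> S x"
    "l2sq {a..b} S \<le> D m"
    "(\<lambda>n. l2sq {a..b} (\<lambda>x. (\<Sum>j<n. F m j x - pol (p m j) x) - S x)) \<longlonglongrightarrow> 0"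
proof -
  note [measurable] = F
  obtain B0 where B0: "\<And>x. x \<in> {a..b} \<Longrightarrow> (\<Sum>j. ennreal (cmod (F m j x - pol (p m j) x))) \<le> ennreal B0"
    using g m unfolding good_def by meson
  define B where "B = max B0 0"
  have B: "(\<Sum>j<n. cmod (F m j x - pol (p m j) x)) \<le> B" if "x \<in> {a..b}" for n x
  proof -
    have "ennreal (\<Sum>j<n. cmod (F m j x - pol (p m j) x)) \<le> (\<Sum>j. ennreal (cmod (F m j x - pol (p m j) x)))"
    proof -
      have "ennreal (\<Sum>j<n. cmod (F m j x - pol (p m j) x)) = (\<Sum>j<n. ennreal (cmod (F m j x - pol (p m j) x)))"
        by (rule sum_ennreal[symmetric]) simp
      also have "\<dots> \<le> (\<Sum>j. ennreal (cmod (F m j x - pol (p m j) x)))" by (rule sum_le_suminf) auto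
      finally show ?thesis .
    qed
    also have "\<dots> \<le> ennreal B" using B0[OF that] by (rule order_trans) (simp add: B_def ennreal_leI)
    finally show ?thesis by (subst (asm) ennreal_le_iff) (simp add: B_def)
  qed
  let ?s = "\<lambda>n x. \<Sum>j<n. F m j x - pol (p m j) x"
  show lim: "(\<lambda>n. ?s n x) \<longlonglongrightarrow> S x" if x: "x \<in> {a..b}" for x
  proof -
    have "summable (\<lambda>j. cmod (F m j x - pol (p m j) x))"
      by (rule summableI_nonneg_bounded[where x = B]) (auto intro: B[OF x])
    then have "summable (\<lambda>j. F m j x - pol (p m j) x)" by (rule summable_norm_cancel)
    then show ?thesis unfolding S by (rule summable_LIMSEQ)
  qed
  have sB: "cmod (?s n x) \<le> B" if "x \<in> {a..b}" for n x
    by (rule order_trans[OF norm_sum B[OF that]])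
  have SB: "cmod (S x) \<le> B" if "x \<in> {a..b}" for x
    by (rule LIMSEQ_le_const2[OF tendsto_norm[OF lim[OF that]]]) (use sB[OF that] in blast)
  have [measurable]: "S \<in> borel_measurable borel" unfolding S by measurable
  show "l2sq {a..b} S \<le> D m"
    by (rule l2sq_tendsto_Fatou[of ?s]) (use lim g m in \<open>auto simp: good_def\<close>)
  have "(\<lambda>n. \<integral>\<^sup>+x. ennreal ((cmod (?s n x - S x))\<^sup>2) * indicator {a..b} x \<partial>lborel) \<longlonglongrightarrow> (\<integral>\<^sup>+x. (0::ennreal) \<partial>(lborel :: real measure))"
  proof (rule nn_integral_dominated_convergence[where w = "\<lambda>x. ennreal ((2 * B)\<^sup>2) * indicator {a..b} x"])
    show "(\<integral>\<^sup>+x. ennreal ((2 * B)\<^sup>2) * indicator {a..b} x \<partial>lborel) < \<infinity>"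
      by (subst nn_integral_cmult_indicator) (auto simp: ennreal_mult_less_top emeasure_lborel_Icc_eq)
    have "ennreal ((cmod (?s n x - S x))\<^sup>2) * indicator {a..b} x \<le> ennreal ((2 * B)\<^sup>2) * indicator {a..b} x" for n x
    proof (cases "x \<in> {a..b}")
      case True
      have "cmod (?s n x - S x) \<le> cmod (?s n x) + cmod (S x)" by (rule norm_triangle_ineq4)
      also have "\<dots> \<le> 2 * B" using sB[OF True, of n] SB[OF True] by simp
      finally show ?thesis by (intro mult_right_mono ennreal_leI power_mono) auto
    next
      case False
      show ?thesis unfolding indicator_simps(2)[OF False] by simp
    qed
    then show "AE x in lborel. ennreal ((cmod (?s n x - S x))\<^sup>2) * indicator {a..b} x \<le> ennreal ((2 * B)\<^sup>2) * indicator {a..b} x" for n by simp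
    have "(\<lambda>n. ennreal ((cmod (?s n x - S x))\<^sup>2) * indicator {a..b} x) \<longlonglongrightarrow> 0" for x
    proof (cases "x \<in> {a..b}")
      case True
      have "(\<lambda>n. ennreal ((cmod (?s n x - S x))\<^sup>2)) \<longlonglongrightarrow> ennreal ((cmod (S x - S x))\<^sup>2)" by (intro tendsto_intros lim True)
      then show ?thesis using True by simp
    next
      case False
      show ?thesis unfolding indicator_simps(2)[OF False] by simp
    qed
    then show "AE x in lborel. (\<lambda>n. ennreal ((cmod (?s n x - S x))\<^sup>2) * indicator {a..b} x) \<longlonglongrightarrow> 0" by simp
  qed measurable
  then show "(\<lambda>n. l2sq {a..b} (\<lambda>x. ?s n x - S x)) \<longlonglongrightarrow> 0" by (simp add: l2sq_def)
qed

text \<open>The series is renormalised once by the polynomials of [-1, 1]. On any other interval the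
  limit differs from the one adapted to it by a polynomial \<open>q\<close>, so the quantitative
  bound survives modulo polynomials, as the Campanato seminorm requires.\<close>

theorem band_limit:
  fixes F :: "nat \<Rightarrow> nat \<Rightarrow> real \<Rightarrow> complex" and C A0 s :: real
  assumes F: "\<And>m j. F m j \<in> borel_measurable borel"
    and main: "\<And>A a b. A > A0 \<Longrightarrow> a < b \<Longrightarrow> \<exists>p D. good M r F p D a b \<and>
       (\<integral>\<^sup>+m. D m \<partial>count_space M) \<le> ennreal (C * (b - a) powr (2 * s + 1) * A\<^sup>2)"
  shows "\<exists>p S. (\<forall>m j. deg_less r (p m j)) \<and> (\<forall>m. S m \<in> borel_measurable borel) \<and>
    (\<forall>a b n. (\<integral>\<^sup>+m. l2sq {a..b} (\<lambda>x. \<Sum>j<n. F m j x - pol (p m j) x) \<partial>count_space M) < \<infinity>) \<and>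
    (\<forall>a b. (\<integral>\<^sup>+m. l2sq {a..b} (S m) \<partial>count_space M) < \<infinity>) \<and>
    (\<forall>a b. (\<lambda>n. \<integral>\<^sup>+m. l2sq {a..b} (\<lambda>x. (\<Sum>j<n. F m j x - pol (p m j) x) - S m x) \<partial>count_space M) \<longlonglongrightarrow> 0) \<and>
    (\<forall>A a b. A > A0 \<longrightarrow> a < b \<longrightarrow> (\<exists>q. (\<forall>m. deg_less r (q m)) \<and>
       (\<forall>k. (\<integral>\<^sup>+m. ennreal ((cmod (coeff (q m) k))\<^sup>2) \<partial>count_space M) < \<infinity>) \<and>
       (\<integral>\<^sup>+m. l2sq {a..b} (\<lambda>x. S m x - pol (q m) x) \<partial>count_space M) \<le> ennreal (C * (b - a) powr (2 * s + 1) * A\<^sup>2)))"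
proof -
  note [measurable] = F
  \<comment> \<open>[-1, 1] is the reference interval that fixes the polynomials.
    \<open>A0 + 1\<close> is just some value above \<open>A0\<close>, since only finiteness is
    wanted.\<close>
  obtain p D0 where g0: "good M r F p D0 (-1) 1" and D0: "(\<integral>\<^sup>+m. D0 m \<partial>count_space M) < \<infinity>"
  proof -
    from main[of "A0 + 1" "-1" 1] obtain p D where "good M r F p D (-1) 1"
      and le: "(\<integral>\<^sup>+m. D m \<partial>count_space M) \<le> ennreal (C * (1 - (-1)) powr (2 * s + 1) * (A0 + 1)\<^sup>2)" by auto
    then show ?thesis using that le_less_trans[OF le ennreal_less_top] by auto
  qed
  have dp: "deg_less r (p m j)" for m j using g0 unfolding good_def by blast
  define S where "S m x = (\<Sum>j. F m j x - pol (p m j) x)" for m x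
  have Sm [measurable]: "S m \<in> borel_measurable borel" for m unfolding S_def[abs_def] by measurable
  have ext: "\<exists>D. good M r F p D a b \<and> (\<integral>\<^sup>+m. D m \<partial>count_space M) < \<infinity>" for a b
  proof -
    define T where "T = 1 + \<bar>a\<bar> + \<bar>b\<bar>"
    have T: "T \<ge> 1" "{a..b} \<subseteq> {-T..T}" by (auto simp: T_def)
    obtain p' D' where g': "good M r F p' D' (-T) T" and D': "(\<integral>\<^sup>+m. D' m \<partial>count_space M) < \<infinity>"
    proof -
      from main[of "A0 + 1" "-T" T] T obtain p D where "good M r F p D (-T) T"
        and le: "(\<integral>\<^sup>+m. D m \<partial>count_space M) \<le> ennreal (C * (T - (-T)) powr (2 * s + 1) * (A0 + 1)\<^sup>2)" by auto
      then show ?thesis using that le_less_trans[OF le ennreal_less_top] by auto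
    qed
    obtain K where K: "K \<ge> 0" "good M r F p (\<lambda>m. ennreal K * (D0 m + D' m)) (-T) T"
      using good_extend[OF F g0 g' T(1)] by blast
    have "(\<integral>\<^sup>+m. ennreal K * (D0 m + D' m) \<partial>count_space M) = ennreal K * ((\<integral>\<^sup>+m. D0 m \<partial>count_space M) + (\<integral>\<^sup>+m. D' m \<partial>count_space M))"
      by (subst nn_integral_cmult) (auto simp: nn_integral_add)
    also have "\<dots> < \<infinity>" using D0 D' by (simp add: ennreal_mult_less_top)
    finally show ?thesis using good_restrict[OF K(2) T(2)] by blast
  qed
  show ?thesis
  proof (intro exI[of _ p] exI[of _ S] conjI allI impI)
    show "deg_less r (p m j)" for m j by (rule dp)
    show "S m \<in> borel_measurable borel" for m by (rule Sm)
  next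
    fix a b n
    obtain D where g: "good M r F p D a b" and D: "(\<integral>\<^sup>+m. D m \<partial>count_space M) < \<infinity>" using ext by blast
    have "(\<integral>\<^sup>+m. l2sq {a..b} (\<lambda>x. \<Sum>j<n. F m j x - pol (p m j) x) \<partial>count_space M) \<le> (\<integral>\<^sup>+m. D m \<partial>count_space M)"
      using g unfolding good_def by (intro nn_integral_mono) auto
    then show "(\<integral>\<^sup>+m. l2sq {a..b} (\<lambda>x. \<Sum>j<n. F m j x - pol (p m j) x) \<partial>count_space M) < \<infinity>" using D by (rule le_less_trans)
  next
    fix a b
    obtain D where g: "good M r F p D a b" and D: "(\<integral>\<^sup>+m. D m \<partial>count_space M) < \<infinity>" using ext by blast
    have "(\<integral>\<^sup>+m. l2sq {a..b} (S m) \<partial>count_space M) \<le> (\<integral>\<^sup>+m. D m \<partial>count_space M)"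
      by (intro nn_integral_mono good_limit(2)[OF F g _ S_def]) auto
    then show "(\<integral>\<^sup>+m. l2sq {a..b} (S m) \<partial>count_space M) < \<infinity>" using D by (rule le_less_trans)
  next
    fix a b
    obtain D where g: "good M r F p D a b" and D: "(\<integral>\<^sup>+m. D m \<partial>count_space M) < \<infinity>" using ext by blast
    have "(\<lambda>n. \<integral>\<^sup>+m. l2sq {a..b} (\<lambda>x. (\<Sum>j<n. F m j x - pol (p m j) x) - S m x) \<partial>count_space M) \<longlonglongrightarrow> (\<integral>\<^sup>+m. (0::ennreal) \<partial>count_space M)"
    \<comment> \<open>Dominated convergence over the counting measure: a squared difference costs 2,
      and both the partial sum and its limit are bounded by \<open>D m\<close>.\<close>
    proof (rule nn_integral_dominated_convergence[where w = "\<lambda>m. 4 * D m"])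
      show "(\<integral>\<^sup>+m. 4 * D m \<partial>count_space M) < \<infinity>"
        using D by (subst nn_integral_cmult) (auto simp: ennreal_mult_less_top)
      have "l2sq {a..b} (\<lambda>x. (\<Sum>j<n. F m j x - pol (p m j) x) - S m x) \<le> 4 * D m" if m: "m \<in> M" for m n
      proof -
        have "l2sq {a..b} (\<lambda>x. (\<Sum>j<n. F m j x - pol (p m j) x) - S m x) \<le> 2 * (l2sq {a..b} (\<lambda>x. \<Sum>j<n. F m j x - pol (p m j) x) + l2sq {a..b} (S m))"
          by (rule l2sq_diff) measurable
        also have "\<dots> \<le> 2 * (D m + D m)"
          using g m unfolding good_def by (intro mult_left_mono add_mono good_limit(2)[OF F g m S_def]) auto
        also have "\<dots> = 4 * D m" by (simp add: mult_2[symmetric] flip: mult.assoc)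
        finally show ?thesis .
      qed
      then show "AE m in count_space M. l2sq {a..b} (\<lambda>x. (\<Sum>j<n. F m j x - pol (p m j) x) - S m x) \<le> 4 * D m" for n
        by (simp add: AE_count_space)
      show "AE m in count_space M. (\<lambda>n. l2sq {a..b} (\<lambda>x. (\<Sum>j<n. F m j x - pol (p m j) x) - S m x)) \<longlonglongrightarrow> 0"
        by (simp add: AE_count_space good_limit(3)[OF F g _ S_def])
    qed auto
    then show "(\<lambda>n. \<integral>\<^sup>+m. l2sq {a..b} (\<lambda>x. (\<Sum>j<n. F m j x - pol (p m j) x) - S m x) \<partial>count_space M) \<longlonglongrightarrow> 0" by simp
  next
    fix A a b :: real assume A: "A > A0" and ab: "a < b"
    obtain D where g: "good M r F p D a b" and D: "(\<integral>\<^sup>+m. D m \<partial>count_space M) < \<infinity>" using ext by blast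
    obtain p' D' where g': "good M r F p' D' a b" and D': "(\<integral>\<^sup>+m. D' m \<partial>count_space M) \<le> ennreal (C * (b - a) powr (2 * s + 1) * A\<^sup>2)"
      using main[OF A ab] by blast
    have D'f: "(\<integral>\<^sup>+m. D' m \<partial>count_space M) < \<infinity>" using le_less_trans[OF D' ennreal_less_top] by simp
    obtain K where K: "K \<ge> 0" and c: "\<And>m k. m \<in> M \<Longrightarrow> summable (\<lambda>j. cmod (coeff (p' m j - p m j) k))"
      and c2: "\<And>m n k. m \<in> M \<Longrightarrow> ennreal ((cmod (coeff (\<Sum>j<n. p' m j - p m j) k))\<^sup>2) \<le> ennreal K * (D' m + D m)"
      using good_coeff[OF F g' g ab] by auto
    have dl: "deg_less r (p' m j - p m j)" for m j using g g' unfolding good_def by (intro deg_less_diff) auto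
    \<comment> \<open>The total correction from the reference polynomials \<open>p\<close> to the
      polynomials \<open>p'\<close> of the present interval, summed coefficientwise. Thus S - q is
      the limit of the partial sums of F - p', to which the sharp bound on \<open>D'\<close>
      applies.\<close>
    define q where "q m = (\<Sum>k<r. monom (\<Sum>j. coeff (p' m j - p m j) k) k)" for m
    have cq: "coeff (q m) k = (if k < r then (\<Sum>j. coeff (p' m j - p m j) k) else 0)" for m k
      by (simp add: q_def coeff_sum)
    have dq: "deg_less r (q m)" for m by (simp add: deg_less_def cq)
    have clim: "(\<lambda>n. coeff (\<Sum>j<n. p' m j - p m j) k) \<longlonglongrightarrow> coeff (q m) k" if m: "m \<in> M" for m k
    proof (cases "k < r")
      case True
      have "summable (\<lambda>j. coeff (p' m j - p m j) k)" using c[OF m] by (rule summable_norm_cancel)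
      then show ?thesis using True by (simp add: cq coeff_sum summable_LIMSEQ del: coeff_diff)
    next
      case False
      then have "coeff (p' m j - p m j) k = 0" for j using dl unfolding deg_less_def by auto
      then show ?thesis using False by (simp add: cq coeff_sum del: coeff_diff)
    qed
    have plim: "(\<lambda>n. pol (\<Sum>j<n. p' m j - p m j) x) \<longlonglongrightarrow> pol (q m) x" if m: "m \<in> M" for m x
      unfolding pol_eq_sum[OF dq] pol_eq_sum[OF deg_less_sum[OF dl]] by (intro tendsto_intros clim m)
    show "\<exists>q. (\<forall>m. deg_less r (q m)) \<and>
       (\<forall>k. (\<integral>\<^sup>+m. ennreal ((cmod (coeff (q m) k))\<^sup>2) \<partial>count_space M) < \<infinity>) \<and>
       (\<integral>\<^sup>+m. l2sq {a..b} (\<lambda>x. S m x - pol (q m) x) \<partial>count_space M) \<le> ennreal (C * (b - a) powr (2 * s + 1) * A\<^sup>2)"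
    proof (intro exI[of _ q] conjI allI dq)
      fix k
      have "ennreal ((cmod (coeff (q m) k))\<^sup>2) \<le> ennreal K * (D' m + D m)" if m: "m \<in> M" for m
      proof -
        have "(\<lambda>n. ennreal ((cmod (coeff (\<Sum>j<n. p' m j - p m j) k))\<^sup>2)) \<longlonglongrightarrow> ennreal ((cmod (coeff (q m) k))\<^sup>2)"
          by (intro tendsto_intros clim m)
        then show ?thesis by (rule LIMSEQ_le_const2) (use c2[OF m] in blast)
      qed
      then have "(\<integral>\<^sup>+m. ennreal ((cmod (coeff (q m) k))\<^sup>2) \<partial>count_space M) \<le> (\<integral>\<^sup>+m. ennreal K * (D' m + D m) \<partial>count_space M)"
        by (intro nn_integral_mono) auto
      also have "\<dots> = ennreal K * ((\<integral>\<^sup>+m. D' m \<partial>count_space M) + (\<integral>\<^sup>+m. D m \<partial>count_space M))"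
        by (subst nn_integral_cmult) (auto simp: nn_integral_add)
      also have "\<dots> < \<infinity>" using D D'f by (simp add: ennreal_mult_less_top)
      finally show "(\<integral>\<^sup>+m. ennreal ((cmod (coeff (q m) k))\<^sup>2) \<partial>count_space M) < \<infinity>" .
    next
      have "l2sq {a..b} (\<lambda>x. S m x - pol (q m) x) \<le> D' m" if m: "m \<in> M" for m
      proof (rule l2sq_tendsto_Fatou[where g = "\<lambda>n x. \<Sum>j<n. F m j x - pol (p' m j) x"])
        show "l2sq {a..b} (\<lambda>x. \<Sum>j<n. F m j x - pol (p' m j) x) \<le> D' m" for n using g' m unfolding good_def by blast
        fix x assume x: "x \<in> {a..b}"
        have "(\<lambda>n. (\<Sum>j<n. F m j x - pol (p m j) x) - pol (\<Sum>j<n. p' m j - p m j) x) \<longlonglongrightarrow> S m x - pol (q m) x"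
          by (intro tendsto_diff good_limit(1)[OF F g m S_def x] plim m)
        moreover have "(\<Sum>j<n. F m j x - pol (p m j) x) - pol (\<Sum>j<n. p' m j - p m j) x = (\<Sum>j<n. F m j x - pol (p' m j) x)" for n
          by (simp add: poly_sum sum_subtractf)
        ultimately show "(\<lambda>n. \<Sum>j<n. F m j x - pol (p' m j) x) \<longlonglongrightarrow> S m x - pol (q m) x" by simp
      qed measurable
      then have "(\<integral>\<^sup>+m. l2sq {a..b} (\<lambda>x. S m x - pol (q m) x) \<partial>count_space M) \<le> (\<integral>\<^sup>+m. D' m \<partial>count_space M)"
        by (intro nn_integral_mono) auto
      then show "(\<integral>\<^sup>+m. l2sq {a..b} (\<lambda>x. S m x - pol (q m) x) \<partial>count_space M) \<le> ennreal (C * (b - a) powr (2 * s + 1) * A\<^sup>2)" using D' by (rule order_trans)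
    qed
  qed
qed

section \<open>The dyadic decomposition of the cut-off function\<close>

lemma vector_derivative_zero_on_open:
  fixes f :: "real \<Rightarrow> complex"
  assumes "open T" "x \<in> T" "\<And>y. y \<in> T \<Longrightarrow> f y = c" "(f has_vector_derivative d) (at x)"
  shows "d = 0"
proof -
  have "(f has_vector_derivative 0) (at x)"
    by (rule has_vector_derivative_transform_within_open[OF has_vector_derivative_const assms(1,2)]) (simp add: assms(3))
  then show ?thesis using assms(4) vector_derivative_unique_at by blast
qed

lemma schwartz_compact_support:
  assumes D: "\<And>n x. (D n has_vector_derivative D (Suc n) x) (at x)" and supp: "\<And>n x. x \<notin> {a..b} \<Longrightarrow> D n x = 0"
  shows "D 0 \<in> schwartz"
proof (rule schwartzI, rule D)
  fix n
  have c: "continuous_on UNIV (D n)" using D[of n] by (meson continuous_at_imp_continuous_on has_vector_derivative_continuous)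
  have "bounded (D n ` {a..b})"
    by (intro compact_imp_bounded compact_continuous_image continuous_on_subset[OF c]) auto
  then obtain B where B: "\<And>x. x \<in> {a..b} \<Longrightarrow> cmod (D n x) \<le> B" unfolding bounded_iff by blast
  show "rapid (D n)"
    unfolding rapid_def
  proof (intro allI exI)
    fix N x
    show "cmod (D n x) * (1 + \<bar>x\<bar>) ^ N \<le> max B 0 * (1 + max \<bar>a\<bar> \<bar>b\<bar>) ^ N"
    proof (cases "x \<in> {a..b}")
      case True
      then have "\<bar>x\<bar> \<le> max \<bar>a\<bar> \<bar>b\<bar>" by auto
      then show ?thesis using B[OF True] by (intro mult_mono power_mono) auto
    qed (simp add: supp)
  qed
qed

text \<open>The extension of \<psi> by zero jumps at 0, but both \<psi>(t) and \<psi>(2 t) equal 1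
  on (0, 1/6) and 0 for t < 0, so the jump cancels in the difference.\<close>

lemma bump_difference_schwartz:
  assumes sm: "smooth_on {0..1} \<psi>" and z: "\<And>t. t \<notin> {0..2/3} \<Longrightarrow> \<psi> t = 0" and o: "\<And>t. 0 \<le> t \<Longrightarrow> t < 1/3 \<Longrightarrow> \<psi> t = 1"
  shows "(\<lambda>t. \<psi> t - \<psi> (2 * t)) \<in> schwartz"
proof -
  obtain E where E0: "E 0 = \<psi>" and E: "\<And>n x. x \<in> {0..1} \<Longrightarrow> (E n has_vector_derivative E (Suc n) x) (at x within {0..1})"
    using sm unfolding smooth_on_def by blast
  have Ei: "(E n has_vector_derivative E (Suc n) x) (at x)" if "x \<in> {0<..<1}" for n x
  proof -
    have "(E n has_vector_derivative E (Suc n) x) (at x within {0<..<1})"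
      using that by (intro has_vector_derivative_within_subset[OF E]) auto
    then show ?thesis using that by (simp add: at_within_open[of x "{0<..<1}"])
  qed
  have Ez: "E n x = 0" if "x \<in> {2/3<..<1}" for n x
    using that
  proof (induction n arbitrary: x)
    case (Suc n)
    show ?case by (rule vector_derivative_zero_on_open[of "{2/3<..<1}" x "E n" 0]) (use Suc Ei in auto)
  qed (simp add: E0 z)
  have Eo: "E n x = (if n = 0 then 1 else 0)" if "x \<in> {0<..<1/3}" for n x
    using that
  proof (induction n arbitrary: x)
    case (Suc n)
    have "E (Suc n) x = 0"
      by (rule vector_derivative_zero_on_open[of "{0<..<1/3}" x "E n" "if n = 0 then 1 else 0"]) (use Suc Ei in auto)
    then show ?case by simp
  qed (simp add: E0 o)
  \<comment> \<open>Derivatives of \<psi> extended by 0. They fit together everywhere except at 0;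
    at 1 this holds because \<psi> already vanishes beyond 2/3.\<close>
  define e where "e n t = (if 0 < t \<and> t < 1 then E n t else 0)" for n and t :: real
  have e: "(e n has_vector_derivative e (Suc n) t) (at t)" if "t \<noteq> 0" for n t
  proof -
    consider "t < 0" | "0 < t" "t < 1" | "1 \<le> t" using \<open>t \<noteq> 0\<close> by (metis linorder_less_linear not_le)
    then show ?thesis
    proof cases
      case 1
      have "(e n has_vector_derivative 0) (at t)"
        by (rule has_vector_derivative_transform_within_open[OF has_vector_derivative_const[of 0], of "{..<0}"]) (use 1 in \<open>auto simp: e_def\<close>)
      then show ?thesis using 1 by (simp add: e_def)
    next
      case 2
      have "(e n has_vector_derivative E (Suc n) t) (at t)"
        by (rule has_vector_derivative_transform_within_open[OF Ei, of t "{0<..<1}"]) (use 2 in \<open>auto simp: e_def\<close>)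
      then show ?thesis using 2 by (simp add: e_def)
    next
      case 3
      have "(e n has_vector_derivative 0) (at t)"
        by (rule has_vector_derivative_transform_within_open[OF has_vector_derivative_const[of 0], of "{2/3<..}"]) (use 3 in \<open>auto simp: e_def Ez\<close>)
      then show ?thesis using 3 by (simp add: e_def)
    qed
  qed
  \<comment> \<open>The n-th derivative of \<psi>(t) - \<psi>(2 t); the chain rule gives 2^n. It
    vanishes for |t| < 1/6, which settles the exceptional point 0.\<close>
  define D where "D n t = e n t - of_real (2 ^ n) * e n (2 * t)" for n t
  have Dz: "D n t = 0" if "\<bar>t\<bar> < 1/6" for n t
    using that Eo[of t n] Eo[of "2 * t" n] by (cases "0 < t") (auto simp: D_def e_def)
  have D: "(D n has_vector_derivative D (Suc n) t) (at t)" for n t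
  proof (cases "t = 0")
    case True
    have "(D n has_vector_derivative 0) (at t)"
      by (rule has_vector_derivative_transform_within_open[OF has_vector_derivative_const[of 0], of "{-1/6<..<1/6}"]) (use True Dz in auto)
    then show ?thesis using True Dz[of 0 "Suc n"] by simp
  next
    case False
    have "((\<lambda>t. 2 * t) has_vector_derivative 2) (at t)"
      unfolding has_real_derivative_iff_has_vector_derivative[symmetric] by (auto intro!: derivative_eq_intros)
    from vector_diff_chain_at[OF this e[of "2 * t" n]] False
    have "((\<lambda>t. e n (2 * t)) has_vector_derivative 2 *\<^sub>R e (Suc n) (2 * t)) (at t)" by (simp add: o_def)
    from has_vector_derivative_diff[OF e[OF False] has_vector_derivative_mult_right[OF this, of "of_real (2 ^ n)"]]
    show ?thesis unfolding D_def[abs_def] by (simp add: scaleR_conv_of_real mult_ac)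
  qed
  have "D 0 \<in> schwartz"
    by (rule schwartz_compact_support[of D 0 1], rule D) (auto simp: e_def D_def)
  moreover have "D 0 = (\<lambda>t. \<psi> t - \<psi> (2 * t))"
  proof
    fix t
    show "D 0 t = \<psi> t - \<psi> (2 * t)"
    \<comment> \<open>At 0 both sides vanish, whatever the value of \<psi> there.\<close>
    proof (cases "t = 0")
      case False
      have "e 0 t = \<psi> t" if "t \<noteq> 0" for t using that z[of t] by (auto simp: e_def E0)
      then show ?thesis using False by (simp add: D_def)
    qed (simp add: D_def e_def)
  qed
  ultimately show ?thesis by simp
qed

section \<open>Translation of the norms\<close>

lemma epowr_ennreal: "c \<ge> 0 \<Longrightarrow> epowr (ennreal c) a = ennreal (c powr a)"
  by (simp add: epowr_def)

lemma epowr_half_square: "(epowr x (1 / 2))\<^sup>2 = x" "epowr (epowr x (1 / 2)) 2 = x"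
proof -
  show "(epowr x (1 / 2))\<^sup>2 = x"
    by (cases x) (auto simp: epowr_def powr_half_sqrt power2_eq_square ennreal_top_mult simp flip: ennreal_mult)
  show "epowr (epowr x (1 / 2)) 2 = x"
    by (cases x) (auto simp: epowr_def powr_powr)
qed

lemma epowr_cmod_square: "epowr (ennreal (cmod z)) 2 = ennreal ((cmod z)\<^sup>2)"
  by (cases "z = 0") (simp_all add: epowr_def powr_numeral)

text \<open>Turns the l^2 norm into an integral for the counting measure, where Tonelli and
  dominated convergence are at hand.\<close>

lemma infsum_eq_nn_integral_count_space:
  fixes f :: "nat \<Rightarrow> ennreal"
  shows "(\<Sum>\<^sub>\<infinity>m\<in>M. f m) = (\<integral>\<^sup>+m. f m \<partial>count_space M)"
proof -
  have "(\<Sum>\<^sub>\<infinity>m\<in>M. f m) = (\<Sum>\<^sub>\<infinity>m\<in>UNIV. f m * indicator M m)"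
    by (rule infsum_cong_neutral) auto
  also have "\<dots> = (\<Sum>m. f m * indicator M m)"
  proof -
    have "(\<lambda>m. f m * indicator M m) summable_on UNIV" by (rule nonneg_summable_on_complete) simp
    then have "((\<lambda>m. f m * indicator M m) has_sum (\<Sum>\<^sub>\<infinity>m\<in>UNIV. f m * indicator M m)) UNIV" by (rule has_sum_infsum)
    then show ?thesis using has_sum_imp_sums sums_unique by blast
  qed
  also have "\<dots> = (\<integral>\<^sup>+m. f m * indicator M m \<partial>count_space UNIV)" by (rule nn_integral_count_space_nat[symmetric])
  also have "\<dots> = (\<integral>\<^sup>+m. f m \<partial>count_space M)" by (rule nn_integral_count_space_indicator[symmetric]) simp
  finally show ?thesis .
qed

lemma l2_norm_square: "(l2_norm M v)\<^sup>2 = (\<integral>\<^sup>+m. ennreal ((cmod (v m))\<^sup>2) \<partial>count_space M)"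
  "epowr (l2_norm M v) 2 = (\<integral>\<^sup>+m. ennreal ((cmod (v m))\<^sup>2) \<partial>count_space M)"
  unfolding l2_norm_def epowr_half_square infsum_eq_nn_integral_count_space by (rule refl)+

lemma l2_norm_finite_iff: "l2_norm M v < \<infinity> \<longleftrightarrow> (\<integral>\<^sup>+m. ennreal ((cmod (v m))\<^sup>2) \<partial>count_space M) < \<infinity>"
  unfolding l2_norm_def infsum_eq_nn_integral_count_space
  by (auto simp: epowr_def less_top)

lemma l2_integral_swap:
  fixes M :: "nat set"
  assumes F: "\<And>m. m \<in> M \<Longrightarrow> (\<lambda>x. F x m) \<in> borel_measurable borel"
  shows "(\<integral>\<^sup>+x\<in>{a..b}. (\<integral>\<^sup>+m. ennreal ((cmod (F x m))\<^sup>2) \<partial>count_space M) \<partial>lebesgue) = (\<integral>\<^sup>+m. l2sq {a..b} (\<lambda>x. F x m) \<partial>count_space M)"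
proof -
  have "(\<integral>\<^sup>+x\<in>{a..b}. (\<integral>\<^sup>+m. ennreal ((cmod (F x m))\<^sup>2) \<partial>count_space M) \<partial>lebesgue)
     = (\<integral>\<^sup>+x. (\<integral>\<^sup>+m. ennreal ((cmod (F x m))\<^sup>2) * indicator {a..b} x \<partial>count_space M) \<partial>lborel)"
    unfolding nn_integral_completion by (intro nn_integral_cong) (simp add: nn_integral_multc)
  also have "\<dots> = (\<integral>\<^sup>+m. (\<integral>\<^sup>+x. ennreal ((cmod (F x m))\<^sup>2) * indicator {a..b} x \<partial>lborel) \<partial>count_space M)"
  proof (rule nn_integral_count_space_nn_integral)
    fix m assume "m \<in> M"
    note [measurable] = F[OF this]
    show "(\<lambda>x. ennreal ((cmod (F x m))\<^sup>2) * indicator {a..b} x) \<in> borel_measurable lborel" by measurable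
  qed (rule countableI_type)
  finally show ?thesis unfolding l2sq_def .
qed

text \<open>Squaring clears the root: L^s contributes 2 s and the mean over the interval contributes
  1 to the exponent of L.\<close>

lemma campanato_value_iff:
  fixes A L s :: real
  assumes L: "L > 0" and A: "A \<ge> 0"
  shows "ennreal (1 / L powr s) * epowr (ennreal (1 / L) * X) (1 / 2) \<le> ennreal A \<longleftrightarrow> X \<le> ennreal (A\<^sup>2 * L powr (2 * s + 1))"
proof (cases X)
  case (real x)
  have Ls: "L powr s > 0" using L by simp
  have e: "ennreal (1 / L powr s) * epowr (ennreal (1 / L) * X) (1 / 2) = ennreal (sqrt (x / L) / L powr s)"
    using real L by (simp add: epowr_ennreal powr_half_sqrt flip: ennreal_mult)
  have "sqrt (x / L) / L powr s \<le> A \<longleftrightarrow> sqrt (x / L) \<le> A * L powr s"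
    using Ls by (simp add: divide_le_eq)
  also have "\<dots> \<longleftrightarrow> x / L \<le> (A * L powr s)\<^sup>2"
  proof -
    have q: "sqrt ((A * L powr s)\<^sup>2) = A * L powr s" using A Ls by simp
    show ?thesis using real_sqrt_le_iff[of "x / L" "(A * L powr s)\<^sup>2"] unfolding q .
  qed
  also have "\<dots> \<longleftrightarrow> x \<le> A\<^sup>2 * L powr (2 * s + 1)"
  proof -
    have "L powr (2 * s + 1) = L powr (s + s) * L powr 1" by (subst powr_add) simp
    also have "\<dots> = (L powr s)\<^sup>2 * L" using L by (simp only: powr_add power2_eq_square powr_one less_imp_le)
    finally have "A\<^sup>2 * L powr (2 * s + 1) = (A * L powr s)\<^sup>2 * L" by (simp only: power_mult_distrib mult.assoc)
    then show ?thesis using L by (simp only: pos_divide_le_eq)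
  qed
  finally have "sqrt (x / L) / L powr s \<le> A \<longleftrightarrow> x \<le> A\<^sup>2 * L powr (2 * s + 1)" .
  moreover have "0 \<le> A\<^sup>2 * L powr (2 * s + 1)" by simp
  ultimately show ?thesis unfolding e unfolding real(2) by (simp only: ennreal_le_iff A)
next
  case top
  have "ennreal (1 / L) * \<top> = \<top>" "ennreal (1 / L powr s) * \<top> = \<top>" using L by (simp_all add: ennreal_mult_top)
  then show ?thesis using top by (simp add: epowr_def top_unique)
qed

lemma polys_eq: "polys r = {pol p | p. deg_less r p}"
  by (auto simp: polys_def deg_less_iff fun_eq_iff)

lemma campanato_measurable:
  assumes "f \<in> campanato i p s"
  shows "f \<in> borel_measurable lebesgue"
proof -
  have i: "set_integrable lebesgue {- real n..real n} f" for n using assms by (simp add: campanato_def)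
  have "(\<lambda>n. indicator {- real n..real n} x *\<^sub>R f x) \<longlonglongrightarrow> f x" for x
  proof (rule tendsto_eventually)
    obtain N :: nat where "\<bar>x\<bar> \<le> real N" using real_arch_simple by blast
    then have "indicator {- real n..real n} x *\<^sub>R f x = f x" if "n \<ge> N" for n
      using that by (auto simp: indicator_def abs_le_iff)
    then show "\<forall>\<^sub>F n in sequentially. indicator {- real n..real n} x *\<^sub>R f x = f x"
      unfolding eventually_sequentially by blast
  qed
  then show ?thesis
    by (rule borel_measurable_LIMSEQ_metric[rotated]) (use i in \<open>auto simp: set_integrable_def\<close>)
qed

text \<open>The strict inequality yields, on each interval, a polynomial that beats \<open>A\<close>
  although the infimum may not be attained. Passing to the Borel version \<open>f'\<close> changes
  only null sets.\<close>

lemma campanato_norm_less_imp_le: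
  assumes n: "campanato_norm i 2 s f < ennreal A" and A: "A \<ge> 0" and ae: "AE x in lebesgue. f x = f' x"
  shows "campanato_le i s A f'"
  unfolding campanato_le_def
proof (intro allI impI)
  fix a b :: real assume ab: "a < b"
  let ?v = "\<lambda>P. ennreal (1 / (b - a) powr s) * epowr (ennreal (1 / (b - a)) * (\<integral>\<^sup>+x\<in>{a..b}. epowr (ennreal (cmod (f x - P x))) 2 \<partial>lebesgue)) (1 / 2)"
  have "(INF P\<in>polys i. ?v P) \<le> campanato_norm i 2 s f"
    unfolding campanato_norm_def campanato_sup_def by (rule SUP_upper2[of "(a, b)"]) (use ab in auto)
  then have "(INF P\<in>polys i. ?v P) < ennreal A" using n by (rule le_less_trans)
  then obtain P where P: "P \<in> polys i" "?v P < ennreal A" unfolding INF_less_iff by blast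
  then obtain p where p: "P = pol p" "deg_less i p" unfolding polys_eq by blast
  have "(\<integral>\<^sup>+x\<in>{a..b}. epowr (ennreal (cmod (f x - P x))) 2 \<partial>lebesgue) \<le> ennreal (A\<^sup>2 * (b - a) powr (2 * s + 1))"
    by (rule campanato_value_iff[THEN iffD1, OF _ A less_imp_le[OF P(2)]]) (use ab in simp)
  moreover have "(\<integral>\<^sup>+x\<in>{a..b}. epowr (ennreal (cmod (f x - P x))) 2 \<partial>lebesgue) = (\<integral>\<^sup>+x\<in>{a..b}. ennreal ((cmod (f' x - P x))\<^sup>2) \<partial>lebesgue)"
    unfolding epowr_cmod_square using ae by (intro nn_integral_cong_AE) auto
  ultimately show "\<exists>P. deg_less i P \<and> l2sq {a..b} (\<lambda>x. f' x - pol P x) \<le> ennreal (A\<^sup>2 * (b - a) powr (2 * s + 1))"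
    using p unfolding l2sq_def nn_integral_completion by auto
qed

text \<open>Connects the distributional definition with the analysis: the approximating multiplier
  is a finite sum of dyadic pieces, and its convolution kernel splits accordingly.\<close>

lemma fourier_multiplier_band:
  assumes \<eta>: "\<eta> \<in> schwartz" and \<kappa>: "\<kappa> \<noteq> 0" and f: "f \<in> borel_measurable lebesgue"
    and ae: "AE x in lebesgue. f x = f' x" and f': "tempered f'"
  shows "cis (- 2 * pi * \<alpha> * x) * fourier_multiplier f (\<lambda>\<xi>. \<Sum>j<n. piece \<eta> \<kappa> j (\<xi> - \<alpha>)) x = (\<Sum>j<n. band \<eta> f' \<alpha> \<kappa> j x)"
proof -
  let ?\<Psi> = "\<lambda>j \<xi>. piece \<eta> \<kappa> j (\<xi> - \<alpha>)"
  note [measurable] = tempered_measurable[OF f']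
  have s: "?\<Psi> j \<in> schwartz" for j using schwartz_affine[OF piece_schwartz[OF \<eta> \<kappa>, of j], of 1 \<alpha>] by simp
  have S: "(\<lambda>\<xi>. \<Sum>j<n. ?\<Psi> j \<xi>) \<in> schwartz" by (intro schwartz_sum s)
  obtain N where N: "integrable lborel (\<lambda>y. cmod (f' y) / (1 + \<bar>y\<bar>) ^ N)" using f' by (auto simp: tempered_def)
  have pos: "(1 + \<bar>y\<bar>) ^ N > 0" for y :: real by (intro zero_less_power) linarith
  have "integrable lborel (\<lambda>y. f' y / of_real ((1 + \<bar>y\<bar>) ^ N))"
  proof (rule Bochner_Integration.integrable_bound[OF N])
    have "norm (f' y / of_real ((1 + \<bar>y\<bar>) ^ N)) \<le> norm (cmod (f' y) / (1 + \<bar>y\<bar>) ^ N)" for y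
      unfolding norm_divide norm_of_real using pos[of y] by simp
    then show "AE y in lborel. norm (f' y / of_real ((1 + \<bar>y\<bar>) ^ N)) \<le> norm (cmod (f' y) / (1 + \<bar>y\<bar>) ^ N)" by simp
  qed measurable
  then have "integrable lebesgue (\<lambda>y. f' y / of_real ((1 + \<bar>y\<bar>) ^ N))" by (subst integrable_completion) auto
  then have i: "integrable lebesgue (\<lambda>y. f y / of_real ((1 + \<bar>y\<bar>) ^ N))"
  proof (rule integrable_cong_AE_imp)
    show "(\<lambda>y. f y / of_real ((1 + \<bar>y\<bar>) ^ N)) \<in> borel_measurable lebesgue"
      by (intro borel_measurable_divide f) (auto intro!: measurable_completion)
    show "AE y in lebesgue. f' y / of_real ((1 + \<bar>y\<bar>) ^ N) = f y / of_real ((1 + \<bar>y\<bar>) ^ N)"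
      using ae by (rule eventually_mono) simp
  qed
  define K where "K = inv_fourier (\<lambda>\<xi>. \<Sum>j<n. ?\<Psi> j \<xi>)"
  have [measurable]: "K \<in> borel_measurable borel"
    unfolding K_def by (intro borel_measurable_continuous_UNIV inv_fourier_continuous schwartz_rapid_continuous S)
  have "fourier_multiplier f (\<lambda>\<xi>. \<Sum>j<n. ?\<Psi> j \<xi>) x = (LINT y|lebesgue. f y * K (x - y))"
    unfolding fourier_multiplier_eq_convolution[OF i S] K_def ..
  also have "\<dots> = (LINT y|lebesgue. f' y * K (x - y))"
    using ae by (intro integral_cong_AE borel_measurable_times f) (auto intro: measurable_completion)
  also have "\<dots> = (LINT y|lborel. f' y * K (x - y))" by (rule integral_completion) measurable
  also have "\<dots> = (LINT y|lborel. (\<Sum>j<n. f' y * inv_fourier (?\<Psi> j) (x - y)))"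
  proof -
    have "integrable lborel (\<lambda>\<xi>. ?\<Psi> j \<xi> * cis (2 * pi * z * \<xi>))" for j z
      by (rule integrable_mult_cis[OF schwartz_integrable[OF s]]) simp
    then have "K z = (\<Sum>j<n. inv_fourier (?\<Psi> j) z)" for z
      unfolding K_def inv_fourier_def by (simp add: sum_distrib_right)
    then show ?thesis by (simp add: sum_distrib_left)
  qed
  also have "\<dots> = (\<Sum>j<n. LINT y|lborel. f' y * inv_fourier (?\<Psi> j) (x - y))"
    by (intro Bochner_Integration.integral_sum tempered_integrable f' inv_fourier_rapid inv_fourier_continuous schwartz_rapid_continuous s)
  finally show ?thesis by (simp add: band_def sum_distrib_left)
qed

text \<open>Removes the slack in \<open>A\<close> that the strict inequality of
  \<open>campanato_norm_less_imp_le\<close> introduces.\<close>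

lemma ennreal_le_of_forall_greater:
  assumes "\<And>A. A > N \<Longrightarrow> x \<le> ennreal (C * A)"
  shows "x \<le> ennreal (C * N)"
proof -
  have "(\<lambda>n. ennreal (C * (N + 1 / real (Suc n)))) \<longlonglongrightarrow> ennreal (C * (N + 0))"
    by (intro tendsto_intros) (use LIMSEQ_Suc[OF lim_inverse_n'] in simp)
  then have "x \<le> ennreal (C * (N + 0))"
    by (rule LIMSEQ_le_const) (use assms in auto)
  then show ?thesis by simp
qed

theorem one_sided_estimate:
  fixes s :: real and i r :: nat
  assumes \<eta>: "\<eta> \<in> schwartz" and supp: "\<And>t. t \<notin> {1/6..2/3} \<Longrightarrow> \<eta> t = 0"
    and b\<eta>: "\<And>n t. cmod (\<Sum>j<n. \<eta> (t * 2 ^ j)) \<le> B\<eta>"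
    and r: "r \<ge> 1" and s: "s > -1/2" and rs: "real r > max s (real i - 1)"
  shows "\<exists>C>0. \<forall>M \<alpha> \<kappa>. (\<forall>m\<in>M. \<kappa> m \<noteq> 0 \<and> 0 \<notin> freq (\<alpha> m) (\<kappa> m)) \<longrightarrow> disjoint_family_on (\<lambda>m. freq (\<alpha> m) (\<kappa> m)) M \<longrightarrow>
    (\<forall>f\<in>campanato i 2 s. \<exists>p S. (\<forall>m\<in>M. \<forall>\<nu>. p m \<nu> \<in> polys r) \<and> S \<in> L2_loc M \<and>
      tendsto_L2_loc M (\<lambda>\<nu> x m. cis (- 2 * pi * \<alpha> m * x) * fourier_multiplier f (\<lambda>\<xi>. \<Sum>j<\<nu>. piece \<eta> (\<kappa> m) j (\<xi> - \<alpha> m)) x - p m \<nu> x) S \<and>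
      campanato_norm_l2 M r 2 s S \<le> ennreal C * campanato_norm i 2 s f)"
proof -
  have "\<exists>C\<ge>0. \<forall>f A M \<alpha> \<kappa> a b. f \<in> borel_measurable borel \<longrightarrow> A \<ge> 0 \<longrightarrow> campanato_le i s A f \<longrightarrow>
    (\<forall>m\<in>M. \<kappa> m \<noteq> 0 \<and> 0 \<notin> freq (\<alpha> m) (\<kappa> m)) \<longrightarrow> disjoint_family_on (\<lambda>m. freq (\<alpha> m) (\<kappa> m)) M \<longrightarrow> a < b \<longrightarrow>
    (\<exists>p D. good M r (\<lambda>m. band \<eta> f (\<alpha> m) (\<kappa> m)) p D a b \<and>
       (\<integral>\<^sup>+m. D m \<partial>count_space M) \<le> ennreal (C * (b - a) powr (2 * s + 1) * A\<^sup>2))"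
    by (rule band_estimate[OF \<eta> _ b\<eta> r s rs]) (rule supp)
  then obtain C where C: "C \<ge> 0" and H: "\<forall>f A M \<alpha> \<kappa> a b. f \<in> borel_measurable borel \<longrightarrow> A \<ge> 0 \<longrightarrow> campanato_le i s A f \<longrightarrow>
    (\<forall>m\<in>M. \<kappa> m \<noteq> 0 \<and> 0 \<notin> freq (\<alpha> m) (\<kappa> m)) \<longrightarrow> disjoint_family_on (\<lambda>m. freq (\<alpha> m) (\<kappa> m)) M \<longrightarrow> a < b \<longrightarrow>
    (\<exists>p D. good M r (\<lambda>m. band \<eta> f (\<alpha> m) (\<kappa> m)) p D a b \<and>
       (\<integral>\<^sup>+m. D m \<partial>count_space M) \<le> ennreal (C * (b - a) powr (2 * s + 1) * A\<^sup>2))"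
    by (elim exE conjE) (rule that)
  note est = H[THEN spec, THEN spec, THEN spec, THEN spec, THEN spec, THEN spec, THEN spec,
    THEN mp, THEN mp, THEN mp, THEN mp, THEN mp, THEN mp]
  show ?thesis
  \<comment> \<open>The root appears because \<open>C\<close> bounds squared norms; adding 1 makes
    the constant positive.\<close>
  proof (intro exI[of _ "sqrt C + 1"] conjI allI impI ballI)
    show "0 < sqrt C + 1" using C by (simp add: add_nonneg_pos)
    fix M and \<alpha> \<kappa>0 :: "nat \<Rightarrow> real" and f
    assume M0: "\<forall>m\<in>M. \<kappa>0 m \<noteq> 0 \<and> 0 \<notin> freq (\<alpha> m) (\<kappa>0 m)" and disj0: "disjoint_family_on (\<lambda>m. freq (\<alpha> m) (\<kappa>0 m)) M"
      and f: "f \<in> campanato i 2 s"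
    \<comment> \<open>A nonzero value outside \<open>M\<close> makes every piece a Schwartz
      function, so that measurability holds for all indices, as \<open>band_limit\<close>
      asks.\<close>
    define \<kappa> where "\<kappa> m = (if m \<in> M then \<kappa>0 m else 1)" for m
    have \<kappa>: "\<kappa> m \<noteq> 0" for m using M0 by (simp add: \<kappa>_def)
    have \<kappa>M: "\<kappa>0 m = \<kappa> m" if "m \<in> M" for m using that by (simp add: \<kappa>_def)
    have M: "\<forall>m\<in>M. \<kappa> m \<noteq> 0 \<and> 0 \<notin> freq (\<alpha> m) (\<kappa> m)" and disj: "disjoint_family_on (\<lambda>m. freq (\<alpha> m) (\<kappa> m)) M"
      using M0 disj0 by (simp_all add: \<kappa>_def disjoint_family_on_def)
    have fm: "f \<in> borel_measurable lebesgue" by (rule campanato_measurable[OF f])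
    obtain f' where f' [measurable]: "f' \<in> borel_measurable borel" and ae: "AE x in lebesgue. f x = f' x"
      using borel_version[OF fm] by blast
    have nf: "campanato_norm i 2 s f < \<infinity>" using f by (simp add: campanato_def)
    define N where "N = enn2real (campanato_norm i 2 s f)"
    have N: "campanato_norm i 2 s f = ennreal N" "N \<ge> 0" using nf by (simp_all add: N_def less_top)
    have ap: "campanato_le i s A f'" if "A > N" for A
      by (rule campanato_norm_less_imp_le[OF _ _ ae]) (use that N in \<open>auto simp: ennreal_less_iff\<close>)
    have ft: "tempered f'" by (rule campanato_le_tempered[OF f' _ s ap[of "N + 1"]]) (use N in auto)
    let ?F = "\<lambda>m. band \<eta> f' (\<alpha> m) (\<kappa> m)"
    have F [measurable]: "?F m j \<in> borel_measurable borel" for m j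
      unfolding band_eq_conv[abs_def]
      by (intro borel_measurable_continuous_onI) (rule conv_continuous[OF tempered_modulate[OF ft] piece_schwartz[OF \<eta> \<kappa>]])
    have main: "\<exists>p D. good M r ?F p D a b \<and> (\<integral>\<^sup>+m. D m \<partial>count_space M) \<le> ennreal (C * (b - a) powr (2 * s + 1) * A\<^sup>2)"
      if "A > N" "a < b" for A a b
      by (rule est[OF f' _ ap[OF that(1)] M disj that(2)]) (use that N in simp)
    obtain p S where *: "\<forall>m j. deg_less r (p m j)" "\<forall>m. S m \<in> borel_measurable borel"
      "\<forall>a b n. (\<integral>\<^sup>+m. l2sq {a..b} (\<lambda>x. \<Sum>j<n. ?F m j x - pol (p m j) x) \<partial>count_space M) < \<infinity>"
      "\<forall>a b. (\<integral>\<^sup>+m. l2sq {a..b} (S m) \<partial>count_space M) < \<infinity>"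
      "\<forall>a b. (\<lambda>n. \<integral>\<^sup>+m. l2sq {a..b} (\<lambda>x. (\<Sum>j<n. ?F m j x - pol (p m j) x) - S m x) \<partial>count_space M) \<longlonglongrightarrow> 0"
      "\<forall>A a b. A > N \<longrightarrow> a < b \<longrightarrow> (\<exists>q. (\<forall>m. deg_less r (q m)) \<and>
       (\<forall>k. (\<integral>\<^sup>+m. ennreal ((cmod (coeff (q m) k))\<^sup>2) \<partial>count_space M) < \<infinity>) \<and>
       (\<integral>\<^sup>+m. l2sq {a..b} (\<lambda>x. S m x - pol (q m) x) \<partial>count_space M) \<le> ennreal (C * (b - a) powr (2 * s + 1) * A\<^sup>2))"
      by (rule exE[OF band_limit[of ?F N M r C s, OF F main]], assumption, assumption, elim exE conjE, rule that)
    note p = *(1)[rule_format] and [measurable] = *(2)[rule_format] and fin1 = *(3)[rule_format]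
      and fin2 = *(4)[rule_format] and lim = *(5)[rule_format] and camp = *(6)[rule_format]
    \<comment> \<open>The polynomial belonging to the \<nu>-th approximation is the sum of those of
      its first \<nu> pieces.\<close>
    define P where "P m \<nu> x = (\<Sum>j<\<nu>. pol (p m j) x)" for m \<nu> x
    define T where "T x m = S m x" for x m
    let ?G = "\<lambda>\<nu> x m. cis (- 2 * pi * \<alpha> m * x) * fourier_multiplier f (\<lambda>\<xi>. \<Sum>j<\<nu>. piece \<eta> (\<kappa>0 m) j (\<xi> - \<alpha> m)) x - P m \<nu> x"
    have G: "?G \<nu> x m = (\<Sum>j<\<nu>. ?F m j x - pol (p m j) x)" if "m \<in> M" for \<nu> x m
      using fourier_multiplier_band[OF \<eta> \<kappa> fm ae ft, of "\<alpha> m" x m \<nu>] by (simp add: P_def sum_subtractf \<kappa>M[OF that])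
    have Gm: "(\<lambda>x. ?G \<nu> x m) \<in> borel_measurable borel" if "m \<in> M" for \<nu> m
      unfolding G[OF that] by measurable
    have sq: "(\<integral>\<^sup>+x\<in>{a..b}. (l2_norm M (H x))\<^sup>2 \<partial>lebesgue) = (\<integral>\<^sup>+m. l2sq {a..b} (\<lambda>x. H' m x) \<partial>count_space M)"
      if "\<And>m x. m \<in> M \<Longrightarrow> H x m = H' m x" "\<And>m. m \<in> M \<Longrightarrow> H' m \<in> borel_measurable borel" for H H' and a b :: real
    proof -
      have "(\<integral>\<^sup>+x\<in>{a..b}. (l2_norm M (H x))\<^sup>2 \<partial>lebesgue) = (\<integral>\<^sup>+m. l2sq {a..b} (\<lambda>x. H x m) \<partial>count_space M)"
        unfolding l2_norm_square by (rule l2_integral_swap) (simp add: that)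
      also have "\<dots> = (\<integral>\<^sup>+m. l2sq {a..b} (\<lambda>x. H' m x) \<partial>count_space M)"
        by (intro nn_integral_cong) (simp add: that)
      finally show ?thesis .
    qed
    have GL: "?G \<nu> \<in> L2_loc M" for \<nu>
      unfolding L2_loc_def mem_Collect_eq
    proof (intro conjI ballI allI)
      show "(\<lambda>x. ?G \<nu> x m) \<in> borel_measurable lebesgue" if "m \<in> M" for m
        using Gm[OF that] by (intro measurable_completion) simp
      show "(\<integral>\<^sup>+x\<in>{a..b}. (l2_norm M (?G \<nu> x))\<^sup>2 \<partial>lebesgue) < \<infinity>" for a b
        by (subst sq[OF G]) (use fin1 in \<open>auto intro: borel_measurable_sum\<close>)
    qed
    have TL: "T \<in> L2_loc M"
      unfolding L2_loc_def mem_Collect_eq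
    proof (intro conjI ballI allI)
      show "(\<lambda>x. T x m) \<in> borel_measurable lebesgue" for m
        unfolding T_def by (intro measurable_completion) simp
      show "(\<integral>\<^sup>+x\<in>{a..b}. (l2_norm M (T x))\<^sup>2 \<partial>lebesgue) < \<infinity>" for a b
        by (subst sq[OF T_def]) (use fin2 in auto)
    qed
    show "\<exists>p S. (\<forall>m\<in>M. \<forall>\<nu>. p m \<nu> \<in> polys r) \<and> S \<in> L2_loc M \<and>
      tendsto_L2_loc M (\<lambda>\<nu> x m. cis (- 2 * pi * \<alpha> m * x) * fourier_multiplier f (\<lambda>\<xi>. \<Sum>j<\<nu>. piece \<eta> (\<kappa>0 m) j (\<xi> - \<alpha> m)) x - p m \<nu> x) S \<and>
      campanato_norm_l2 M r 2 s S \<le> ennreal (sqrt C + 1) * campanato_norm i 2 s f"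
    proof (intro exI[of _ P] exI[of _ T] conjI ballI allI)
      show "P m \<nu> \<in> polys r" for m \<nu>
      proof -
        have "P m \<nu> = pol (\<Sum>j<\<nu>. p m j)" by (simp add: P_def fun_eq_iff poly_sum)
        then show ?thesis unfolding polys_eq using deg_less_sum[of "{..<\<nu>}" r "p m"] p by blast
      qed
      show "T \<in> L2_loc M" by (rule TL)
      show "tendsto_L2_loc M ?G T"
        unfolding tendsto_L2_loc_def
      proof (intro conjI allI GL TL)
        fix a b
        have e: "(\<integral>\<^sup>+x\<in>{a..b}. (l2_norm M (?G \<nu> x - T x))\<^sup>2 \<partial>lebesgue) = (\<integral>\<^sup>+m. l2sq {a..b} (\<lambda>x. (\<Sum>j<\<nu>. ?F m j x - pol (p m j) x) - S m x) \<partial>count_space M)" for \<nu>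
          by (rule sq) (simp_all only: minus_apply G T_def, measurable)
        show "(\<lambda>\<nu>. \<integral>\<^sup>+x\<in>{a..b}. (l2_norm M (?G \<nu> x - T x))\<^sup>2 \<partial>lebesgue) \<longlonglongrightarrow> 0"
          unfolding e by (rule lim)
      qed
      have "campanato_norm_l2 M r 2 s T \<le> ennreal (sqrt C * A)" if A: "A > N" for A
        unfolding campanato_norm_l2_def campanato_sup_def
      proof (rule SUP_least, clarify)
        fix a b :: real assume ab: "a < b"
        obtain q where q: "\<And>m. deg_less r (q m)" and qf: "\<And>k. (\<integral>\<^sup>+m. ennreal ((cmod (coeff (q m) k))\<^sup>2) \<partial>count_space M) < \<infinity>"
          and qb: "(\<integral>\<^sup>+m. l2sq {a..b} (\<lambda>x. S m x - pol (q m) x) \<partial>count_space M) \<le> ennreal (C * (b - a) powr (2 * s + 1) * A\<^sup>2)"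
          using camp[OF A ab] by blast
        define Q where "Q x m = pol (q m) x" for x m
        have "Q = (\<lambda>x m. \<Sum>k<r. (\<lambda>k m. coeff (q m) k) k m * of_real x ^ k)"
          by (simp add: Q_def fun_eq_iff pol_eq_sum[OF q])
        then have Q: "Q \<in> polys_l2 M r"
          unfolding polys_l2_def mem_Collect_eq using qf[folded l2_norm_finite_iff]
          by (intro exI[of _ "\<lambda>k m. coeff (q m) k"] conjI) simp_all
        have I: "(\<integral>\<^sup>+x\<in>{a..b}. epowr (l2_norm M (T x - Q x)) 2 \<partial>lebesgue) \<le> ennreal ((sqrt C * A)\<^sup>2 * (b - a) powr (2 * s + 1))"
        proof -
          have "(\<integral>\<^sup>+x\<in>{a..b}. epowr (l2_norm M (T x - Q x)) 2 \<partial>lebesgue) = (\<integral>\<^sup>+x\<in>{a..b}. (l2_norm M (T x - Q x))\<^sup>2 \<partial>lebesgue)"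
            unfolding l2_norm_square ..
          also have "\<dots> = (\<integral>\<^sup>+m. l2sq {a..b} (\<lambda>x. S m x - pol (q m) x) \<partial>count_space M)"
            by (rule sq) (simp_all only: minus_apply T_def Q_def, measurable)
          also have "\<dots> \<le> ennreal ((sqrt C * A)\<^sup>2 * (b - a) powr (2 * s + 1))"
            using qb C by (simp add: power_mult_distrib mult_ac)
          finally show ?thesis .
        qed
        show "(INF P\<in>polys_l2 M r. ennreal (1 / (b - a) powr s) * epowr (ennreal (1 / (b - a)) * (\<integral>\<^sup>+x\<in>{a..b}. epowr (l2_norm M (T x - P x)) 2 \<partial>lebesgue)) (1 / 2)) \<le> ennreal (sqrt C * A)"
          by (rule INF_lower2[OF Q]) (subst campanato_value_iff, use ab A N C I in auto)
      qed
      then have "campanato_norm_l2 M r 2 s T \<le> ennreal (sqrt C * N)" by (rule ennreal_le_of_forall_greater)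
      also have "\<dots> \<le> ennreal ((sqrt C + 1) * N)" using N by (intro ennreal_leI mult_right_mono) auto
      also have "\<dots> = ennreal (sqrt C + 1) * campanato_norm i 2 s f" using N C by (simp add: ennreal_mult)
      finally show "campanato_norm_l2 M r 2 s T \<le> ennreal (sqrt C + 1) * campanato_norm i 2 s f" .
    qed
  qed
qed

lemma dyadic_sum_telescope:
  "(\<Sum>j<n. (\<lambda>t. \<psi> t - \<psi> (2 * t)) (t * 2 ^ j)) = \<psi> t - \<psi> (t * 2 ^ n :: real)" for \<psi> :: "real \<Rightarrow> complex"
proof -
  have "(\<Sum>j<n. \<psi> (t * 2 ^ j) - \<psi> (t * 2 ^ Suc j)) = \<psi> (t * 2 ^ 0) - \<psi> (t * 2 ^ n)"
    by (rule sum_lessThan_telescope')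
  then show ?thesis by (simp add: mult_ac)
qed

text \<open>By telescoping, the error is -\<psi> dilated by 2^\<nu>: a bounded function living
  within |\<kappa>| / 2^\<nu> of \<alpha>.\<close>

lemma cutoff_tendsto_L2:
  assumes B: "\<And>t. cmod (\<psi> t) \<le> B" and z: "\<And>t. t \<notin> {0..2/3} \<Longrightarrow> \<psi> t = 0" and \<kappa>: "\<kappa> \<noteq> 0"
  shows "tendsto_L2 (\<lambda>\<nu> \<xi>. \<Sum>j<\<nu>. piece (\<lambda>t. \<psi> t - \<psi> (2 * t)) \<kappa> j (\<xi> - \<alpha>)) (\<lambda>\<xi>. \<psi> ((\<xi> - \<alpha>) / \<kappa>))"
proof -
  have e: "(\<Sum>j<\<nu>. piece (\<lambda>t. \<psi> t - \<psi> (2 * t)) \<kappa> j (\<xi> - \<alpha>)) - \<psi> ((\<xi> - \<alpha>) / \<kappa>) = - \<psi> ((\<xi> - \<alpha>) / \<kappa> * 2 ^ \<nu>)" for \<nu> \<xi>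
    using dyadic_sum_telescope[of \<psi> "(\<xi> - \<alpha>) / \<kappa>" \<nu>] by (simp add: piece_def)
  have bd: "(\<integral>\<^sup>+\<xi>. ennreal ((cmod (- \<psi> ((\<xi> - \<alpha>) / \<kappa> * 2 ^ \<nu>)))\<^sup>2) \<partial>lebesgue) \<le> ennreal (B\<^sup>2 * (2 * \<bar>\<kappa>\<bar>) * (1 / 2) ^ \<nu>)" for \<nu>
  proof -
    define d where "d = \<bar>\<kappa>\<bar> / 2 ^ \<nu>"
    have d: "d > 0" using \<kappa> by (simp add: d_def)
    have "(\<integral>\<^sup>+\<xi>. ennreal ((cmod (- \<psi> ((\<xi> - \<alpha>) / \<kappa> * 2 ^ \<nu>)))\<^sup>2) \<partial>lebesgue) \<le> (\<integral>\<^sup>+\<xi>. ennreal (B\<^sup>2) * indicator {\<alpha> - d..\<alpha> + d} \<xi> \<partial>lebesgue)"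
    proof (rule nn_integral_mono)
      fix \<xi>
      show "ennreal ((cmod (- \<psi> ((\<xi> - \<alpha>) / \<kappa> * 2 ^ \<nu>)))\<^sup>2) \<le> ennreal (B\<^sup>2) * indicator {\<alpha> - d..\<alpha> + d} \<xi>"
      proof (cases "\<bar>\<xi> - \<alpha>\<bar> \<le> d")
        case True
        then have "\<xi> \<in> {\<alpha> - d..\<alpha> + d}" by (auto simp: abs_le_iff)
        then show ?thesis using B by (auto intro!: ennreal_leI power_mono)
      next
        case False
        then have "\<bar>\<kappa>\<bar> < \<bar>\<xi> - \<alpha>\<bar> * 2 ^ \<nu>" by (simp add: d_def not_le pos_divide_less_eq)
        then have "1 < \<bar>\<xi> - \<alpha>\<bar> * 2 ^ \<nu> / \<bar>\<kappa>\<bar>" using \<kappa> by (simp add: less_divide_eq)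
        then have "\<bar>(\<xi> - \<alpha>) / \<kappa> * 2 ^ \<nu>\<bar> > 1" by (simp add: abs_mult)
        then have "(\<xi> - \<alpha>) / \<kappa> * 2 ^ \<nu> \<notin> {0..2/3}" unfolding atLeastAtMost_iff by linarith
        then show ?thesis by (simp add: z)
      qed
    qed
    also have "\<dots> = ennreal (B\<^sup>2) * ennreal (2 * d)" using d by (subst nn_integral_cmult_indicator) auto
    also have "\<dots> = ennreal (B\<^sup>2 * (2 * \<bar>\<kappa>\<bar>) * (1 / 2) ^ \<nu>)"
      using d by (simp add: d_def power_one_over flip: ennreal_mult)
    finally show ?thesis .
  qed
  have "(\<lambda>\<nu>. ennreal (B\<^sup>2 * (2 * \<bar>\<kappa>\<bar>) * (1 / 2) ^ \<nu>)) \<longlonglongrightarrow> ennreal (B\<^sup>2 * (2 * \<bar>\<kappa>\<bar>) * 0)"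
    by (intro tendsto_intros LIMSEQ_power_zero) auto
  then have lim: "(\<lambda>\<nu>. ennreal (B\<^sup>2 * (2 * \<bar>\<kappa>\<bar>) * (1 / 2) ^ \<nu>)) \<longlonglongrightarrow> 0" by simp
  show ?thesis
    unfolding tendsto_L2_def e by (rule tendsto_sandwich[OF _ _ tendsto_const lim]; rule always_eventually; rule allI; (rule bd | rule zero_le))
qed

text \<open>The partial sums telescope to \<psi>(t) - \<psi>(2^n t), whence 2 B uniformly in n. The
  left end 1/6 of the support is half of 1/3: up to there \<psi>(t) and \<psi>(2 t) are both
  1.\<close>

lemma cutoff_data:
  assumes sm: "smooth_on {0..1} \<psi>" and z: "\<And>t. t \<notin> {0..2/3} \<Longrightarrow> \<psi> t = 0" and o: "\<And>t. 0 \<le> t \<Longrightarrow> t < 1/3 \<Longrightarrow> \<psi> t = 1"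
  obtains B where "\<And>t. cmod (\<psi> t) \<le> B"
    "\<And>n t. cmod (\<Sum>j<n. (\<lambda>t. \<psi> t - \<psi> (2 * t)) (t * 2 ^ j)) \<le> 2 * B"
    "\<And>t. t \<notin> {1/6..2/3} \<Longrightarrow> \<psi> t - \<psi> (2 * t) = 0"
proof -
  obtain E where E: "E 0 = \<psi>" "\<And>n x. x \<in> {0..1} \<Longrightarrow> (E n has_vector_derivative E (Suc n) x) (at x within {0..1})"
    using sm unfolding smooth_on_def by blast
  have "continuous_on {0..1} \<psi>"
    using E(2)[of _ 0] unfolding E(1) continuous_on_eq_continuous_within by (blast intro: has_vector_derivative_continuous)
  then have "bounded (\<psi> ` {0..1})" by (intro compact_imp_bounded compact_continuous_image) auto
  then obtain B0 where B0: "\<And>t. t \<in> {0..1} \<Longrightarrow> cmod (\<psi> t) \<le> B0" unfolding bounded_iff by blast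
  have B: "cmod (\<psi> t) \<le> max B0 0" for t
  proof (cases "t \<in> {0..1}")
    case False
    then have "t \<notin> {0..2/3}" by auto
    then show ?thesis by (simp add: z)
  qed (use B0 in fastforce)
  have "cmod (\<Sum>j<n. (\<lambda>t. \<psi> t - \<psi> (2 * t)) (t * 2 ^ j)) \<le> 2 * max B0 0" for n t
    unfolding dyadic_sum_telescope using norm_triangle_ineq4[of "\<psi> t" "\<psi> (t * 2 ^ n)"] B[of t] B[of "t * 2 ^ n"] by linarith
  moreover have "\<psi> t - \<psi> (2 * t) = 0" if "t \<notin> {1/6..2/3}" for t
  proof -
    consider "t < 0" | "0 \<le> t" "t < 1/6" | "t > 2/3" using \<open>t \<notin> {1/6..2/3}\<close> by (metis atLeastAtMost_iff not_le)
    then show ?thesis by cases (auto simp: z o)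
  qed
  ultimately show ?thesis using that B by blast
qed

theorem corollary1:
  fixes i r :: nat and s :: real and \<psi>1 \<psi>2 :: "real \<Rightarrow> complex"
  assumes "r \<ge> 1" and "- 1 / 2 < s" and "s \<le> real i" and "real r > max s (real i - 1)"
    and "smooth_on {0..1} \<psi>1" and "smooth_on {0..1} \<psi>2"
    and "closure {x. \<psi>1 x \<noteq> 0} \<subseteq> {0..2/3}"
    and "closure {x. \<psi>2 x \<noteq> 0} \<subseteq> {1/3..1}"
    and "\<And>x. x \<in> {0..1} \<Longrightarrow> \<psi>1 x + \<psi>2 x = 1"
  shows "\<exists>C::real. C > 0 \<and>
    (\<forall>(M :: nat set) (a :: nat \<Rightarrow> real) (b :: nat \<Rightarrow> real).
      (\<forall>m\<in>M. a m < b m \<and> 0 \<notin> {a m<..<b m}) \<and>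
      disjoint_family_on (\<lambda>m. {a m..b m}) M \<longrightarrow>
      (\<exists>\<Psi>1 \<Psi>2 :: nat \<Rightarrow> nat \<Rightarrow> real \<Rightarrow> complex.
        (\<forall>m\<in>M. (\<forall>\<nu>. \<Psi>1 m \<nu> \<in> schwartz \<and> \<Psi>2 m \<nu> \<in> schwartz) \<and>
          tendsto_L2 (\<Psi>1 m) (\<lambda>\<xi>. \<psi>1 ((\<xi> - a m) / (b m - a m))) \<and>
          tendsto_L2 (\<Psi>2 m) (\<lambda>\<xi>. \<psi>2 ((\<xi> - a m) / (b m - a m)))) \<and>
        (\<forall>f\<in>campanato i 2 s.
          \<exists>(p1 :: nat \<Rightarrow> nat \<Rightarrow> real \<Rightarrow> complex) (p2 :: nat \<Rightarrow> nat \<Rightarrow> real \<Rightarrow> complex)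
            (S1 :: real \<Rightarrow> nat \<Rightarrow> complex) (S2 :: real \<Rightarrow> nat \<Rightarrow> complex).
            (\<forall>m\<in>M. \<forall>\<nu>. p1 m \<nu> \<in> polys r \<and> p2 m \<nu> \<in> polys r) \<and>
            S1 \<in> L2_loc M \<and> S2 \<in> L2_loc M \<and>
            tendsto_L2_loc M
              (\<lambda>\<nu> x m. cis (- 2 * pi * a m * x) * fourier_multiplier f (\<Psi>1 m \<nu>) x - p1 m \<nu> x) S1 \<and>
            tendsto_L2_loc M
              (\<lambda>\<nu> x m. cis (- 2 * pi * b m * x) * fourier_multiplier f (\<Psi>2 m \<nu>) x - p2 m \<nu> x) S2 \<and>
            campanato_norm_l2 M r 2 s S1 \<le> ennreal C * campanato_norm i 2 s f \<and>
            campanato_norm_l2 M r 2 s S2 \<le> ennreal C * campanato_norm i 2 s f)))"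
proof -
  have z1: "\<psi>1 t = 0" if "t \<notin> {0..2/3}" for t
    using that assms(7) closure_subset[of "{x. \<psi>1 x \<noteq> 0}"] by blast
  have z2: "\<psi>2 t = 0" if "t \<notin> {1/3..1}" for t
    using that assms(8) closure_subset[of "{x. \<psi>2 x \<noteq> 0}"] by blast
  \<comment> \<open>Reflection turns the cut-off for right end points into one of the same type as
    \<psi>1; the direction is recovered by the negative length a - b.\<close>
  define \<phi> where "\<phi> t = \<psi>2 (1 - t)" for t
  \<comment> \<open>Where \<psi>2 vanishes, the partition of unity forces the value 1.\<close>
  have o1: "\<psi>1 t = 1" if "0 \<le> t" "t < 1/3" for t using assms(9)[of t] z2[of t] that by auto
  have z\<phi>: "\<phi> t = 0" if "t \<notin> {0..2/3}" for t unfolding \<phi>_def by (rule z2) (use that in auto)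
  have o\<phi>: "\<phi> t = 1" if "0 \<le> t" "t < 1/3" for t using assms(9)[of "1 - t"] z1[of "1 - t"] that by (auto simp: \<phi>_def)
  have s\<phi>: "smooth_on {0..1} \<phi>"
  proof -
    obtain E where E0: "E 0 = \<psi>2" and E: "\<And>n x. x \<in> {0..1} \<Longrightarrow> (E n has_vector_derivative E (Suc n) x) (at x within {0..1})"
      using assms(6) unfolding smooth_on_def by blast
    let ?D = "\<lambda>n t. (-1) ^ n * E n (1 - t)"
    have "(?D n has_vector_derivative ?D (Suc n) x) (at x within {0..1})" if x: "x \<in> {0..1}" for n x
    proof -
      have im: "(\<lambda>t. 1 - t) ` {0..1} = {0..1::real}" by (auto intro!: image_eqI[of _ _ "1 - _"])
      have "((\<lambda>t. 1 - t) has_vector_derivative -1) (at x within {0..1})"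
        unfolding has_real_derivative_iff_has_vector_derivative[symmetric] by (auto intro!: derivative_eq_intros)
      from vector_diff_chain_within[OF this, of "E n" "E (Suc n) (1 - x)"]
      have "((\<lambda>t. E n (1 - t)) has_vector_derivative (-1) *\<^sub>R E (Suc n) (1 - x)) (at x within {0..1})"
        using E[of "1 - x" n] x unfolding im by (simp add: o_def)
      from has_vector_derivative_mult_right[OF this, of "(-1) ^ n"] show ?thesis by simp
    qed
    moreover have "?D 0 = \<phi>" by (simp add: \<phi>_def E0 fun_eq_iff)
    ultimately show ?thesis unfolding smooth_on_def by (intro exI[of _ ?D]) blast
  qed
  let ?\<eta> = "\<lambda>\<psi> t. \<psi> t - \<psi> (2 * t)"
  let ?\<Psi> = "\<lambda>\<psi> \<alpha> \<kappa> (\<nu>::nat) \<xi>. \<Sum>j<\<nu>. piece (?\<eta> \<psi>) \<kappa> j (\<xi> - \<alpha>)"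
  have half: "\<exists>C>0. \<forall>M \<alpha> \<kappa>. (\<forall>m\<in>M. \<kappa> m \<noteq> 0 \<and> 0 \<notin> freq (\<alpha> m) (\<kappa> m)) \<longrightarrow> disjoint_family_on (\<lambda>m. freq (\<alpha> m) (\<kappa> m)) M \<longrightarrow>
    (\<forall>f\<in>campanato i 2 s. \<exists>p S. (\<forall>m\<in>M. \<forall>\<nu>. p m \<nu> \<in> polys r) \<and> S \<in> L2_loc M \<and>
      tendsto_L2_loc M (\<lambda>\<nu> x m. cis (- 2 * pi * \<alpha> m * x) * fourier_multiplier f (?\<Psi> \<psi> (\<alpha> m) (\<kappa> m) \<nu>) x - p m \<nu> x) S \<and>
      campanato_norm_l2 M r 2 s S \<le> ennreal C * campanato_norm i 2 s f)"
    if sm: "smooth_on {0..1} \<psi>" and z: "\<And>t. t \<notin> {0..2/3} \<Longrightarrow> \<psi> t = 0" and o: "\<And>t. 0 \<le> t \<Longrightarrow> t < 1/3 \<Longrightarrow> \<psi> t = 1" for \<psi>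
  proof -
    obtain B where B: "\<And>n t. cmod (\<Sum>j<n. (?\<eta> \<psi>) (t * 2 ^ j)) \<le> 2 * B"
      and supp: "\<And>t. t \<notin> {1/6..2/3} \<Longrightarrow> \<psi> t - \<psi> (2 * t) = 0"
      by (rule cutoff_data[OF sm]) (use z o in auto)
    show ?thesis
      by (rule one_sided_estimate[OF bump_difference_schwartz[OF sm] _ B assms(1)]) (use z o supp assms in auto)
  qed
  obtain C1 where C1: "C1 > 0" and H1: "\<forall>M \<alpha> \<kappa>. (\<forall>m\<in>M. \<kappa> m \<noteq> 0 \<and> 0 \<notin> freq (\<alpha> m) (\<kappa> m)) \<longrightarrow> disjoint_family_on (\<lambda>m. freq (\<alpha> m) (\<kappa> m)) M \<longrightarrow>
    (\<forall>f\<in>campanato i 2 s. \<exists>p S. (\<forall>m\<in>M. \<forall>\<nu>. p m \<nu> \<in> polys r) \<and> S \<in> L2_loc M \<and>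
      tendsto_L2_loc M (\<lambda>\<nu> x m. cis (- 2 * pi * \<alpha> m * x) * fourier_multiplier f (?\<Psi> \<psi>1 (\<alpha> m) (\<kappa> m) \<nu>) x - p m \<nu> x) S \<and>
      campanato_norm_l2 M r 2 s S \<le> ennreal C1 * campanato_norm i 2 s f)"
    by (rule exE[OF half[OF assms(5) z1 o1]], assumption, assumption, assumption, elim conjE, rule that)
  obtain C2 where C2: "C2 > 0" and H2: "\<forall>M \<alpha> \<kappa>. (\<forall>m\<in>M. \<kappa> m \<noteq> 0 \<and> 0 \<notin> freq (\<alpha> m) (\<kappa> m)) \<longrightarrow> disjoint_family_on (\<lambda>m. freq (\<alpha> m) (\<kappa> m)) M \<longrightarrow>
    (\<forall>f\<in>campanato i 2 s. \<exists>p S. (\<forall>m\<in>M. \<forall>\<nu>. p m \<nu> \<in> polys r) \<and> S \<in> L2_loc M \<and>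
      tendsto_L2_loc M (\<lambda>\<nu> x m. cis (- 2 * pi * \<alpha> m * x) * fourier_multiplier f (?\<Psi> \<phi> (\<alpha> m) (\<kappa> m) \<nu>) x - p m \<nu> x) S \<and>
      campanato_norm_l2 M r 2 s S \<le> ennreal C2 * campanato_norm i 2 s f)"
    by (rule exE[OF half[OF s\<phi> z\<phi> o\<phi>]], assumption, assumption, assumption, elim conjE, rule that)
  obtain B1 where B1: "\<And>t. cmod (\<psi>1 t) \<le> B1" by (rule cutoff_data[OF assms(5)]) (use z1 o1 in auto)
  obtain B2 where B2: "\<And>t. cmod (\<phi> t) \<le> B2" by (rule cutoff_data[OF s\<phi>]) (use z\<phi> o\<phi> in auto)
  have \<eta>1: "?\<eta> \<psi>1 \<in> schwartz" by (rule bump_difference_schwartz[OF assms(5)]) (use z1 o1 in auto)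
  have \<eta>2: "?\<eta> \<phi> \<in> schwartz" by (rule bump_difference_schwartz[OF s\<phi>]) (use z\<phi> o\<phi> in auto)
  have \<Psi>s: "?\<Psi> \<psi> \<alpha> \<kappa> \<nu> \<in> schwartz" if "?\<eta> \<psi> \<in> schwartz" "\<kappa> \<noteq> 0" for \<psi> \<alpha> \<kappa> \<nu>
  proof (rule schwartz_sum)
    fix j
    show "(\<lambda>\<xi>. piece (?\<eta> \<psi>) \<kappa> j (\<xi> - \<alpha>)) \<in> schwartz"
      using schwartz_affine[OF piece_schwartz[OF that, of j], of 1 \<alpha>] by simp
  qed
  show ?thesis
  proof (intro exI[of _ "max C1 C2"] conjI allI impI)
    show "max C1 C2 > 0" using C1 by simp
    fix M :: "nat set" and a b :: "nat \<Rightarrow> real"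
    assume "(\<forall>m\<in>M. a m < b m \<and> 0 \<notin> {a m<..<b m}) \<and> disjoint_family_on (\<lambda>m. {a m..b m}) M"
    then have ab: "\<And>m. m \<in> M \<Longrightarrow> a m < b m" and nz: "\<And>m. m \<in> M \<Longrightarrow> 0 \<notin> {a m<..<b m}"
      and disj: "disjoint_family_on (\<lambda>m. {a m..b m}) M" by blast+
    \<comment> \<open>Measured from either end point, the band is the same open interval, so a
      single disjointness hypothesis serves both halves.\<close>
    have fr: "freq (a m) (b m - a m) = {a m<..<b m}" "freq (b m) (a m - b m) = {a m<..<b m}" if "m \<in> M" for m
      using ab[OF that] by (auto simp: freq_def field_simps)
    have dj: "disjoint_family_on (\<lambda>m. {a m<..<b m}) M"
      using disj by (rule disjoint_family_on_bisimulation) auto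
    have cond1: "\<forall>m\<in>M. b m - a m \<noteq> 0 \<and> 0 \<notin> freq (a m) (b m - a m)" "disjoint_family_on (\<lambda>m. freq (a m) (b m - a m)) M"
      and cond2: "\<forall>m\<in>M. a m - b m \<noteq> 0 \<and> 0 \<notin> freq (b m) (a m - b m)" "disjoint_family_on (\<lambda>m. freq (b m) (a m - b m)) M"
      using ab nz dj fr by (fastforce simp: disjoint_family_on_def)+
    show "\<exists>\<Psi>1 \<Psi>2 :: nat \<Rightarrow> nat \<Rightarrow> real \<Rightarrow> complex.
        (\<forall>m\<in>M. (\<forall>\<nu>. \<Psi>1 m \<nu> \<in> schwartz \<and> \<Psi>2 m \<nu> \<in> schwartz) \<and>
          tendsto_L2 (\<Psi>1 m) (\<lambda>\<xi>. \<psi>1 ((\<xi> - a m) / (b m - a m))) \<and>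
          tendsto_L2 (\<Psi>2 m) (\<lambda>\<xi>. \<psi>2 ((\<xi> - a m) / (b m - a m)))) \<and>
        (\<forall>f\<in>campanato i 2 s.
          \<exists>(p1 :: nat \<Rightarrow> nat \<Rightarrow> real \<Rightarrow> complex) (p2 :: nat \<Rightarrow> nat \<Rightarrow> real \<Rightarrow> complex)
            (S1 :: real \<Rightarrow> nat \<Rightarrow> complex) (S2 :: real \<Rightarrow> nat \<Rightarrow> complex).
            (\<forall>m\<in>M. \<forall>\<nu>. p1 m \<nu> \<in> polys r \<and> p2 m \<nu> \<in> polys r) \<and>
            S1 \<in> L2_loc M \<and> S2 \<in> L2_loc M \<and>
            tendsto_L2_loc M
              (\<lambda>\<nu> x m. cis (- 2 * pi * a m * x) * fourier_multiplier f (\<Psi>1 m \<nu>) x - p1 m \<nu> x) S1 \<and>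
            tendsto_L2_loc M
              (\<lambda>\<nu> x m. cis (- 2 * pi * b m * x) * fourier_multiplier f (\<Psi>2 m \<nu>) x - p2 m \<nu> x) S2 \<and>
            campanato_norm_l2 M r 2 s S1 \<le> ennreal (max C1 C2) * campanato_norm i 2 s f \<and>
            campanato_norm_l2 M r 2 s S2 \<le> ennreal (max C1 C2) * campanato_norm i 2 s f)"
    proof (rule exI[of _ "\<lambda>m. ?\<Psi> \<psi>1 (a m) (b m - a m)"], rule exI[of _ "\<lambda>m. ?\<Psi> \<phi> (b m) (a m - b m)"], intro conjI ballI allI)
      fix m assume m: "m \<in> M"
      then have ne: "b m - a m \<noteq> 0" "a m - b m \<noteq> 0" using ab by fastforce+
      show "?\<Psi> \<psi>1 (a m) (b m - a m) \<nu> \<in> schwartz" "?\<Psi> \<phi> (b m) (a m - b m) \<nu> \<in> schwartz" for \<nu>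
        by (rule \<Psi>s[OF \<eta>1 ne(1)], rule \<Psi>s[OF \<eta>2 ne(2)])
      show "tendsto_L2 (?\<Psi> \<psi>1 (a m) (b m - a m)) (\<lambda>\<xi>. \<psi>1 ((\<xi> - a m) / (b m - a m)))"
        by (rule cutoff_tendsto_L2[OF B1 _ ne(1)]) (rule z1)
      have "1 - (\<xi> - b m) / (a m - b m) = (\<xi> - a m) / (b m - a m)" for \<xi> using ab[OF m] by (simp add: field_simps)
      then have "(\<lambda>\<xi>. \<psi>2 ((\<xi> - a m) / (b m - a m))) = (\<lambda>\<xi>. \<phi> ((\<xi> - b m) / (a m - b m)))" by (simp add: \<phi>_def)
      then show "tendsto_L2 (?\<Psi> \<phi> (b m) (a m - b m)) (\<lambda>\<xi>. \<psi>2 ((\<xi> - a m) / (b m - a m)))"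
        using cutoff_tendsto_L2[OF B2 z\<phi> ne(2), where \<alpha> = "b m"] by simp
    next
      fix f assume f: "f \<in> campanato i 2 s"
      obtain p1 S1 where 1: "\<forall>m\<in>M. \<forall>\<nu>. p1 m \<nu> \<in> polys r" "S1 \<in> L2_loc M"
        "tendsto_L2_loc M (\<lambda>\<nu> x m. cis (- 2 * pi * a m * x) * fourier_multiplier f (?\<Psi> \<psi>1 (a m) (b m - a m) \<nu>) x - p1 m \<nu> x) S1"
        "campanato_norm_l2 M r 2 s S1 \<le> ennreal C1 * campanato_norm i 2 s f"
        using H1[THEN spec, THEN spec, THEN spec, THEN mp, THEN mp, OF cond1, THEN bspec, OF f] by (elim exE conjE) (rule that)
      obtain p2 S2 where 2: "\<forall>m\<in>M. \<forall>\<nu>. p2 m \<nu> \<in> polys r" "S2 \<in> L2_loc M"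
        "tendsto_L2_loc M (\<lambda>\<nu> x m. cis (- 2 * pi * b m * x) * fourier_multiplier f (?\<Psi> \<phi> (b m) (a m - b m) \<nu>) x - p2 m \<nu> x) S2"
        "campanato_norm_l2 M r 2 s S2 \<le> ennreal C2 * campanato_norm i 2 s f"
        using H2[THEN spec, THEN spec, THEN spec, THEN mp, THEN mp, OF cond2, THEN bspec, OF f] by (elim exE conjE) (rule that)
      have le: "ennreal C1 * x \<le> ennreal (max C1 C2) * x" "ennreal C2 * x \<le> ennreal (max C1 C2) * x" for x
        by (intro mult_right_mono ennreal_leI; simp)+
      show "\<exists>(p1 :: nat \<Rightarrow> nat \<Rightarrow> real \<Rightarrow> complex) (p2 :: nat \<Rightarrow> nat \<Rightarrow> real \<Rightarrow> complex)
            (S1 :: real \<Rightarrow> nat \<Rightarrow> complex) (S2 :: real \<Rightarrow> nat \<Rightarrow> complex).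
            (\<forall>m\<in>M. \<forall>\<nu>. p1 m \<nu> \<in> polys r \<and> p2 m \<nu> \<in> polys r) \<and>
            S1 \<in> L2_loc M \<and> S2 \<in> L2_loc M \<and>
            tendsto_L2_loc M
              (\<lambda>\<nu> x m. cis (- 2 * pi * a m * x) * fourier_multiplier f (?\<Psi> \<psi>1 (a m) (b m - a m) \<nu>) x - p1 m \<nu> x) S1 \<and>
            tendsto_L2_loc M
              (\<lambda>\<nu> x m. cis (- 2 * pi * b m * x) * fourier_multiplier f (?\<Psi> \<phi> (b m) (a m - b m) \<nu>) x - p2 m \<nu> x) S2 \<and>
            campanato_norm_l2 M r 2 s S1 \<le> ennreal (max C1 C2) * campanato_norm i 2 s f \<and>
            campanato_norm_l2 M r 2 s S2 \<le> ennreal (max C1 C2) * campanato_norm i 2 s f"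
        by (rule exI[of _ p1], rule exI[of _ p2], rule exI[of _ S1], rule exI[of _ S2])
          (intro conjI 1(2,3) 2(2,3) order_trans[OF 1(4) le(1)] order_trans[OF 2(4) le(2)]; use 1(1) 2(1) in blast)
    qed
  qed
qed

end
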